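(* Let $G$ be a diffeological group and let $\mathbf{Diffeol}_{\mathrm{HSP}}$ be the full subcategory of the category of diffeological spaces and smooth maps consisting of the Hausdorff, second-countable, smoothly paracompact diffeological spaces. For a diffeological space $X$ let $\mathcal{B}_G(X)$ be the set of isomorphism classes of D-numerable principal $G$-bundles over $X$, and let $[X,BG]$ be the set of smooth homotopy classes of smooth maps $X\to BG$, where $BG$ is the diffeological Milnor classifying space of $G$; for a smooth map $\varphi\colon X\to Y$ let $\mathcal{B}_G(\varphi)\colon\mathcal{B}_G(Y)\to\mathcal{B}_G(X)$ be pullback of bundles along $\varphi$ and let $[\varphi,BG]\colon[Y,BG]\to[X,BG]$ be precomposition with $\varphi$. Then $\mathcal{B}_G(\cdot)$ and $[\cdot,BG]$ are naturally isomorphic (contravariant) functors from $\mathbf{Diffeol}_{\mathrm{HSP}}$ to $\mathbf{Set}$.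
   Context: Diffeology. A diffeology on a set $X$ is a collection of maps $p\colon U\to X$ ("plots"), $U$ ranging over open subsets of Euclidean spaces $\mathbb{R}^n$, $n\ge 0$, that contains all constant maps, is closed under precomposition with smooth maps between open subsets of Euclidean spaces, and contains every map that is locally a plot. A map is smooth if its composition with every plot is a plot. The D-topology on $X$ is the finest topology making all plots continuous; all topological terms (open, Hausdorff, second-countable, paracompact, support) refer to it. Subsets carry the subset diffeology (plots of $X$ with image in the subset), products the product diffeology (maps all of whose components are plots), quotients the quotient diffeology (maps that locally lift to plots); $[0,1]\subseteq\mathbb{R}$ has the subset diffeology. A diffeological group is a group with a diffeology for which multiplication and inversion are smooth; an action of $G$ on $X$ is smooth if $G\times X\to X$ is smooth. Two smooth maps $f_0,f_1\colon X\to Y$ are smoothly homotopic if there is a smooth $H\colon X\times\mathbb{R}\to Y$ with $H(\cdot,0)=f_0$, $H(\cdot,1)=f_1$. Smooth paracompactness. $X$ is smoothly paracompact if its D-topology is paracompact (any open cover admits a locally finite open refinement) and every open cover admits a subordinate smooth partition of unity. Bundles. Let $\pi\colon E\to X$ be a smooth surjection. The pullback by a smooth $f\colon Y\to X$ is $f^*E=\{(y,e)\in Y\times E\mid f(y)=\pi(e)\}$. $\pi$ is trivial with fibre $F$ if there is a diffeomorphism $E\to X\times F$ over $X$. A local trivialisation is a D-open cover $\{U_\alpha\}$ of $X$ together with trivialisations of $E|_{U_\alpha}$ (fibre $F$); if one exists, $\pi$ is locally trivial. $\pi$ is a diffeological fibre bundle if $p^*E\to U$ is locally trivial for every plot $p\colon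 U\to X$. It is a principal $G$-bundle if moreover $G$ acts smoothly on $E$ and for every plot $p\colon U\to X$ and $u\in U$ there are an open neighbourhood $V$ of $u$ and a plot $q\colon V\to E$ with $\pi\circ q=p|_V$ such that $V\times G\to (p|_V)^*E$, $(v,g)\mapsto(v,g\cdot q(v))$ is an equivariant diffeomorphism. A diffeological fibre bundle is weakly D-numerable if there are a local trivialisation over a cover $\{U_i\}_{i\in\mathbb{N}}$ and a pointwise-finite smooth partition of unity $\{\zeta_i\}_{i\in\mathbb{N}}$ with $\zeta_i^{-1}((0,1])\subseteq U_i$; it is D-numerable if these can be chosen with $\{U_i\}$ locally finite and $\operatorname{supp}(\zeta_i)\subseteq U_i$ for each $i$. Isomorphisms of principal $G$-bundles over $X$ are $G$-equivariant diffeomorphisms over $X$. Milnor construction. Let $S_G\subseteq[0,1]^{\mathbb{N}}\times G^{\mathbb{N}}$ be the set of $(t_i,g_i)_{i\in\mathbb{N}}$ with only finitely many $t_i\ne 0$ and $\sum_i t_i=1$, with the subset diffeology of the product diffeology. Define $(t_i,g_i)\sim(t_i',g_i')$ iff $t_i=t_i'$ for all $i$ and $g_i=g_i'$ whenever $t_i=t'_i\neq0$. $EG:=S_G/\!\sim$ with the quotient diffeology, with elements $(t_ig_i)$; $G$ acts on $EG$ by $h\cdot(t_ig_i)=(t_ig_ih^{-1})$, and $BG:=EG/G$ with the quotient diffeology, with elements $[t_ig_i]$. *)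

theory Defs
  imports "HOL-Analysis.Analysis" "HOL-Algebra.Group"
begin

section \<open>Smooth maps between open subsets of Euclidean spaces\<close>

text \<open>
  Plots have domains in Euclidean spaces of all finite dimensions, so \<open>\<real>\<^sup>n\<close> is the subspace
  \<^term>\<open>topspace (Euclidean_space n)\<close> of \<^typ>\<open>nat \<Rightarrow> real\<close> consisting of the sequences that vanish
  from index \<open>n\<close> on. Maps on an open set are total functions whose values outside the domain are
  irrelevant.

  A function on an open set is \<open>C\<^sup>k\<^sup>+\<^sup>1\<close> iff it is continuous and has all first order partial
  derivatives, and these are \<open>C\<^sup>k\<close>.
\<close>

fun Ck_on :: "nat \<Rightarrow> nat \<Rightarrow> (nat \<Rightarrow> real) set \<Rightarrow> ((nat \<Rightarrow> real) \<Rightarrow> real) \<Rightarrow> bool" where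
  "Ck_on 0 n U f \<longleftrightarrow> continuous_map (subtopology (Euclidean_space n) U) euclideanreal f"
| "Ck_on (Suc k) n U f \<longleftrightarrow>
     continuous_map (subtopology (Euclidean_space n) U) euclideanreal f \<and>
     (\<forall>i<n. \<exists>f'. (\<forall>x\<in>U. ((\<lambda>t. f (x(i := t))) has_real_derivative f' x) (at (x i))) \<and>
                 Ck_on k n U f')"

definition smooth_function :: "nat \<Rightarrow> (nat \<Rightarrow> real) set \<Rightarrow> ((nat \<Rightarrow> real) \<Rightarrow> real) \<Rightarrow> bool" where
  "smooth_function n U f \<longleftrightarrow> (\<forall>k. Ck_on k n U f)"

definition smooth_between ::
  "nat \<Rightarrow> (nat \<Rightarrow> real) set \<Rightarrow> nat \<Rightarrow> (nat \<Rightarrow> real) set \<Rightarrow> ((nat \<Rightarrow> real) \<Rightarrow> nat \<Rightarrow> real) \<Rightarrow> bool"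
  where
  "smooth_between m V n U f \<longleftrightarrow> f \<in> V \<rightarrow> U \<and> (\<forall>i<n. smooth_function m V (\<lambda>v. f v i))"


section \<open>Diffeological spaces\<close>

text \<open>\<open>plots X n U\<close> is the set of plots of \<open>X\<close> with domain the open set \<open>U\<close> of \<open>\<real>\<^sup>n\<close>.\<close>

record 'a diffeology = "'a partial_object" +
  plots :: "nat \<Rightarrow> (nat \<Rightarrow> real) set \<Rightarrow> ((nat \<Rightarrow> real) \<Rightarrow> 'a) set"

text \<open>
  The last condition also makes membership in \<open>plots X n U\<close> independent of the values outside \<open>U\<close>.
\<close>

definition diffeological_space :: "'a diffeology \<Rightarrow> bool" where
  "diffeological_space X \<longleftrightarrow>
     (\<forall>n U p. p \<in> plots X n U \<longrightarrow> openin (Euclidean_space n) U \<and> p \<in> U \<rightarrow> carrier X) \<and>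
     (\<forall>n U x. openin (Euclidean_space n) U \<and> x \<in> carrier X \<longrightarrow> (\<lambda>_. x) \<in> plots X n U) \<and>
     (\<forall>n U p m V f. p \<in> plots X n U \<and> openin (Euclidean_space m) V \<and> smooth_between m V n U f
        \<longrightarrow> p \<circ> f \<in> plots X m V) \<and>
     (\<forall>n U p. openin (Euclidean_space n) U \<and>
        (\<forall>u\<in>U. \<exists>V q. openin (Euclidean_space n) V \<and> u \<in> V \<and> V \<subseteq> U \<and>
                      q \<in> plots X n V \<and> (\<forall>v\<in>V. p v = q v))
        \<longrightarrow> p \<in> plots X n U)"

definition smooth_map :: "'a diffeology \<Rightarrow> 'b diffeology \<Rightarrow> ('a \<Rightarrow> 'b) \<Rightarrow> bool" where
  "smooth_map X Y f \<longleftrightarrow>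
     f \<in> carrier X \<rightarrow> carrier Y \<and> (\<forall>n U. \<forall>p\<in>plots X n U. f \<circ> p \<in> plots Y n U)"

definition diffeomorphism :: "'a diffeology \<Rightarrow> 'b diffeology \<Rightarrow> ('a \<Rightarrow> 'b) \<Rightarrow> bool" where
  "diffeomorphism X Y f \<longleftrightarrow>
     bij_betw f (carrier X) (carrier Y) \<and> smooth_map X Y f \<and>
     smooth_map Y X (inv_into (carrier X) f)"

definition D_topology :: "'a diffeology \<Rightarrow> 'a topology" where
  "D_topology X = topology (\<lambda>A. A \<subseteq> carrier X \<and>
     (\<forall>n U. \<forall>p\<in>plots X n U. openin (Euclidean_space n) {u \<in> U. p u \<in> A}))"

lemma openin_D_topology:
  "openin (D_topology X) A \<longleftrightarrow> A \<subseteq> carrier X \<and>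
     (\<forall>n U. \<forall>p\<in>plots X n U. openin (Euclidean_space n) {u \<in> U. p u \<in> A})"
proof -
  have "istopology (\<lambda>A. A \<subseteq> carrier X \<and>
     (\<forall>n U. \<forall>p\<in>plots X n U. openin (Euclidean_space n) {u \<in> U. p u \<in> A}))"
    unfolding istopology_def
  proof (intro conjI allI impI ballI)
    fix S T n U p
    assume S: "S \<subseteq> carrier X \<and>
        (\<forall>n U. \<forall>p\<in>plots X n U. openin (Euclidean_space n) {u \<in> U. p u \<in> S})"
      and T: "T \<subseteq> carrier X \<and>
        (\<forall>n U. \<forall>p\<in>plots X n U. openin (Euclidean_space n) {u \<in> U. p u \<in> T})"
    show "S \<inter> T \<subseteq> carrier X" using S by blast
    assume p: "p \<in> plots X n U"
    have "{u \<in> U. p u \<in> S \<inter> T} = {u \<in> U. p u \<in> S} \<inter> {u \<in> U. p u \<in> T}" by blast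
    then show "openin (Euclidean_space n) {u \<in> U. p u \<in> S \<inter> T}"
      using S T p by auto
  next
    fix \<K> n U p
    assume K: "\<forall>K\<in>\<K>. K \<subseteq> carrier X \<and>
        (\<forall>n U. \<forall>p\<in>plots X n U. openin (Euclidean_space n) {u \<in> U. p u \<in> K})"
    show "\<Union> \<K> \<subseteq> carrier X" using K by blast
    assume p: "p \<in> plots X n U"
    have "{u \<in> U. p u \<in> \<Union> \<K>} = \<Union> ((\<lambda>K. {u \<in> U. p u \<in> K}) ` \<K>)" by blast
    then show "openin (Euclidean_space n) {u \<in> U. p u \<in> \<Union> \<K>}"
      using K p by auto
  qed
  then show ?thesis
    unfolding D_topology_def by (simp add: topology_inverse')
qed

definition euclidean_diffeology :: "nat \<Rightarrow> (nat \<Rightarrow> real) set \<Rightarrow> (nat \<Rightarrow> real) diffeology" where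
  "euclidean_diffeology n U =
     \<lparr>carrier = U, plots = \<lambda>m V. {f. openin (Euclidean_space m) V \<and> smooth_between m V n U f}\<rparr>"

definition real_diffeology :: "real diffeology" where
  "real_diffeology =
     \<lparr>carrier = UNIV, plots = \<lambda>m V. {f. openin (Euclidean_space m) V \<and> smooth_function m V f}\<rparr>"

definition subset_diffeology :: "'a diffeology \<Rightarrow> 'a set \<Rightarrow> 'a diffeology" where
  "subset_diffeology X A =
     \<lparr>carrier = carrier X \<inter> A, plots = \<lambda>n U. {p \<in> plots X n U. p \<in> U \<rightarrow> A}\<rparr>"

definition prod_diffeology :: "'a diffeology \<Rightarrow> 'b diffeology \<Rightarrow> ('a \<times> 'b) diffeology" where
  "prod_diffeology X Y =
     \<lparr>carrier = carrier X \<times> carrier Y,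
      plots = \<lambda>n U. {p. fst \<circ> p \<in> plots X n U \<and> snd \<circ> p \<in> plots Y n U}\<rparr>"

definition seq_diffeology :: "'a diffeology \<Rightarrow> (nat \<Rightarrow> 'a) diffeology" where
  "seq_diffeology X =
     \<lparr>carrier = UNIV \<rightarrow> carrier X, plots = \<lambda>n U. {p. \<forall>i. (\<lambda>u. p u i) \<in> plots X n U}\<rparr>"

definition quotient_diffeology :: "'a diffeology \<Rightarrow> ('a \<times> 'a) set \<Rightarrow> 'a set diffeology" where
  "quotient_diffeology X r =
     \<lparr>carrier = carrier X // r,
      plots = \<lambda>n U. {p. openin (Euclidean_space n) U \<and>
        (\<forall>u\<in>U. \<exists>V q. openin (Euclidean_space n) V \<and> u \<in> V \<and> V \<subseteq> U \<and>
                      q \<in> plots X n V \<and> (\<forall>v\<in>V. p v = r `` {q v}))}\<rparr>"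

definition unit_interval_diffeology :: "real diffeology" where
  "unit_interval_diffeology = subset_diffeology real_diffeology {0..1}"

definition smoothly_homotopic ::
  "'a diffeology \<Rightarrow> 'b diffeology \<Rightarrow> ('a \<Rightarrow> 'b) \<Rightarrow> ('a \<Rightarrow> 'b) \<Rightarrow> bool" where
  "smoothly_homotopic X Y f g \<longleftrightarrow>
     (\<exists>H. smooth_map (prod_diffeology X real_diffeology) Y H \<and>
          (\<forall>x\<in>carrier X. H (x, 0) = f x \<and> H (x, 1) = g x))"


section \<open>Covers, partitions of unity, smooth paracompactness\<close>

definition open_cover :: "'a topology \<Rightarrow> 'i set \<Rightarrow> ('i \<Rightarrow> 'a set) \<Rightarrow> bool" where
  "open_cover T I U \<longleftrightarrow> (\<forall>i\<in>I. openin T (U i)) \<and> (\<Union>i\<in>I. U i) = topspace T"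

definition locally_finite_family :: "'a topology \<Rightarrow> 'i set \<Rightarrow> ('i \<Rightarrow> 'a set) \<Rightarrow> bool" where
  "locally_finite_family T I A \<longleftrightarrow>
     (\<forall>x\<in>topspace T. \<exists>V. openin T V \<and> x \<in> V \<and> finite {i \<in> I. A i \<inter> V \<noteq> {}})"

definition paracompact_space :: "'a topology \<Rightarrow> bool" where
  "paracompact_space T \<longleftrightarrow>
     (\<forall>\<U>. open_cover T \<U> id \<longrightarrow>
        (\<exists>\<V>. open_cover T \<V> id \<and> (\<forall>V\<in>\<V>. \<exists>U\<in>\<U>. V \<subseteq> U) \<and> locally_finite_in T \<V>))"

definition smooth_support :: "'a diffeology \<Rightarrow> ('a \<Rightarrow> real) \<Rightarrow> 'a set" where
  "smooth_support X \<zeta> = D_topology X closure_of {x \<in> carrier X. \<zeta> x \<noteq> 0}"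

definition pointwise_finite_partition_of_unity ::
  "'a diffeology \<Rightarrow> 'i set \<Rightarrow> ('i \<Rightarrow> 'a \<Rightarrow> real) \<Rightarrow> bool" where
  "pointwise_finite_partition_of_unity X I \<zeta> \<longleftrightarrow>
     (\<forall>i\<in>I. smooth_map X unit_interval_diffeology (\<zeta> i)) \<and>
     (\<forall>x\<in>carrier X. finite {i \<in> I. \<zeta> i x \<noteq> 0} \<and> (\<Sum>i | i \<in> I \<and> \<zeta> i x \<noteq> 0. \<zeta> i x) = 1)"

definition subordinate_partition_of_unity ::
  "'a diffeology \<Rightarrow> 'i set \<Rightarrow> ('i \<Rightarrow> 'a set) \<Rightarrow> ('i \<Rightarrow> 'a \<Rightarrow> real) \<Rightarrow> bool" where
  "subordinate_partition_of_unity X I U \<zeta> \<longleftrightarrow>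
     pointwise_finite_partition_of_unity X I \<zeta> \<and>
     locally_finite_family (D_topology X) I (\<lambda>i. smooth_support X (\<zeta> i)) \<and>
     (\<forall>i\<in>I. smooth_support X (\<zeta> i) \<subseteq> U i)"

definition smoothly_paracompact :: "'a diffeology \<Rightarrow> bool" where
  "smoothly_paracompact X \<longleftrightarrow>
     paracompact_space (D_topology X) \<and>
     (\<forall>\<U>. open_cover (D_topology X) \<U> id \<longrightarrow> (\<exists>\<zeta>. subordinate_partition_of_unity X \<U> id \<zeta>))"


section \<open>Diffeological groups and principal bundles\<close>

definition diffeological_group :: "('g, 'm) monoid_scheme \<Rightarrow> 'g diffeology \<Rightarrow> bool" where
  "diffeological_group G D \<longleftrightarrow>
     group G \<and> diffeological_space D \<and> carrier D = carrier G \<and>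
     smooth_map (prod_diffeology D D) D (\<lambda>(a, b). a \<otimes>\<^bsub>G\<^esub> b) \<and>
     smooth_map D D (\<lambda>a. inv\<^bsub>G\<^esub> a)"

definition smooth_action ::
  "('g, 'm) monoid_scheme \<Rightarrow> 'g diffeology \<Rightarrow> 'e diffeology \<Rightarrow> ('g \<Rightarrow> 'e \<Rightarrow> 'e) \<Rightarrow> bool" where
  "smooth_action G D E a \<longleftrightarrow>
     smooth_map (prod_diffeology D E) E (\<lambda>(g, e). a g e) \<and>
     (\<forall>e\<in>carrier E. a \<one>\<^bsub>G\<^esub> e = e) \<and>
     (\<forall>g\<in>carrier G. \<forall>h\<in>carrier G. \<forall>e\<in>carrier E. a (g \<otimes>\<^bsub>G\<^esub> h) e = a g (a h e))"

definition pullback_diffeology ::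
  "'y diffeology \<Rightarrow> ('y \<Rightarrow> 'x) \<Rightarrow> 'e diffeology \<Rightarrow> ('e \<Rightarrow> 'x) \<Rightarrow> ('y \<times> 'e) diffeology" where
  "pullback_diffeology Y f E \<pi> = subset_diffeology (prod_diffeology Y E) {(y, e). f y = \<pi> e}"

definition trivialisation ::
  "'e diffeology \<Rightarrow> 'x diffeology \<Rightarrow> ('e \<Rightarrow> 'x) \<Rightarrow> 'f diffeology \<Rightarrow> ('e \<Rightarrow> 'x \<times> 'f) \<Rightarrow> bool" where
  "trivialisation E X \<pi> F \<psi> \<longleftrightarrow>
     diffeomorphism E (prod_diffeology X F) \<psi> \<and> (\<forall>e\<in>carrier E. fst (\<psi> e) = \<pi> e)"

definition trivialised_over ::
  "'e diffeology \<Rightarrow> 'x diffeology \<Rightarrow> ('e \<Rightarrow> 'x) \<Rightarrow> 'f diffeology \<Rightarrow> 'i set \<Rightarrow> ('i \<Rightarrow> 'x set) \<Rightarrow> bool"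
  where
  "trivialised_over E X \<pi> F I U \<longleftrightarrow>
     diffeological_space F \<and> open_cover (D_topology X) I U \<and>
     (\<forall>i\<in>I. \<exists>\<psi>. trivialisation (subset_diffeology E (\<pi> -` U i)) (subset_diffeology X (U i)) \<pi> F \<psi>)"

text \<open>
  The fibre \<open>F\<close> may be sought in the type of the total space: a trivialisation over a nonempty set
  identifies \<open>F\<close> with a fibre of the bundle.
\<close>

definition locally_trivial :: "'e diffeology \<Rightarrow> 'x diffeology \<Rightarrow> ('e \<Rightarrow> 'x) \<Rightarrow> bool" where
  "locally_trivial E X \<pi> \<longleftrightarrow> (\<exists>(F :: 'e diffeology) \<U>. trivialised_over E X \<pi> F \<U> id)"

definition diffeological_fibre_bundle ::
  "'e diffeology \<Rightarrow> 'x diffeology \<Rightarrow> ('e \<Rightarrow> 'x) \<Rightarrow> bool" where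
  "diffeological_fibre_bundle E X \<pi> \<longleftrightarrow>
     diffeological_space E \<and> diffeological_space X \<and>
     smooth_map E X \<pi> \<and> \<pi> ` carrier E = carrier X \<and>
     (\<forall>n U. \<forall>p\<in>plots X n U.
        locally_trivial (pullback_diffeology (euclidean_diffeology n U) p E \<pi>)
          (euclidean_diffeology n U) fst)"

definition D_numerable :: "'e diffeology \<Rightarrow> 'x diffeology \<Rightarrow> ('e \<Rightarrow> 'x) \<Rightarrow> bool" where
  "D_numerable E X \<pi> \<longleftrightarrow>
     diffeological_fibre_bundle E X \<pi> \<and>
     (\<exists>(F :: 'e diffeology) (U :: nat \<Rightarrow> 'x set) \<zeta>.
        trivialised_over E X \<pi> F UNIV U \<and>
        locally_finite_family (D_topology X) UNIV U \<and>
        pointwise_finite_partition_of_unity X UNIV \<zeta> \<and>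
        (\<forall>i. smooth_support X (\<zeta> i) \<subseteq> U i))"

text \<open>A bundle with an action; its values outside the carriers are irrelevant.\<close>

record ('e, 'x, 'g) gbundle =
  total :: "'e diffeology"
  proj :: "'e \<Rightarrow> 'x"
  act :: "'g \<Rightarrow> 'e \<Rightarrow> 'e"

definition principal_bundle ::
  "('g, 'm) monoid_scheme \<Rightarrow> 'g diffeology \<Rightarrow> 'x diffeology \<Rightarrow> ('e, 'x, 'g) gbundle \<Rightarrow> bool" where
  "principal_bundle G D X P \<longleftrightarrow>
     diffeological_fibre_bundle (total P) X (proj P) \<and>
     smooth_action G D (total P) (act P) \<and>
     (\<forall>n U. \<forall>p\<in>plots X n U. \<forall>u\<in>U.
        \<exists>V q. openin (Euclidean_space n) V \<and> u \<in> V \<and> V \<subseteq> U \<and>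
          q \<in> plots (total P) n V \<and> (\<forall>v\<in>V. proj P (q v) = p v) \<and>
          diffeomorphism (prod_diffeology (euclidean_diffeology n V) D)
            (pullback_diffeology (euclidean_diffeology n V) p (total P) (proj P))
            (\<lambda>(v, g). (v, act P g (q v))) \<and>
          (\<forall>v\<in>V. \<forall>g\<in>carrier G. \<forall>h\<in>carrier G.
             act P (h \<otimes>\<^bsub>G\<^esub> g) (q v) = act P h (act P g (q v))))"

definition bundle_isomorphic ::
  "('g, 'm) monoid_scheme \<Rightarrow> ('e, 'x, 'g) gbundle \<Rightarrow> ('d, 'x, 'g) gbundle \<Rightarrow> bool" where
  "bundle_isomorphic G P Q \<longleftrightarrow>
     (\<exists>\<psi>. diffeomorphism (total P) (total Q) \<psi> \<and>
          (\<forall>e\<in>carrier (total P). proj Q (\<psi> e) = proj P e) \<and>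
          (\<forall>g\<in>carrier G. \<forall>e\<in>carrier (total P). \<psi> (act P g e) = act Q g (\<psi> e)))"

definition pullback_bundle ::
  "'y diffeology \<Rightarrow> ('y \<Rightarrow> 'x) \<Rightarrow> ('e, 'x, 'g) gbundle \<Rightarrow> ('y \<times> 'e, 'y, 'g) gbundle" where
  "pullback_bundle Y f P =
     \<lparr>total = pullback_diffeology Y f (total P) (proj P), proj = fst,
      act = \<lambda>g (y, e). (y, act P g e)\<rparr>"


section \<open>Milnor's construction\<close>

definition milnor_S :: "'g diffeology \<Rightarrow> ((nat \<Rightarrow> real) \<times> (nat \<Rightarrow> 'g)) diffeology" where
  "milnor_S D =
     subset_diffeology
       (prod_diffeology (seq_diffeology unit_interval_diffeology) (seq_diffeology D))
       {(t, g). finite {i. t i \<noteq> 0} \<and> (\<Sum>i | t i \<noteq> 0. t i) = 1}"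

definition milnor_rel ::
  "'g diffeology \<Rightarrow> (((nat \<Rightarrow> real) \<times> (nat \<Rightarrow> 'g)) \<times> ((nat \<Rightarrow> real) \<times> (nat \<Rightarrow> 'g))) set" where
  "milnor_rel D =
     {((t, g), (t', g')). (t, g) \<in> carrier (milnor_S D) \<and> (t', g') \<in> carrier (milnor_S D) \<and>
        t = t' \<and> (\<forall>i. t i \<noteq> 0 \<longrightarrow> g i = g' i)}"

definition milnor_EG :: "'g diffeology \<Rightarrow> ((nat \<Rightarrow> real) \<times> (nat \<Rightarrow> 'g)) set diffeology" where
  "milnor_EG D = quotient_diffeology (milnor_S D) (milnor_rel D)"

text \<open>Points of \<open>EG\<close> are equivalence classes; right translation maps classes onto classes.\<close>

definition milnor_act ::
  "('g, 'm) monoid_scheme \<Rightarrow> 'g \<Rightarrow> ((nat \<Rightarrow> real) \<times> (nat \<Rightarrow> 'g)) set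
     \<Rightarrow> ((nat \<Rightarrow> real) \<times> (nat \<Rightarrow> 'g)) set" where
  "milnor_act G h c = (\<lambda>(t, g). (t, \<lambda>i. g i \<otimes>\<^bsub>G\<^esub> inv\<^bsub>G\<^esub> h)) ` c"

definition milnor_orbit_rel ::
  "('g, 'm) monoid_scheme \<Rightarrow> 'g diffeology \<Rightarrow>
    (((nat \<Rightarrow> real) \<times> (nat \<Rightarrow> 'g)) set \<times> ((nat \<Rightarrow> real) \<times> (nat \<Rightarrow> 'g)) set) set" where
  "milnor_orbit_rel G D =
     {(c, c'). c \<in> carrier (milnor_EG D) \<and> (\<exists>h\<in>carrier G. c' = milnor_act G h c)}"

definition milnor_BG ::
  "('g, 'm) monoid_scheme \<Rightarrow> 'g diffeology \<Rightarrow> ((nat \<Rightarrow> real) \<times> (nat \<Rightarrow> 'g)) set set diffeology" where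
  "milnor_BG G D = quotient_diffeology (milnor_EG D) (milnor_orbit_rel G D)"


section \<open>Categories and contravariant functors to sets\<close>

record ('o, 'm) category =
  Obj :: "'o set"
  Hom :: "'o \<Rightarrow> 'o \<Rightarrow> 'm set"
  Id :: "'o \<Rightarrow> 'm"
  Comp :: "'o \<Rightarrow> 'o \<Rightarrow> 'o \<Rightarrow> 'm \<Rightarrow> 'm \<Rightarrow> 'm"

text \<open>\<open>Fm X Y \<phi> : Fo Y \<rightarrow> Fo X\<close> is the action of \<open>\<phi> : X \<rightarrow> Y\<close>.\<close>

definition contravariant_set_functor ::
  "('o, 'm) category \<Rightarrow> ('o \<Rightarrow> 's set) \<Rightarrow> ('o \<Rightarrow> 'o \<Rightarrow> 'm \<Rightarrow> 's \<Rightarrow> 's) \<Rightarrow> bool" where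
  "contravariant_set_functor C Fo Fm \<longleftrightarrow>
     (\<forall>X\<in>Obj C. \<forall>Y\<in>Obj C. \<forall>\<phi>\<in>Hom C X Y. Fm X Y \<phi> \<in> Fo Y \<rightarrow> Fo X) \<and>
     (\<forall>X\<in>Obj C. \<forall>c\<in>Fo X. Fm X X (Id C X) c = c) \<and>
     (\<forall>X\<in>Obj C. \<forall>Y\<in>Obj C. \<forall>Z\<in>Obj C. \<forall>\<phi>\<in>Hom C X Y. \<forall>\<psi>\<in>Hom C Y Z. \<forall>c\<in>Fo Z.
        Fm X Z (Comp C X Y Z \<psi> \<phi>) c = Fm X Y \<phi> (Fm Y Z \<psi> c))"

definition natural_isomorphism ::
  "('o, 'm) category \<Rightarrow> ('o \<Rightarrow> 's set) \<Rightarrow> ('o \<Rightarrow> 'o \<Rightarrow> 'm \<Rightarrow> 's \<Rightarrow> 's) \<Rightarrow>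
     ('o \<Rightarrow> 't set) \<Rightarrow> ('o \<Rightarrow> 'o \<Rightarrow> 'm \<Rightarrow> 't \<Rightarrow> 't) \<Rightarrow> ('o \<Rightarrow> 's \<Rightarrow> 't) \<Rightarrow> bool" where
  "natural_isomorphism C Fo Fm Ko Km \<eta> \<longleftrightarrow>
     (\<forall>X\<in>Obj C. bij_betw (\<eta> X) (Fo X) (Ko X)) \<and>
     (\<forall>X\<in>Obj C. \<forall>Y\<in>Obj C. \<forall>\<phi>\<in>Hom C X Y. \<forall>c\<in>Fo Y. \<eta> X (Fm X Y \<phi> c) = Km X Y \<phi> (\<eta> Y c))"

text \<open>Morphisms are normalised to be undefined outside the carrier, so that they are honest functions.\<close>

definition smooth_hom :: "'a diffeology \<Rightarrow> 'b diffeology \<Rightarrow> ('a \<Rightarrow> 'b) set" where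
  "smooth_hom X Y = {f \<in> extensional (carrier X). smooth_map X Y f}"

text \<open>The category of diffeological spaces whose points are taken from the type \<^typ>\<open>'x\<close>.\<close>

definition Diffeol :: "('x diffeology, 'x \<Rightarrow> 'x) category" where
  "Diffeol =
     \<lparr>Obj = {X. diffeological_space X}, Hom = smooth_hom,
      Id = (\<lambda>X. restrict id (carrier X)), Comp = (\<lambda>X Y Z \<psi> \<phi>. compose (carrier X) \<psi> \<phi>)\<rparr>"

definition Diffeol_HSP :: "('x diffeology, 'x \<Rightarrow> 'x) category" where
  "Diffeol_HSP = Diffeol
     \<lparr>Obj := {X \<in> Obj Diffeol. Hausdorff_space (D_topology X) \<and>
                second_countable (D_topology X) \<and> smoothly_paracompact X}\<rparr>"


section \<open>The two functors\<close>

text \<open>\<open>[X, Z]\<close> and precomposition.\<close>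

definition homotopy_rel ::
  "'x diffeology \<Rightarrow> 'z diffeology \<Rightarrow> (('x \<Rightarrow> 'z) \<times> ('x \<Rightarrow> 'z)) set" where
  "homotopy_rel X Z =
     {(f, g). f \<in> smooth_hom X Z \<and> g \<in> smooth_hom X Z \<and> smoothly_homotopic X Z f g}"

definition homotopy_classes :: "'z diffeology \<Rightarrow> 'x diffeology \<Rightarrow> ('x \<Rightarrow> 'z) set set" where
  "homotopy_classes Z X = smooth_hom X Z // homotopy_rel X Z"

definition homotopy_precomp ::
  "'z diffeology \<Rightarrow> 'x diffeology \<Rightarrow> 'x diffeology \<Rightarrow> ('x \<Rightarrow> 'x)
     \<Rightarrow> ('x \<Rightarrow> 'z) set \<Rightarrow> ('x \<Rightarrow> 'z) set" where
  "homotopy_precomp Z X Y \<phi> c = homotopy_rel X Z `` ((\<lambda>f. compose (carrier X) f \<phi>) ` c)"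

text \<open>
  \<open>\<B>\<^sub>G(X)\<close>, built from bundles whose total space is carried by the type \<^typ>\<open>'e\<close>. The total space
  of a principal \<open>G\<close>-bundle over \<open>X\<close> is in (non-canonical) bijection with \<open>X \<times> G\<close>. Hence every such
  bundle is isomorphic to one carried by \<^typ>\<open>'e\<close> as soon as \<^typ>\<open>'x \<times> 'g\<close> embeds into
  \<^typ>\<open>'e\<close>, and then no isomorphism class is missing. As the pullback
  of such a bundle is carried by \<^typ>\<open>'x \<times> 'e\<close>, its class consists of the bundles carried by
  \<^typ>\<open>'e\<close> that are isomorphic to it.
\<close>

definition numerable_bundles ::
  "('g, 'm) monoid_scheme \<Rightarrow> 'g diffeology \<Rightarrow> 'x diffeology \<Rightarrow> ('e, 'x, 'g) gbundle set" where
  "numerable_bundles G D X = {P. principal_bundle G D X P \<and> D_numerable (total P) X (proj P)}"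

definition bundle_rel ::
  "('g, 'm) monoid_scheme \<Rightarrow> 'g diffeology \<Rightarrow> 'x diffeology
     \<Rightarrow> (('e, 'x, 'g) gbundle \<times> ('e, 'x, 'g) gbundle) set" where
  "bundle_rel G D X =
     {(P, Q). P \<in> numerable_bundles G D X \<and> Q \<in> numerable_bundles G D X \<and> bundle_isomorphic G P Q}"

definition bundle_classes ::
  "('g, 'm) monoid_scheme \<Rightarrow> 'g diffeology \<Rightarrow> 'x diffeology \<Rightarrow> ('e, 'x, 'g) gbundle set set" where
  "bundle_classes G D X = numerable_bundles G D X // bundle_rel G D X"

definition bundle_pullback ::
  "('g, 'm) monoid_scheme \<Rightarrow> 'g diffeology \<Rightarrow> 'x diffeology \<Rightarrow> 'x diffeology \<Rightarrow> ('x \<Rightarrow> 'x)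
     \<Rightarrow> ('e, 'x, 'g) gbundle set \<Rightarrow> ('e, 'x, 'g) gbundle set" where
  "bundle_pullback G D X Y \<phi> c =
     {Q \<in> numerable_bundles G D X. \<exists>P\<in>c. bundle_isomorphic G (pullback_bundle X \<phi> P) Q}"

end

theory Submission
  imports Defs
begin

text \<open>
  A principal bundle is a smooth torsor: plots of the base lift locally, and the group element taking one point
  of a fibre to another depends smoothly on the two points. Classifying maps of a bundle are the maps covered by
  equivariant smooth maps from its total space to \<open>EG\<close>, so bundles with a common classifying map are isomorphic.

  A numerable bundle has a classifying map, with the partition of unity as first coordinates and the local
  trivialisations as second ones; local finiteness supplies the lifts to \<open>S\<^sub>G\<close>. Two classifying maps of
  one bundle are homotopic by Milnor's argument: spread the coordinates of the first over the even slots and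
  those of the second over the odd ones, and join the results linearly. Spreading is smooth only for locally
  finite coordinates; a partition of unity subordinate to the sets where the coordinates do not vanish
  achieves this by a linear homotopy.

  Conversely an equivariant map to \<open>EG\<close> is carried along a homotopy of the map it covers. A point of \<open>EG\<close> is
  determined by its image in \<open>BG\<close> and its group coordinate in any one slot where the weight does not vanish, so
  it can be moved as long as this slot stays non-zero. By compactness the unit interval splits, locally over the
  base, into finitely many pieces with a common such slot, and a countable partition of unity on the base
  is used to advance the time one summand after the other.
\<close>

section \<open>Calculus\<close>

text \<open>The obstacle that shapes the proof is the quotient diffeology of \<open>EG\<close>. A
  plot of \<open>EG\<close> must lift near each point to \<open>milnor_S D\<close>, with all the
  infinitely many group coordinates being plots on one common neighbourhood, although a group
  coordinate exists only where its weight is non-zero. Pointwise finite weights give no such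
  neighbourhood. Locally finite ones do: near the point all but finitely many slots are empty, and
  in each of the others either the coordinate is a plot or the weight vanishes identically. This is
  where it matters that supports, and not only non-vanishing sets, lie in the trivialising sets.
  Weights of two maps can be averaged only if each slot has one group coordinate in play; otherwise
  no group element could be attached to the sum. Hence the even and odd slots. Homotopies are
  parametrised by the whole real line, so smooth cut-offs replace all piecewise linear
  constructions. Bundles live in a fixed type, so pullbacks have to be carried back into it by
  transport of structure.\<close>

abbreviation eopen :: "nat \<Rightarrow> (nat \<Rightarrow> real) set \<Rightarrow> bool" where
  "eopen n U \<equiv> openin (Euclidean_space n) U"

lemma Euclidean_space_eq: "Euclidean_space n = top_of_set {x. \<forall>i\<ge>n. x i = 0}"
  by (simp add: Euclidean_space_def euclidean_product_topology)

lemma eopen_zero: "eopen n U \<Longrightarrow> x \<in> U \<Longrightarrow> i \<ge> n \<Longrightarrow> x i = 0"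
  using openin_subset[of "Euclidean_space n" U] by (auto simp: topspace_Euclidean_space)

lemma subtopology_eopen:
  assumes "eopen n U" shows "subtopology (Euclidean_space n) U = top_of_set U"
proof -
  have "{x. \<forall>i\<ge>n. x i = 0} \<inter> U = U"
    using eopen_zero[OF assms] by auto
  then show ?thesis by (simp add: Euclidean_space_eq subtopology_subtopology)
qed

lemma continuous_map_eopen:
  assumes "eopen n U"
  shows "continuous_map (subtopology (Euclidean_space n) U) euclidean f \<longleftrightarrow> continuous_on U f"
  by (simp add: subtopology_eopen[OF assms])

lemma eopen_preimage:
  assumes "eopen n U" "continuous_on U f" "open W"
  shows "eopen n {u \<in> U. f u \<in> W}"
proof -
  have "{u \<in> U. f u \<in> W} = U \<inter> f -` W" by auto
  then have "openin (subtopology (Euclidean_space n) U) {u \<in> U. f u \<in> W}"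
    using continuous_openin_preimage_gen[OF assms(2,3)] subtopology_eopen[OF assms(1)] by simp
  then show ?thesis using openin_trans_full assms(1) by blast
qed

lemma continuous_on_fun_upd: "continuous_on S (\<lambda>t::real. (x :: nat \<Rightarrow> real)(i := t))"
proof (rule continuous_on_coordinatewise_then_product)
  fix j show "continuous_on S (\<lambda>t. (x(i := t)) j)"
    by (cases "j = i") (auto intro: continuous_on_id continuous_on_const)
qed

text \<open>The derivative in \<open>Ck_on\<close> is two-sided and looks at \<open>f\<close> along
  a whole coordinate line. Openness of \<open>U\<close> keeps the line inside \<open>U\<close> for a
  short while, so values outside \<open>U\<close> never matter.\<close>

lemma eopen_fun_upd:
  assumes "eopen n U" "x \<in> U" "i < n"
  shows "open {t. x(i := t) \<in> U}"
proof -
  obtain W where W: "open W" "U = {x. \<forall>i\<ge>n. x i = 0} \<inter> W"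
    using assms(1) unfolding Euclidean_space_eq openin_open by blast
  have "{t. x(i := t) \<in> U} = (\<lambda>t. x(i := t)) -` W"
    using assms W by auto
  then show ?thesis
    using open_vimage[OF W(1) continuous_on_fun_upd] by simp
qed

lemma eventually_fun_upd_in:
  assumes "eopen n U" "x \<in> U" "i < n"
  shows "\<forall>\<^sub>F t in nhds (x i). x(i := t) \<in> U"
  using eventually_nhds_in_open[OF eopen_fun_upd[OF assms], of "x i"] assms by simp

lemma Ck_cong:
  assumes "eopen n U" "\<And>x. x \<in> U \<Longrightarrow> f x = g x" "Ck_on k n U f"
  shows "Ck_on k n U g"
proof (cases k)
  case 0
  then show ?thesis using assms
    by (simp add: continuous_map_eopen cong: continuous_on_cong)
next
  case (Suc l)
  have "((\<lambda>t. g (x(i := t))) has_real_derivative f' x) (at (x i))"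
    if "((\<lambda>t. f (x(i := t))) has_real_derivative f' x) (at (x i))" "x \<in> U" "i < n" for f' x i
  proof -
    have "\<forall>\<^sub>F t in nhds (x i). f (x(i := t)) = g (x(i := t))"
      using eventually_fun_upd_in[OF assms(1) that(2,3)] by eventually_elim (use assms(2) in auto)
    then show ?thesis
      using DERIV_cong_ev[OF refl _ refl, of "\<lambda>t. f (x(i := t))" "\<lambda>t. g (x(i := t))" "x i" "f' x"] that(1)
      by metis
  qed
  moreover have "continuous_on U g" if "continuous_on U f"
    using that assms(2) by (simp cong: continuous_on_cong)
  ultimately show ?thesis using assms(3) Suc
    by (simp add: continuous_map_eopen[OF assms(1)]) blast
qed

lemma Ck_continuous: "eopen n U \<Longrightarrow> Ck_on k n U f \<Longrightarrow> continuous_on U f"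
  by (cases k) (auto simp: continuous_map_eopen)

text \<open>One canonical function replaces the existential witness in \<open>Ck_on\<close>.
  Derivatives found on different open sets are then literally the same function, which makes
  restriction, localisation and induction on the order possible.\<close>

definition partial :: "nat \<Rightarrow> ((nat \<Rightarrow> real) \<Rightarrow> real) \<Rightarrow> (nat \<Rightarrow> real) \<Rightarrow> real" where
  "partial i f x = deriv (\<lambda>t. f (x(i := t))) (x i)"

lemma Ck_Suc:
  assumes "eopen n U"
  shows "Ck_on (Suc k) n U f \<longleftrightarrow> continuous_on U f \<and>
    (\<forall>i<n. (\<forall>x\<in>U. ((\<lambda>t. f (x(i := t))) has_real_derivative partial i f x) (at (x i))) \<and>
           Ck_on k n U (partial i f))" (is "?L = ?R")
proof
  assume L: ?L
  have "(\<forall>x\<in>U. ((\<lambda>t. f (x(i := t))) has_real_derivative partial i f x) (at (x i))) \<and>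
           Ck_on k n U (partial i f)" if i: "i < n" for i
  proof -
    have "\<forall>i<n. \<exists>f'. (\<forall>x\<in>U. ((\<lambda>t. f (x(i := t))) has_real_derivative f' x) (at (x i))) \<and> Ck_on k n U f'"
      using L unfolding Ck_on.simps(2) by (rule conjunct2)
    then obtain f' where f': "\<forall>x\<in>U. ((\<lambda>t. f (x(i := t))) has_real_derivative f' x) (at (x i))"
      "Ck_on k n U f'" using i by (elim allE[of _ i] impE exE conjE)
    have "partial i f x = f' x" if "x \<in> U" for x
      unfolding partial_def using f'(1) that by (simp add: DERIV_imp_deriv)
    then show ?thesis using f' Ck_cong[OF assms _ f'(2), of "partial i f"] by simp
  qed
  then show ?R using L by (simp add: continuous_map_eopen[OF assms])
next
  assume ?R
  then show ?L by (auto simp: continuous_map_eopen[OF assms])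
qed

lemma Ck_SucI:
  assumes "eopen n U" "continuous_on U f"
    and "\<And>i x. i < n \<Longrightarrow> x \<in> U \<Longrightarrow> ((\<lambda>t. f (x(i := t))) has_real_derivative f' i x) (at (x i))"
    and "\<And>i. i < n \<Longrightarrow> Ck_on k n U (f' i)"
  shows "Ck_on (Suc k) n U f"
  unfolding Ck_on.simps(2) continuous_map_eopen[OF assms(1)] using assms(2-4) by blast

lemma Ck_SucD:
  assumes "eopen n U" "Ck_on (Suc k) n U f" "i < n"
  shows "x \<in> U \<Longrightarrow> ((\<lambda>t. f (x(i := t))) has_real_derivative partial i f x) (at (x i))"
    and "Ck_on k n U (partial i f)"
  using assms(2,3) unfolding Ck_Suc[OF assms(1)] by blast+

lemma Ck_pred: "eopen n U \<Longrightarrow> Ck_on (Suc k) n U f \<Longrightarrow> Ck_on k n U f"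
proof (induction k arbitrary: f)
  case 0
  then show ?case by simp
next
  case (Suc k)
  show ?case
  proof (rule Ck_SucI[where f' = "\<lambda>i. partial i f"])
    show "continuous_on U f" by (rule Ck_continuous[OF Suc.prems])
  next
    fix i x assume "i < n" "x \<in> U"
    then show "((\<lambda>t. f (x(i := t))) has_real_derivative partial i f x) (at (x i))"
      by (rule Ck_SucD(1)[OF Suc.prems])
  next
    fix i assume "i < n"
    then show "Ck_on k n U (partial i f)"
      by (rule Suc.IH[OF Suc.prems(1) Ck_SucD(2)[OF Suc.prems]])
  qed (rule Suc.prems(1))
qed

text \<open>Since \<open>partial i f\<close> is defined without reference to an open set, local
  derivatives need no gluing. The induction is over all \<open>f\<close>, as it is applied to the
  partial derivatives.\<close>

lemma Ck_local:
  assumes "eopen n U"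
    and "\<And>u. u \<in> U \<Longrightarrow> \<exists>V. eopen n V \<and> u \<in> V \<and> V \<subseteq> U \<and> Ck_on k n V f"
  shows "Ck_on k n U f"
  using assms(2)
proof (induction k arbitrary: f)
  case 0
  have "continuous_on U f"
    unfolding continuous_on_eq_continuous_within
  proof
    fix u assume "u \<in> U"
    then obtain V where V: "eopen n V" "u \<in> V" "V \<subseteq> U" "continuous_on V f"
      using 0 by (metis Ck_continuous)
    have "openin (top_of_set U) V"
      using V(1,3) assms(1) by (metis openin_subtopology_Int2 inf.absorb_iff2 subtopology_eopen)
    then obtain W where "open W" "V = U \<inter> W" by (auto simp: openin_open)
    then have "at u within V = at u within U"
      using V(2) by (intro at_within_nhd[of u W]) auto
    then show "continuous (at u within U) f"
      using V by (metis continuous_on_eq_continuous_within continuous_within)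
  qed
  then show ?case by (simp add: continuous_map_eopen[OF assms(1)])
next
  case (Suc k)
  have D: "((\<lambda>t. f (x(i := t))) has_real_derivative partial i f x) (at (x i))"
    if "x \<in> U" "i < n" for x i
  proof -
    obtain V where "eopen n V" "x \<in> V" "Ck_on (Suc k) n V f"
      using Suc.prems[OF \<open>x \<in> U\<close>] by (elim exE conjE)
    then show ?thesis using Ck_SucD(1)[of n V k f i x] \<open>i < n\<close> by simp
  qed
  have "Ck_on k n U (partial i f)" if "i < n" for i
  proof (rule Suc.IH)
    fix u assume "u \<in> U"
    then obtain V where "eopen n V" "u \<in> V" "V \<subseteq> U" "Ck_on (Suc k) n V f"
      by (drule_tac Suc.prems, elim exE conjE)
    then show "\<exists>V. eopen n V \<and> u \<in> V \<and> V \<subseteq> U \<and> Ck_on k n V (partial i f)"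
      using Ck_SucD(2)[of n V k f i] that by (intro exI[of _ V] conjI)
  qed
  moreover have "Ck_on k n U f"
  proof (rule Suc.IH)
    fix u assume "u \<in> U"
    then show "\<exists>V. eopen n V \<and> u \<in> V \<and> V \<subseteq> U \<and> Ck_on k n V f"
      by (drule_tac Suc.prems) (blast dest: Ck_pred)
  qed
  then have "continuous_on U f" using Ck_continuous[OF assms(1)] by simp
  ultimately show ?case
    using Ck_SucI[OF assms(1), of f "\<lambda>i. partial i f" k] D by simp
qed

lemma Ck_subset: "eopen n U \<Longrightarrow> eopen n V \<Longrightarrow> V \<subseteq> U \<Longrightarrow> Ck_on k n U f \<Longrightarrow> Ck_on k n V f"
proof (induction k arbitrary: f)
  case 0
  then show ?case using continuous_on_subset by (auto simp: continuous_map_eopen)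
next
  case (Suc k)
  show ?case
  proof (rule Ck_SucI[where f' = "\<lambda>i. partial i f"])
    show "continuous_on V f"
      using Ck_continuous[OF Suc.prems(1,4)] Suc.prems(3) continuous_on_subset by blast
  next
    fix i x assume "i < n" "x \<in> V"
    then show "((\<lambda>t. f (x(i := t))) has_real_derivative partial i f x) (at (x i))"
      using Ck_SucD(1)[OF Suc.prems(1,4), of i x] Suc.prems(3) subsetD by metis
  next
    fix i assume "i < n"
    then show "Ck_on k n V (partial i f)"
      by (rule Suc.IH[OF Suc.prems(1-3) Ck_SucD(2)[OF Suc.prems(1,4)]])
  qed (rule Suc.prems(2))
qed

lemma Ck_const: "eopen n U \<Longrightarrow> Ck_on k n U (\<lambda>_. c)"
proof (induction k arbitrary: c)
  case (Suc k)
  show ?case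
    by (rule Ck_SucI[where f' = "\<lambda>_ _. 0"]) (use Suc in auto)
qed (simp add: continuous_map_eopen)

lemma Ck_add:
  "eopen n U \<Longrightarrow> Ck_on k n U f \<Longrightarrow> Ck_on k n U g \<Longrightarrow> Ck_on k n U (\<lambda>x. f x + g x)"
proof (induction k arbitrary: f g)
  case 0
  then show ?case by (auto simp: continuous_map_eopen intro: continuous_intros)
next
  case (Suc k)
  have "continuous_on U (\<lambda>x. f x + g x)"
    using Suc.prems Ck_continuous by (blast intro: continuous_on_add)
  moreover have "((\<lambda>t. f (x(i := t)) + g (x(i := t))) has_real_derivative
      partial i f x + partial i g x) (at (x i)) " if "i < n" "x \<in> U" for x i
    using Suc.prems that by (intro DERIV_add Ck_SucD(1))
  moreover have "Ck_on k n U (\<lambda>x. partial i f x + partial i g x)" if "i < n" for i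
    using Suc.prems that by (intro Suc.IH Ck_SucD(2))
  ultimately show ?case
    by (rule Ck_SucI[where f = "\<lambda>x. f x + g x" and f' = "\<lambda>i x. partial i f x + partial i g x", OF Suc.prems(1)])
qed

lemma Ck_mult:
  "eopen n U \<Longrightarrow> Ck_on k n U f \<Longrightarrow> Ck_on k n U g \<Longrightarrow> Ck_on k n U (\<lambda>x. f x * g x)"
proof (induction k arbitrary: f g)
  case 0
  then show ?case by (auto simp: continuous_map_eopen intro: continuous_intros)
next
  case (Suc k)
  have c: "continuous_on U (\<lambda>x. f x * g x)"
    using Suc.prems Ck_continuous by (blast intro: continuous_on_mult)
  have d: "((\<lambda>t. f (x(i := t)) * g (x(i := t))) has_real_derivative
      partial i f x * g x + partial i g x * f x) (at (x i))" if "i < n" "x \<in> U" for x i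
  proof -
    have "((\<lambda>t. f (x(i := t))) has_real_derivative partial i f x) (at (x i))"
      by (rule Ck_SucD(1)[OF Suc.prems(1,2) that])
    moreover have "((\<lambda>t. g (x(i := t))) has_real_derivative partial i g x) (at (x i))"
      by (rule Ck_SucD(1)[OF Suc.prems(1,3) that])
    ultimately show ?thesis using DERIV_mult[of "\<lambda>t. f (x(i := t))" _ "x i" UNIV "\<lambda>t. g (x(i := t))"] by simp
  qed
  have k: "Ck_on k n U (\<lambda>x. partial i f x * g x + partial i g x * f x)" if "i < n" for i
  proof (rule Ck_add[OF Suc.prems(1)])
    show "Ck_on k n U (\<lambda>x. partial i f x * g x)"
      by (rule Suc.IH[OF Suc.prems(1) Ck_SucD(2)[OF Suc.prems(1,2) that] Ck_pred[OF Suc.prems(1,3)]])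
    show "Ck_on k n U (\<lambda>x. partial i g x * f x)"
      by (rule Suc.IH[OF Suc.prems(1) Ck_SucD(2)[OF Suc.prems(1,3) that] Ck_pred[OF Suc.prems(1,2)]])
  qed
  show ?case
    by (rule Ck_SucI[where f = "\<lambda>x. f x * g x"
          and f' = "\<lambda>i x. partial i f x * g x + partial i g x * f x", OF Suc.prems(1) c d k])
qed

lemma Ck_sum:
  "eopen n U \<Longrightarrow> (\<And>i. i \<in> I \<Longrightarrow> Ck_on k n U (f i)) \<Longrightarrow> Ck_on k n U (\<lambda>x. \<Sum>i\<in>I. f i x)"
proof (induction I rule: infinite_finite_induct)
  case (insert i I)
  then show ?case using Ck_add[of n U k "f i" "\<lambda>x. \<Sum>i\<in>I. f i x"] by simp
qed (simp_all add: Ck_const)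

lemma Ck_coord:
  assumes "eopen n U" shows "Ck_on k n U (\<lambda>x. x i)"
proof (cases k)
  case 0
  then show ?thesis using continuous_on_subset[OF continuous_on_product_coordinates subset_UNIV]
    by (simp add: continuous_map_eopen[OF assms])
next
  case (Suc l)
  have d: "((\<lambda>t. (x(j := t)) i) has_real_derivative (if i = j then 1 else 0)) (at (x j))"
    for x :: "nat \<Rightarrow> real" and j
    by (cases "i = j") auto
  moreover have "continuous_on U (\<lambda>x. x i)"
    by (rule continuous_on_subset[OF continuous_on_product_coordinates subset_UNIV])
  ultimately show ?thesis unfolding Suc using assms
    by (intro Ck_SucI[where f' = "\<lambda>j _. if i = j then 1 else 0"] Ck_const)
qed

text \<open>All iterated derivatives are given at once as a sequence \<open>d\<close>. In
  \<open>Ck_compose_real\<close> the induction then treats all \<open>d m\<close> simultaneously,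
  because differentiating \<open>d m\<close> after \<open>f\<close> produces
  \<open>d (Suc m)\<close>.\<close>

definition smooth_on_real :: "real set \<Rightarrow> (real \<Rightarrow> real) \<Rightarrow> bool" where
  "smooth_on_real S f \<longleftrightarrow>
     (\<exists>d. d 0 = f \<and> (\<forall>m. \<forall>x\<in>S. (d m has_real_derivative d (Suc m) x) (at x)))"

lemma Ck_compose_real:
  assumes "eopen n U" "smooth_on_real S b" "f \<in> U \<rightarrow> S" "Ck_on k n U f"
  shows "Ck_on k n U (\<lambda>x. b (f x))"
proof -
  obtain d where d: "d 0 = b" "\<And>m x. x \<in> S \<Longrightarrow> (d m has_real_derivative d (Suc m) x) (at x)"
    using assms(2) unfolding smooth_on_real_def by blast
  have cd: "continuous_on S (d m)" for m
    by (rule DERIV_continuous_on[OF has_field_derivative_at_within[OF d(2)]])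
  have "Ck_on k n U (\<lambda>x. d m (f x))" for m
    using assms(4)
  proof (induction k arbitrary: m)
    case 0
    then have "continuous_on U f" using assms(1) Ck_continuous by blast
    then have "continuous_on U (\<lambda>x. d m (f x))"
      using cd assms(3) by (intro continuous_on_compose2[OF cd]) auto
    then show ?case by (simp add: continuous_map_eopen[OF assms(1)])
  next
    case (Suc k)
    have "continuous_on U f" using assms(1) Suc.prems Ck_continuous by blast
    then have "continuous_on U (\<lambda>x. d m (f x))"
      using cd assms(3) by (intro continuous_on_compose2[OF cd]) auto
    moreover have "((\<lambda>t. d m (f (x(i := t)))) has_real_derivative
        d (Suc m) (f x) * partial i f x) (at (x i))" if "i < n" "x \<in> U" for x i
    proof -
      have 1: "((\<lambda>t. f (x(i := t))) has_real_derivative partial i f x) (at (x i))"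
        using Suc.prems assms(1) that by (intro Ck_SucD(1))
      have "(d m has_real_derivative d (Suc m) (f x)) (at (f (x(i := x i))))"
        using d(2) assms(3) that by auto
      from DERIV_chain2[OF this 1] show ?thesis .
    qed
    moreover have "Ck_on k n U (\<lambda>x. d (Suc m) (f x) * partial i f x)" if "i < n" for i
      using Ck_SucD(2)[OF assms(1) Suc.prems that] Suc.IH[OF Ck_pred[OF assms(1) Suc.prems]]
      by (rule Ck_mult[OF assms(1) _, rotated])
    ultimately show ?case
      by (rule Ck_SucI[OF assms(1), where f = "\<lambda>x. d m (f x)" and f' = "\<lambda>i x. d (Suc m) (f x) * partial i f x"])
  qed
  from this[of 0] show ?thesis using d(1) by simp
qed


lemma eopen_singleton_0: "eopen 0 {\<lambda>_. 0}"
proof -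
  have "topspace (Euclidean_space 0) = {\<lambda>_. 0}" by (auto simp: topspace_Euclidean_space)
  then show ?thesis using openin_topspace[of "Euclidean_space 0"] by simp
qed

section \<open>The chain rule on open subsets of Euclidean space\<close>

lemma eopen_box:
  assumes "eopen n U" "a \<in> U"
  obtains e where "e > 0" "\<And>y. (\<And>i. i < n \<Longrightarrow> \<bar>y i - a i\<bar> < e) \<Longrightarrow> (\<And>i. i \<ge> n \<Longrightarrow> y i = 0) \<Longrightarrow> y \<in> U"
proof -
  obtain W where W: "openin (powertop_real UNIV) W" "U = W \<inter> {x. \<forall>i\<ge>n. x i = 0}"
    using assms(1) unfolding Euclidean_space_def openin_subtopology by blast
  then obtain X where X: "\<And>i. open (X i)" "a \<in> PiE UNIV X" "PiE UNIV X \<subseteq> W"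
    using assms(2) unfolding openin_product_topology_alt by fastforce
  have "\<exists>e>0. \<forall>y. \<bar>y - a i\<bar> < e \<longrightarrow> y \<in> X i" for i
    using X(1)[of i] X(2) by (auto simp: open_dist dist_real_def PiE_iff)
  then obtain d where d: "\<And>i. d i > 0" "\<And>i y. \<bar>y - a i\<bar> < d i \<Longrightarrow> y \<in> X i"
    by metis
  define e where "e = Min (insert 1 (d ` {..<n}))"
  have "e > 0" unfolding e_def using d(1) by auto
  moreover have "y \<in> U" if "\<And>i. i < n \<Longrightarrow> \<bar>y i - a i\<bar> < e" "\<And>i. i \<ge> n \<Longrightarrow> y i = 0" for y
  proof -
    have "y i \<in> X i" for i
    proof (cases "i < n")
      case True
      then have "e \<le> d i" unfolding e_def by auto
      then show ?thesis using that(1)[OF True] d(2) by force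
    next
      case False
      then have "y i = a i" using that(2)[of i] eopen_zero[OF assms, of i] by simp
      then show ?thesis using d(1)[of i] d(2)[of "y i" i] by simp
    qed
    then show ?thesis using X(3) W(2) that(2) by auto
  qed
  ultimately show ?thesis by (rule that)
qed

lemma mvt_between:
  fixes f :: "real \<Rightarrow> real"
  assumes "\<And>s. \<bar>s - p\<bar> \<le> \<bar>q - p\<bar> \<Longrightarrow> (f has_real_derivative f' s) (at s)"
  obtains z where "\<bar>z - p\<bar> \<le> \<bar>q - p\<bar>" "f q - f p = f' z * (q - p)"
proof -
  consider "p < q" | "q < p" | "p = q" by linarith
  then show ?thesis
  proof cases
    case 1
    then obtain z where "z > p" "z < q" "f q - f p = (q - p) * f' z"
      using MVT2[of p q f f'] assms by auto
    then show ?thesis using that[of z] by (simp add: mult.commute)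
  next
    case 2
    then obtain z where "z > q" "z < p" "f p - f q = (p - q) * f' z"
      using MVT2[of q p f f'] assms by auto
    then show ?thesis using that[of z] by (simp add: algebra_simps)
  next
    case 3
    then show ?thesis using that[of p] by simp
  qed
qed

lemma tendsto_funI:
  fixes a :: "nat \<Rightarrow> real"
  assumes "\<And>j. ((\<lambda>t. x t j) \<longlongrightarrow> a j) F"
  shows "(x \<longlongrightarrow> a) F"
proof -
  have "limitin (product_topology (\<lambda>_. euclidean) UNIV) x a F"
    using assms by (simp add: limitin_componentwise)
  then show ?thesis by (simp add: euclidean_product_topology)
qed

text \<open>The hypotheses give only continuous partial derivatives, so the increment of
  \<open>g\<close> along \<open>c\<close> is telescoped over points that change one coordinate at a
  time, and the one-variable mean value theorem is applied to each difference.\<close>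

lemma partial_chain_rule:
  assumes U: "eopen n U"
    and c: "c t0 \<in> U" "\<forall>\<^sub>F t in nhds t0. c t \<in> U"
      "\<And>i. i < n \<Longrightarrow> ((\<lambda>t. c t i) has_real_derivative c' i) (at t0)"
    and g: "\<And>i x. i < n \<Longrightarrow> x \<in> U \<Longrightarrow> ((\<lambda>t. g (x(i := t))) has_real_derivative g' i x) (at (x i))"
      "\<And>i. i < n \<Longrightarrow> continuous_on U (g' i)"
  shows "((\<lambda>t. g (c t)) has_real_derivative (\<Sum>i<n. g' i (c t0) * c' i)) (at t0)"
proof -
  define a where "a = c t0"
  \<comment> \<open>Already moved in the coordinates below \<open>i\<close>, still at
    \<open>a\<close> in the others: from \<open>mix i t\<close> to \<open>mix (Suc i) t\<close> only
    coordinate \<open>i\<close> changes.\<close>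
  define mix where "mix i t = (\<lambda>j. if j < i then c t j else a j)" for i :: nat and t
  obtain e where e: "e > 0"
    "\<And>y. (\<And>i. i < n \<Longrightarrow> \<bar>y i - a i\<bar> < e) \<Longrightarrow> (\<And>i. i \<ge> n \<Longrightarrow> y i = 0) \<Longrightarrow> y \<in> U"
    using eopen_box[OF U c(1)] unfolding a_def by metis
  have lim: "((\<lambda>t. c t i) \<longlongrightarrow> a i) (at t0)" if "i < n" for i
    using DERIV_isCont[OF c(3)[OF that]] by (simp add: isCont_def a_def)
  have near: "\<forall>\<^sub>F t in at t0. \<forall>i<n. \<bar>c t i - a i\<bar> < e"
  proof -
    have "\<forall>\<^sub>F t in at t0. \<forall>i\<in>{..<n}. \<bar>c t i - a i\<bar> < e"
    proof (rule eventually_ball_finite)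
      show "\<forall>i\<in>{..<n}. \<forall>\<^sub>F t in at t0. \<bar>c t i - a i\<bar> < e"
        using tendstoD[OF lim e(1)] by (auto simp: dist_real_def)
    qed simp
    then show ?thesis by (rule eventually_mono) simp
  qed
  have a0: "a i = 0" if "i \<ge> n" for i using eopen_zero[OF U c(1)] that by (simp add: a_def)
  have q: "((\<lambda>t. g (mix (Suc i) t) - g (mix i t)) has_real_derivative g' i a * c' i) (at t0)"
    if i: "i < n" for i
  proof -
    \<comment> \<open>Here \<open>z\<close> is a mean value point for the \<open>i\<close>-th
      difference. It lies no further from \<open>a i\<close> than \<open>c t i\<close> does, hence
      tends to \<open>a i\<close> as \<open>t\<close> tends to \<open>t0\<close>.\<close>
    define P where "P t z \<longleftrightarrow> \<bar>z - a i\<bar> \<le> \<bar>c t i - a i\<bar> \<and>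
      g (mix (Suc i) t) - g (mix i t) = g' i ((mix i t)(i := z)) * (c t i - a i)" for t z
    have mem: "(mix i t)(i := s) \<in> U" if "\<forall>i<n. \<bar>c t i - a i\<bar> < e" "\<bar>s - a i\<bar> \<le> \<bar>c t i - a i\<bar>" for t s
    proof (rule e(2))
      fix j assume "j < n"
      then show "\<bar>((mix i t)(i := s)) j - a j\<bar> < e"
        using that i e(1) by (cases "j = i") (auto simp: mix_def intro: le_less_trans)
    qed (use i a0 in \<open>auto simp: mix_def\<close>)
    have ex: "\<exists>z. P t z" if t: "\<forall>i<n. \<bar>c t i - a i\<bar> < e" for t
    proof -
      have "((\<lambda>s. g ((mix i t)(i := s))) has_real_derivative g' i ((mix i t)(i := s))) (at s)"
        if "\<bar>s - a i\<bar> \<le> \<bar>c t i - a i\<bar>" for s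
        using g(1)[OF i mem[OF t that]] by simp
      then obtain z where "\<bar>z - a i\<bar> \<le> \<bar>c t i - a i\<bar>"
        "g ((mix i t)(i := c t i)) - g ((mix i t)(i := a i)) = g' i ((mix i t)(i := z)) * (c t i - a i)"
        by (rule mvt_between)
      moreover have "(mix i t)(i := c t i) = mix (Suc i) t" "(mix i t)(i := a i) = mix i t"
        by (auto simp: mix_def)
      ultimately show ?thesis unfolding P_def by metis
    qed
    define z where "z t = (SOME z. P t z)" for t
    have z: "\<forall>\<^sub>F t in at t0. P t (z t)"
      using near by eventually_elim (unfold z_def, metis ex someI_ex)
    have zlim: "(z \<longlongrightarrow> a i) (at t0)"
    proof -
      have "((\<lambda>t. \<bar>c t i - a i\<bar>) \<longlongrightarrow> 0) (at t0)"
        using lim[OF i] by (simp add: LIM_zero_iff tendsto_rabs_zero_iff)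
      moreover have "\<forall>\<^sub>F t in at t0. norm (z t - a i) \<le> \<bar>c t i - a i\<bar>"
        using z by eventually_elim (simp add: P_def)
      ultimately have "((\<lambda>t. z t - a i) \<longlongrightarrow> 0) (at t0)"
        by (rule Lim_null_comparison[rotated])
      then show ?thesis by (simp add: LIM_zero_iff)
    qed
    have "((\<lambda>t. (mix i t)(i := z t)) \<longlongrightarrow> a) (at t0)"
    proof (rule tendsto_funI)
      fix j
      show "((\<lambda>t. ((mix i t)(i := z t)) j) \<longlongrightarrow> a j) (at t0)"
        using zlim lim[of j] i by (cases "j = i"; cases "j < i") (auto simp: mix_def)
    qed
    moreover have "\<forall>\<^sub>F t in at t0. (mix i t)(i := z t) \<in> U"
      using near z by eventually_elim (use mem in \<open>simp add: P_def\<close>)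
    ultimately have "((\<lambda>t. g' i ((mix i t)(i := z t))) \<longlongrightarrow> g' i a) (at t0)"
      using continuous_on_tendsto_compose[OF g(2)[OF i]] c(1) by (simp add: a_def)
    moreover have "((\<lambda>t. (c t i - a i) / (t - t0)) \<longlongrightarrow> c' i) (at t0)"
      using c(3)[OF i] by (simp add: has_field_derivative_iff a_def)
    ultimately have "((\<lambda>t. g' i ((mix i t)(i := z t)) * ((c t i - a i) / (t - t0))) \<longlongrightarrow> g' i a * c' i) (at t0)"
      by (rule tendsto_mult)
    moreover have "\<forall>\<^sub>F t in at t0. g' i ((mix i t)(i := z t)) * ((c t i - a i) / (t - t0)) =
        (g (mix (Suc i) t) - g (mix i t) - (g (mix (Suc i) t0) - g (mix i t0))) / (t - t0)"
      using z
    proof eventually_elim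
      case (elim t)
      have "mix (Suc i) t0 = mix i t0" by (auto simp: mix_def a_def)
      then show ?case using elim by (simp add: P_def)
    qed
    ultimately show ?thesis
      unfolding has_field_derivative_iff by (rule Lim_transform_eventually)
  qed
  have "((\<lambda>t. g a + (\<Sum>i<n. g (mix (Suc i) t) - g (mix i t))) has_real_derivative
      0 + (\<Sum>i<n. g' i a * c' i)) (at t0)"
    by (intro DERIV_add DERIV_const DERIV_sum q) simp
  moreover have "\<forall>\<^sub>F t in nhds t0. g a + (\<Sum>i<n. g (mix (Suc i) t) - g (mix i t)) = g (c t)"
    using c(2)
  proof eventually_elim
    case (elim t)
    \<comment> \<open>From index \<open>n\<close> on the coordinates of \<open>a\<close> and of
      \<open>c t\<close> vanish, both being points of \<open>U\<close>.\<close>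
    have "mix n t j = c t j" for j
      using a0 eopen_zero[OF U elim] by (simp add: mix_def)
    then have "mix n t = c t" by auto
    moreover have "mix 0 t = a" by (simp add: mix_def)
    ultimately show ?case using sum_lessThan_telescope[of "\<lambda>i. g (mix i t)" n] by simp
  qed
  ultimately show ?thesis
    using DERIV_cong_ev[OF refl _ refl, of "\<lambda>t. g a + (\<Sum>i<n. g (mix (Suc i) t) - g (mix i t))" "\<lambda>t. g (c t)" t0]
    by (simp add: a_def)
qed

lemma continuous_on_smooth_between:
  assumes "eopen n U" "eopen m V" "smooth_between m V n U f"
  shows "continuous_on V f"
proof (rule continuous_on_coordinatewise_then_product)
  fix i show "continuous_on V (\<lambda>v. f v i)"
  proof (cases "i < n")
    case True
    then show ?thesis
      using assms Ck_continuous[of m V 0] unfolding smooth_between_def smooth_function_def by blast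
  next
    case False
    then have "f v i = 0" if "v \<in> V" for v
      using assms(3) eopen_zero[OF assms(1), of "f v" i] that by (auto simp: smooth_between_def)
    then show ?thesis by (simp cong: continuous_on_cong)
  qed
qed

text \<open>A partial derivative of the composite is a sum of products: the partial derivatives of
  \<open>g\<close> after \<open>f\<close> are covered by the induction hypothesis, and those of the
  components of \<open>f\<close> have all orders.\<close>

lemma Ck_compose:
  assumes "eopen n U" "eopen m V" "smooth_between m V n U f" "Ck_on k n U g"
  shows "Ck_on k m V (\<lambda>v. g (f v))"
  using assms(4)
proof (induction k arbitrary: g)
  case 0
  have "continuous_on V (\<lambda>v. g (f v))"
    using continuous_on_compose2[OF Ck_continuous[OF assms(1) 0] continuous_on_smooth_between[OF assms(1-3)]]
      assms(3) by (auto simp: smooth_between_def)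
  then show ?case by (simp add: continuous_map_eopen[OF assms(2)])
next
  case (Suc k)
  have fU: "f v \<in> U" if "v \<in> V" for v using assms(3) that by (auto simp: smooth_between_def)
  have fk: "Ck_on l m V (\<lambda>v. f v i)" if "i < n" for i l
    using assms(3) that by (simp add: smooth_between_def smooth_function_def)
  have c: "continuous_on V (\<lambda>v. g (f v))"
    using continuous_on_compose2[OF Ck_continuous[OF assms(1) Suc.prems] continuous_on_smooth_between[OF assms(1-3)]]
      fU by auto
  show ?case
  proof (rule Ck_SucI[where f' = "\<lambda>j v. \<Sum>i<n. partial i g (f v) * partial j (\<lambda>v. f v i) v"])
    fix j v assume jv: "j < m" "v \<in> V"
    have "((\<lambda>t. g (f (v(j := t)))) has_real_derivative
       (\<Sum>i<n. partial i g (f (v(j := v j))) * partial j (\<lambda>v. f v i) v)) (at (v j))"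
    proof (rule partial_chain_rule[OF assms(1), where c = "\<lambda>t. f (v(j := t))"])
      show "f (v(j := v j)) \<in> U" using fU jv by simp
      show "\<forall>\<^sub>F t in nhds (v j). f (v(j := t)) \<in> U"
        using eventually_fun_upd_in[OF assms(2) jv(2,1)] by eventually_elim (rule fU)
      show "((\<lambda>t. f (v(j := t)) i) has_real_derivative partial j (\<lambda>v. f v i) v) (at (v j))"
        if "i < n" for i by (rule Ck_SucD(1)[OF assms(2) fk[OF that] jv])
      show "((\<lambda>t. g (x(i := t))) has_real_derivative partial i g x) (at (x i))"
        if "i < n" "x \<in> U" for i x by (rule Ck_SucD(1)[OF assms(1) Suc.prems that])
      show "continuous_on U (partial i g)" if "i < n" for i
        by (rule Ck_continuous[OF assms(1) Ck_SucD(2)[OF assms(1) Suc.prems that]])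
    qed
    then show "((\<lambda>t. g (f (v(j := t)))) has_real_derivative
       (\<Sum>i<n. partial i g (f v) * partial j (\<lambda>v. f v i) v)) (at (v j))" by simp
  next
    fix j assume j: "j < m"
    show "Ck_on k m V (\<lambda>v. \<Sum>i<n. partial i g (f v) * partial j (\<lambda>v. f v i) v)"
    proof (rule Ck_sum[OF assms(2)])
      fix i assume "i \<in> {..<n}"
      then have i: "i < n" by simp
      show "Ck_on k m V (\<lambda>v. partial i g (f v) * partial j (\<lambda>v. f v i) v)"
        by (rule Ck_mult[OF assms(2) Suc.IH[OF Ck_SucD(2)[OF assms(1) Suc.prems i]]
              Ck_SucD(2)[OF assms(2) fk[OF i] j]])
    qed
  qed (rule assms(2) c)+
qed

section \<open>Closure properties of smooth functions\<close>

lemma smooth_function_compose: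
  assumes "eopen n U" "eopen m V" "smooth_between m V n U f" "smooth_function n U g"
  shows "smooth_function m V (\<lambda>v. g (f v))"
  using assms Ck_compose unfolding smooth_function_def by blast

lemma smooth_function_compose_real:
  assumes "eopen n U" "smooth_on_real S b" "f \<in> U \<rightarrow> S" "smooth_function n U f"
  shows "smooth_function n U (\<lambda>x. b (f x))"
  using assms Ck_compose_real unfolding smooth_function_def by blast

lemma smooth_function_const: "eopen n U \<Longrightarrow> smooth_function n U (\<lambda>_. c)"
  by (simp add: smooth_function_def Ck_const)

lemma smooth_function_coord: "eopen n U \<Longrightarrow> smooth_function n U (\<lambda>x. x i)"
  by (simp add: smooth_function_def Ck_coord)

lemma smooth_function_add:
  "eopen n U \<Longrightarrow> smooth_function n U f \<Longrightarrow> smooth_function n U g \<Longrightarrow> smooth_function n U (\<lambda>x. f x + g x)"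
  by (simp add: smooth_function_def Ck_add)

lemma smooth_function_mult:
  "eopen n U \<Longrightarrow> smooth_function n U f \<Longrightarrow> smooth_function n U g \<Longrightarrow> smooth_function n U (\<lambda>x. f x * g x)"
  by (simp add: smooth_function_def Ck_mult)

lemma smooth_function_diff:
  "eopen n U \<Longrightarrow> smooth_function n U f \<Longrightarrow> smooth_function n U g \<Longrightarrow> smooth_function n U (\<lambda>x. f x - g x)"
  using smooth_function_add[of n U f "\<lambda>x. (- 1) * g x"] smooth_function_mult[of n U "\<lambda>_. - 1" g]
  by (simp add: smooth_function_const)

lemma smooth_function_sum:
  "eopen n U \<Longrightarrow> (\<And>i. i \<in> I \<Longrightarrow> smooth_function n U (f i)) \<Longrightarrow> smooth_function n U (\<lambda>x. \<Sum>i\<in>I. f i x)"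
  by (simp add: smooth_function_def Ck_sum)

lemma smooth_function_cong:
  "eopen n U \<Longrightarrow> smooth_function n U f \<Longrightarrow> (\<And>x. x \<in> U \<Longrightarrow> f x = g x) \<Longrightarrow> smooth_function n U g"
  unfolding smooth_function_def using Ck_cong by blast

lemma smooth_function_subset:
  "eopen n U \<Longrightarrow> eopen n V \<Longrightarrow> V \<subseteq> U \<Longrightarrow> smooth_function n U f \<Longrightarrow> smooth_function n V f"
  unfolding smooth_function_def using Ck_subset by blast

lemma smooth_function_local:
  assumes "eopen n U"
    and "\<And>u. u \<in> U \<Longrightarrow> \<exists>V. eopen n V \<and> u \<in> V \<and> V \<subseteq> U \<and> smooth_function n V f"
  shows "smooth_function n U f"
  unfolding smooth_function_def
proof
  fix k show "Ck_on k n U f"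
  proof (rule Ck_local[OF assms(1)])
    fix u assume "u \<in> U"
    from assms(2)[OF this] show "\<exists>V. eopen n V \<and> u \<in> V \<and> V \<subseteq> U \<and> Ck_on k n V f"
      by (elim exE conjE) (metis smooth_function_def)
  qed
qed

lemma smooth_function_continuous: "eopen n U \<Longrightarrow> smooth_function n U f \<Longrightarrow> continuous_on U f"
  unfolding smooth_function_def using Ck_continuous by blast


subsection \<open>A smooth step function\<close>

text \<open>The functions \<open>p (1/x) * exp (- 1/x)\<close>, extended by zero, form a family
  closed under differentiation. The case \<open>p = 1\<close> is the usual flat function, and the
  closure yields all its derivatives at once.\<close>

definition exp_inv_poly :: "real poly \<Rightarrow> real \<Rightarrow> real" where
  "exp_inv_poly p x = (if x > 0 then poly p (inverse x) * exp (- inverse x) else 0)"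

lemma poly_div_exp_tendsto_0: "((\<lambda>y. poly p y * y ^ k / exp y) \<longlongrightarrow> 0) (at_top :: real filter)"
proof (induction p arbitrary: k)
  case 0
  then show ?case by simp
next
  case (pCons a p)
  have "((\<lambda>y. a * (y ^ k / exp y) + poly p y * y ^ Suc k / exp y) \<longlongrightarrow> a * 0 + 0) (at_top :: real filter)"
    by (intro tendsto_add tendsto_mult tendsto_const tendsto_power_div_exp_0 pCons.IH)
  then show ?case by (simp add: field_simps)
qed

text \<open>Differentiation sends the polynomial \<open>p\<close> to \<open>X^2 * (p - p')\<close>.
  At zero the difference quotient becomes \<open>poly p y * y / exp y\<close> with
  \<open>y = 1/x\<close>, and the exponential beats every polynomial.\<close>

lemma exp_inv_poly_derivative:
  "(exp_inv_poly p has_real_derivative exp_inv_poly ([:0, 0, 1:] * (p - pderiv p)) x) (at x)"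
proof -
  consider "x > 0" | "x < 0" | "x = 0" by linarith
  then show ?thesis
  proof cases
    case 1
    have "((\<lambda>x. poly p (inverse x) * exp (- inverse x)) has_real_derivative
        exp_inv_poly ([:0, 0, 1:] * (p - pderiv p)) x) (at x)"
    proof -
      have "((\<lambda>x. poly p (inverse x)) has_real_derivative
          poly (pderiv p) (inverse x) * (- (inverse x ^ Suc (Suc 0)))) (at x)"
        using 1 by (intro DERIV_chain2[OF poly_DERIV DERIV_inverse]) simp
      moreover have "((\<lambda>x. exp (- inverse x)) has_real_derivative
          exp (- inverse x) * (- (- (inverse x ^ Suc (Suc 0))))) (at x)"
        using 1 by (intro DERIV_chain2[OF DERIV_exp] DERIV_minus DERIV_inverse) simp
      ultimately have "((\<lambda>x. poly p (inverse x) * exp (- inverse x)) has_real_derivative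
          poly (pderiv p) (inverse x) * (- (inverse x ^ Suc (Suc 0))) * exp (- inverse x) +
          exp (- inverse x) * (- (- (inverse x ^ Suc (Suc 0)))) * poly p (inverse x)) (at x)"
        by (rule DERIV_mult)
      then show ?thesis using 1 by (simp add: exp_inv_poly_def algebra_simps)
    qed
    moreover have "\<forall>\<^sub>F y in nhds x. poly p (inverse y) * exp (- inverse y) = exp_inv_poly p y"
      using eventually_nhds_in_open[OF open_greaterThan[of 0], of x] 1
      by (auto elim!: eventually_mono simp: exp_inv_poly_def)
    ultimately show ?thesis by (rule DERIV_cong_ev[THEN iffD1, OF refl _ refl, rotated])
  next
    case 2
    have "\<forall>\<^sub>F y in nhds x. 0 = exp_inv_poly p y"
      using eventually_nhds_in_open[OF open_lessThan[of 0], of x] 2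
      by (auto elim!: eventually_mono simp: exp_inv_poly_def)
    moreover have "((\<lambda>_. 0) has_real_derivative exp_inv_poly ([:0, 0, 1:] * (p - pderiv p)) x) (at x)"
      using 2 by (simp add: exp_inv_poly_def)
    ultimately show ?thesis by (rule DERIV_cong_ev[THEN iffD1, OF refl _ refl])
  next
    case 3
    have "((\<lambda>y. exp_inv_poly p y / y) \<longlongrightarrow> 0) (at_right 0)"
    proof -
      have "((\<lambda>y. poly p (inverse y) * inverse y ^ 1 / exp (inverse y)) \<longlongrightarrow> 0) (at_right 0)"
        by (rule filterlim_compose[OF poly_div_exp_tendsto_0 filterlim_inverse_at_top_right])
      moreover have "\<forall>\<^sub>F y in at_right 0. poly p (inverse y) * inverse y ^ 1 / exp (inverse y) = exp_inv_poly p y / y"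
        by (auto simp: eventually_at_filter exp_inv_poly_def exp_minus field_simps)
      ultimately show ?thesis by (rule Lim_transform_eventually)
    qed
    moreover have "((\<lambda>y. exp_inv_poly p y / y) \<longlongrightarrow> 0) (at_left 0)"
      by (rule tendsto_eventually) (auto simp: eventually_at_filter exp_inv_poly_def)
    ultimately have "((\<lambda>y. exp_inv_poly p y / y) \<longlongrightarrow> 0) (at 0)"
      by (simp add: filterlim_split_at)
    then show ?thesis using 3 by (simp add: has_field_derivative_iff exp_inv_poly_def)
  qed
qed

lemma smooth_on_real_exp_inv_poly: "smooth_on_real UNIV (exp_inv_poly p)"
  unfolding smooth_on_real_def
  by (intro exI[of _ "\<lambda>m. exp_inv_poly (((\<lambda>p. [:0, 0, 1:] * (p - pderiv p)) ^^ m) p)"])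
     (auto simp del: mult_pCons_left intro: exp_inv_poly_derivative)

lemma smooth_on_real_inverse: "smooth_on_real {0<..} inverse"
  unfolding smooth_on_real_def
proof (intro exI[of _ "\<lambda>m x. (- 1) ^ m * fact m * inverse x ^ Suc m"] conjI allI ballI)
  fix m and x :: real assume x: "x \<in> {0<..}"
  show "((\<lambda>x. (- 1) ^ m * fact m * inverse x ^ Suc m) has_real_derivative
      (- 1) ^ Suc m * fact (Suc m) * inverse x ^ Suc (Suc m)) (at x)"
    by (rule DERIV_cong[OF DERIV_cmult[OF DERIV_power[OF DERIV_inverse]]]) (use x in \<open>simp_all add: algebra_simps\<close>)
qed auto

text \<open>The standard quotient \<open>h x / (h x + h (1 - x))\<close> for the flat function
  \<open>h\<close>; its denominator is positive because \<open>x\<close> and \<open>1 - x\<close>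
  are never both non-positive.\<close>

definition smooth_step :: "real \<Rightarrow> real" where
  "smooth_step x = exp_inv_poly 1 x * inverse (exp_inv_poly 1 x + exp_inv_poly 1 (1 - x))"

lemma exp_inv_poly_1_pos: "x > 0 \<Longrightarrow> exp_inv_poly 1 x > 0"
  and exp_inv_poly_1_nonneg: "exp_inv_poly 1 x \<ge> 0"
  by (auto simp: exp_inv_poly_def)

lemma smooth_step_denominator_pos: "exp_inv_poly 1 x + exp_inv_poly 1 (1 - x) > 0"
  using exp_inv_poly_1_pos[of x] exp_inv_poly_1_pos[of "1 - x"]
    exp_inv_poly_1_nonneg[of x] exp_inv_poly_1_nonneg[of "1 - x"] by fastforce

lemma smooth_step_0: "x \<le> 0 \<Longrightarrow> smooth_step x = 0"
  by (simp add: smooth_step_def exp_inv_poly_def)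

lemma smooth_step_1: "x \<ge> 1 \<Longrightarrow> smooth_step x = 1"
  using smooth_step_denominator_pos[of x] by (simp add: smooth_step_def exp_inv_poly_def)

lemma smooth_step_bounds: "0 \<le> smooth_step x" "smooth_step x \<le> 1"
  using smooth_step_denominator_pos[of x] exp_inv_poly_1_nonneg[of x] exp_inv_poly_1_nonneg[of "1 - x"]
  by (auto simp: smooth_step_def divide_simps mult_le_0_iff)

lemma smooth_function_step:
  assumes "eopen n U" "smooth_function n U f"
  shows "smooth_function n U (\<lambda>x. smooth_step (f x))"
proof -
  note U = assms(1)
  have h: "smooth_function n U (\<lambda>x. exp_inv_poly 1 (g x))" if "smooth_function n U g" for g
    by (rule smooth_function_compose_real[OF U smooth_on_real_exp_inv_poly _ that]) simp
  have "smooth_function n U (\<lambda>x. 1 - f x)"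
    by (intro smooth_function_diff smooth_function_const U assms)
  then have d: "smooth_function n U (\<lambda>x. exp_inv_poly 1 (f x) + exp_inv_poly 1 (1 - f x))"
    by (intro smooth_function_add h U assms)
  have "smooth_function n U (\<lambda>x. inverse (exp_inv_poly 1 (f x) + exp_inv_poly 1 (1 - f x)))"
    by (rule smooth_function_compose_real[OF U smooth_on_real_inverse _ d])
       (use smooth_step_denominator_pos in auto)
  then show ?thesis
    unfolding smooth_step_def by (intro smooth_function_mult h U assms)
qed

section \<open>Diffeological spaces\<close>

lemma plot_eopen: "diffeological_space X \<Longrightarrow> p \<in> plots X n U \<Longrightarrow> eopen n U"
  by (drule diffeological_space_def[THEN iffD1, THEN conjunct1, rule_format]) auto

lemma plot_in_carrier: "diffeological_space X \<Longrightarrow> p \<in> plots X n U \<Longrightarrow> u \<in> U \<Longrightarrow> p u \<in> carrier X"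
  by (drule diffeological_space_def[THEN iffD1, THEN conjunct1, rule_format]) auto

lemma plot_const: "diffeological_space X \<Longrightarrow> eopen n U \<Longrightarrow> x \<in> carrier X \<Longrightarrow> (\<lambda>_. x) \<in> plots X n U"
  by (rule diffeological_space_def[THEN iffD1, THEN conjunct2, THEN conjunct1, rule_format]) auto

lemma plot_compose:
  assumes "diffeological_space X" "p \<in> plots X n U" "eopen m V" "smooth_between m V n U f"
  shows "(\<lambda>v. p (f v)) \<in> plots X m V"
  using diffeological_space_def[THEN iffD1, THEN conjunct2, THEN conjunct2, THEN conjunct1, rule_format,
      OF assms(1), of p n U m V f] assms(2-4) by (simp add: comp_def)

lemma plot_local:
  assumes "diffeological_space X" "eopen n U"
    and "\<And>u. u \<in> U \<Longrightarrow> \<exists>V q. eopen n V \<and> u \<in> V \<and> V \<subseteq> U \<and> q \<in> plots X n V \<and> (\<forall>v\<in>V. p v = q v)"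
  shows "p \<in> plots X n U"
  using diffeological_space_def[THEN iffD1, THEN conjunct2, THEN conjunct2, THEN conjunct2, rule_format,
      OF assms(1), of n U p] assms(2,3) by simp

text \<open>Locality with the single neighbourhood \<open>U\<close>; this is how values outside the
  domain are disposed of.\<close>

lemma plot_cong:
  assumes "diffeological_space X" "p \<in> plots X n U" "\<And>u. u \<in> U \<Longrightarrow> q u = p u"
  shows "q \<in> plots X n U"
proof (rule plot_local[OF assms(1) plot_eopen[OF assms(1,2)]])
  fix u assume "u \<in> U"
  then show "\<exists>V r. eopen n V \<and> u \<in> V \<and> V \<subseteq> U \<and> r \<in> plots X n V \<and> (\<forall>v\<in>V. q v = r v)"
    using assms plot_eopen[OF assms(1,2)] by (intro exI[of _ U] exI[of _ p]) simp
qed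

lemma smooth_between_id: "eopen n V \<Longrightarrow> V \<subseteq> U \<Longrightarrow> smooth_between n V n U (\<lambda>v. v)"
  by (auto simp: smooth_between_def smooth_function_coord)

lemma plot_restrict:
  "diffeological_space X \<Longrightarrow> p \<in> plots X n U \<Longrightarrow> eopen n V \<Longrightarrow> V \<subseteq> U \<Longrightarrow> p \<in> plots X n V"
  using plot_compose[of X p n U n V "\<lambda>v. v"] smooth_between_id by simp

lemma eopen_Int: "eopen n U \<Longrightarrow> eopen n V \<Longrightarrow> eopen n (U \<inter> V)"
  by (rule openin_Int)

lemma diffeological_spaceI:
  assumes "\<And>n U p. p \<in> plots X n U \<Longrightarrow> eopen n U"
    and "\<And>n U p u. p \<in> plots X n U \<Longrightarrow> u \<in> U \<Longrightarrow> p u \<in> carrier X"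
    and "\<And>n U x. eopen n U \<Longrightarrow> x \<in> carrier X \<Longrightarrow> (\<lambda>_. x) \<in> plots X n U"
    and "\<And>n U p m V f. p \<in> plots X n U \<Longrightarrow> eopen m V \<Longrightarrow> smooth_between m V n U f \<Longrightarrow>
           (\<lambda>v. p (f v)) \<in> plots X m V"
    and "\<And>n U p. eopen n U \<Longrightarrow>
           (\<And>u. u \<in> U \<Longrightarrow> \<exists>V q. eopen n V \<and> u \<in> V \<and> V \<subseteq> U \<and> q \<in> plots X n V \<and> (\<forall>v\<in>V. p v = q v)) \<Longrightarrow>
           p \<in> plots X n U"
  shows "diffeological_space X"
  unfolding diffeological_space_def comp_def
proof (intro conjI allI impI; (elim conjE)?)
  fix n U p assume p: "p \<in> plots X n U"
  show "eopen n U" by (rule assms(1)[OF p])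
  show "p \<in> U \<rightarrow> carrier X" using assms(2)[OF p] by blast
next
  fix n U p assume "eopen n U" "\<forall>u\<in>U. \<exists>V q. eopen n V \<and> u \<in> V \<and> V \<subseteq> U \<and> q \<in> plots X n V \<and> (\<forall>v\<in>V. p v = q v)"
  then show "p \<in> plots X n U" by (intro assms(5)) auto
qed (rule assms(3) assms(4); assumption)+

lemma smooth_mapI:
  assumes "\<And>x. x \<in> carrier X \<Longrightarrow> f x \<in> carrier Y"
    and "\<And>n U p. p \<in> plots X n U \<Longrightarrow> (\<lambda>u. f (p u)) \<in> plots Y n U"
  shows "smooth_map X Y f"
  using assms by (auto simp: smooth_map_def comp_def)

lemma smooth_map_carrier: "smooth_map X Y f \<Longrightarrow> x \<in> carrier X \<Longrightarrow> f x \<in> carrier Y"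
  by (auto simp: smooth_map_def)

lemma smooth_map_plot: "smooth_map X Y f \<Longrightarrow> p \<in> plots X n U \<Longrightarrow> (\<lambda>u. f (p u)) \<in> plots Y n U"
  by (auto simp: smooth_map_def comp_def)

lemma smooth_map_compose:
  "smooth_map X Y f \<Longrightarrow> smooth_map Y Z g \<Longrightarrow> smooth_map X Z (\<lambda>x. g (f x))"
  by (rule smooth_mapI) (auto intro: smooth_map_carrier smooth_map_plot)

lemma smooth_map_id: "smooth_map X X (\<lambda>x. x)"
  by (rule smooth_mapI) auto

lemma smooth_map_cong:
  assumes "diffeological_space X" "diffeological_space Y" "smooth_map X Y f"
    "\<And>x. x \<in> carrier X \<Longrightarrow> g x = f x"
  shows "smooth_map X Y g"
proof (rule smooth_mapI)
  fix n U p assume p: "p \<in> plots X n U"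
  show "(\<lambda>u. g (p u)) \<in> plots Y n U"
    by (rule plot_cong[OF assms(2) smooth_map_plot[OF assms(3) p]])
       (use assms(4) plot_in_carrier[OF assms(1) p] in auto)
qed (use assms smooth_map_carrier in force)

lemma smooth_map_const:
  "diffeological_space X \<Longrightarrow> diffeological_space Y \<Longrightarrow> y \<in> carrier Y \<Longrightarrow> smooth_map X Y (\<lambda>_. y)"
  by (rule smooth_mapI) (auto intro: plot_const plot_eopen)

lemma smooth_map_localI:
  assumes "diffeological_space X" "diffeological_space Y"
    and "\<And>x. x \<in> carrier X \<Longrightarrow> f x \<in> carrier Y"
    and "\<And>n U p u. p \<in> plots X n U \<Longrightarrow> u \<in> U \<Longrightarrow>
      \<exists>V q. eopen n V \<and> u \<in> V \<and> V \<subseteq> U \<and> q \<in> plots Y n V \<and> (\<forall>v\<in>V. f (p v) = q v)"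
  shows "smooth_map X Y f"
proof (rule smooth_mapI)
  fix n U p assume "p \<in> plots X n U"
  then show "(\<lambda>u. f (p u)) \<in> plots Y n U"
    by (intro plot_local[OF assms(2)] plot_eopen[OF assms(1)] assms(4))
qed (rule assms(3))

lemma smooth_between_compose:
  assumes "eopen m V" "eopen l W" "smooth_between m V n U f" "smooth_between l W m V g"
  shows "smooth_between l W n U (\<lambda>w. f (g w))"
  using assms smooth_function_compose[OF assms(1,2,4)] by (auto simp: smooth_between_def)

section \<open>Euclidean, subset, product, sequence and quotient diffeologies\<close>

lemma diffeological_space_euclidean:
  assumes U: "eopen n U"
  shows "diffeological_space (euclidean_diffeology n U)"
proof (rule diffeological_spaceI)
  fix k V and p :: "(nat \<Rightarrow> real) \<Rightarrow> nat \<Rightarrow> real"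
  assume V: "eopen k V"
    and *: "\<And>u. u \<in> V \<Longrightarrow> \<exists>W q. eopen k W \<and> u \<in> W \<and> W \<subseteq> V \<and>
      q \<in> plots (euclidean_diffeology n U) k W \<and> (\<forall>v\<in>W. p v = q v)"
  have "smooth_function k V (\<lambda>v. p v i)" if "i < n" for i
  proof (rule smooth_function_local[OF V])
    fix u assume "u \<in> V"
    then obtain W q where W: "eopen k W" "u \<in> W" "W \<subseteq> V"
      "q \<in> plots (euclidean_diffeology n U) k W" "\<forall>v\<in>W. p v = q v" using *[OF \<open>u \<in> V\<close>] by blast
    then have "smooth_function k W (\<lambda>v. q v i)"
      using that by (auto simp: euclidean_diffeology_def smooth_between_def)
    then show "\<exists>W. eopen k W \<and> u \<in> W \<and> W \<subseteq> V \<and> smooth_function k W (\<lambda>v. p v i)"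
      using W smooth_function_cong[OF W(1), of "\<lambda>v. q v i" "\<lambda>v. p v i"] by auto
  qed
  moreover have "p u \<in> U" if "u \<in> V" for u
    using *[OF that] by (auto simp: euclidean_diffeology_def smooth_between_def)
  ultimately show "p \<in> plots (euclidean_diffeology n U) k V"
    using V by (auto simp: euclidean_diffeology_def smooth_between_def)
next
  fix k V p m W f
  assume "p \<in> plots (euclidean_diffeology n U) k V" "eopen m W" "smooth_between m W k V f"
  then show "(\<lambda>v. p (f v)) \<in> plots (euclidean_diffeology n U) m W"
    using smooth_between_compose[of k V m W n U p f] by (auto simp: euclidean_diffeology_def)
qed (auto simp: euclidean_diffeology_def smooth_between_def smooth_function_const)

lemma plots_euclidean: "plots (euclidean_diffeology n U) m V = {f. eopen m V \<and> smooth_between m V n U f}"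
  and carrier_euclidean [simp]: "carrier (euclidean_diffeology n U) = U"
  by (simp_all add: euclidean_diffeology_def)

lemma plots_real: "plots real_diffeology n U = {f. eopen n U \<and> smooth_function n U f}"
  and carrier_real [simp]: "carrier real_diffeology = UNIV"
  by (simp_all add: real_diffeology_def)

lemma diffeological_space_real: "diffeological_space real_diffeology"
proof (rule diffeological_spaceI)
  fix k V and p :: "(nat \<Rightarrow> real) \<Rightarrow> real"
  assume V: "eopen k V"
    and *: "\<And>u. u \<in> V \<Longrightarrow> \<exists>W q. eopen k W \<and> u \<in> W \<and> W \<subseteq> V \<and>
      q \<in> plots real_diffeology k W \<and> (\<forall>v\<in>W. p v = q v)"
  have "smooth_function k V p"
  proof (rule smooth_function_local[OF V])
    fix u assume "u \<in> V"
    then obtain W q where W: "eopen k W" "u \<in> W" "W \<subseteq> V"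
      "q \<in> plots real_diffeology k W" "\<forall>v\<in>W. p v = q v" using *[OF \<open>u \<in> V\<close>] by blast
    then show "\<exists>W. eopen k W \<and> u \<in> W \<and> W \<subseteq> V \<and> smooth_function k W p"
      using smooth_function_cong[OF W(1), of q p] by (auto simp: plots_real)
  qed
  then show "p \<in> plots real_diffeology k V" using V by (simp add: plots_real)
qed (auto simp: plots_real smooth_function_const smooth_function_compose)

lemma carrier_subset [simp]: "carrier (subset_diffeology X A) = carrier X \<inter> A"
  and plots_subset: "plots (subset_diffeology X A) n U = {p \<in> plots X n U. p \<in> U \<rightarrow> A}"
  by (simp_all add: subset_diffeology_def)

lemma diffeological_space_subset:
  assumes X: "diffeological_space X"
  shows "diffeological_space (subset_diffeology X A)"
proof (rule diffeological_spaceI)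
  fix n U p
  assume U: "eopen n U" and *: "\<And>u. u \<in> U \<Longrightarrow> \<exists>V q. eopen n V \<and> u \<in> V \<and> V \<subseteq> U \<and>
      q \<in> plots (subset_diffeology X A) n V \<and> (\<forall>v\<in>V. p v = q v)"
  have "p \<in> plots X n U"
  proof (rule plot_local[OF X U])
    fix u assume "u \<in> U"
    from *[OF this] show "\<exists>V q. eopen n V \<and> u \<in> V \<and> V \<subseteq> U \<and> q \<in> plots X n V \<and> (\<forall>v\<in>V. p v = q v)"
      by (simp add: plots_subset) blast
  qed
  moreover have "p u \<in> A" if "u \<in> U" for u
    using *[OF that] by (auto simp: plots_subset)
  ultimately show "p \<in> plots (subset_diffeology X A) n U" by (auto simp: plots_subset)
next
  fix n U p m V f
  assume "p \<in> plots (subset_diffeology X A) n U" "eopen m V" "smooth_between m V n U f"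
  then show "(\<lambda>v. p (f v)) \<in> plots (subset_diffeology X A) m V"
    using plot_compose[OF X] by (auto simp: plots_subset smooth_between_def Pi_iff)
qed (auto simp: plots_subset plot_const[OF X] plot_in_carrier[OF X] plot_eopen[OF X])

lemma carrier_prod [simp]: "carrier (prod_diffeology X Y) = carrier X \<times> carrier Y"
  and plots_prod: "plots (prod_diffeology X Y) n U =
    {p. (\<lambda>u. fst (p u)) \<in> plots X n U \<and> (\<lambda>u. snd (p u)) \<in> plots Y n U}"
  by (simp_all add: prod_diffeology_def comp_def)

lemma diffeological_space_prod:
  assumes X: "diffeological_space X" and Y: "diffeological_space Y"
  shows "diffeological_space (prod_diffeology X Y)"
proof (rule diffeological_spaceI)
  fix n U p
  assume U: "eopen n U" and *: "\<And>u. u \<in> U \<Longrightarrow> \<exists>V q. eopen n V \<and> u \<in> V \<and> V \<subseteq> U \<and>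
      q \<in> plots (prod_diffeology X Y) n V \<and> (\<forall>v\<in>V. p v = q v)"
  have "(\<lambda>u. fst (p u)) \<in> plots X n U" "(\<lambda>u. snd (p u)) \<in> plots Y n U"
  proof -
    show "(\<lambda>u. fst (p u)) \<in> plots X n U"
    proof (rule plot_local[OF X U])
      fix u assume "u \<in> U"
      then obtain V q where "eopen n V" "u \<in> V" "V \<subseteq> U"
        "q \<in> plots (prod_diffeology X Y) n V" "\<forall>v\<in>V. p v = q v" using *[OF \<open>u \<in> U\<close>] by blast
      then show "\<exists>V q. eopen n V \<and> u \<in> V \<and> V \<subseteq> U \<and> q \<in> plots X n V \<and> (\<forall>v\<in>V. fst (p v) = q v)"
        by (intro exI[of _ V] exI[of _ "\<lambda>u. fst (q u)"]) (auto simp: plots_prod)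
    qed
    show "(\<lambda>u. snd (p u)) \<in> plots Y n U"
    proof (rule plot_local[OF Y U])
      fix u assume "u \<in> U"
      then obtain V q where "eopen n V" "u \<in> V" "V \<subseteq> U"
        "q \<in> plots (prod_diffeology X Y) n V" "\<forall>v\<in>V. p v = q v" using *[OF \<open>u \<in> U\<close>] by blast
      then show "\<exists>V q. eopen n V \<and> u \<in> V \<and> V \<subseteq> U \<and> q \<in> plots Y n V \<and> (\<forall>v\<in>V. snd (p v) = q v)"
        by (intro exI[of _ V] exI[of _ "\<lambda>u. snd (q u)"]) (auto simp: plots_prod)
    qed
  qed
  then show "p \<in> plots (prod_diffeology X Y) n U" by (simp add: plots_prod)
next
  fix n U p m V f
  assume "p \<in> plots (prod_diffeology X Y) n U" "eopen m V" "smooth_between m V n U f"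
  then show "(\<lambda>v. p (f v)) \<in> plots (prod_diffeology X Y) m V"
    using plot_compose[OF X, of "\<lambda>u. fst (p u)"] plot_compose[OF Y, of "\<lambda>u. snd (p u)"]
    by (auto simp: plots_prod)
next
  fix n U p u assume "p \<in> plots (prod_diffeology X Y) n U" "u \<in> U"
  then show "p u \<in> carrier (prod_diffeology X Y)"
    using plot_in_carrier[OF X, of "\<lambda>u. fst (p u)"] plot_in_carrier[OF Y, of "\<lambda>u. snd (p u)"]
    by (auto simp: plots_prod mem_Times_iff)
qed (auto simp: plots_prod plot_const[OF X] plot_const[OF Y] plot_eopen[OF X] plot_eopen[OF Y])

lemma carrier_seq [simp]: "carrier (seq_diffeology X) = UNIV \<rightarrow> carrier X"
  and plots_seq: "plots (seq_diffeology X) n U = {p. \<forall>i. (\<lambda>u. p u i) \<in> plots X n U}"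
  by (simp_all add: seq_diffeology_def)

lemma diffeological_space_seq:
  assumes X: "diffeological_space X"
  shows "diffeological_space (seq_diffeology X)"
proof (rule diffeological_spaceI)
  fix n U p
  assume U: "eopen n U" and *: "\<And>u. u \<in> U \<Longrightarrow> \<exists>V q. eopen n V \<and> u \<in> V \<and> V \<subseteq> U \<and>
      q \<in> plots (seq_diffeology X) n V \<and> (\<forall>v\<in>V. p v = q v)"
  have "(\<lambda>u. p u i) \<in> plots X n U" for i
  proof (rule plot_local[OF X U])
    fix u assume "u \<in> U"
    then obtain V q where "eopen n V" "u \<in> V" "V \<subseteq> U"
      "q \<in> plots (seq_diffeology X) n V" "\<forall>v\<in>V. p v = q v" using *[OF \<open>u \<in> U\<close>] by blast
    then show "\<exists>V q. eopen n V \<and> u \<in> V \<and> V \<subseteq> U \<and> q \<in> plots X n V \<and> (\<forall>v\<in>V. p v i = q v)"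
      by (intro exI[of _ V] exI[of _ "\<lambda>u. q u i"]) (auto simp: plots_seq)
  qed
  then show "p \<in> plots (seq_diffeology X) n U" by (simp add: plots_seq)
next
  fix n U p m V f
  assume "p \<in> plots (seq_diffeology X) n U" "eopen m V" "smooth_between m V n U f"
  then show "(\<lambda>v. p (f v)) \<in> plots (seq_diffeology X) m V"
    using plot_compose[OF X, of "\<lambda>u. p u i" n U m V f for i] by (auto simp: plots_seq)
next
  fix n U p u assume "p \<in> plots (seq_diffeology X) n U" "u \<in> U"
  then show "p u \<in> carrier (seq_diffeology X)"
    using plot_in_carrier[OF X, of "\<lambda>u. p u i" n U u for i] by (auto simp: plots_seq)
next
  fix n U p assume "p \<in> plots (seq_diffeology X) n U"
  then show "eopen n U" using plot_eopen[OF X, of "\<lambda>u. p u 0" n U] by (simp add: plots_seq)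
next
  fix n U x assume "eopen n U" "x \<in> carrier (seq_diffeology X)"
  then show "(\<lambda>_. x) \<in> plots (seq_diffeology X) n U" using plot_const[OF X] by (auto simp: plots_seq)
qed

lemma carrier_quotient: "carrier (quotient_diffeology X r) = carrier X // r"
  and plots_quotient: "plots (quotient_diffeology X r) n U = {p. eopen n U \<and>
        (\<forall>u\<in>U. \<exists>V q. eopen n V \<and> u \<in> V \<and> V \<subseteq> U \<and> q \<in> plots X n V \<and> (\<forall>v\<in>V. p v = r `` {q v}))}"
  by (simp_all add: quotient_diffeology_def)

text \<open>Lifts are only local, so each axiom is checked near a point. For precomposition the
  neighbourhood that carries the lift is pulled back, which uses that smooth maps between Euclidean
  open sets are continuous.\<close>

lemma diffeological_space_quotient:
  assumes X: "diffeological_space X"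
  shows "diffeological_space (quotient_diffeology X r)"
proof (rule diffeological_spaceI)
  fix n U p
  assume U: "eopen n U" and *: "\<And>u. u \<in> U \<Longrightarrow> \<exists>V q. eopen n V \<and> u \<in> V \<and> V \<subseteq> U \<and>
      q \<in> plots (quotient_diffeology X r) n V \<and> (\<forall>v\<in>V. p v = q v)"
  have "\<exists>V q. eopen n V \<and> u \<in> V \<and> V \<subseteq> U \<and> q \<in> plots X n V \<and> (\<forall>v\<in>V. p v = r `` {q v})"
    if u: "u \<in> U" for u
  proof -
    obtain V q where V: "eopen n V" "u \<in> V" "V \<subseteq> U"
      "q \<in> plots (quotient_diffeology X r) n V" "\<forall>v\<in>V. p v = q v" using *[OF u] by blast
    then obtain W s where "eopen n W" "u \<in> W" "W \<subseteq> V" "s \<in> plots X n W" "\<forall>v\<in>W. q v = r `` {s v}"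
      unfolding plots_quotient by blast
    then show ?thesis using V by (intro exI[of _ W] exI[of _ s]) auto
  qed
  then show "p \<in> plots (quotient_diffeology X r) n U" using U by (simp add: plots_quotient)
next
  fix n U p m V f
  assume p: "p \<in> plots (quotient_diffeology X r) n U" and V: "eopen m V" and f: "smooth_between m V n U f"
  have U: "eopen n U" using p by (simp add: plots_quotient)
  have "\<exists>W q. eopen m W \<and> v \<in> W \<and> W \<subseteq> V \<and> q \<in> plots X m W \<and> (\<forall>w\<in>W. p (f w) = r `` {q w})"
    if v: "v \<in> V" for v
  proof -
    have fv: "f v \<in> U" using f v by (auto simp: smooth_between_def)
    obtain U' q where U': "eopen n U'" "f v \<in> U'" "U' \<subseteq> U" "q \<in> plots X n U'"
      "\<forall>v\<in>U'. p v = r `` {q v}" using p fv unfolding plots_quotient by blast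
    define W where "W = {w \<in> V. f w \<in> U'}"
    obtain O' where O': "open O'" "U' = {x. \<forall>i\<ge>n. x i = 0} \<inter> O'"
      using U'(1) unfolding Euclidean_space_eq openin_open by blast
    have "W = {w \<in> V. f w \<in> O'}"
      using f eopen_zero[OF U] by (auto simp: W_def O' smooth_between_def)
    then have W: "eopen m W"
      using eopen_preimage[OF V continuous_on_smooth_between[OF U V f] O'(1)] by simp
    have "smooth_between m W n U' f"
      using f smooth_function_subset[OF V W] by (auto simp: smooth_between_def W_def)
    then have "(\<lambda>w. q (f w)) \<in> plots X m W" by (rule plot_compose[OF X U'(4) W])
    then show ?thesis using U' W v by (intro exI[of _ W] exI[of _ "\<lambda>w. q (f w)"]) (auto simp: W_def)
  qed
  then show "(\<lambda>v. p (f v)) \<in> plots (quotient_diffeology X r) m V" using V by (simp add: plots_quotient)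
next
  fix n U p u assume "p \<in> plots (quotient_diffeology X r) n U" "u \<in> U"
  then obtain V q where "u \<in> V" "q \<in> plots X n V" "\<forall>v\<in>V. p v = r `` {q v}"
    unfolding plots_quotient by blast
  then show "p u \<in> carrier (quotient_diffeology X r)"
    using plot_in_carrier[OF X, of q n V u] by (auto simp: carrier_quotient intro: quotientI)
next
  fix n U x assume U: "eopen n U" and "x \<in> carrier (quotient_diffeology X r)"
  then obtain y where y: "y \<in> carrier X" "x = r `` {y}" by (auto simp: carrier_quotient elim: quotientE)
  show "(\<lambda>_. x) \<in> plots (quotient_diffeology X r) n U"
    unfolding plots_quotient using U y plot_const[OF X U y(1)] by blast
qed (simp add: plots_quotient)

lemma smooth_map_quotient:
  assumes X: "diffeological_space X"
  shows "smooth_map X (quotient_diffeology X r) (\<lambda>x. r `` {x})"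
proof (rule smooth_mapI)
  fix n U p assume p: "p \<in> plots X n U"
  have "\<exists>V q. eopen n V \<and> u \<in> V \<and> V \<subseteq> U \<and> q \<in> plots X n V \<and> (\<forall>v\<in>V. r `` {p v} = r `` {q v})"
    if "u \<in> U" for u
    using that p plot_eopen[OF X p] by (intro exI[of _ U] exI[of _ p]) auto
  then show "(\<lambda>u. r `` {p u}) \<in> plots (quotient_diffeology X r) n U"
    using plot_eopen[OF X p] by (simp add: plots_quotient)
qed (auto simp: carrier_quotient intro: quotientI)

lemma carrier_unit_interval [simp]: "carrier unit_interval_diffeology = {0..1}"
  by (simp add: unit_interval_diffeology_def)

lemma plots_unit_interval:
  "plots unit_interval_diffeology n U = {p. eopen n U \<and> smooth_function n U p \<and> (\<forall>u\<in>U. 0 \<le> p u \<and> p u \<le> 1)}"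
  by (auto simp: unit_interval_diffeology_def plots_subset plots_real)

lemma diffeological_space_unit_interval: "diffeological_space unit_interval_diffeology"
  unfolding unit_interval_diffeology_def by (intro diffeological_space_subset diffeological_space_real)

lemma smooth_map_fst: "smooth_map (prod_diffeology X Y) X fst"
  and smooth_map_snd: "smooth_map (prod_diffeology X Y) Y snd"
  by (rule smooth_mapI; auto simp: plots_prod)+

lemma smooth_map_Pair:
  "smooth_map X Y f \<Longrightarrow> smooth_map X Z g \<Longrightarrow> smooth_map X (prod_diffeology Y Z) (\<lambda>x. (f x, g x))"
  by (rule smooth_mapI) (auto simp: plots_prod intro: smooth_map_carrier smooth_map_plot)

section \<open>Smooth real-valued functions\<close>

abbreviation smooth_real :: "'a diffeology \<Rightarrow> ('a \<Rightarrow> real) \<Rightarrow> bool" where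
  "smooth_real X \<equiv> smooth_map X real_diffeology"

lemma smooth_real_iff:
  assumes "diffeological_space X"
  shows "smooth_real X f \<longleftrightarrow> (\<forall>n U. \<forall>p\<in>plots X n U. smooth_function n U (\<lambda>u. f (p u)))"
  using plot_eopen[OF assms] by (auto simp: smooth_map_def plots_real comp_def)

lemma smooth_real_plot: "smooth_real X f \<Longrightarrow> p \<in> plots X n U \<Longrightarrow> smooth_function n U (\<lambda>u. f (p u))"
  by (auto simp: smooth_map_def plots_real comp_def)

lemma smooth_map_unit_interval:
  assumes "diffeological_space X"
  shows "smooth_map X unit_interval_diffeology f \<longleftrightarrow> smooth_real X f \<and> (\<forall>x\<in>carrier X. 0 \<le> f x \<and> f x \<le> 1)"
  using plot_in_carrier[OF assms]
  by (auto simp: smooth_map_def plots_real plots_unit_interval comp_def Pi_iff)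

lemma smooth_real_const: "diffeological_space X \<Longrightarrow> smooth_real X (\<lambda>_. c)"
  by (simp add: smooth_map_const diffeological_space_real)

lemma smooth_real_add:
  "diffeological_space X \<Longrightarrow> smooth_real X f \<Longrightarrow> smooth_real X g \<Longrightarrow> smooth_real X (\<lambda>x. f x + g x)"
  by (auto simp: smooth_real_iff intro: smooth_function_add plot_eopen)

lemma smooth_real_diff:
  "diffeological_space X \<Longrightarrow> smooth_real X f \<Longrightarrow> smooth_real X g \<Longrightarrow> smooth_real X (\<lambda>x. f x - g x)"
  by (auto simp: smooth_real_iff intro: smooth_function_diff plot_eopen)

lemma smooth_real_mult:
  "diffeological_space X \<Longrightarrow> smooth_real X f \<Longrightarrow> smooth_real X g \<Longrightarrow> smooth_real X (\<lambda>x. f x * g x)"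
  by (auto simp: smooth_real_iff intro: smooth_function_mult plot_eopen)

lemma smooth_real_sum:
  "diffeological_space X \<Longrightarrow> (\<And>i. i \<in> I \<Longrightarrow> smooth_real X (f i)) \<Longrightarrow> smooth_real X (\<lambda>x. \<Sum>i\<in>I. f i x)"
  by (auto simp: smooth_real_iff intro: smooth_function_sum plot_eopen)

lemma smooth_real_step:
  "diffeological_space X \<Longrightarrow> smooth_real X f \<Longrightarrow> smooth_real X (\<lambda>x. smooth_step (f x))"
  by (auto simp: smooth_real_iff intro: smooth_function_step plot_eopen)

section \<open>The D-topology\<close>

lemma topspace_D_topology: "diffeological_space X \<Longrightarrow> topspace (D_topology X) = carrier X"
proof
  assume X: "diffeological_space X"
  have "{u \<in> U. p u \<in> carrier X} = U" if "p \<in> plots X n U" for p n U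
    using plot_in_carrier[OF X that] by auto
  then have "openin (D_topology X) (carrier X)"
    using plot_eopen[OF X] by (simp add: openin_D_topology)
  then show "carrier X \<subseteq> topspace (D_topology X)" by (rule openin_subset)
  show "topspace (D_topology X) \<subseteq> carrier X"
    using openin_topspace[of "D_topology X"] unfolding openin_D_topology by blast
qed

lemma D_open_plot: "openin (D_topology X) A \<Longrightarrow> p \<in> plots X n U \<Longrightarrow> eopen n {u \<in> U. p u \<in> A}"
  by (simp add: openin_D_topology)

lemma D_open_preimage:
  assumes "diffeological_space X" "smooth_map X Y f" "openin (D_topology Y) W"
  shows "openin (D_topology X) {x \<in> carrier X. f x \<in> W}"
  unfolding openin_D_topology
proof (intro conjI allI ballI)
  fix n U p assume p: "p \<in> plots X n U"
  have "{u \<in> U. p u \<in> {x \<in> carrier X. f x \<in> W}} = {u \<in> U. f (p u) \<in> W}"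
    using plot_in_carrier[OF assms(1) p] by auto
  then show "eopen n {u \<in> U. p u \<in> {x \<in> carrier X. f x \<in> W}}"
    using D_open_plot[OF assms(3) smooth_map_plot[OF assms(2) p]] by simp
qed auto

lemma D_open_real_preimage:
  assumes "diffeological_space X" "smooth_real X f" "open W"
  shows "openin (D_topology X) {x \<in> carrier X. f x \<in> W}"
proof (rule D_open_preimage[OF assms(1,2)])
  show "openin (D_topology real_diffeology) W"
    unfolding openin_D_topology
    by (auto simp: plots_real intro: eopen_preimage smooth_function_continuous assms(3))
qed

lemma D_closed_real_preimage:
  assumes "diffeological_space X" "smooth_real X f" "closed W"
  shows "closedin (D_topology X) {x \<in> carrier X. f x \<in> W}"
proof -
  have "carrier X - {x \<in> carrier X. f x \<in> W} = {x \<in> carrier X. f x \<in> - W}" by auto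
  then show ?thesis
    using D_open_real_preimage[OF assms(1,2) open_Compl[OF assms(3)]]
    by (auto simp: closedin_def topspace_D_topology[OF assms(1)])
qed

lemma D_open_nonzero:
  "diffeological_space X \<Longrightarrow> smooth_real X f \<Longrightarrow> openin (D_topology X) {x \<in> carrier X. f x \<noteq> 0}"
  using D_open_real_preimage[of X f "- {0}"] by auto

lemma D_open_complement:
  "diffeological_space X \<Longrightarrow> closedin (D_topology X) C \<Longrightarrow> openin (D_topology X) (carrier X - C)"
  by (metis openin_diff openin_topspace topspace_D_topology)

text \<open>Half of the fact that the D-topology of an open Euclidean set is its usual topology;
  this half turns the domains of local lifts into a D-open cover.\<close>

lemma D_open_euclidean:
  assumes "eopen n U" "eopen n V" "V \<subseteq> U"
  shows "openin (D_topology (euclidean_diffeology n U)) V"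
  unfolding openin_D_topology
proof (intro conjI allI ballI)
  fix m W p assume "p \<in> plots (euclidean_diffeology n U) m W"
  then have W: "eopen m W" and p: "smooth_between m W n U p" by (auto simp: plots_euclidean)
  obtain O' where O': "open O'" "V = {x. \<forall>i\<ge>n. x i = 0} \<inter> O'"
    using assms(2) unfolding Euclidean_space_eq openin_open by blast
  have "{u \<in> W. p u \<in> V} = {u \<in> W. p u \<in> O'}"
    using p eopen_zero[OF assms(1)] by (auto simp: O' smooth_between_def)
  then show "eopen m {u \<in> W. p u \<in> V}"
    using eopen_preimage[OF W continuous_on_smooth_between[OF assms(1) W p] O'(1)] by simp
qed (use assms in auto)

lemma smooth_support_superset:
  "diffeological_space X \<Longrightarrow> x \<in> carrier X \<Longrightarrow> f x \<noteq> 0 \<Longrightarrow> x \<in> smooth_support X f"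
  unfolding smooth_support_def
  using closure_of_subset[of "{x \<in> carrier X. f x \<noteq> 0}" "D_topology X"]
  by (auto simp: topspace_D_topology)

lemma closedin_smooth_support: "closedin (D_topology X) (smooth_support X f)"
  by (simp add: smooth_support_def)

section \<open>Principal bundles as smooth torsors\<close>

lemma D_closed_preimage:
  assumes "diffeological_space X" "diffeological_space Y" "smooth_map X Y f" "closedin (D_topology Y) C"
  shows "closedin (D_topology X) {x \<in> carrier X. f x \<in> C}"
proof -
  have "carrier X - {x \<in> carrier X. f x \<in> C} = {x \<in> carrier X. f x \<in> carrier Y - C}"
    using smooth_map_carrier[OF assms(3)] by auto
  then show ?thesis
    using D_open_preimage[OF assms(1,3) D_open_complement[OF assms(2,4)]]
    by (auto simp: closedin_def topspace_D_topology[OF assms(1)])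
qed

text \<open>The preimage of a support is closed, since smooth maps are continuous, and it contains
  all points where the composite is non-zero.\<close>

lemma smooth_support_compose:
  assumes "diffeological_space X" "diffeological_space Y" "smooth_map X Y f" "x \<in> smooth_support X (\<lambda>x. g (f x))"
  shows "x \<in> carrier X" "f x \<in> smooth_support Y g"
proof -
  have "smooth_support X (\<lambda>x. g (f x)) \<subseteq> {x \<in> carrier X. f x \<in> smooth_support Y g}"
    unfolding smooth_support_def[of X]
  proof (rule closure_of_minimal)
    show "{x \<in> carrier X. g (f x) \<noteq> 0} \<subseteq> {x \<in> carrier X. f x \<in> smooth_support Y g}"
      using smooth_support_superset[OF assms(2)] smooth_map_carrier[OF assms(3)] by auto
    show "closedin (D_topology X) {x \<in> carrier X. f x \<in> smooth_support Y g}"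
      by (rule D_closed_preimage[OF assms(1-3) closedin_smooth_support])
  qed
  then show "x \<in> carrier X" "f x \<in> smooth_support Y g" using assms(4) by auto
qed

section \<open>Diffeomorphisms and transport of structure\<close>

lemma diffeomorphismI:
  assumes "diffeological_space X" "diffeological_space Y" "smooth_map X Y f" "smooth_map Y X g"
    and gf: "\<And>x. x \<in> carrier X \<Longrightarrow> g (f x) = x" and fg: "\<And>y. y \<in> carrier Y \<Longrightarrow> f (g y) = y"
  shows "diffeomorphism X Y f"
proof -
  have b: "bij_betw f (carrier X) (carrier Y)"
    by (rule bij_betwI[of f _ _ g])
       (use smooth_map_carrier[OF assms(3)] smooth_map_carrier[OF assms(4)] gf fg in auto)
  have "inv_into (carrier X) f y = g y" if "y \<in> carrier Y" for y
    using b smooth_map_carrier[OF assms(4) that] fg[OF that]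
    by (metis bij_betw_imp_inj_on inv_into_f_f)
  then have "smooth_map Y X (inv_into (carrier X) f)"
    by (rule smooth_map_cong[OF assms(2,1,4)])
  then show ?thesis using b assms(3) by (simp add: diffeomorphism_def)
qed

lemma diffeomorphism_inv:
  assumes "diffeomorphism X Y f"
  shows "smooth_map Y X (inv_into (carrier X) f)"
    and "x \<in> carrier X \<Longrightarrow> inv_into (carrier X) f (f x) = x"
    and "y \<in> carrier Y \<Longrightarrow> f (inv_into (carrier X) f y) = y"
  using assms by (auto simp: diffeomorphism_def bij_betw_def f_inv_into_f)

text \<open>Transport of structure along an injection. It puts the group into the type of a total
  space, where local triviality and numerability look for the fibre, and it moves total spaces into
  the type \<open>'e\<close>.\<close>

definition image_diffeology :: "('a \<Rightarrow> 'b) \<Rightarrow> 'a diffeology \<Rightarrow> 'b diffeology" where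
  "image_diffeology \<iota> X = \<lparr>carrier = \<iota> ` carrier X,
     plots = \<lambda>n U. {p. p \<in> U \<rightarrow> \<iota> ` carrier X \<and> (\<lambda>u. inv_into (carrier X) \<iota> (p u)) \<in> plots X n U}\<rparr>"

lemma carrier_image [simp]: "carrier (image_diffeology \<iota> X) = \<iota> ` carrier X"
  and plots_image: "plots (image_diffeology \<iota> X) n U =
    {p. p \<in> U \<rightarrow> \<iota> ` carrier X \<and> (\<lambda>u. inv_into (carrier X) \<iota> (p u)) \<in> plots X n U}"
  by (simp_all add: image_diffeology_def)

lemma diffeological_space_image:
  assumes X: "diffeological_space X" and \<iota>: "inj_on \<iota> (carrier X)"
  shows "diffeological_space (image_diffeology \<iota> X)"
proof (rule diffeological_spaceI)
  fix n U p
  assume U: "eopen n U" and *: "\<And>u. u \<in> U \<Longrightarrow> \<exists>V q. eopen n V \<and> u \<in> V \<and> V \<subseteq> U \<and>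
      q \<in> plots (image_diffeology \<iota> X) n V \<and> (\<forall>v\<in>V. p v = q v)"
  have "(\<lambda>u. inv_into (carrier X) \<iota> (p u)) \<in> plots X n U"
  proof (rule plot_local[OF X U])
    fix u assume "u \<in> U"
    then obtain V q where "eopen n V" "u \<in> V" "V \<subseteq> U"
      "q \<in> plots (image_diffeology \<iota> X) n V" "\<forall>v\<in>V. p v = q v" using *[OF \<open>u \<in> U\<close>] by blast
    then show "\<exists>V q. eopen n V \<and> u \<in> V \<and> V \<subseteq> U \<and> q \<in> plots X n V \<and> (\<forall>v\<in>V. inv_into (carrier X) \<iota> (p v) = q v)"
      by (intro exI[of _ V] exI[of _ "\<lambda>u. inv_into (carrier X) \<iota> (q u)"]) (auto simp: plots_image)
  qed
  moreover have "p u \<in> \<iota> ` carrier X" if "u \<in> U" for u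
    using *[OF that] by (fastforce simp: plots_image)
  ultimately show "p \<in> plots (image_diffeology \<iota> X) n U" by (simp add: plots_image)
next
  fix n U p m V f
  assume "p \<in> plots (image_diffeology \<iota> X) n U" "eopen m V" "smooth_between m V n U f"
  then show "(\<lambda>v. p (f v)) \<in> plots (image_diffeology \<iota> X) m V"
    using plot_compose[OF X, of "\<lambda>u. inv_into (carrier X) \<iota> (p u)" n U m V f]
    by (auto simp: plots_image smooth_between_def)
next
  fix n U p assume "p \<in> plots (image_diffeology \<iota> X) n U"
  then show "eopen n U" using plot_eopen[OF X, of "\<lambda>u. inv_into (carrier X) \<iota> (p u)" n U]
    by (simp add: plots_image)
next
  fix n U x assume "eopen n U" "x \<in> carrier (image_diffeology \<iota> X)"
  then show "(\<lambda>_. x) \<in> plots (image_diffeology \<iota> X) n U"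
    using \<iota> by (auto simp: plots_image intro: plot_const[OF X])
qed (auto simp: plots_image)

lemma smooth_map_image:
  assumes X: "diffeological_space X" and \<iota>: "inj_on \<iota> (carrier X)"
  shows "smooth_map X (image_diffeology \<iota> X) \<iota>"
    and "smooth_map (image_diffeology \<iota> X) X (inv_into (carrier X) \<iota>)"
proof -
  show "smooth_map X (image_diffeology \<iota> X) \<iota>"
  proof (rule smooth_mapI)
    fix n U p assume p: "p \<in> plots X n U"
    have "(\<lambda>u. inv_into (carrier X) \<iota> (\<iota> (p u))) \<in> plots X n U"
      by (rule plot_cong[OF X p]) (use plot_in_carrier[OF X p] \<iota> in auto)
    then show "(\<lambda>u. \<iota> (p u)) \<in> plots (image_diffeology \<iota> X) n U"
      using plot_in_carrier[OF X p] by (auto simp: plots_image)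
  qed auto
  show "smooth_map (image_diffeology \<iota> X) X (inv_into (carrier X) \<iota>)"
    by (rule smooth_mapI) (auto simp: plots_image intro: inv_into_into)
qed

text \<open>Smoothness is tested on the plots of \<open>X\<close> that stay in \<open>A\<close>,
  which amounts to smoothness for the subset diffeology on \<open>A\<close>.\<close>

definition smooth_section ::
  "'x diffeology \<Rightarrow> 'e diffeology \<Rightarrow> ('e \<Rightarrow> 'x) \<Rightarrow> 'x set \<Rightarrow> ('x \<Rightarrow> 'e) \<Rightarrow> bool" where
  "smooth_section X E \<pi> A s \<longleftrightarrow>
     (\<forall>x\<in>A \<inter> carrier X. s x \<in> carrier E \<and> \<pi> (s x) = x) \<and>
     (\<forall>n U. \<forall>p\<in>plots X n U. p \<in> U \<rightarrow> A \<longrightarrow> (\<lambda>u. s (p u)) \<in> plots E n U)"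

lemma smooth_sectionD:
  assumes "smooth_section X E \<pi> A s"
  shows "x \<in> A \<Longrightarrow> x \<in> carrier X \<Longrightarrow> s x \<in> carrier E"
    and "x \<in> A \<Longrightarrow> x \<in> carrier X \<Longrightarrow> \<pi> (s x) = x"
    and "p \<in> plots X n U \<Longrightarrow> (\<And>u. u \<in> U \<Longrightarrow> p u \<in> A) \<Longrightarrow> (\<lambda>u. s (p u)) \<in> plots E n U"
  using assms by (simp_all add: smooth_section_def Pi_iff)

text \<open>Numerability with sections in place of trivialisations. It mentions neither a fibre nor
  its type, so it passes along pullbacks and maps over \<open>X\<close>. For torsors it is
  equivalent to \<open>D_numerable\<close> once the group embeds in the type of the total
  space.\<close>

definition numerable_sections :: "'x diffeology \<Rightarrow> 'e diffeology \<Rightarrow> ('e \<Rightarrow> 'x) \<Rightarrow> bool" where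
  "numerable_sections X E \<pi> \<longleftrightarrow> (\<exists>(U :: nat \<Rightarrow> 'x set) \<zeta> s.
     open_cover (D_topology X) UNIV U \<and> locally_finite_family (D_topology X) UNIV U \<and>
     pointwise_finite_partition_of_unity X UNIV \<zeta> \<and>
     (\<forall>i. smooth_support X (\<zeta> i) \<subseteq> U i \<and> smooth_section X E \<pi> (U i) (s i)))"

lemma plots_pullback: "plots (pullback_diffeology Y f E \<pi>) n U =
    {p. (\<lambda>u. fst (p u)) \<in> plots Y n U \<and> (\<lambda>u. snd (p u)) \<in> plots E n U \<and>
      (\<forall>u\<in>U. f (fst (p u)) = \<pi> (snd (p u)))}"
  by (auto simp: pullback_diffeology_def plots_subset plots_prod case_prod_beta Pi_iff)

lemma carrier_pullback: "carrier (pullback_diffeology Y f E \<pi>) =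
    {z. fst z \<in> carrier Y \<and> snd z \<in> carrier E \<and> f (fst z) = \<pi> (snd z)}"
  by (auto simp: pullback_diffeology_def)

section \<open>Smooth torsors of a diffeological group\<close>

locale diff_group =
  fixes G :: "('g, 'm) monoid_scheme" (structure) and D :: "'g diffeology"
  assumes diffeological_group: "diffeological_group G D"

sublocale diff_group \<subseteq> group G
  using diffeological_group by (simp add: diffeological_group_def)

context diff_group
begin

lemma D_space: "diffeological_space D" and D_carrier [simp]: "carrier D = carrier G"
  using diffeological_group by (simp_all add: diffeological_group_def)

lemma plot_mult: "p \<in> plots D n U \<Longrightarrow> q \<in> plots D n U \<Longrightarrow> (\<lambda>u. p u \<otimes> q u) \<in> plots D n U"
  using smooth_map_plot[of "prod_diffeology D D" D "\<lambda>(a, b). a \<otimes> b" "\<lambda>u. (p u, q u)" n U] diffeological_group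
  by (simp add: diffeological_group_def plots_prod)

lemma plot_inv: "p \<in> plots D n U \<Longrightarrow> (\<lambda>u. inv p u) \<in> plots D n U"
  using smooth_map_plot[of D D "\<lambda>a. inv a" p n U] diffeological_group
  by (simp add: diffeological_group_def)

definition gdiv :: "('g \<Rightarrow> 'e \<Rightarrow> 'e) \<Rightarrow> 'e \<Rightarrow> 'e \<Rightarrow> 'g" where
  "gdiv a e e' = (THE g. g \<in> carrier G \<and> a g e = e')"

text \<open>All conditions are about points and plots, without charts, so they survive pullback and
  transport of structure easily. The last one, smoothness of division, stands in for the smoothness
  of inverse charts.\<close>

definition torsor :: "'x diffeology \<Rightarrow> 'e diffeology \<Rightarrow> ('e \<Rightarrow> 'x) \<Rightarrow> ('g \<Rightarrow> 'e \<Rightarrow> 'e) \<Rightarrow> bool" where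
  "torsor X E \<pi> a \<longleftrightarrow>
     diffeological_space X \<and> diffeological_space E \<and> smooth_map E X \<pi> \<and> smooth_action G D E a \<and>
     (\<forall>g\<in>carrier G. \<forall>e\<in>carrier E. \<pi> (a g e) = \<pi> e) \<and>
     (\<forall>n U. \<forall>p\<in>plots X n U. \<forall>u\<in>U. \<exists>V q. eopen n V \<and> u \<in> V \<and> V \<subseteq> U \<and> q \<in> plots E n V \<and>
        (\<forall>v\<in>V. \<pi> (q v) = p v)) \<and>
     (\<forall>e\<in>carrier E. \<forall>e'\<in>carrier E. \<pi> e = \<pi> e' \<longrightarrow> (\<exists>!g. g \<in> carrier G \<and> a g e = e')) \<and>
     (\<forall>n U. \<forall>p\<in>plots E n U. \<forall>q\<in>plots E n U. (\<forall>u\<in>U. \<pi> (p u) = \<pi> (q u)) \<longrightarrow>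
        (\<lambda>u. gdiv a (p u) (q u)) \<in> plots D n U)"

lemma torsorI:
  assumes "diffeological_space X" "diffeological_space E" "smooth_map E X \<pi>" "smooth_action G D E a"
    and "\<And>g e. g \<in> carrier G \<Longrightarrow> e \<in> carrier E \<Longrightarrow> \<pi> (a g e) = \<pi> e"
    and "\<And>n U p u. p \<in> plots X n U \<Longrightarrow> u \<in> U \<Longrightarrow>
      \<exists>V q. eopen n V \<and> u \<in> V \<and> V \<subseteq> U \<and> q \<in> plots E n V \<and> (\<forall>v\<in>V. \<pi> (q v) = p v)"
    and "\<And>g h e. g \<in> carrier G \<Longrightarrow> h \<in> carrier G \<Longrightarrow> e \<in> carrier E \<Longrightarrow> a g e = a h e \<Longrightarrow> g = h"
    and "\<And>e e'. e \<in> carrier E \<Longrightarrow> e' \<in> carrier E \<Longrightarrow> \<pi> e = \<pi> e' \<Longrightarrow> \<exists>g\<in>carrier G. a g e = e'"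
    and "\<And>n U p q. p \<in> plots E n U \<Longrightarrow> q \<in> plots E n U \<Longrightarrow> (\<And>u. u \<in> U \<Longrightarrow> \<pi> (p u) = \<pi> (q u)) \<Longrightarrow>
      (\<lambda>u. gdiv a (p u) (q u)) \<in> plots D n U"
  shows "torsor X E \<pi> a"
proof -
  have "\<exists>!g. g \<in> carrier G \<and> a g e = e'" if "e \<in> carrier E" "e' \<in> carrier E" "\<pi> e = \<pi> e'" for e e'
    using assms(7)[OF _ _ that(1)] assms(8)[OF that] by metis
  then show ?thesis
    unfolding torsor_def
    by (intro conjI ballI allI impI) (use assms(1-6,9) in auto)
qed

context
  fixes X :: "'x diffeology" and E :: "'e diffeology" and \<pi> a
  assumes T: "torsor X E \<pi> a"
begin

lemma torsor_base_space: "diffeological_space X"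
  and torsor_total_space: "diffeological_space E"
  and torsor_proj: "smooth_map E X \<pi>"
  and torsor_action: "smooth_action G D E a"
  by (rule T[unfolded torsor_def, THEN conjunct1]
      T[unfolded torsor_def, THEN conjunct2, THEN conjunct1]
      T[unfolded torsor_def, THEN conjunct2, THEN conjunct2, THEN conjunct1]
      T[unfolded torsor_def, THEN conjunct2, THEN conjunct2, THEN conjunct2, THEN conjunct1])+

lemma torsor_proj_act: "g \<in> carrier G \<Longrightarrow> e \<in> carrier E \<Longrightarrow> \<pi> (a g e) = \<pi> e"
  using T unfolding torsor_def by (elim conjE) simp

lemma torsor_lift:
  assumes "p \<in> plots X n U" "u \<in> U"
  obtains V q where "eopen n V" "u \<in> V" "V \<subseteq> U" "q \<in> plots E n V" "\<And>v. v \<in> V \<Longrightarrow> \<pi> (q v) = p v"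
proof -
  have "\<exists>V q. eopen n V \<and> u \<in> V \<and> V \<subseteq> U \<and> q \<in> plots E n V \<and> (\<forall>v\<in>V. \<pi> (q v) = p v)"
    using T[unfolded torsor_def, THEN conjunct2, THEN conjunct2, THEN conjunct2, THEN conjunct2, THEN conjunct2,
        THEN conjunct1] assms by simp
  then show ?thesis using that by blast
qed

lemma torsor_gdiv_plot:
  assumes "p \<in> plots E n U" "q \<in> plots E n U" "\<And>u. u \<in> U \<Longrightarrow> \<pi> (p u) = \<pi> (q u)"
  shows "(\<lambda>u. gdiv a (p u) (q u)) \<in> plots D n U"
  using T[unfolded torsor_def, THEN conjunct2, THEN conjunct2, THEN conjunct2, THEN conjunct2, THEN conjunct2,
        THEN conjunct2, THEN conjunct2] assms by simp

lemma torsor_unique: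
  "e \<in> carrier E \<Longrightarrow> e' \<in> carrier E \<Longrightarrow> \<pi> e = \<pi> e' \<Longrightarrow> \<exists>!g. g \<in> carrier G \<and> a g e = e'"
  using T[unfolded torsor_def, THEN conjunct2, THEN conjunct2, THEN conjunct2, THEN conjunct2, THEN conjunct2,
        THEN conjunct2, THEN conjunct1] by simp

lemma torsor_gdiv:
  assumes "e \<in> carrier E" "e' \<in> carrier E" "\<pi> e = \<pi> e'"
  shows "gdiv a e e' \<in> carrier G" "a (gdiv a e e') e = e'"
  using theI'[OF torsor_unique[OF assms]] by (simp_all add: gdiv_def)

lemma torsor_act_in: "g \<in> carrier G \<Longrightarrow> e \<in> carrier E \<Longrightarrow> a g e \<in> carrier E"
  using torsor_action smooth_map_carrier[of "prod_diffeology D E" E "\<lambda>(g, e). a g e" "(g, e)"]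
  by (simp add: smooth_action_def)

lemma torsor_act_one: "e \<in> carrier E \<Longrightarrow> a \<one> e = e"
  and torsor_act_mult: "g \<in> carrier G \<Longrightarrow> h \<in> carrier G \<Longrightarrow> e \<in> carrier E \<Longrightarrow> a (g \<otimes> h) e = a g (a h e)"
  using torsor_action by (simp_all add: smooth_action_def)

lemma torsor_act_plot: "\<gamma> \<in> plots D n U \<Longrightarrow> p \<in> plots E n U \<Longrightarrow> (\<lambda>u. a (\<gamma> u) (p u)) \<in> plots E n U"
  using torsor_action smooth_map_plot[of "prod_diffeology D E" E "\<lambda>(g, e). a g e" "\<lambda>u. (\<gamma> u, p u)" n U]
  by (simp add: smooth_action_def plots_prod)

lemma torsor_proj_in: "e \<in> carrier E \<Longrightarrow> \<pi> e \<in> carrier X"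
  by (rule smooth_map_carrier[OF torsor_proj])

lemma torsor_gdivI:
  assumes "g \<in> carrier G" "e \<in> carrier E" "a g e = e'"
  shows "gdiv a e e' = g"
  unfolding gdiv_def
  by (rule the1_equality[OF torsor_unique]) (use assms torsor_act_in torsor_proj_act in force)+

lemma torsor_act_cancel:
  "g \<in> carrier G \<Longrightarrow> h \<in> carrier G \<Longrightarrow> e \<in> carrier E \<Longrightarrow> a g e = a h e \<Longrightarrow> g = h"
  using torsor_gdivI by metis

lemma torsor_gdiv_act_left:
  assumes "e \<in> carrier E" "e' \<in> carrier E" "\<pi> e = \<pi> e'" "h \<in> carrier G"
  shows "gdiv a (a h e) e' = gdiv a e e' \<otimes> inv h"
  by (rule torsor_gdivI)
     (use assms torsor_gdiv[OF assms(1-3)] torsor_act_in in \<open>auto simp: torsor_act_mult[symmetric] m_assoc\<close>)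

text \<open>A point of \<open>X\<close> is a plot on the one-point space in dimension zero, and
  plots lift.\<close>

lemma torsor_surj:
  assumes "x \<in> carrier X"
  obtains e where "e \<in> carrier E" "\<pi> e = x"
proof -
  obtain V q where q: "(\<lambda>_. 0) \<in> V" "q \<in> plots E 0 V" "\<And>v. v \<in> V \<Longrightarrow> \<pi> (q v) = x"
    using torsor_lift[OF plot_const[OF torsor_base_space eopen_singleton_0 assms], of "\<lambda>_. 0"] by (metis singletonI)
  then show ?thesis using that plot_in_carrier[OF torsor_total_space q(2,1)] by auto
qed

end

text \<open>Both fibres over a point are copies of the group, so an equivariant map is bijective on
  them. The inverse is smooth because a plot of \<open>F\<close> comes locally from a plot of
  \<open>E\<close>: lift its projection to \<open>E\<close>, then correct the lift by the smooth
  division in \<open>F\<close>.\<close>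

lemma torsor_map_diffeomorphism:
  assumes T: "torsor X E \<pi> a" and S: "torsor X F \<rho> b" and \<psi>: "smooth_map E F \<psi>"
    and over: "\<And>e. e \<in> carrier E \<Longrightarrow> \<rho> (\<psi> e) = \<pi> e"
    and eqv: "\<And>g e. g \<in> carrier G \<Longrightarrow> e \<in> carrier E \<Longrightarrow> \<psi> (a g e) = b g (\<psi> e)"
  shows "diffeomorphism E F \<psi>"
proof -
  define \<phi> where "\<phi> y = (SOME e. e \<in> carrier E \<and> \<psi> e = y)" for y
  note E = torsor_total_space[OF T] and F = torsor_total_space[OF S]
  have inj: "e = e'" if e: "e \<in> carrier E" "e' \<in> carrier E" "\<psi> e = \<psi> e'" for e e'
  proof -
    have "\<pi> e = \<pi> e'" using over e by metis
    note d = torsor_gdiv[OF T e(1,2) this]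
    have "b (gdiv a e e') (\<psi> e) = b \<one> (\<psi> e)"
      using eqv[OF d(1) e(1)] d(2) e torsor_act_one[OF S smooth_map_carrier[OF \<psi> e(1)]] by simp
    then have "gdiv a e e' = \<one>"
      using torsor_act_cancel[OF S d(1) one_closed smooth_map_carrier[OF \<psi> e(1)]] by simp
    then show ?thesis using d(2) torsor_act_one[OF T e(1)] by simp
  qed
  have lift: "\<exists>W r. eopen n W \<and> u \<in> W \<and> W \<subseteq> U \<and> r \<in> plots E n W \<and> (\<forall>v\<in>W. \<psi> (r v) = q v)"
    if q: "q \<in> plots F n U" and u: "u \<in> U" for q n U u
  proof -
    obtain V p where V: "eopen n V" "u \<in> V" "V \<subseteq> U" "p \<in> plots E n V" "\<And>v. v \<in> V \<Longrightarrow> \<pi> (p v) = \<rho> (q v)"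
      using torsor_lift[OF T smooth_map_plot[OF torsor_proj[OF S] q] u] by blast
    note qV = plot_restrict[OF F q V(1,3)] and pV = smooth_map_plot[OF \<psi> V(4)]
    have same: "\<rho> (\<psi> (p v)) = \<rho> (q v)" if "v \<in> V" for v
      using that V(5) over plot_in_carrier[OF E V(4)] by simp
    have g: "(\<lambda>v. gdiv b (\<psi> (p v)) (q v)) \<in> plots D n V"
      by (rule torsor_gdiv_plot[OF S pV qV same])
    have "\<psi> (a (gdiv b (\<psi> (p v)) (q v)) (p v)) = q v" if v: "v \<in> V" for v
      using eqv[OF _ plot_in_carrier[OF E V(4) v]] torsor_gdiv[OF S plot_in_carrier[OF F pV v]
          plot_in_carrier[OF F qV v] same[OF v]] by simp
    then show ?thesis using V torsor_act_plot[OF T g V(4)] by blast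
  qed
  have ex: "\<exists>e. e \<in> carrier E \<and> \<psi> e = y" if y: "y \<in> carrier F" for y
  proof -
    obtain e where e: "e \<in> carrier E" "\<pi> e = \<rho> y" using torsor_surj[OF T torsor_proj_in[OF S y]] .
    note d = torsor_gdiv[OF S smooth_map_carrier[OF \<psi> e(1)] y, unfolded over[OF e(1)], OF e(2)]
    show ?thesis using eqv[OF d(1) e(1)] d(2) torsor_act_in[OF T d(1) e(1)] by auto
  qed
  have \<phi>: "\<phi> y \<in> carrier E" "\<psi> (\<phi> y) = y" if "y \<in> carrier F" for y
    using someI_ex[OF ex[OF that]] by (auto simp: \<phi>_def)
  have \<phi>\<psi>: "\<phi> (\<psi> e) = e" if "e \<in> carrier E" for e
    using inj \<phi> that smooth_map_carrier[OF \<psi>] by metis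
  have "smooth_map F E \<phi>"
  proof (rule smooth_map_localI[OF F E \<phi>(1)])
    fix n U q u assume "q \<in> plots F n U" "u \<in> U"
    then obtain W r where W: "eopen n W" "u \<in> W" "W \<subseteq> U" "r \<in> plots E n W" "\<forall>v\<in>W. \<psi> (r v) = q v"
      using lift[OF \<open>q \<in> plots F n U\<close> \<open>u \<in> U\<close>] by blast
    then have "\<forall>v\<in>W. \<phi> (q v) = r v" using \<phi>\<psi> plot_in_carrier[OF E W(4)] by metis
    then show "\<exists>V p. eopen n V \<and> u \<in> V \<and> V \<subseteq> U \<and> p \<in> plots E n V \<and> (\<forall>v\<in>V. \<phi> (q v) = p v)"
      using W by (intro exI[of _ W] exI[of _ r]) simp
  qed
  then show ?thesis using \<phi> \<phi>\<psi> by (intro diffeomorphismI[OF E F \<psi>]) auto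
qed

section \<open>Pullback and transport of torsors\<close>

lemma diffeological_space_pullback:
  "diffeological_space Y \<Longrightarrow> diffeological_space E \<Longrightarrow> diffeological_space (pullback_diffeology Y f E \<pi>)"
  unfolding pullback_diffeology_def by (intro diffeological_space_subset diffeological_space_prod)

lemma smooth_map_pullback_fst: "smooth_map (pullback_diffeology Y f E \<pi>) Y fst"
  and smooth_map_pullback_snd: "smooth_map (pullback_diffeology Y f E \<pi>) E snd"
  by (rule smooth_mapI; simp add: carrier_pullback plots_pullback)+

text \<open>Everything happens in the second component: action, lifts and division are those of
  \<open>E\<close>, and the first component is carried along.\<close>

lemma torsor_pullback:
  assumes T: "torsor X E \<pi> a" and Y: "diffeological_space Y" and f: "smooth_map Y X f"
  shows "torsor Y (pullback_diffeology Y f E \<pi>) fst (\<lambda>g (y, e). (y, a g e))"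
proof (rule torsorI)
  let ?P = "pullback_diffeology Y f E \<pi>" and ?a = "\<lambda>g (y, e). (y, a g e)"
  note E = torsor_total_space[OF T]
  show "diffeological_space ?P" by (rule diffeological_space_pullback[OF Y E])
  show "smooth_map ?P Y fst" by (rule smooth_map_pullback_fst)
  show "smooth_action G D ?P ?a"
    unfolding smooth_action_def
  proof (intro conjI ballI)
    show "smooth_map (prod_diffeology D ?P) ?P (\<lambda>(g, e). ?a g e)"
    proof (rule smooth_mapI)
      fix n U p assume "p \<in> plots (prod_diffeology D ?P) n U"
      then have p: "(\<lambda>u. fst (p u)) \<in> plots D n U" "(\<lambda>u. fst (snd (p u))) \<in> plots Y n U"
        "(\<lambda>u. snd (snd (p u))) \<in> plots E n U" "\<And>u. u \<in> U \<Longrightarrow> f (fst (snd (p u))) = \<pi> (snd (snd (p u)))"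
        by (auto simp: plots_prod plots_pullback)
      have "\<pi> (a (fst (p u)) (snd (snd (p u)))) = \<pi> (snd (snd (p u)))" if "u \<in> U" for u
        using torsor_proj_act[OF T] plot_in_carrier[OF D_space p(1) that] plot_in_carrier[OF E p(3) that] by simp
      then show "(\<lambda>u. (\<lambda>(g, e). ?a g e) (p u)) \<in> plots ?P n U"
        using p torsor_act_plot[OF T p(1,3)] by (simp add: plots_pullback case_prod_beta)
    qed (auto simp: carrier_pullback torsor_act_in[OF T] torsor_proj_act[OF T])
  qed (auto simp: carrier_pullback torsor_act_one[OF T] torsor_act_mult[OF T])
  show "\<exists>V q. eopen n V \<and> u \<in> V \<and> V \<subseteq> U \<and> q \<in> plots ?P n V \<and> (\<forall>v\<in>V. fst (q v) = p v)"
    if p: "p \<in> plots Y n U" and u: "u \<in> U" for n U p u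
  proof -
    obtain V q where V: "eopen n V" "u \<in> V" "V \<subseteq> U" "q \<in> plots E n V" "\<And>v. v \<in> V \<Longrightarrow> \<pi> (q v) = f (p v)"
      using torsor_lift[OF T smooth_map_plot[OF f p] u] by blast
    then show ?thesis using plot_restrict[OF Y p V(1,3)]
      by (intro exI[of _ V] exI[of _ "\<lambda>v. (p v, q v)"]) (simp add: plots_pullback)
  qed
  show "g = h" if "g \<in> carrier G" "h \<in> carrier G" "e \<in> carrier ?P" "?a g e = ?a h e" for g h e
    using that torsor_act_cancel[OF T, of g h "snd e"] by (simp add: carrier_pullback case_prod_beta)
  have gd: "gdiv a (snd e) (snd e') \<in> carrier G \<and> ?a (gdiv a (snd e) (snd e')) e = e'"
    if "e \<in> carrier ?P" "e' \<in> carrier ?P" "fst e = fst e'" for e e'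
    using that torsor_gdiv[OF T, of "snd e" "snd e'"] by (cases e; cases e') (auto simp: carrier_pullback)
  then show "\<exists>g\<in>carrier G. ?a g e = e'" if "e \<in> carrier ?P" "e' \<in> carrier ?P" "fst e = fst e'" for e e'
    using that by blast
  show "(\<lambda>u. gdiv ?a (p u) (q u)) \<in> plots D n U"
    if p: "p \<in> plots ?P n U" and q: "q \<in> plots ?P n U" and eq: "\<And>u. u \<in> U \<Longrightarrow> fst (p u) = fst (q u)" for n U p q
  proof -
    have "(\<lambda>u. gdiv a (snd (p u)) (snd (q u))) \<in> plots D n U"
    proof (rule torsor_gdiv_plot[OF T])
      show "(\<lambda>u. snd (p u)) \<in> plots E n U" "(\<lambda>u. snd (q u)) \<in> plots E n U"
        using p q by (auto simp: plots_pullback)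
      show "\<pi> (snd (p u)) = \<pi> (snd (q u))" if "u \<in> U" for u
        using p q eq[OF that] that by (auto simp: plots_pullback)
    qed
    then show ?thesis
    proof (rule plot_cong[OF D_space])
      fix u assume u: "u \<in> U"
      note c = plot_in_carrier[OF \<open>diffeological_space ?P\<close> p u] plot_in_carrier[OF \<open>diffeological_space ?P\<close> q u]
      have "h = gdiv a (snd (p u)) (snd (q u))" if "h \<in> carrier G" "?a h (p u) = q u" for h
      proof -
        have "a h (snd (p u)) = snd (q u)" using that(2) by (metis case_prod_beta snd_conv)
        then show ?thesis using torsor_gdivI[OF T that(1)] c by (simp add: carrier_pullback)
      qed
      then show "gdiv ?a (p u) (q u) = gdiv a (snd (p u)) (snd (q u))"
        unfolding gdiv_def[of ?a] using gd[OF c eq[OF u]] by (intro the_equality) auto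
    qed
  qed
qed (auto simp: Y)

lemma numerable_sections_pullback:
  assumes T: "torsor X E \<pi> a" and Y: "diffeological_space Y" and f: "smooth_map Y X f"
    and N: "numerable_sections X E \<pi>"
  shows "numerable_sections Y (pullback_diffeology Y f E \<pi>) fst"
proof -
  note X = torsor_base_space[OF T]
  obtain U \<zeta> s where U: "open_cover (D_topology X) UNIV U" "locally_finite_family (D_topology X) UNIV U"
    and \<zeta>: "pointwise_finite_partition_of_unity X UNIV \<zeta>" "\<And>i::nat. smooth_support X (\<zeta> i) \<subseteq> U i"
    and s: "\<And>i. smooth_section X E \<pi> (U i) (s i)"
    using N unfolding numerable_sections_def by blast
  define V where "V i = {y \<in> carrier Y. f y \<in> U i}" for i
  have "open_cover (D_topology Y) UNIV V"
  proof -
    have "openin (D_topology Y) (V i)" for i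
      unfolding V_def by (rule D_open_preimage[OF Y f]) (use U(1) in \<open>simp add: open_cover_def\<close>)
    moreover have "(\<Union>i. V i) = carrier Y"
    proof -
      have "(\<Union>i. U i) = carrier X" using U(1) by (simp add: open_cover_def topspace_D_topology[OF X])
      then show ?thesis using smooth_map_carrier[OF f] by (fastforce simp: V_def)
    qed
    ultimately show ?thesis by (simp add: open_cover_def topspace_D_topology[OF Y])
  qed
  moreover have "locally_finite_family (D_topology Y) UNIV V"
    unfolding locally_finite_family_def
  proof
    fix y assume "y \<in> topspace (D_topology Y)"
    then have y: "y \<in> carrier Y" by (simp add: topspace_D_topology[OF Y])
    then obtain W where W: "openin (D_topology X) W" "f y \<in> W" "finite {i. U i \<inter> W \<noteq> {}}"
      using U(2) smooth_map_carrier[OF f y] by (auto simp: locally_finite_family_def topspace_D_topology[OF X])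
    have "finite {i. V i \<inter> {y \<in> carrier Y. f y \<in> W} \<noteq> {}}"
      by (rule finite_subset[OF _ W(3)]) (auto simp: V_def)
    then show "\<exists>W. openin (D_topology Y) W \<and> y \<in> W \<and> finite {i \<in> UNIV. V i \<inter> W \<noteq> {}}"
      using D_open_preimage[OF Y f W(1)] y W(2) by (intro exI[of _ "{y \<in> carrier Y. f y \<in> W}"]) simp
  qed
  moreover have "pointwise_finite_partition_of_unity Y UNIV (\<lambda>i y. \<zeta> i (f y))"
    using \<zeta>(1) smooth_map_carrier[OF f] smooth_map_compose[OF f]
    unfolding pointwise_finite_partition_of_unity_def by auto
  moreover have "smooth_support Y (\<lambda>y. \<zeta> i (f y)) \<subseteq> V i" for i
    using smooth_support_compose[OF Y X f] \<zeta>(2) by (fastforce simp: V_def)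
  moreover have "smooth_section Y (pullback_diffeology Y f E \<pi>) fst (V i) (\<lambda>y. (y, s i (f y)))" for i
    unfolding smooth_section_def
  proof (intro conjI ballI allI impI)
    fix n W p assume p: "p \<in> plots Y n W" "p \<in> W \<rightarrow> V i"
    have "(\<lambda>u. s i (f (p u))) \<in> plots E n W"
      by (rule smooth_sectionD(3)[OF s smooth_map_plot[OF f p(1)]]) (use p(2) in \<open>auto simp: V_def\<close>)
    moreover have "\<pi> (s i (f (p u))) = f (p u)" if "u \<in> W" for u
      by (rule smooth_sectionD(2)[OF s]) (use p(2) that smooth_map_carrier[OF f] in \<open>auto simp: V_def\<close>)
    ultimately show "(\<lambda>u. (p u, s i (f (p u)))) \<in> plots (pullback_diffeology Y f E \<pi>) n W"
      using p(1) by (simp add: plots_pullback)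
  next
    fix y assume "y \<in> V i \<inter> carrier Y"
    then show "(y, s i (f y)) \<in> carrier (pullback_diffeology Y f E \<pi>)"
      using s[of i] smooth_map_carrier[OF f] by (auto simp: carrier_pullback smooth_section_def V_def)
  qed simp
  ultimately show ?thesis
    unfolding numerable_sections_def
    by (intro exI[of _ V] exI[of _ "\<lambda>i y. \<zeta> i (f y)"] exI[of _ "\<lambda>i y. (y, s i (f y))"]) simp
qed

lemma smooth_section_map:
  assumes "smooth_section X E \<pi> A s" "smooth_map E F \<psi>" "\<And>e. e \<in> carrier E \<Longrightarrow> \<rho> (\<psi> e) = \<pi> e"
  shows "smooth_section X F \<rho> A (\<lambda>x. \<psi> (s x))"
  using assms smooth_map_carrier[OF assms(2)] smooth_map_plot[OF assms(2)]
  unfolding smooth_section_def by auto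

lemma numerable_sections_map:
  assumes "numerable_sections X E \<pi>" "smooth_map E F \<psi>" "\<And>e. e \<in> carrier E \<Longrightarrow> \<rho> (\<psi> e) = \<pi> e"
  shows "numerable_sections X F \<rho>"
proof -
  obtain U \<zeta> s where *: "open_cover (D_topology X) UNIV U" "locally_finite_family (D_topology X) UNIV U"
    "pointwise_finite_partition_of_unity X UNIV \<zeta>"
    "\<And>i::nat. smooth_support X (\<zeta> i) \<subseteq> U i" "\<And>i. smooth_section X E \<pi> (U i) (s i)"
    using assms(1) unfolding numerable_sections_def by blast
  have "smooth_section X F \<rho> (U i) (\<lambda>x. \<psi> (s i x))" for i
    by (rule smooth_section_map[OF *(5) assms(2)]) (rule assms(3))
  then show ?thesis
    unfolding numerable_sections_def using *(1-4)
    by (intro exI[of _ U] exI[of _ \<zeta>] exI[of _ "\<lambda>i x. \<psi> (s i x)"]) simp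
qed

lemma torsor_image:
  assumes T: "torsor X E \<pi> a" and j: "inj_on j (carrier E)"
  defines "k \<equiv> inv_into (carrier E) j"
  shows "torsor X (image_diffeology j E) (\<lambda>y. \<pi> (k y)) (\<lambda>g y. j (a g (k y)))"
proof -
  let ?F = "image_diffeology j E" and ?b = "\<lambda>g y. j (a g (k y))"
  note E = torsor_total_space[OF T]
  note F = diffeological_space_image[OF E j]
  note sj = smooth_map_image(1)[OF E j] and sk = smooth_map_image(2)[OF E j, folded k_def]
  have kj: "k (j e) = e" if "e \<in> carrier E" for e using j that by (simp add: k_def)
  have jk: "j (k y) = y" if "y \<in> carrier ?F" for y using that by (simp add: k_def f_inv_into_f)
  have kin: "k y \<in> carrier E" if "y \<in> carrier ?F" for y using smooth_map_carrier[OF sk that] .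
  show ?thesis
  proof (rule torsorI[OF torsor_base_space[OF T] F smooth_map_compose[OF sk torsor_proj[OF T]]])
    have "smooth_map (prod_diffeology D ?F) ?F (\<lambda>(g, y). ?b g y)"
    proof (rule smooth_mapI)
      fix n U p assume "p \<in> plots (prod_diffeology D ?F) n U"
      then have "(\<lambda>u. fst (p u)) \<in> plots D n U" "(\<lambda>u. snd (p u)) \<in> plots ?F n U" by (auto simp: plots_prod)
      from smooth_map_plot[OF sj torsor_act_plot[OF T this(1) smooth_map_plot[OF sk this(2)]]]
      show "(\<lambda>u. (\<lambda>(g, y). ?b g y) (p u)) \<in> plots ?F n U" by (simp add: case_prod_beta)
    qed (use kin torsor_act_in[OF T] in auto)
    moreover have "?b \<one> y = y" if "y \<in> carrier ?F" for y
      using torsor_act_one[OF T kin[OF that]] jk[OF that] by simp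
    moreover have "?b (g \<otimes> h) y = ?b g (?b h y)" if "g \<in> carrier G" "h \<in> carrier G" "y \<in> carrier ?F" for g h y
      using torsor_act_mult[OF T that(1,2) kin[OF that(3)]] kj torsor_act_in[OF T that(2) kin[OF that(3)]] by simp
    ultimately show "smooth_action G D ?F ?b" by (simp add: smooth_action_def)
    show "\<pi> (k (?b g y)) = \<pi> (k y)" if "g \<in> carrier G" "y \<in> carrier ?F" for g y
      using kj torsor_act_in[OF T that(1) kin[OF that(2)]] torsor_proj_act[OF T that(1) kin[OF that(2)]] by simp
    show "\<exists>V q. eopen n V \<and> u \<in> V \<and> V \<subseteq> U \<and> q \<in> plots ?F n V \<and> (\<forall>v\<in>V. \<pi> (k (q v)) = p v)"
      if p: "p \<in> plots X n U" and u: "u \<in> U" for n U p u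
    proof -
      obtain V q where V: "eopen n V" "u \<in> V" "V \<subseteq> U" "q \<in> plots E n V" "\<And>v. v \<in> V \<Longrightarrow> \<pi> (q v) = p v"
        using torsor_lift[OF T p u] by blast
      then show ?thesis using smooth_map_plot[OF sj V(4)] kj plot_in_carrier[OF E V(4)]
        by (intro exI[of _ V] exI[of _ "\<lambda>v. j (q v)"]) simp
    qed
    have inj: "a g (k y) = a h (k y)" if "?b g y = ?b h y" "g \<in> carrier G" "h \<in> carrier G" "y \<in> carrier ?F" for g h y
      using kj torsor_act_in[OF T _ kin[OF that(4)]] that(1-3) by metis
    then show "g = h" if "g \<in> carrier G" "h \<in> carrier G" "y \<in> carrier ?F" "?b g y = ?b h y" for g h y
      using torsor_act_cancel[OF T that(1,2) kin[OF that(3)]] that by blast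
    have gd: "gdiv a (k y) (k z) \<in> carrier G" "?b (gdiv a (k y) (k z)) y = z"
      if "y \<in> carrier ?F" "z \<in> carrier ?F" "\<pi> (k y) = \<pi> (k z)" for y z
      using torsor_gdiv[OF T kin[OF that(1)] kin[OF that(2)] that(3)] jk[OF that(2)] by auto
    then show "\<exists>g\<in>carrier G. ?b g y = z" if "y \<in> carrier ?F" "z \<in> carrier ?F" "\<pi> (k y) = \<pi> (k z)" for y z
      using that by blast
    have eq: "gdiv ?b y z = gdiv a (k y) (k z)"
      if "y \<in> carrier ?F" "z \<in> carrier ?F" "\<pi> (k y) = \<pi> (k z)" for y z
      unfolding gdiv_def[of ?b]
    proof (rule the_equality)
      fix g assume "g \<in> carrier G \<and> ?b g y = z"
      then show "g = gdiv a (k y) (k z)"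
        using torsor_gdivI[OF T _ kin[OF that(1)], of g "k z"] kj torsor_act_in[OF T _ kin[OF that(1)]] by metis
    qed (use gd[OF that] in simp)
    show "(\<lambda>u. gdiv ?b (p u) (q u)) \<in> plots D n U"
      if p: "p \<in> plots ?F n U" "q \<in> plots ?F n U" "\<And>u. u \<in> U \<Longrightarrow> \<pi> (k (p u)) = \<pi> (k (q u))" for n U p q
      by (rule plot_cong[OF D_space torsor_gdiv_plot[OF T smooth_map_plot[OF sk p(1)] smooth_map_plot[OF sk p(2)] p(3)]])
         (use eq p(3) plot_in_carrier[OF F p(1)] plot_in_carrier[OF F p(2)] in auto)
  qed
qed

text \<open>A section splits a torsor: \<open>e\<close> corresponds to its base point together with
  the group element that leads from the section to \<open>e\<close>, and the inverse lets
  \<open>g\<close> act on \<open>s x\<close>. The group enters through its image under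
  \<open>\<iota>\<close> because the fibre is sought in a prescribed type.\<close>

lemma trivialisation_section:
  assumes T: "torsor X E \<pi> a" and s: "smooth_section X E \<pi> A s" and \<iota>: "inj_on \<iota> (carrier G)"
  shows "trivialisation (subset_diffeology E (\<pi> -` A)) (subset_diffeology X A) \<pi> (image_diffeology \<iota> D)
    (\<lambda>e. (\<pi> e, \<iota> (gdiv a (s (\<pi> e)) e)))"
proof -
  let ?E = "subset_diffeology E (\<pi> -` A)" and ?X = "subset_diffeology X A" and ?F = "image_diffeology \<iota> D"
  let ?k = "inv_into (carrier D) \<iota>"
  note X = torsor_base_space[OF T] and E = torsor_total_space[OF T]
  have \<iota>': "inj_on \<iota> (carrier D)" using \<iota> by simp
  note F = diffeological_space_image[OF D_space \<iota>']
  note si = smooth_map_image(1)[OF D_space \<iota>'] and sk = smooth_map_image(2)[OF D_space \<iota>']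
  have s1: "s x \<in> carrier E" "\<pi> (s x) = x" if "x \<in> A" "x \<in> carrier X" for x
    using s that by (auto simp: smooth_section_def)
  have s2: "(\<lambda>u. s (p u)) \<in> plots E n U" if "p \<in> plots X n U" "\<And>u. u \<in> U \<Longrightarrow> p u \<in> A" for p n U
    using s that by (auto simp: smooth_section_def)
  have g: "gdiv a (s (\<pi> e)) e \<in> carrier G" "a (gdiv a (s (\<pi> e)) e) (s (\<pi> e)) = e"
    if "e \<in> carrier E" "\<pi> e \<in> A" for e
    using torsor_gdiv[OF T s1(1)[OF that(2) torsor_proj_in[OF T that(1)]] that(1)]
      s1(2)[OF that(2) torsor_proj_in[OF T that(1)]] by auto
  have k: "?k y \<in> carrier G" "\<iota> (?k y) = y" if "y \<in> \<iota> ` carrier G" for y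
    using that by (auto simp: inv_into_into f_inv_into_f)
  have "diffeomorphism ?E (prod_diffeology ?X ?F) (\<lambda>e. (\<pi> e, \<iota> (gdiv a (s (\<pi> e)) e)))"
  proof (rule diffeomorphismI[where g = "\<lambda>(x, y). a (?k y) (s x)"])
    show "smooth_map ?E (prod_diffeology ?X ?F) (\<lambda>e. (\<pi> e, \<iota> (gdiv a (s (\<pi> e)) e)))"
    proof (rule smooth_mapI)
      fix n U p assume "p \<in> plots ?E n U"
      then have p: "p \<in> plots E n U" "\<And>u. u \<in> U \<Longrightarrow> \<pi> (p u) \<in> A" by (auto simp: plots_subset)
      note pp = smooth_map_plot[OF torsor_proj[OF T] p(1)]
      have "\<pi> (s (\<pi> (p u))) = \<pi> (p u)" if "u \<in> U" for u
        by (rule s1(2)[OF p(2)[OF that] plot_in_carrier[OF X pp that]])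
      then have "(\<lambda>u. gdiv a (s (\<pi> (p u))) (p u)) \<in> plots D n U"
        by (intro torsor_gdiv_plot[OF T s2[OF pp p(2)] p(1)]) simp
      then show "(\<lambda>u. (\<pi> (p u), \<iota> (gdiv a (s (\<pi> (p u))) (p u)))) \<in> plots (prod_diffeology ?X ?F) n U"
        using pp p(2) smooth_map_plot[OF si] by (simp add: plots_prod plots_subset)
    qed (use torsor_proj_in[OF T] g in auto)
    show "smooth_map (prod_diffeology ?X ?F) ?E (\<lambda>(x, y). a (?k y) (s x))"
    proof (rule smooth_mapI)
      fix n U p assume "p \<in> plots (prod_diffeology ?X ?F) n U"
      then have p: "(\<lambda>u. fst (p u)) \<in> plots X n U" "\<And>u. u \<in> U \<Longrightarrow> fst (p u) \<in> A"
        "(\<lambda>u. snd (p u)) \<in> plots ?F n U" by (auto simp: plots_prod plots_subset)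
      note kp = smooth_map_plot[OF sk p(3)] and sp = s2[OF p(1,2)]
      have "\<pi> (a (?k (snd (p u))) (s (fst (p u)))) \<in> A" if "u \<in> U" for u
        using torsor_proj_act[OF T _ plot_in_carrier[OF E sp that], of "?k (snd (p u))"]
          plot_in_carrier[OF D_space kp that] s1(2)[OF p(2)[OF that] plot_in_carrier[OF X p(1) that]]
          p(2)[OF that] by simp
      then show "(\<lambda>u. (\<lambda>(x, y). a (?k y) (s x)) (p u)) \<in> plots ?E n U"
        using torsor_act_plot[OF T kp sp] by (simp add: plots_subset case_prod_beta)
    next
      fix z assume "z \<in> carrier (prod_diffeology ?X ?F)"
      then show "(\<lambda>(x, y). a (?k y) (s x)) z \<in> carrier ?E"
        using k(1) s1 torsor_act_in[OF T] torsor_proj_act[OF T] by auto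
    qed
    show "(\<lambda>(x, y). a (?k y) (s x)) (\<pi> e, \<iota> (gdiv a (s (\<pi> e)) e)) = e" if "e \<in> carrier ?E" for e
      using that g \<iota> by simp
    show "(\<pi> ((\<lambda>(x, y). a (?k y) (s x)) z), \<iota> (gdiv a (s (\<pi> ((\<lambda>(x, y). a (?k y) (s x)) z))) ((\<lambda>(x, y). a (?k y) (s x)) z))) = z"
      if z: "z \<in> carrier (prod_diffeology ?X ?F)" for z
    proof -
      obtain x y where z': "z = (x, y)" "x \<in> carrier X" "x \<in> A" "y \<in> \<iota> ` carrier G" using z by auto
      have "\<pi> (a (?k y) (s x)) = x"
        using torsor_proj_act[OF T k(1)[OF z'(4)] s1(1)[OF z'(3,2)]] s1(2)[OF z'(3,2)] by simp
      moreover have "gdiv a (s x) (a (?k y) (s x)) = ?k y"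
        by (rule torsor_gdivI[OF T k(1)[OF z'(4)] s1(1)[OF z'(3,2)] refl])
      ultimately show ?thesis using k(2)[OF z'(4)] z'(1) by simp
    qed
  qed (intro diffeological_space_subset diffeological_space_prod X E F)+
  then show ?thesis by (simp add: trivialisation_def)
qed

end

section \<open>Equivalence of torsors and principal bundles\<close>

lemma plot_euclidean_id: "eopen n V \<Longrightarrow> V \<subseteq> U \<Longrightarrow> (\<lambda>v. v) \<in> plots (euclidean_diffeology n U) n V"
  by (simp add: plots_euclidean smooth_between_id)

lemma smooth_map_of_plot:
  assumes "diffeological_space X" "p \<in> plots X n U"
  shows "smooth_map (euclidean_diffeology n U) X p"
  by (rule smooth_mapI) (use plot_in_carrier[OF assms] plot_compose[OF assms] in \<open>auto simp: plots_euclidean\<close>)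

context diff_group
begin

text \<open>The identity plot of \<open>U\<close> lifts locally, and such lifts are sections. The
  fibre must have the type of \<open>E\<close>, so the group is embedded by an orbit map, which is
  injective because the action is free.\<close>

lemma torsor_locally_trivial:
  fixes E :: "'e diffeology"
  assumes T: "torsor (euclidean_diffeology n U) E \<pi> a" and U: "eopen n U"
  shows "locally_trivial E (euclidean_diffeology n U) \<pi>"
proof (cases "U = {}")
  case True
  \<comment> \<open>Over the empty set there is no orbit to serve as fibre; the empty cover works,
    with \<open>E\<close> as a dummy fibre.\<close>
  have "trivialised_over E (euclidean_diffeology n U) \<pi> E {} id"
    using True torsor_base_space[OF T] torsor_total_space[OF T]
    by (auto simp: trivialised_over_def open_cover_def topspace_D_topology)
  then show ?thesis unfolding locally_trivial_def by blast
next
  case False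
  let ?X = "euclidean_diffeology n U"
  obtain e0 where e0: "e0 \<in> carrier E"
    using False torsor_surj[OF T] by (metis carrier_euclidean ex_in_conv)
  have inj: "inj_on (\<lambda>g. a g e0) (carrier G)"
    using torsor_act_cancel[OF T _ _ e0] by (auto simp: inj_on_def)
  define \<U> where "\<U> = {V. eopen n V \<and> V \<subseteq> U \<and> (\<exists>s. smooth_section ?X E \<pi> V s)}"
  have "\<exists>V\<in>\<U>. u \<in> V" if u: "u \<in> U" for u
  proof -
    obtain V q where V: "eopen n V" "u \<in> V" "V \<subseteq> U" "q \<in> plots E n V" "\<And>v. v \<in> V \<Longrightarrow> \<pi> (q v) = v"
      using torsor_lift[OF T plot_euclidean_id[OF U subset_refl] u] by blast
    have "smooth_section ?X E \<pi> V q"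
      unfolding smooth_section_def
    proof (intro conjI ballI allI impI)
      fix m W p assume "p \<in> plots ?X m W" "p \<in> W \<rightarrow> V"
      then show "(\<lambda>w. q (p w)) \<in> plots E m W"
        by (intro plot_compose[OF torsor_total_space[OF T] V(4)]) (auto simp: plots_euclidean smooth_between_def)
    qed (use V plot_in_carrier[OF torsor_total_space[OF T] V(4)] in auto)
    then show ?thesis using V unfolding \<U>_def by blast
  qed
  then have "open_cover (D_topology ?X) \<U> id"
    using D_open_euclidean[OF U] unfolding open_cover_def topspace_D_topology[OF torsor_base_space[OF T]]
    by (auto simp: \<U>_def)
  moreover have "\<exists>\<psi>. trivialisation (subset_diffeology E (\<pi> -` id V)) (subset_diffeology ?X (id V)) \<pi>
      (image_diffeology (\<lambda>g. a g e0) D) \<psi>" if V: "V \<in> \<U>" for V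
  proof -
    obtain s where "smooth_section ?X E \<pi> V s" using V unfolding \<U>_def by blast
    from trivialisation_section[OF T this inj] show ?thesis unfolding id_apply by blast
  qed
  moreover have "diffeological_space (image_diffeology (\<lambda>g. a g e0) D)"
    by (rule diffeological_space_image[OF D_space]) (use inj in simp)
  ultimately have "trivialised_over E ?X \<pi> (image_diffeology (\<lambda>g. a g e0) D) \<U> id"
    unfolding trivialised_over_def by blast
  then show ?thesis unfolding locally_trivial_def by blast
qed

lemma torsor_fibre_bundle:
  assumes T: "torsor X E \<pi> a"
  shows "diffeological_fibre_bundle E X \<pi>"
  unfolding diffeological_fibre_bundle_def
proof (intro conjI allI ballI)
  show "\<pi> ` carrier E = carrier X"
    using torsor_surj[OF T] torsor_proj_in[OF T] by (auto simp: image_iff)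
  fix n U p assume p: "p \<in> plots X n U"
  note U = plot_eopen[OF torsor_base_space[OF T] p]
  show "locally_trivial (pullback_diffeology (euclidean_diffeology n U) p E \<pi>) (euclidean_diffeology n U) fst"
    by (rule torsor_locally_trivial[OF torsor_pullback[OF T diffeological_space_euclidean[OF U]
          smooth_map_of_plot[OF torsor_base_space[OF T] p]] U])
qed (use torsor_base_space[OF T] torsor_total_space[OF T] torsor_proj[OF T] in auto)

text \<open>A local lift \<open>q\<close> of the plot gives the chart. The inverse chart keeps
  \<open>v\<close> and sends \<open>e\<close> to the group element leading from \<open>q v\<close>
  to \<open>e\<close>, so it is smooth by smoothness of division.\<close>

lemma torsor_imp_principal_bundle:
  assumes T: "torsor X (total P) (proj P) (act P)"
  shows "principal_bundle G D X P"
proof -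
  let ?E = "total P" and ?\<pi> = "proj P" and ?a = "act P"
  note E = torsor_total_space[OF T]
  have "\<exists>V q. eopen n V \<and> u \<in> V \<and> V \<subseteq> U \<and>
          q \<in> plots ?E n V \<and> (\<forall>v\<in>V. ?\<pi> (q v) = p v) \<and>
          diffeomorphism (prod_diffeology (euclidean_diffeology n V) D)
            (pullback_diffeology (euclidean_diffeology n V) p ?E ?\<pi>) (\<lambda>(v, g). (v, ?a g (q v))) \<and>
          (\<forall>v\<in>V. \<forall>g\<in>carrier G. \<forall>h\<in>carrier G. ?a (h \<otimes> g) (q v) = ?a h (?a g (q v)))"
    if p: "p \<in> plots X n U" and u: "u \<in> U" for n U p u
  proof -
    obtain V q where V: "eopen n V" "u \<in> V" "V \<subseteq> U" "q \<in> plots ?E n V" "\<And>v. v \<in> V \<Longrightarrow> ?\<pi> (q v) = p v"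
      using torsor_lift[OF T p u] by blast
    let ?V = "euclidean_diffeology n V" and ?f = "\<lambda>(v, g). (v, ?a g (q v))"
    let ?P = "pullback_diffeology ?V p ?E ?\<pi>" and ?k = "\<lambda>(v, e). (v, gdiv ?a (q v) e)"
    note Vs = diffeological_space_euclidean[OF V(1)]
    note q = plot_in_carrier[OF E V(4)]
    note qc = plot_compose[OF E V(4)]
    have "diffeomorphism (prod_diffeology ?V D) ?P ?f"
    proof (rule diffeomorphismI[where g = ?k])
      show "diffeological_space (prod_diffeology ?V D)" by (rule diffeological_space_prod[OF Vs D_space])
      show "diffeological_space ?P" by (rule diffeological_space_pullback[OF Vs E])
      show "smooth_map (prod_diffeology ?V D) ?P ?f"
      proof (rule smooth_mapI)
        fix m W r assume "r \<in> plots (prod_diffeology ?V D) m W"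
        then have r: "eopen m W" "smooth_between m W n V (\<lambda>w. fst (r w))" "(\<lambda>w. snd (r w)) \<in> plots D m W"
          by (auto simp: plots_prod plots_euclidean)
        have "p (fst (r w)) = ?\<pi> (?a (snd (r w)) (q (fst (r w))))" if "w \<in> W" for w
        proof -
          have "fst (r w) \<in> V" using r(2) that by (auto simp: smooth_between_def)
          then show ?thesis
            using torsor_proj_act[OF T] plot_in_carrier[OF D_space r(3) that] q V(5) by simp
        qed
        then show "(\<lambda>w. ?f (r w)) \<in> plots ?P m W"
          using r torsor_act_plot[OF T r(3) qc[OF r(1,2)]]
          by (simp add: plots_pullback plots_euclidean case_prod_beta)
      qed (use q V(5) torsor_act_in[OF T] torsor_proj_act[OF T] in \<open>auto simp: carrier_pullback\<close>)
      show "smooth_map ?P (prod_diffeology ?V D) ?k"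
      proof (rule smooth_mapI)
        fix m W r assume "r \<in> plots ?P m W"
        then have r: "eopen m W" "smooth_between m W n V (\<lambda>w. fst (r w))" "(\<lambda>w. snd (r w)) \<in> plots ?E m W"
          "\<And>w. w \<in> W \<Longrightarrow> p (fst (r w)) = ?\<pi> (snd (r w))"
          by (auto simp: plots_pullback plots_euclidean)
        have "?\<pi> (q (fst (r w))) = ?\<pi> (snd (r w))" if "w \<in> W" for w
          using r(2,4) that V(5) by (auto simp: smooth_between_def Pi_iff)
        then show "(\<lambda>w. ?k (r w)) \<in> plots (prod_diffeology ?V D) m W"
          using r torsor_gdiv_plot[OF T qc[OF r(1,2)] r(3)]
          by (simp add: plots_prod plots_euclidean case_prod_beta)
      qed (use q V(5) torsor_gdiv[OF T] in \<open>auto simp: carrier_pullback\<close>)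
      show "?k (?f z) = z" if "z \<in> carrier (prod_diffeology ?V D)" for z
        using that q torsor_gdivI[OF T] by auto
      show "?f (?k z) = z" if "z \<in> carrier ?P" for z
        using that q torsor_gdiv[OF T] V(5) by (auto simp: carrier_pullback case_prod_beta)
    qed
    then show ?thesis using V torsor_act_mult[OF T] q
      by (intro exI[of _ V] exI[of _ q]) simp
  qed
  then show ?thesis
    unfolding principal_bundle_def using torsor_fibre_bundle[OF T] torsor_action[OF T] by blast
qed

text \<open>The charts speak only about translates of the points \<open>q v\<close>. Every point of
  a fibre is such a translate, and the action law carries invariance of the projection, freeness and
  transitivity from \<open>q v\<close> to the whole fibre. Division of two plots is a quotient of
  their chart coordinates.\<close>

lemma principal_bundle_imp_torsor:
  assumes P: "principal_bundle G D X P"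
  shows "torsor X (total P) (proj P) (act P)"
proof -
  let ?E = "total P" and ?\<pi> = "proj P" and ?a = "act P"
  have fb: "diffeological_fibre_bundle ?E X ?\<pi>" and act: "smooth_action G D ?E ?a"
    using P unfolding principal_bundle_def by blast+
  have E: "diffeological_space ?E" and X: "diffeological_space X" and \<pi>: "smooth_map ?E X ?\<pi>"
    using fb unfolding diffeological_fibre_bundle_def by blast+
  have ain: "?a g e \<in> carrier ?E" if "g \<in> carrier G" "e \<in> carrier ?E" for g e
    using act that smooth_map_carrier[of "prod_diffeology D ?E" ?E "\<lambda>(g, e). ?a g e" "(g, e)"]
    by (simp add: smooth_action_def)
  have amult: "?a (g \<otimes> h) e = ?a g (?a h e)" if "g \<in> carrier G" "h \<in> carrier G" "e \<in> carrier ?E" for g h e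
    using act that by (simp add: smooth_action_def)
  have aone: "?a \<one> e = e" if "e \<in> carrier ?E" for e using act that by (simp add: smooth_action_def)
  \<comment> \<open>Elimination form of the local condition. The value \<open>\<gamma> v e\<close>
    is the chart coordinate of \<open>e\<close>, that is, the group element leading from
    \<open>q v\<close> to \<open>e\<close>.\<close>
  have loc: thesis
    if p: "p \<in> plots X n U" and u: "u \<in> U"
      and K: "\<And>V q \<gamma>. eopen n V \<Longrightarrow> u \<in> V \<Longrightarrow> V \<subseteq> U \<Longrightarrow> q \<in> plots ?E n V \<Longrightarrow> (\<And>v. v \<in> V \<Longrightarrow> ?\<pi> (q v) = p v) \<Longrightarrow>
      (\<And>v g. v \<in> V \<Longrightarrow> g \<in> carrier G \<Longrightarrow> ?\<pi> (?a g (q v)) = p v) \<Longrightarrow>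
      (\<And>v g h. v \<in> V \<Longrightarrow> g \<in> carrier G \<Longrightarrow> h \<in> carrier G \<Longrightarrow> ?a g (q v) = ?a h (q v) \<Longrightarrow> g = h) \<Longrightarrow>
      (\<And>v e. v \<in> V \<Longrightarrow> e \<in> carrier ?E \<Longrightarrow> ?\<pi> e = p v \<Longrightarrow> \<gamma> v e \<in> carrier G \<and> ?a (\<gamma> v e) (q v) = e) \<Longrightarrow>
      (\<And>r. r \<in> plots ?E n V \<Longrightarrow> (\<And>v. v \<in> V \<Longrightarrow> ?\<pi> (r v) = p v) \<Longrightarrow> (\<lambda>v. \<gamma> v (r v)) \<in> plots D n V) \<Longrightarrow> thesis"
    for n U p u thesis
  proof -
    let ?f = "\<lambda>q (v, g). (v, ?a g (q v))"
    have "\<exists>V q. eopen n V \<and> u \<in> V \<and> V \<subseteq> U \<and> q \<in> plots ?E n V \<and> (\<forall>v\<in>V. ?\<pi> (q v) = p v) \<and>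
        diffeomorphism (prod_diffeology (euclidean_diffeology n V) D)
            (pullback_diffeology (euclidean_diffeology n V) p ?E ?\<pi>) (?f q) \<and>
          (\<forall>v\<in>V. \<forall>g\<in>carrier G. \<forall>h\<in>carrier G. ?a (h \<otimes> g) (q v) = ?a h (?a g (q v)))"
      using P[unfolded principal_bundle_def, THEN conjunct2, THEN conjunct2] p u by simp
    then obtain V q where V: "eopen n V" "u \<in> V" "V \<subseteq> U" "q \<in> plots ?E n V" "\<forall>v\<in>V. ?\<pi> (q v) = p v"
      and df: "diffeomorphism (prod_diffeology (euclidean_diffeology n V) D)
            (pullback_diffeology (euclidean_diffeology n V) p ?E ?\<pi>) (?f q)"
      by (elim exE conjE) (rule that)
    let ?VD = "prod_diffeology (euclidean_diffeology n V) D"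
      and ?P = "pullback_diffeology (euclidean_diffeology n V) p ?E ?\<pi>"
    let ?k = "inv_into (carrier ?VD) (?f q)"
    define \<gamma> where "\<gamma> v e = snd (?k (v, e))" for v e
    have bij: "bij_betw (?f q) (carrier ?VD) (carrier ?P)" using df by (simp add: diffeomorphism_def)
    have k: "smooth_map ?P ?VD ?k" by (rule diffeomorphism_inv(1)[OF df])
    have kin: "?k z \<in> carrier ?VD" "?f q (?k z) = z" if "z \<in> carrier ?P" for z
      using smooth_map_carrier[OF k that] diffeomorphism_inv(3)[OF df that] by auto
    have 1: "?\<pi> (?a g (q v)) = p v" if "v \<in> V" "g \<in> carrier G" for v g
      using bij_betwE[OF bij] that by (fastforce simp: carrier_pullback)
    have 2: "g = h" if "v \<in> V" "g \<in> carrier G" "h \<in> carrier G" "?a g (q v) = ?a h (q v)" for v g h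
      using bij_betw_imp_inj_on[OF bij] that unfolding inj_on_def by fastforce
    have 3: "\<gamma> v e \<in> carrier G \<and> ?a (\<gamma> v e) (q v) = e" if "v \<in> V" "e \<in> carrier ?E" "?\<pi> e = p v" for v e
    proof -
      have "(v, e) \<in> carrier ?P" using that by (simp add: carrier_pullback)
      from kin[OF this] show ?thesis by (auto simp: \<gamma>_def case_prod_beta)
    qed
    have 4: "(\<lambda>v. \<gamma> v (r v)) \<in> plots D n V" if "r \<in> plots ?E n V" "\<forall>v\<in>V. ?\<pi> (r v) = p v" for r
    proof -
      have "(\<lambda>v. (v, r v)) \<in> plots ?P n V"
        using that plot_euclidean_id[OF V(1) subset_refl] by (simp add: plots_pullback)
      from smooth_map_plot[OF k this] show ?thesis by (simp add: plots_prod \<gamma>_def)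
    qed
    show ?thesis
      by (rule K[of V q \<gamma>]) (use V 1 2 3 4 in auto)
  qed
  \<comment> \<open>Constant plots in dimension zero turn the local condition into a statement about
    single fibres.\<close>
  have pt: "\<exists>e'\<in>carrier ?E. ?\<pi> e' = x \<and> (\<forall>g\<in>carrier G. ?\<pi> (?a g e') = x) \<and>
      (\<forall>g\<in>carrier G. \<forall>h\<in>carrier G. ?a g e' = ?a h e' \<longrightarrow> g = h) \<and>
      (\<forall>e\<in>carrier ?E. ?\<pi> e = x \<longrightarrow> (\<exists>g\<in>carrier G. ?a g e' = e))" if x: "x \<in> carrier X" for x
  proof -
    show ?thesis
    proof (rule loc[OF plot_const[OF X eopen_singleton_0 x] singletonI], goal_cases)
      case (1 V q \<gamma>)
      have "\<exists>g\<in>carrier G. ?a g (q (\<lambda>_. 0)) = e" if "e \<in> carrier ?E" "?\<pi> e = x" for e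
        using 1(8)[OF 1(2) that] by blast
      then show ?case using plot_in_carrier[OF E 1(4,2)] 1(5)[OF 1(2)] 1(6)[OF 1(2)] 1(7)[OF 1(2)]
        by (intro bexI[of _ "q (\<lambda>_. 0)"]) simp_all
    qed
  qed
  have free: "g = h" if gh: "g \<in> carrier G" "h \<in> carrier G" and e: "e \<in> carrier ?E" and eq: "?a g e = ?a h e" for g h e
  proof -
    obtain e' k where e': "e' \<in> carrier ?E" "k \<in> carrier G" "?a k e' = e"
      "\<forall>g\<in>carrier G. \<forall>h\<in>carrier G. ?a g e' = ?a h e' \<longrightarrow> g = h"
      using pt[OF smooth_map_carrier[OF \<pi> e]] e by metis
    then have "?a (g \<otimes> k) e' = ?a (h \<otimes> k) e'" using amult gh eq by simp
    then have "g \<otimes> k = h \<otimes> k" using e' gh by simp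
    then show ?thesis using gh e'(2) by simp
  qed
  show ?thesis
  proof (rule torsorI[OF X E \<pi> act])
    show "?\<pi> (?a g e) = ?\<pi> e" if g: "g \<in> carrier G" and e: "e \<in> carrier ?E" for g e
    proof -
      obtain e' k where e': "e' \<in> carrier ?E" "k \<in> carrier G" "?a k e' = e"
        "\<forall>g\<in>carrier G. ?\<pi> (?a g e') = ?\<pi> e"
        using pt[OF smooth_map_carrier[OF \<pi> e]] e by metis
      then show ?thesis using amult[OF g e'(2,1)] g by (metis m_closed)
    qed
    show "\<exists>V q. eopen n V \<and> u \<in> V \<and> V \<subseteq> U \<and> q \<in> plots ?E n V \<and> (\<forall>v\<in>V. ?\<pi> (q v) = p v)"
      if "p \<in> plots X n U" "u \<in> U" for n U p u
    proof (rule loc[OF that], goal_cases)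
      case (1 V q \<gamma>)
      show ?case by (intro exI[of _ V] exI[of _ q]) (simp add: 1(1-5))
    qed
    show "g = h" if "g \<in> carrier G" "h \<in> carrier G" "e \<in> carrier ?E" "?a g e = ?a h e" for g h e
      by (rule free[OF that])
    show "\<exists>g\<in>carrier G. ?a g e = e'" if e: "e \<in> carrier ?E" "e' \<in> carrier ?E" "?\<pi> e = ?\<pi> e'" for e e'
    proof -
      obtain d g h where d: "d \<in> carrier ?E" "g \<in> carrier G" "?a g d = e" "h \<in> carrier G" "?a h d = e'"
        using pt[OF smooth_map_carrier[OF \<pi> e(1)]] e by metis
      have "?a (h \<otimes> inv g) e = ?a (h \<otimes> inv g \<otimes> g) d" using d by (simp add: amult)
      also have "\<dots> = e'" using d by (simp add: m_assoc)
      finally show ?thesis using d by blast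
    qed
    show "(\<lambda>u. gdiv ?a (p u) (q u)) \<in> plots D n U"
      if p: "p \<in> plots ?E n U" and q: "q \<in> plots ?E n U" and eq: "\<And>u. u \<in> U \<Longrightarrow> ?\<pi> (p u) = ?\<pi> (q u)" for n U p q
    proof (rule plot_local[OF D_space plot_eopen[OF E p]])
      fix u assume u: "u \<in> U"
      obtain V r \<gamma> where V: "eopen n V" "u \<in> V" "V \<subseteq> U" "r \<in> plots ?E n V"
        and \<gamma>: "\<And>v e. v \<in> V \<Longrightarrow> e \<in> carrier ?E \<Longrightarrow> ?\<pi> e = ?\<pi> (p v) \<Longrightarrow> \<gamma> v e \<in> carrier G \<and> ?a (\<gamma> v e) (r v) = e"
          "\<And>s. s \<in> plots ?E n V \<Longrightarrow> (\<And>v. v \<in> V \<Longrightarrow> ?\<pi> (s v) = ?\<pi> (p v)) \<Longrightarrow> (\<lambda>v. \<gamma> v (s v)) \<in> plots D n V"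
      proof (rule loc[OF smooth_map_plot[OF \<pi> p] u], goal_cases)
        case (1 V r \<gamma>)
        show ?case by (rule 1(1)[OF 1(2-5) 1(9,10)])
      qed
      note pV = plot_restrict[OF E p V(1,3)] and qV = plot_restrict[OF E q V(1,3)]
      have "(\<lambda>v. \<gamma> v (p v)) \<in> plots D n V" by (rule \<gamma>(2)[OF pV]) simp
      moreover have "(\<lambda>v. \<gamma> v (q v)) \<in> plots D n V" by (rule \<gamma>(2)[OF qV]) (use eq V(3) in auto)
      ultimately have "(\<lambda>v. \<gamma> v (q v) \<otimes> inv (\<gamma> v (p v))) \<in> plots D n V"
        by (intro plot_mult plot_inv)
      \<comment> \<open>Both points are measured against the same \<open>r v\<close>, so the element
        leading from \<open>p v\<close> to \<open>q v\<close> is the second coordinate times the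
        inverse of the first.\<close>
      moreover have "gdiv ?a (p v) (q v) = \<gamma> v (q v) \<otimes> inv (\<gamma> v (p v))" if v: "v \<in> V" for v
      proof -
        have g1: "\<gamma> v (p v) \<in> carrier G" "?a (\<gamma> v (p v)) (r v) = p v"
          using \<gamma>(1)[OF v plot_in_carrier[OF E pV v]] by auto
        have g2: "\<gamma> v (q v) \<in> carrier G" "?a (\<gamma> v (q v)) (r v) = q v"
          using \<gamma>(1)[OF v plot_in_carrier[OF E qV v]] eq[of v] V(3) v by auto
        have rv: "r v \<in> carrier ?E" by (rule plot_in_carrier[OF E V(4) v])
        have "?a (\<gamma> v (q v) \<otimes> inv (\<gamma> v (p v))) (p v) = ?a (\<gamma> v (q v) \<otimes> inv (\<gamma> v (p v)) \<otimes> \<gamma> v (p v)) (r v)"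
          using g1 g2(1) rv by (simp add: amult)
        also have "\<dots> = q v" using g1 g2 by (simp add: m_assoc)
        finally show ?thesis
          unfolding gdiv_def using g1 g2 free[OF _ _ plot_in_carrier[OF E pV v]]
          by (intro the_equality) auto
      qed
      ultimately show "\<exists>V q'. eopen n V \<and> u \<in> V \<and> V \<subseteq> U \<and> q' \<in> plots D n V \<and> (\<forall>v\<in>V. gdiv ?a (p v) (q v) = q' v)"
        using V by (intro exI[of _ V] exI[of _ "\<lambda>v. \<gamma> v (q v) \<otimes> inv (\<gamma> v (p v))"]) simp
    qed
  qed
qed

lemma numerable_sections_imp_D_numerable:
  fixes E :: "'e diffeology"
  assumes T: "torsor X E \<pi> a" and N: "numerable_sections X E \<pi>" and j: "inj_on (j :: 'g \<Rightarrow> 'e) (carrier G)"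
  shows "D_numerable E X \<pi>"
proof -
  obtain U \<zeta> s where *: "open_cover (D_topology X) UNIV U" "locally_finite_family (D_topology X) UNIV U"
    "pointwise_finite_partition_of_unity X UNIV \<zeta>"
    "\<And>i::nat. smooth_support X (\<zeta> i) \<subseteq> U i" "\<And>i. smooth_section X E \<pi> (U i) (s i)"
    using N unfolding numerable_sections_def by blast
  have "diffeological_space (image_diffeology j D)"
    by (rule diffeological_space_image[OF D_space]) (use j in simp)
  then have "trivialised_over E X \<pi> (image_diffeology j D) UNIV U"
    unfolding trivialised_over_def using *(1) trivialisation_section[OF T *(5) j] by blast
  then show ?thesis
    unfolding D_numerable_def using torsor_fibre_bundle[OF T] *(2-4) by blast
qed

text \<open>An arbitrary trivialisation, equivariant or not, has constant sections: fix the fibre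
  component of one point. Over a set that meets the carrier of \<open>X\<close> such a point
  exists.\<close>

lemma D_numerable_imp_numerable_sections:
  fixes E :: "'e diffeology"
  assumes T: "torsor X E \<pi> a" and N: "D_numerable E X \<pi>"
  shows "numerable_sections X E \<pi>"
proof -
  note E = torsor_total_space[OF T]
  obtain F :: "'e diffeology" and U \<zeta> where U: "trivialised_over E X \<pi> F UNIV U" "locally_finite_family (D_topology X) UNIV U"
    "pointwise_finite_partition_of_unity X UNIV \<zeta>" "\<And>i::nat. smooth_support X (\<zeta> i) \<subseteq> U i"
    using N unfolding D_numerable_def by blast
  have F: "diffeological_space F" and oc: "open_cover (D_topology X) UNIV U" and
    tr: "\<And>i. \<exists>\<psi>. trivialisation (subset_diffeology E (\<pi> -` U i)) (subset_diffeology X (U i)) \<pi> F \<psi>"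
    using U(1) unfolding trivialised_over_def by blast+
  have "\<exists>s. smooth_section X E \<pi> (U i) s" for i
  proof (cases "U i \<inter> carrier X = {}")
    case True
    \<comment> \<open>Over a set without points of \<open>X\<close> only plots with empty domain
      occur, and by locality every function is a plot there.\<close>
    have "(\<lambda>u. undefined) \<in> plots E n W" if "p \<in> plots X n W" "p \<in> W \<rightarrow> U i" for n W p
    proof -
      have "W = {}" using True that plot_in_carrier[OF torsor_base_space[OF T] that(1)] by blast
      then show ?thesis
        by (intro plot_local[OF E plot_eopen[OF torsor_base_space[OF T] that(1)]]) simp
    qed
    then show ?thesis using True
      by (intro exI[of _ "\<lambda>_. undefined"]) (simp add: smooth_section_def)
  next
    case False
    then obtain x where x: "x \<in> U i" "x \<in> carrier X" by blast
    let ?E = "subset_diffeology E (\<pi> -` U i)" and ?X = "subset_diffeology X (U i)"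
    obtain \<psi> where d: "diffeomorphism ?E (prod_diffeology ?X F) \<psi>" and p1: "\<And>e. e \<in> carrier ?E \<Longrightarrow> fst (\<psi> e) = \<pi> e"
      using tr[of i] unfolding trivialisation_def by blast
    obtain e where e: "e \<in> carrier E" "\<pi> e = x" using torsor_surj[OF T x(2)] .
    define y where "y = snd (\<psi> e)"
    have sm: "smooth_map ?E (prod_diffeology ?X F) \<psi>" using d by (simp add: diffeomorphism_def)
    have y: "y \<in> carrier F"
      using smooth_map_carrier[OF sm, of e] e x by (auto simp: y_def mem_Times_iff)
    let ?k = "inv_into (carrier ?E) \<psi>"
    note k = diffeomorphism_inv[OF d]
    have "smooth_section X E \<pi> (U i) (\<lambda>x. ?k (x, y))"
      unfolding smooth_section_def
    proof (intro conjI ballI allI impI)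
      fix z assume "z \<in> U i \<inter> carrier X"
      then have z: "(z, y) \<in> carrier (prod_diffeology ?X F)" using y by simp
      note kz = smooth_map_carrier[OF k(1) z]
      then show "?k (z, y) \<in> carrier E" by simp
      show "\<pi> (?k (z, y)) = z" using p1[OF kz] k(3)[OF z] by simp
    next
      fix n W p assume p: "p \<in> plots X n W" "p \<in> W \<rightarrow> U i"
      have "(\<lambda>u. (p u, y)) \<in> plots (prod_diffeology ?X F) n W"
        using p plot_const[OF F plot_eopen[OF torsor_base_space[OF T] p(1)] y] by (simp add: plots_prod plots_subset)
      from smooth_map_plot[OF k(1) this] show "(\<lambda>u. ?k (p u, y)) \<in> plots E n W" by (simp add: plots_subset)
    qed
    then show ?thesis by blast
  qed
  then obtain s where "\<And>i. smooth_section X E \<pi> (U i) (s i)" by metis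
  then show ?thesis unfolding numerable_sections_def using oc U(2-4) by blast
qed

end

section \<open>The universal bundle\<close>

definition in_simplex :: "(nat \<Rightarrow> real) \<Rightarrow> bool" where
  "in_simplex t \<longleftrightarrow> (\<forall>i. 0 \<le> t i \<and> t i \<le> 1) \<and> finite {i. t i \<noteq> 0} \<and> (\<Sum>i | t i \<noteq> 0. t i) = 1"

lemma in_simplex_nonzero: "in_simplex t \<Longrightarrow> \<exists>i. t i \<noteq> 0"
  unfolding in_simplex_def by (metis (mono_tags, lifting) Collect_empty_eq sum.empty zero_neq_one)

text \<open>The value \<open>gco c i\<close> is meaningful only where \<open>tco c i \<noteq> 0\<close>.\<close>

definition tco :: "((nat \<Rightarrow> real) \<times> (nat \<Rightarrow> 'g)) set \<Rightarrow> nat \<Rightarrow> real" where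
  "tco c = fst (SOME z. z \<in> c)"

definition gco :: "((nat \<Rightarrow> real) \<times> (nat \<Rightarrow> 'g)) set \<Rightarrow> nat \<Rightarrow> 'g" where
  "gco c = snd (SOME z. z \<in> c)"

text \<open>The choice of a representative is harmless: the action changes group coordinates only,
  so weights are constant on orbits.\<close>

definition tcoB :: "((nat \<Rightarrow> real) \<times> (nat \<Rightarrow> 'g)) set set \<Rightarrow> nat \<Rightarrow> real" where
  "tcoB b = tco (SOME c. c \<in> b)"

section \<open>Points and plots of EG in coordinates\<close>

context diff_group
begin

abbreviation "EG \<equiv> milnor_EG D"
abbreviation "BG \<equiv> milnor_BG G D"

text \<open>Group coordinates are unconstrained where the weight vanishes, so that formulas with
  meaningless values in empty slots can be used as they stand.\<close>

definition valid_coords :: "(nat \<Rightarrow> real) \<Rightarrow> (nat \<Rightarrow> 'g) \<Rightarrow> bool" where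
  "valid_coords t g \<longleftrightarrow> in_simplex t \<and> (\<forall>i. t i \<noteq> 0 \<longrightarrow> g i \<in> carrier G)"

text \<open>For a point of the simplex this is the class of \<open>(t, g)\<close> under
  \<open>milnor_rel\<close>. Since \<open>g\<close> enters only at slots of non-zero weight, it may
  leave the group elsewhere, while the representatives never do.\<close>

definition mkE :: "(nat \<Rightarrow> real) \<Rightarrow> (nat \<Rightarrow> 'g) \<Rightarrow> ((nat \<Rightarrow> real) \<times> (nat \<Rightarrow> 'g)) set" where
  "mkE t g = {(t', g'). t' = t \<and> (\<forall>i. g' i \<in> carrier G) \<and> (\<forall>i. t i \<noteq> 0 \<longrightarrow> g' i = g i)}"

definition projB :: "((nat \<Rightarrow> real) \<times> (nat \<Rightarrow> 'g)) set \<Rightarrow> ((nat \<Rightarrow> real) \<times> (nat \<Rightarrow> 'g)) set set" where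
  "projB c = milnor_orbit_rel G D `` {c}"

lemma carrier_milnor_S: "carrier (milnor_S D) = {(t, g). in_simplex t \<and> (\<forall>i. g i \<in> carrier G)}"
  by (auto simp: milnor_S_def in_simplex_def Pi_iff)

lemma milnor_rel_class:
  assumes "in_simplex t" "\<And>i. g i \<in> carrier G"
  shows "milnor_rel D `` {(t, g)} = mkE t g"
  using assms by (auto simp: milnor_rel_def mkE_def carrier_milnor_S)

lemma mkE_cong: "(\<And>i. t i \<noteq> 0 \<Longrightarrow> g i = g' i) \<Longrightarrow> mkE t g = mkE t g'"
  by (auto simp: mkE_def)

lemma carrier_EG: "carrier EG = {mkE t g |t g. in_simplex t \<and> (\<forall>i. g i \<in> carrier G)}"
proof -
  have "carrier EG = (\<lambda>z. milnor_rel D `` {z}) ` carrier (milnor_S D)"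
    by (auto simp: milnor_EG_def carrier_quotient quotient_def)
  also have "\<dots> = (\<lambda>(t, g). mkE t g) ` carrier (milnor_S D)"
  proof (rule image_cong)
    fix z assume "z \<in> carrier (milnor_S D)"
    then show "milnor_rel D `` {z} = (\<lambda>(t, g). mkE t g) z"
      by (cases z) (simp add: carrier_milnor_S milnor_rel_class)
  qed simp
  also have "\<dots> = {mkE t g |t g. in_simplex t \<and> (\<forall>i. g i \<in> carrier G)}"
    by (auto simp: carrier_milnor_S image_iff)
  finally show ?thesis .
qed

lemma mkE_in:
  assumes "valid_coords t g"
  shows "mkE t g \<in> carrier EG"
proof -
  have "mkE t g = mkE t (\<lambda>i. if t i \<noteq> 0 then g i else \<one>)" by (rule mkE_cong) simp
  then show ?thesis using assms unfolding carrier_EG valid_coords_def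
    by (intro CollectI exI[of _ t] exI[of _ "\<lambda>i. if t i \<noteq> 0 then g i else \<one>"]) simp
qed

lemma mkE_some: "valid_coords t g \<Longrightarrow> (SOME z. z \<in> mkE t g) \<in> mkE t g"
  by (rule someI[of _ "(t, \<lambda>i. if t i \<noteq> 0 then g i else \<one>)"]) (auto simp: mkE_def valid_coords_def)

lemma tco_mkE: "valid_coords t g \<Longrightarrow> tco (mkE t g) = t"
  and gco_mkE: "valid_coords t g \<Longrightarrow> t i \<noteq> 0 \<Longrightarrow> gco (mkE t g) i = g i"
  and gco_mkE_in: "valid_coords t g \<Longrightarrow> gco (mkE t g) i \<in> carrier G"
  using mkE_some[of t g] by (auto simp: mkE_def tco_def gco_def)

lemma EG_cases:
  assumes "c \<in> carrier EG"
  obtains t g where "valid_coords t g" "c = mkE t g"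
proof -
  obtain t g where "c = mkE t g" "in_simplex t" "\<forall>i. g i \<in> carrier G"
    using assms unfolding carrier_EG by (elim CollectE exE conjE)
  then show ?thesis by (intro that[of t g]) (simp_all add: valid_coords_def)
qed

lemma in_simplex_tco: "c \<in> carrier EG \<Longrightarrow> in_simplex (tco c)"
  by (erule EG_cases) (auto simp: tco_mkE valid_coords_def)

lemma gco_in: "c \<in> carrier EG \<Longrightarrow> gco c i \<in> carrier G"
  by (erule EG_cases) (auto simp: gco_mkE_in)

lemma valid_coords_tco: "c \<in> carrier EG \<Longrightarrow> valid_coords (tco c) (gco c)"
  by (simp add: valid_coords_def in_simplex_tco gco_in)

lemma mkE_tco: "c \<in> carrier EG \<Longrightarrow> mkE (tco c) (gco c) = c"
  by (erule EG_cases) (auto simp: tco_mkE gco_mkE intro!: mkE_cong)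

lemma EG_eqI:
  assumes "c \<in> carrier EG" "c' \<in> carrier EG" "tco c = tco c'" "\<And>i. tco c i \<noteq> 0 \<Longrightarrow> gco c i = gco c' i"
  shows "c = c'"
  using mkE_tco[OF assms(1)] mkE_tco[OF assms(2)] mkE_cong[of "tco c" "gco c" "gco c'"] assms(3,4) by simp

lemma milnor_act_mkE:
  assumes "valid_coords t g" "h \<in> carrier G"
  shows "milnor_act G h (mkE t g) = mkE t (\<lambda>i. g i \<otimes> inv h)"
proof
  show "milnor_act G h (mkE t g) \<subseteq> mkE t (\<lambda>i. g i \<otimes> inv h)"
    using assms by (auto simp: milnor_act_def mkE_def)
  show "mkE t (\<lambda>i. g i \<otimes> inv h) \<subseteq> milnor_act G h (mkE t g)"
  proof
    fix z assume "z \<in> mkE t (\<lambda>i. g i \<otimes> inv h)"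
    then obtain g' where z: "z = (t, g')" "\<And>i. g' i \<in> carrier G" "\<And>i. t i \<noteq> 0 \<Longrightarrow> g' i = g i \<otimes> inv h"
      by (auto simp: mkE_def)
    have "(t, \<lambda>i. g' i \<otimes> h) \<in> mkE t g"
      using z(2,3) assms by (auto simp: mkE_def valid_coords_def m_assoc)
    moreover have "z = (\<lambda>(t, g). (t, \<lambda>i. g i \<otimes> inv h)) (t, \<lambda>i. g' i \<otimes> h)"
      using z(1,2) assms(2) by (simp add: m_assoc)
    ultimately show "z \<in> milnor_act G h (mkE t g)" unfolding milnor_act_def by (rule rev_image_eqI)
  qed
qed

lemma valid_coords_act: "valid_coords t g \<Longrightarrow> h \<in> carrier G \<Longrightarrow> valid_coords t (\<lambda>i. g i \<otimes> inv h)"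
  by (simp add: valid_coords_def)

lemma milnor_act_in: "c \<in> carrier EG \<Longrightarrow> h \<in> carrier G \<Longrightarrow> milnor_act G h c \<in> carrier EG"
  by (erule EG_cases) (simp add: milnor_act_mkE mkE_in valid_coords_act)

lemma tco_act: "c \<in> carrier EG \<Longrightarrow> h \<in> carrier G \<Longrightarrow> tco (milnor_act G h c) = tco c"
  by (erule EG_cases) (simp add: milnor_act_mkE valid_coords_act tco_mkE)

lemma gco_act: "c \<in> carrier EG \<Longrightarrow> h \<in> carrier G \<Longrightarrow> tco c i \<noteq> 0 \<Longrightarrow> gco (milnor_act G h c) i = gco c i \<otimes> inv h"
  by (erule EG_cases) (simp add: milnor_act_mkE valid_coords_act tco_mkE gco_mkE)

lemma diffeological_space_milnor_S: "diffeological_space (milnor_S D)"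
  unfolding milnor_S_def
  by (intro diffeological_space_subset diffeological_space_prod diffeological_space_seq
      diffeological_space_unit_interval D_space)

lemma EG_space: "diffeological_space EG"
  unfolding milnor_EG_def by (intro diffeological_space_quotient diffeological_space_milnor_S)

lemma BG_space: "diffeological_space BG"
  unfolding milnor_BG_def by (intro diffeological_space_quotient EG_space)

lemma plots_milnor_S: "p \<in> plots (milnor_S D) n U \<longleftrightarrow>
    (\<forall>i. smooth_function n U (\<lambda>u. fst (p u) i) \<and> (\<lambda>u. snd (p u) i) \<in> plots D n U) \<and>
    (\<forall>u\<in>U. in_simplex (fst (p u)))"
proof -
  have "eopen n U" if "(\<lambda>u. snd (p u) 0) \<in> plots D n U" using plot_eopen[OF D_space that] .
  then show ?thesis
    by (auto simp: milnor_S_def plots_subset plots_prod plots_seq plots_unit_interval in_simplex_def Pi_iff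
        case_prod_beta)
qed

text \<open>Lifting to \<open>milnor_S D\<close> requires, on one neighbourhood for all slots, plots
  \<open>\<gamma> i\<close> that extend the group coordinates across the places where their weights
  vanish. There they may take any values in the group, because the quotient forgets them.\<close>

lemma EG_plotI:
  assumes U: "eopen n U" and v: "\<And>u. u \<in> U \<Longrightarrow> valid_coords (T u) (\<Gamma> u)"
    and T: "\<And>i. smooth_function n U (\<lambda>u. T u i)"
    and \<Gamma>: "\<And>u. u \<in> U \<Longrightarrow> \<exists>V \<gamma>. eopen n V \<and> u \<in> V \<and> V \<subseteq> U \<and>
      (\<forall>i. \<gamma> i \<in> plots D n V \<and> (\<forall>v\<in>V. T v i \<noteq> 0 \<longrightarrow> \<gamma> i v = \<Gamma> v i))"
  shows "(\<lambda>u. mkE (T u) (\<Gamma> u)) \<in> plots EG n U"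
proof -
  have "\<exists>V q. eopen n V \<and> u \<in> V \<and> V \<subseteq> U \<and> q \<in> plots (milnor_S D) n V \<and>
      (\<forall>v\<in>V. mkE (T v) (\<Gamma> v) = milnor_rel D `` {q v})" if u: "u \<in> U" for u
  proof -
    obtain V \<gamma> where V: "eopen n V" "u \<in> V" "V \<subseteq> U" "\<And>i. \<gamma> i \<in> plots D n V"
      "\<And>i v. v \<in> V \<Longrightarrow> T v i \<noteq> 0 \<Longrightarrow> \<gamma> i v = \<Gamma> v i"
      using \<Gamma>[OF u] by blast
    have s: "in_simplex (T v)" if "v \<in> V" for v using v V(3) that by (auto simp: valid_coords_def)
    have "(\<lambda>v. (T v, \<lambda>i. \<gamma> i v)) \<in> plots (milnor_S D) n V"
      using V(4) s smooth_function_subset[OF U V(1,3) T] by (simp add: plots_milnor_S)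
    moreover have "mkE (T v) (\<Gamma> v) = milnor_rel D `` {(T v, \<lambda>i. \<gamma> i v)}" if "v \<in> V" for v
    proof -
      have "mkE (T v) (\<Gamma> v) = mkE (T v) (\<lambda>i. \<gamma> i v)" using V(5)[OF that] by (intro mkE_cong) simp
      also have "\<dots> = milnor_rel D `` {(T v, \<lambda>i. \<gamma> i v)}"
        by (rule milnor_rel_class[symmetric, OF s[OF that]]) (use plot_in_carrier[OF D_space V(4) that] in simp)
      finally show ?thesis .
    qed
    ultimately show ?thesis using V(1-3) by (intro exI[of _ V] exI[of _ "\<lambda>v. (T v, \<lambda>i. \<gamma> i v)"]) simp
  qed
  then show ?thesis using U unfolding milnor_EG_def plots_quotient by simp
qed

lemma EG_plotE:
  assumes p: "p \<in> plots EG n U" and u: "u \<in> U"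
  obtains V \<gamma> where "eopen n V" "u \<in> V" "V \<subseteq> U" "\<And>i. \<gamma> i \<in> plots D n V"
    "\<And>i. smooth_function n V (\<lambda>v. tco (p v) i)"
    "\<And>i v. v \<in> V \<Longrightarrow> tco (p v) i \<noteq> 0 \<Longrightarrow> \<gamma> i v = gco (p v) i"
proof -
  obtain V q where V: "eopen n V" "u \<in> V" "V \<subseteq> U" "q \<in> plots (milnor_S D) n V"
    "\<forall>v\<in>V. p v = milnor_rel D `` {q v}"
    using p u unfolding milnor_EG_def plots_quotient by blast
  have q: "smooth_function n V (\<lambda>u. fst (q u) i)" "(\<lambda>u. snd (q u) i) \<in> plots D n V" for i
    using V(4) by (simp_all add: plots_milnor_S)
  have "valid_coords (fst (q v)) (snd (q v)) \<and> p v = mkE (fst (q v)) (snd (q v))" if v: "v \<in> V" for v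
  proof -
    have "in_simplex (fst (q v))" using V(4) v by (simp add: plots_milnor_S)
    moreover have "snd (q v) i \<in> carrier G" for i using plot_in_carrier[OF D_space q(2) v] by simp
    ultimately show ?thesis using milnor_rel_class[of "fst (q v)" "snd (q v)"] V(5) v
      by (simp add: valid_coords_def)
  qed
  then have c: "tco (p v) = fst (q v)" "tco (p v) i \<noteq> 0 \<Longrightarrow> snd (q v) i = gco (p v) i" if "v \<in> V" for v i
    using that tco_mkE gco_mkE by metis+
  show ?thesis
  proof (rule that[OF V(1-3), of "\<lambda>i u. snd (q u) i"])
    show "smooth_function n V (\<lambda>v. tco (p v) i)" for i
      by (rule smooth_function_cong[OF V(1) q(1)[of i]]) (simp add: c(1))
  qed (use q(2) c(2) in auto)
qed

lemma smooth_tco: "smooth_real EG (\<lambda>c. tco c i)"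
  unfolding smooth_real_iff[OF EG_space]
proof (intro allI ballI)
  fix n U p assume p: "p \<in> plots EG n U"
  show "smooth_function n U (\<lambda>u. tco (p u) i)"
  proof (rule smooth_function_local[OF plot_eopen[OF EG_space p]])
    fix u assume "u \<in> U"
    obtain V where "eopen n V" "u \<in> V" "V \<subseteq> U" "\<And>i. smooth_function n V (\<lambda>v. tco (p v) i)"
      using EG_plotE[OF p \<open>u \<in> U\<close>] by metis
    then show "\<exists>V. eopen n V \<and> u \<in> V \<and> V \<subseteq> U \<and> smooth_function n V (\<lambda>u. tco (p u) i)" by blast
  qed
qed

text \<open>Where the weight never vanishes, local lifts have no freedom in this slot, so their
  coordinates glue.\<close>

lemma gco_plot:
  assumes p: "p \<in> plots EG n U" and nz: "\<And>u. u \<in> U \<Longrightarrow> tco (p u) i \<noteq> 0"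
  shows "(\<lambda>u. gco (p u) i) \<in> plots D n U"
proof (rule plot_local[OF D_space plot_eopen[OF EG_space p]])
  fix u assume "u \<in> U"
  obtain V \<gamma> where V: "eopen n V" "u \<in> V" "V \<subseteq> U" "\<And>i::nat. \<gamma> i \<in> plots D n V"
    "\<And>i v. v \<in> V \<Longrightarrow> tco (p v) i \<noteq> 0 \<Longrightarrow> \<gamma> i v = gco (p v) i"
    using EG_plotE[OF p \<open>u \<in> U\<close>] by metis
  have "\<forall>v\<in>V. gco (p v) i = \<gamma> i v" using V(3) V(5)[of _ i] nz by auto
  then show "\<exists>V q. eopen n V \<and> u \<in> V \<and> V \<subseteq> U \<and> q \<in> plots D n V \<and> (\<forall>v\<in>V. gco (p v) i = q v)"
    using V by blast
qed

lemma smooth_milnor_act: "smooth_action G D EG (milnor_act G)"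
  unfolding smooth_action_def
proof (intro conjI ballI)
  show "smooth_map (prod_diffeology D EG) EG (\<lambda>(g, e). milnor_act G g e)"
  proof (rule smooth_mapI)
    fix n U p assume "p \<in> plots (prod_diffeology D EG) n U"
    then have h: "(\<lambda>u. fst (p u)) \<in> plots D n U" and c: "(\<lambda>u. snd (p u)) \<in> plots EG n U"
      by (auto simp: plots_prod)
    have hc: "fst (p u) \<in> carrier G" "snd (p u) \<in> carrier EG" if "u \<in> U" for u
      using plot_in_carrier[OF D_space h that] plot_in_carrier[OF EG_space c that] by auto
    have "(\<lambda>u. mkE (tco (snd (p u))) (\<lambda>i. gco (snd (p u)) i \<otimes> inv (fst (p u)))) \<in> plots EG n U"
    proof (rule EG_plotI[OF plot_eopen[OF D_space h]])
      fix u assume u: "u \<in> U"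
      show "valid_coords (tco (snd (p u))) (\<lambda>i. gco (snd (p u)) i \<otimes> inv (fst (p u)))"
        by (intro valid_coords_act valid_coords_tco hc u)
      obtain V \<gamma> where V: "eopen n V" "u \<in> V" "V \<subseteq> U" "\<And>i::nat. \<gamma> i \<in> plots D n V"
        "\<And>i. smooth_function n V (\<lambda>v. tco (snd (p v)) i)"
        "\<And>i v. v \<in> V \<Longrightarrow> tco (snd (p v)) i \<noteq> 0 \<Longrightarrow> \<gamma> i v = gco (snd (p v)) i"
        using EG_plotE[OF c u] by metis
      have "(\<lambda>v. \<gamma> i v \<otimes> inv (fst (p v))) \<in> plots D n V" for i
        by (intro plot_mult plot_inv V plot_restrict[OF D_space h])
      then show "\<exists>V \<gamma>. eopen n V \<and> u \<in> V \<and> V \<subseteq> U \<and> (\<forall>i. \<gamma> i \<in> plots D n V \<and>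
          (\<forall>v\<in>V. tco (snd (p v)) i \<noteq> 0 \<longrightarrow> \<gamma> i v = gco (snd (p v)) i \<otimes> inv (fst (p v))))"
        using V(1-3,6) by (intro exI[of _ V] exI[of _ "\<lambda>i v. \<gamma> i v \<otimes> inv (fst (p v))"]) simp
    qed (rule smooth_real_plot[OF smooth_tco c])
    then show "(\<lambda>u. (\<lambda>(g, e). milnor_act G g e) (p u)) \<in> plots EG n U"
    proof (rule plot_cong[OF EG_space])
      fix u assume u: "u \<in> U"
      show "(\<lambda>(g, e). milnor_act G g e) (p u) = mkE (tco (snd (p u))) (\<lambda>i. gco (snd (p u)) i \<otimes> inv (fst (p u)))"
        using milnor_act_mkE[OF valid_coords_tco[OF hc(2)[OF u]] hc(1)[OF u]] mkE_tco[OF hc(2)[OF u]]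
        by (simp add: case_prod_beta)
    qed
  qed (auto simp: milnor_act_in)
  show "milnor_act G \<one> e = e" if "e \<in> carrier EG" for e
    by (rule EG_eqI) (use that in \<open>auto simp: milnor_act_in tco_act gco_act gco_in\<close>)
  show "milnor_act G (g \<otimes> h) e = milnor_act G g (milnor_act G h e)"
    if "g \<in> carrier G" "h \<in> carrier G" "e \<in> carrier EG" for g h e
    by (rule EG_eqI) (use that in \<open>auto simp: milnor_act_in tco_act gco_act gco_in inv_mult_group m_assoc\<close>)
qed

section \<open>The projection of EG onto BG\<close>

lemma projB_eq: "c \<in> carrier EG \<Longrightarrow> projB c = {milnor_act G h c |h. h \<in> carrier G}"
  by (auto simp: projB_def milnor_orbit_rel_def)

lemma milnor_act_one: "c \<in> carrier EG \<Longrightarrow> milnor_act G \<one> c = c"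
  and milnor_act_mult: "g \<in> carrier G \<Longrightarrow> h \<in> carrier G \<Longrightarrow> c \<in> carrier EG \<Longrightarrow>
    milnor_act G (g \<otimes> h) c = milnor_act G g (milnor_act G h c)"
  using smooth_milnor_act by (simp_all add: smooth_action_def)

lemma projB_self: "c \<in> carrier EG \<Longrightarrow> c \<in> projB c"
  using milnor_act_one[of c] by (auto simp: projB_eq intro!: exI[of _ \<one>])

lemma projB_act:
  assumes "c \<in> carrier EG" "h \<in> carrier G"
  shows "projB (milnor_act G h c) = projB c"
proof -
  have 1: "milnor_act G k c \<in> projB (milnor_act G h c)" if "k \<in> carrier G" for k
    using assms that by (auto simp: projB_eq milnor_act_in milnor_act_mult[symmetric] m_assoc intro!: exI[of _ "k \<otimes> inv h"])
  have 2: "milnor_act G k (milnor_act G h c) \<in> projB c" if "k \<in> carrier G" for k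
    using assms that by (auto simp: projB_eq milnor_act_mult[symmetric] intro!: exI[of _ "k \<otimes> h"])
  show ?thesis
  proof
    show "projB (milnor_act G h c) \<subseteq> projB c"
      using 2 unfolding projB_eq[OF milnor_act_in[OF assms]] by blast
    show "projB c \<subseteq> projB (milnor_act G h c)"
      using 1 unfolding projB_eq[OF assms(1)] by blast
  qed
qed

lemma carrier_BG: "carrier BG = projB ` carrier EG"
  by (auto simp: milnor_BG_def carrier_quotient quotient_def projB_def)

lemma smooth_projB: "smooth_map EG BG projB"
  unfolding milnor_BG_def projB_def[abs_def] by (rule smooth_map_quotient[OF EG_space])

text \<open>Division can be read off a single slot: if \<open>h\<close> takes \<open>c\<close> to
  \<open>c'\<close>, then \<open>h\<close> is the inverse of the coordinate of \<open>c'\<close>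
  times that of \<open>c\<close>, in any slot of non-zero weight. Such a slot exists at every point
  and remains usable on an open set.\<close>

lemma milnor_torsor: "torsor BG EG projB (milnor_act G)"
proof (rule torsorI[OF BG_space EG_space smooth_projB smooth_milnor_act])
  show "projB (milnor_act G g e) = projB e" if "g \<in> carrier G" "e \<in> carrier EG" for g e
    using projB_act that by simp
  show "\<exists>V q. eopen n V \<and> u \<in> V \<and> V \<subseteq> U \<and> q \<in> plots EG n V \<and> (\<forall>v\<in>V. projB (q v) = p v)"
    if "p \<in> plots BG n U" "u \<in> U" for n U p u
  proof -
    have "\<exists>V q. eopen n V \<and> u \<in> V \<and> V \<subseteq> U \<and> q \<in> plots EG n V \<and> (\<forall>v\<in>V. p v = projB (q v))"
      using that by (simp add: milnor_BG_def plots_quotient projB_def)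
    then obtain V q where "eopen n V" "u \<in> V" "V \<subseteq> U" "q \<in> plots EG n V" "\<forall>v\<in>V. p v = projB (q v)"
      by blast
    then show ?thesis by (intro exI[of _ V] exI[of _ q]) simp
  qed
  have gd: "h = inv (gco (milnor_act G h e) i) \<otimes> gco e i"
    if "h \<in> carrier G" "e \<in> carrier EG" "tco e i \<noteq> 0" for h e i
    using that by (simp add: gco_act gco_in inv_mult_group m_assoc)
  show "g = h" if "g \<in> carrier G" "h \<in> carrier G" "e \<in> carrier EG" "milnor_act G g e = milnor_act G h e" for g h e
    using in_simplex_nonzero[OF in_simplex_tco[OF that(3)]] gd that by metis
  have ex: "\<exists>h\<in>carrier G. milnor_act G h e = e'" if "e \<in> carrier EG" "e' \<in> carrier EG" "projB e = projB e'" for e e'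
  proof -
    have "e' \<in> projB e" using projB_self[OF that(2)] that(3) by simp
    then show ?thesis by (auto simp: projB_eq[OF that(1)])
  qed
  then show "\<exists>h\<in>carrier G. milnor_act G h e = e'" if "e \<in> carrier EG" "e' \<in> carrier EG" "projB e = projB e'" for e e'
    using that .
  show "(\<lambda>u. gdiv (milnor_act G) (p u) (q u)) \<in> plots D n U"
    if p: "p \<in> plots EG n U" and q: "q \<in> plots EG n U" and eq: "\<And>u. u \<in> U \<Longrightarrow> projB (p u) = projB (q u)" for n U p q
  proof (rule plot_local[OF D_space plot_eopen[OF EG_space p]])
    fix u assume u: "u \<in> U"
    note pin = plot_in_carrier[OF EG_space p] and qin = plot_in_carrier[OF EG_space q]
    obtain i where i: "tco (p u) i \<noteq> 0" using in_simplex_nonzero[OF in_simplex_tco[OF pin[OF u]]] by blast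
    define V where "V = {v \<in> U. tco (p v) i \<in> - {0}}"
    have "eopen n V"
      unfolding V_def
      by (intro eopen_preimage[OF plot_eopen[OF EG_space p]] smooth_real_plot[OF smooth_tco p]
          smooth_function_continuous[OF plot_eopen[OF EG_space p]]) auto
    then have V: "eopen n V" "V \<subseteq> U" "u \<in> V" using i u by (auto simp: V_def)
    have nz: "tco (p v) i \<noteq> 0" "tco (q v) i \<noteq> 0" if v: "v \<in> V" for v
    proof -
      show "tco (p v) i \<noteq> 0" using v by (simp add: V_def)
      obtain h where "h \<in> carrier G" "milnor_act G h (p v) = q v"
        using ex[OF pin qin eq] v V(2) by blast
      then show "tco (q v) i \<noteq> 0" using tco_act[OF pin, of v h] v V(2) \<open>tco (p v) i \<noteq> 0\<close> by auto
    qed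
    have "(\<lambda>v. inv (gco (q v) i) \<otimes> gco (p v) i) \<in> plots D n V"
      using V nz by (intro plot_mult plot_inv gco_plot plot_restrict[OF EG_space p] plot_restrict[OF EG_space q]) auto
    moreover have "gdiv (milnor_act G) (p v) (q v) = inv (gco (q v) i) \<otimes> gco (p v) i" if v: "v \<in> V" for v
      unfolding gdiv_def
    proof (rule the_equality)
      have vU: "v \<in> U" using v V(2) by blast
      show "h = inv (gco (q v) i) \<otimes> gco (p v) i" if "h \<in> carrier G \<and> milnor_act G h (p v) = q v" for h
        using gd[OF _ pin[OF vU] nz(1)[OF v], of h] that by auto
      obtain h where h: "h \<in> carrier G" "milnor_act G h (p v) = q v"
        using ex[OF pin[OF vU] qin[OF vU] eq[OF vU]] by blast
      then show "inv (gco (q v) i) \<otimes> gco (p v) i \<in> carrier G \<and>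
          milnor_act G (inv (gco (q v) i) \<otimes> gco (p v) i) (p v) = q v"
        using gd[OF h(1) pin[OF vU] nz(1)[OF v]] by auto
    qed
    ultimately show "\<exists>V g. eopen n V \<and> u \<in> V \<and> V \<subseteq> U \<and> g \<in> plots D n V \<and>
        (\<forall>v\<in>V. gdiv (milnor_act G) (p v) (q v) = g v)"
      using V by blast
  qed
qed

section \<open>Weights on BG, and points of EG with a prescribed group coordinate\<close>

lemma tcoB_projB: "c \<in> carrier EG \<Longrightarrow> tcoB (projB c) = tco c"
proof -
  assume c: "c \<in> carrier EG"
  have "(SOME c'. c' \<in> projB c) \<in> projB c" using projB_self[OF c] by (rule someI)
  then show ?thesis using c by (auto simp: projB_eq tcoB_def tco_act)
qed

lemma in_simplex_tcoB: "b \<in> carrier BG \<Longrightarrow> in_simplex (tcoB b)"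
  by (auto simp: carrier_BG tcoB_projB in_simplex_tco)

lemma smooth_tcoB: "smooth_real BG (\<lambda>b. tcoB b i)"
  unfolding smooth_real_iff[OF BG_space]
proof (intro allI ballI)
  fix n U p assume p: "p \<in> plots BG n U"
  show "smooth_function n U (\<lambda>u. tcoB (p u) i)"
  proof (rule smooth_function_local[OF plot_eopen[OF BG_space p]])
    fix u assume "u \<in> U"
    then obtain V q where V: "eopen n V" "u \<in> V" "V \<subseteq> U" "q \<in> plots EG n V" "\<And>v. v \<in> V \<Longrightarrow> projB (q v) = p v"
      using torsor_lift[OF milnor_torsor p] by blast
    have "smooth_function n V (\<lambda>u. tcoB (p u) i)"
      by (rule smooth_function_cong[OF V(1) smooth_real_plot[OF smooth_tco[of i] V(4)]])
         (use V(5) tcoB_projB plot_in_carrier[OF EG_space V(4)] in metis)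
    then show "\<exists>V. eopen n V \<and> u \<in> V \<and> V \<subseteq> U \<and> smooth_function n V (\<lambda>u. tcoB (p u) i)" using V by blast
  qed
qed

text \<open>For fixed \<open>i\<close> this is the inverse of a local trivialisation of the
  universal bundle, over the set where slot \<open>i\<close> has non-zero weight.\<close>

definition pointE :: "nat \<Rightarrow> ((nat \<Rightarrow> real) \<times> (nat \<Rightarrow> 'g)) set set \<Rightarrow> 'g \<Rightarrow> ((nat \<Rightarrow> real) \<times> (nat \<Rightarrow> 'g)) set" where
  "pointE i b g = (THE c. c \<in> carrier EG \<and> projB c = b \<and> gco c i = g)"

lemma pointE_unique:
  assumes "c \<in> carrier EG" "c' \<in> carrier EG" "projB c = projB c'" "gco c i = gco c' i" "tco c i \<noteq> 0"
  shows "c = c'"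
proof -
  obtain h where h: "h \<in> carrier G" "c' = milnor_act G h c"
    using torsor_gdiv[OF milnor_torsor assms(1,2,3)] by metis
  have *: "gco c i \<otimes> inv h = gco c i" using gco_act[OF assms(1) h(1) assms(5)] h(2) assms(4) by simp
  have "inv h = inv (gco c i) \<otimes> (gco c i \<otimes> inv h)"
    using gco_in[OF assms(1)] h(1) by (simp add: m_assoc[symmetric])
  then have "inv h = \<one>" unfolding * using gco_in[OF assms(1)] by simp
  then have "h = \<one>" using h(1) by (metis inv_inv inv_one)
  then show ?thesis using h(2) milnor_act_one[OF assms(1)] by simp
qed

text \<open>Acting by \<open>h\<close> multiplies the coordinate by \<open>inv h\<close> on the
  right, so \<open>h = inv g \<otimes> gco c i\<close> turns \<open>gco c i\<close> into
  \<open>g\<close>. The freedom to use any lift \<open>c\<close> is what makes \<open>pointE\<close>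
  smooth.\<close>

lemma pointE_eq:
  assumes "c \<in> carrier EG" "tco c i \<noteq> 0" "g \<in> carrier G"
  shows "pointE i (projB c) g = milnor_act G (inv g \<otimes> gco c i) c"
proof -
  let ?c = "milnor_act G (inv g \<otimes> gco c i) c"
  have k: "inv g \<otimes> gco c i \<in> carrier G" using assms gco_in by simp
  have "?c \<in> carrier EG \<and> projB ?c = projB c \<and> gco ?c i = g"
    using k assms by (simp add: milnor_act_in projB_act gco_act gco_in inv_mult_group m_assoc[symmetric])
  moreover have "tco ?c i \<noteq> 0" using k assms by (simp add: tco_act)
  ultimately show ?thesis unfolding pointE_def using pointE_unique by (intro the_equality) metis+
qed

lemma pointE:
  assumes "b \<in> carrier BG" "tcoB b i \<noteq> 0" "g \<in> carrier G"
  shows "pointE i b g \<in> carrier EG" "projB (pointE i b g) = b" "gco (pointE i b g) i = g"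
proof -
  obtain c where c: "c \<in> carrier EG" "b = projB c" using assms(1) by (auto simp: carrier_BG)
  have t: "tco c i \<noteq> 0" using assms(2) c tcoB_projB by simp
  have k: "inv g \<otimes> gco c i \<in> carrier G" using assms c gco_in by simp
  note e = pointE_eq[OF c(1) t assms(3)]
  show "pointE i b g \<in> carrier EG" "projB (pointE i b g) = b" "gco (pointE i b g) i = g"
    using k assms(3) c t e by (simp_all add: milnor_act_in projB_act gco_act gco_in inv_mult_group m_assoc[symmetric])
qed

lemma pointE_self: "c \<in> carrier EG \<Longrightarrow> tco c i \<noteq> 0 \<Longrightarrow> pointE i (projB c) (gco c i) = c"
  by (simp add: pointE_eq gco_in milnor_act_one)

lemma pointE_act:
  assumes "b \<in> carrier BG" "tcoB b i \<noteq> 0" "g \<in> carrier G" "h \<in> carrier G"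
  shows "pointE i b (g \<otimes> inv h) = milnor_act G h (pointE i b g)"
proof -
  note e = pointE[OF assms(1-3)]
  have t: "tco (pointE i b g) i \<noteq> 0" using e assms(2) tcoB_projB by metis
  have "gco (milnor_act G h (pointE i b g)) i = g \<otimes> inv h" using gco_act[OF e(1) assms(4) t] e(3) by simp
  moreover have "projB (milnor_act G h (pointE i b g)) = b" using projB_act[OF e(1) assms(4)] e(2) by simp
  ultimately show ?thesis
    using pointE_self[OF milnor_act_in[OF e(1) assms(4)], of i] tco_act[OF e(1) assms(4)] t by simp
qed

lemma pointE_plot:
  assumes b: "b \<in> plots BG n U" and g: "g \<in> plots D n U" and nz: "\<And>u. u \<in> U \<Longrightarrow> tcoB (b u) i \<noteq> 0"
  shows "(\<lambda>u. pointE i (b u) (g u)) \<in> plots EG n U"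
proof (rule plot_local[OF EG_space plot_eopen[OF BG_space b]])
  fix u assume "u \<in> U"
  then obtain V q where V: "eopen n V" "u \<in> V" "V \<subseteq> U" "q \<in> plots EG n V" "\<And>v. v \<in> V \<Longrightarrow> projB (q v) = b v"
    using torsor_lift[OF milnor_torsor b] by blast
  note qin = plot_in_carrier[OF EG_space V(4)]
  have t: "tco (q v) i \<noteq> 0" if "v \<in> V" for v
    using nz[of v] V(3,5) that tcoB_projB[OF qin[OF that]] by auto
  have "(\<lambda>v. milnor_act G (inv (g v) \<otimes> gco (q v) i) (q v)) \<in> plots EG n V"
    by (intro torsor_act_plot[OF milnor_torsor] plot_mult plot_inv gco_plot V plot_restrict[OF D_space g] t)
  moreover have "pointE i (b v) (g v) = milnor_act G (inv (g v) \<otimes> gco (q v) i) (q v)" if v: "v \<in> V" for v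
    using pointE_eq[OF qin[OF v] t[OF v], of "g v"] V(3,5) v plot_in_carrier[OF D_space g, of v] by auto
  ultimately show "\<exists>V q. eopen n V \<and> u \<in> V \<and> V \<subseteq> U \<and> q \<in> plots EG n V \<and> (\<forall>v\<in>V. pointE i (b v) (g v) = q v)"
    using V(1-3) by blast
qed

end

section \<open>Homotopies and partitions of unity\<close>

lemma smooth_real_snd: "smooth_real (prod_diffeology X real_diffeology) snd"
  by (rule smooth_map_snd)

lemma smoothly_homotopic_refl:
  assumes "diffeological_space X" "smooth_map X Y f"
  shows "smoothly_homotopic X Y f f"
  unfolding smoothly_homotopic_def
  using smooth_map_compose[OF smooth_map_fst assms(2)] by (intro exI[of _ "\<lambda>z. f (fst z)"]) simp

lemma smoothly_homotopic_sym:
  assumes "diffeological_space X" "smoothly_homotopic X Y f g"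
  shows "smoothly_homotopic X Y g f"
proof -
  let ?R = "prod_diffeology X real_diffeology"
  note R = diffeological_space_prod[OF assms(1) diffeological_space_real]
  obtain H where H: "smooth_map ?R Y H" "\<forall>x\<in>carrier X. H (x, 0) = f x \<and> H (x, 1) = g x"
    using assms(2) unfolding smoothly_homotopic_def by blast
  have "smooth_real ?R (\<lambda>z. 1 - snd z)"
    by (intro smooth_real_diff smooth_real_const R smooth_real_snd)
  then have "smooth_map ?R Y (\<lambda>z. H (fst z, 1 - snd z))"
    by (intro smooth_map_compose[OF smooth_map_Pair H(1)] smooth_map_fst)
  then show ?thesis unfolding smoothly_homotopic_def
    using H(2) by (intro exI[of _ "\<lambda>z. H (fst z, 1 - snd z)"]) simp
qed

lemma smoothly_homotopic_trans:
  assumes X: "diffeological_space X" and Y: "diffeological_space Y"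
    and "smoothly_homotopic X Y f g" "smoothly_homotopic X Y g h"
  shows "smoothly_homotopic X Y f h"
proof -
  let ?R = "prod_diffeology X real_diffeology"
  note R = diffeological_space_prod[OF X diffeological_space_real]
  obtain H where H: "smooth_map ?R Y H" "\<forall>x\<in>carrier X. H (x, 0) = f x \<and> H (x, 1) = g x"
    using assms(3) unfolding smoothly_homotopic_def by blast
  obtain K where K: "smooth_map ?R Y K" "\<forall>x\<in>carrier X. K (x, 0) = g x \<and> K (x, 1) = h x"
    using assms(4) unfolding smoothly_homotopic_def by blast
  \<comment> \<open>The reparametrised \<open>H\<close> rests at \<open>g\<close> from parameter 1/3
    on, and the reparametrised \<open>K\<close> rests there up to 2/3. Both formulas agree between
    these values, so the seam at 1/2 is smooth.\<close>
  define L where "L z = (if snd z \<le> 1/2 then H (fst z, smooth_step (3 * snd z))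
    else K (fst z, smooth_step (3 * snd z - 2)))" for z
  have "smooth_real ?R (\<lambda>z. smooth_step (3 * snd z))"
    by (intro smooth_real_step smooth_real_mult smooth_real_const R smooth_real_snd)
  then have H': "smooth_map ?R Y (\<lambda>z. H (fst z, smooth_step (3 * snd z)))"
    by (intro smooth_map_compose[OF smooth_map_Pair H(1)] smooth_map_fst)
  have "smooth_real ?R (\<lambda>z. smooth_step (3 * snd z - 2))"
    by (intro smooth_real_step smooth_real_diff smooth_real_mult smooth_real_const R smooth_real_snd)
  then have K': "smooth_map ?R Y (\<lambda>z. K (fst z, smooth_step (3 * snd z - 2)))"
    by (intro smooth_map_compose[OF smooth_map_Pair K(1)] smooth_map_fst)
  have LH: "L z = H (fst z, smooth_step (3 * snd z))" if "fst z \<in> carrier X" "snd z < 2/3" for z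
    using that H(2) K(2) by (simp add: L_def smooth_step_0 smooth_step_1)
  have LK: "L z = K (fst z, smooth_step (3 * snd z - 2))" if "fst z \<in> carrier X" "snd z > 1/3" for z
    using that H(2) K(2) by (simp add: L_def smooth_step_0 smooth_step_1)
  have "smooth_map ?R Y L"
  proof (rule smooth_map_localI[OF R Y])
    show "L z \<in> carrier Y" if "z \<in> carrier ?R" for z
      using smooth_map_carrier[OF H' that] smooth_map_carrier[OF K' that] by (simp add: L_def)
    fix n U p u assume p: "p \<in> plots ?R n U" and u: "u \<in> U"
    note U = plot_eopen[OF R p]
    have c: "continuous_on U (\<lambda>u. snd (p u))"
      by (rule smooth_function_continuous[OF U smooth_real_plot[OF smooth_real_snd p]])
    have pc: "fst (p v) \<in> carrier X" if "v \<in> U" for v using plot_in_carrier[OF R p that] by auto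
    show "\<exists>V q. eopen n V \<and> u \<in> V \<and> V \<subseteq> U \<and> q \<in> plots Y n V \<and> (\<forall>v\<in>V. L (p v) = q v)"
    proof (cases "snd (p u) < 2/3")
      case True
      let ?V = "{v \<in> U. snd (p v) \<in> {..<2/3}}"
      have V: "eopen n ?V" by (rule eopen_preimage[OF U c]) simp
      then show ?thesis
        using True u LH pc plot_restrict[OF Y smooth_map_plot[OF H' p] V]
        by (intro exI[of _ ?V] exI[of _ "\<lambda>u. H (fst (p u), smooth_step (3 * snd (p u)))"]) auto
    next
      case False
      let ?V = "{v \<in> U. snd (p v) \<in> {1/3<..}}"
      have V: "eopen n ?V" by (rule eopen_preimage[OF U c]) simp
      then show ?thesis
        using False u LK pc plot_restrict[OF Y smooth_map_plot[OF K' p] V]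
        by (intro exI[of _ ?V] exI[of _ "\<lambda>u. K (fst (p u), smooth_step (3 * snd (p u) - 2))"]) auto
    qed
  qed
  then show ?thesis unfolding smoothly_homotopic_def using H(2) K(2)
    by (intro exI[of _ L]) (simp add: L_def smooth_step_0 smooth_step_1)
qed

text \<open>Smooth paracompactness indexes a partition by the members of the cover, while the
  arguments below need sequences, and a sequence may repeat a member. Each member goes to its first
  index; all other indices get the zero function.\<close>

lemma smoothly_paracompact_countable:
  fixes W :: "nat \<Rightarrow> 'a set"
  assumes X: "diffeological_space X" and sp: "smoothly_paracompact X" and W: "open_cover (D_topology X) UNIV W"
  obtains \<zeta> where "subordinate_partition_of_unity X UNIV W \<zeta>"
proof -
  have "open_cover (D_topology X) (range W) id" using W by (simp add: open_cover_def)
  then obtain \<zeta> where "subordinate_partition_of_unity X (range W) id \<zeta>"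
    using sp unfolding smoothly_paracompact_def by blast
  then have z: "\<And>A. A \<in> range W \<Longrightarrow> smooth_map X unit_interval_diffeology (\<zeta> A)"
    and zs: "\<And>x. x \<in> carrier X \<Longrightarrow> finite {A \<in> range W. \<zeta> A x \<noteq> 0}"
      "\<And>x. x \<in> carrier X \<Longrightarrow> (\<Sum>A | A \<in> range W \<and> \<zeta> A x \<noteq> 0. \<zeta> A x) = 1"
    and lf: "locally_finite_family (D_topology X) (range W) (\<lambda>A. smooth_support X (\<zeta> A))"
    and sub: "\<And>A. A \<in> range W \<Longrightarrow> smooth_support X (\<zeta> A) \<subseteq> A"
    unfolding subordinate_partition_of_unity_def pointwise_finite_partition_of_unity_def by auto
  define l where "l A = (LEAST k. W k = A)" for A
  define J where "J = {i. i = l (W i)}"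
  have inj: "inj_on W J"
  proof (rule inj_onI)
    fix x y assume "x \<in> J" "y \<in> J" and W: "W x = W y"
    then have "x = l (W x)" "y = l (W y)" by (simp_all only: J_def mem_Collect_eq)
    then show "x = y" using W by metis
  qed
  have WJ: "W ` J = range W"
  proof -
    have "W i \<in> W ` J" for i
    proof -
      have e: "W (l (W i)) = W i" unfolding l_def by (rule LeastI) simp
      then have "l (W i) \<in> J" unfolding J_def by simp
      then show ?thesis using e by (metis imageI)
    qed
    then show ?thesis by auto
  qed
  define \<xi> where "\<xi> i = (if i \<in> J then \<zeta> (W i) else (\<lambda>_. 0))" for i
  have "smooth_map X unit_interval_diffeology (\<xi> i)" for i
    using z[of "W i"] smooth_real_const[OF X, of 0] by (auto simp: \<xi>_def smooth_map_unit_interval[OF X])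
  moreover have "finite {i. \<xi> i x \<noteq> 0} \<and> (\<Sum>i | \<xi> i x \<noteq> 0. \<xi> i x) = 1" if x: "x \<in> carrier X" for x
  proof -
    have im: "W ` {i. \<xi> i x \<noteq> 0} = {A \<in> range W. \<zeta> A x \<noteq> 0}"
      unfolding WJ[symmetric] by (auto simp: \<xi>_def split: if_splits)
    have sJ: "{i. \<xi> i x \<noteq> 0} \<subseteq> J" by (auto simp: \<xi>_def)
    note inj' = inj_on_subset[OF inj sJ]
    have "finite {i. \<xi> i x \<noteq> 0}" using zs(1)[OF x] unfolding im[symmetric] by (rule finite_imageD[OF _ inj'])
    moreover have "(\<Sum>i | \<xi> i x \<noteq> 0. \<xi> i x) = (\<Sum>i | \<xi> i x \<noteq> 0. \<zeta> (W i) x)"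
      by (rule sum.cong) (auto simp: \<xi>_def)
    moreover have "(\<Sum>i | \<xi> i x \<noteq> 0. \<zeta> (W i) x) = (\<Sum>A\<in>{A \<in> range W. \<zeta> A x \<noteq> 0}. \<zeta> A x)"
      unfolding im[symmetric] by (simp add: sum.reindex[OF inj'])
    ultimately show ?thesis using zs(2)[OF x] by simp
  qed
  moreover have s0: "smooth_support X (\<xi> i) = (if i \<in> J then smooth_support X (\<zeta> (W i)) else {})" for i
    by (simp add: \<xi>_def smooth_support_def)
  then have "locally_finite_family (D_topology X) UNIV (\<lambda>i. smooth_support X (\<xi> i))"
    unfolding locally_finite_family_def
  proof (intro ballI)
    fix x assume "x \<in> topspace (D_topology X)"
    then obtain V where V: "openin (D_topology X) V" "x \<in> V"
      "finite {A \<in> range W. smooth_support X (\<zeta> A) \<inter> V \<noteq> {}}"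
      using lf unfolding locally_finite_family_def by blast
    have "{i. smooth_support X (\<xi> i) \<inter> V \<noteq> {}} = {i \<in> J. smooth_support X (\<zeta> (W i)) \<inter> V \<noteq> {}}"
      by (auto simp: s0 split: if_splits)
    moreover have "finite {i \<in> J. smooth_support X (\<zeta> (W i)) \<inter> V \<noteq> {}}"
    proof (rule finite_imageD)
      show "finite (W ` {i \<in> J. smooth_support X (\<zeta> (W i)) \<inter> V \<noteq> {}})"
        by (rule finite_subset[OF _ V(3)]) auto
      show "inj_on W {i \<in> J. smooth_support X (\<zeta> (W i)) \<inter> V \<noteq> {}}"
        by (rule inj_on_subset[OF inj]) auto
    qed
    ultimately show "\<exists>V. openin (D_topology X) V \<and> x \<in> V \<and> finite {i \<in> UNIV. smooth_support X (\<xi> i) \<inter> V \<noteq> {}}"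
      using V(1,2) by auto
  qed
  moreover have "smooth_support X (\<xi> i) \<subseteq> W i" for i using sub[of "W i"] by (simp add: s0)
  ultimately show ?thesis
    by (intro that[of \<xi>]) (simp add: subordinate_partition_of_unity_def pointwise_finite_partition_of_unity_def)
qed

lemma in_simplex_partition:
  assumes "diffeological_space X" "pointwise_finite_partition_of_unity X UNIV \<zeta>" "x \<in> carrier X"
  shows "in_simplex (\<lambda>i. \<zeta> i x)"
  using assms by (simp add: pointwise_finite_partition_of_unity_def in_simplex_def smooth_map_unit_interval)

lemma smooth_real_partition:
  assumes "diffeological_space X" "pointwise_finite_partition_of_unity X UNIV \<zeta>"
  shows "smooth_real X (\<zeta> i)"
  using assms by (simp add: pointwise_finite_partition_of_unity_def smooth_map_unit_interval)

lemma in_simplexI: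
  assumes "\<And>i. t i \<ge> 0" "finite K" "\<And>i. i \<notin> K \<Longrightarrow> t i = 0" "sum t K = 1"
  shows "in_simplex t"
proof -
  have sub: "{i. t i \<noteq> 0} \<subseteq> K" using assms(3) by auto
  then have "sum t {i. t i \<noteq> 0} = sum t K" by (intro sum.mono_neutral_left assms(2)) auto
  moreover have "t i \<le> 1" for i
  proof (cases "i \<in> K")
    case True
    then show ?thesis using member_le_sum[of i K t] assms by simp
  qed (simp add: assms(3))
  ultimately show ?thesis using assms finite_subset[OF sub assms(2)] by (simp add: in_simplex_def)
qed

section \<open>Equivariant maps into the universal bundle\<close>

context diff_group
begin

definition equivariant_map :: "'e diffeology \<Rightarrow> ('g \<Rightarrow> 'e \<Rightarrow> 'e) \<Rightarrow> ('e \<Rightarrow> ((nat \<Rightarrow> real) \<times> (nat \<Rightarrow> 'g)) set) \<Rightarrow> bool" where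
  "equivariant_map E a \<theta> \<longleftrightarrow> smooth_map E EG \<theta> \<and>
     (\<forall>g\<in>carrier G. \<forall>e\<in>carrier E. \<theta> (a g e) = milnor_act G g (\<theta> e))"

definition covers :: "'e diffeology \<Rightarrow> ('e \<Rightarrow> 'x) \<Rightarrow> ('e \<Rightarrow> ((nat \<Rightarrow> real) \<times> (nat \<Rightarrow> 'g)) set)
    \<Rightarrow> ('x \<Rightarrow> ((nat \<Rightarrow> real) \<times> (nat \<Rightarrow> 'g)) set set) \<Rightarrow> bool" where
  "covers E \<pi> \<theta> f \<longleftrightarrow> (\<forall>e\<in>carrier E. projB (\<theta> e) = f (\<pi> e))"

definition classifies :: "'x diffeology \<Rightarrow> 'e diffeology \<Rightarrow> ('e \<Rightarrow> 'x) \<Rightarrow> ('g \<Rightarrow> 'e \<Rightarrow> 'e)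
    \<Rightarrow> ('x \<Rightarrow> ((nat \<Rightarrow> real) \<times> (nat \<Rightarrow> 'g)) set set) \<Rightarrow> bool" where
  "classifies X E \<pi> a f \<longleftrightarrow> smooth_map X BG f \<and> (\<exists>\<theta>. equivariant_map E a \<theta> \<and> covers E \<pi> \<theta> f)"

lemma EG_mapI:
  assumes Y: "diffeological_space Y" and v: "\<And>y. y \<in> carrier Y \<Longrightarrow> valid_coords (T y) (\<Gamma> y)"
    and T: "\<And>i. smooth_real Y (\<lambda>y. T y i)"
    and \<Gamma>: "\<And>n U p u. p \<in> plots Y n U \<Longrightarrow> u \<in> U \<Longrightarrow> \<exists>V \<gamma>. eopen n V \<and> u \<in> V \<and> V \<subseteq> U \<and>
      (\<forall>i. \<gamma> i \<in> plots D n V \<and> (\<forall>v\<in>V. T (p v) i \<noteq> 0 \<longrightarrow> \<gamma> i v = \<Gamma> (p v) i))"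
  shows "smooth_map Y EG (\<lambda>y. mkE (T y) (\<Gamma> y))"
proof (rule smooth_mapI)
  fix n U p assume p: "p \<in> plots Y n U"
  show "(\<lambda>u. mkE (T (p u)) (\<Gamma> (p u))) \<in> plots EG n U"
    by (rule EG_plotI[OF plot_eopen[OF Y p] v[OF plot_in_carrier[OF Y p]] smooth_real_plot[OF T p] \<Gamma>[OF p]])
qed (rule mkE_in[OF v])

text \<open>Slots outside the finite set \<open>J\<close> pose no condition on \<open>V0\<close> and
  receive the constant \<open>\<one>\<close>; for the slots in \<open>J\<close> finitely many
  neighbourhoods are intersected. This produces the common neighbourhood that plots of
  \<open>EG\<close> demand.\<close>

lemma finite_local_plots:
  assumes "eopen n V0" "u \<in> V0" "finite J"
    and J: "\<And>i. i \<in> J \<Longrightarrow> \<exists>V \<gamma>. eopen n V \<and> u \<in> V \<and> \<gamma> \<in> plots D n V \<and> (\<forall>v\<in>V \<inter> V0. Q i v (\<gamma> v))"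
    and nJ: "\<And>i v y. i \<notin> J \<Longrightarrow> v \<in> V0 \<Longrightarrow> Q i v y"
  shows "\<exists>V \<gamma>. eopen n V \<and> u \<in> V \<and> V \<subseteq> V0 \<and> (\<forall>i. \<gamma> i \<in> plots D n V \<and> (\<forall>v\<in>V. Q i v (\<gamma> i v)))"
proof -
  obtain W \<gamma> where W: "\<And>i. i \<in> J \<Longrightarrow> eopen n (W i)" "\<And>i. i \<in> J \<Longrightarrow> u \<in> W i"
    "\<And>i. i \<in> J \<Longrightarrow> \<gamma> i \<in> plots D n (W i)" "\<And>i v. i \<in> J \<Longrightarrow> v \<in> W i \<Longrightarrow> v \<in> V0 \<Longrightarrow> Q i v (\<gamma> i v)"
    using J by (metis IntI)
  define V where "V = \<Inter> (insert V0 (W ` J))"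
  have V: "eopen n V" unfolding V_def using assms(1,3) W(1) by (intro openin_Inter) auto
  moreover have "u \<in> V" "V \<subseteq> V0" using assms(2) W(2) by (auto simp: V_def)
  moreover have "(if i \<in> J then \<gamma> i else (\<lambda>_. \<one>)) \<in> plots D n V" for i
  proof (cases "i \<in> J")
    case True
    then have "V \<subseteq> W i" by (auto simp: V_def)
    then show ?thesis using True plot_restrict[OF D_space W(3)[OF True] V] by simp
  qed (simp add: plot_const[OF D_space V])
  moreover have "Q i v ((if i \<in> J then \<gamma> i else (\<lambda>_. \<one>)) v)" if "v \<in> V" for i v
    using that W(4)[of i v] nJ[of i v] by (auto simp: V_def)
  ultimately show ?thesis by (intro exI[of _ V] exI[of _ "\<lambda>i. if i \<in> J then \<gamma> i else (\<lambda>_. \<one>)"]) blast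
qed

text \<open>Points of a fibre differ by the group, so an invariant map factors through the
  projection, and smoothness follows by lifting plots of the base. The spectator \<open>P\<close>
  lets the same statement serve for maps and for homotopies.\<close>

lemma torsor_descend:
  assumes T: "torsor X E \<pi> a" and P: "diffeological_space P" and Z: "diffeological_space Z"
    and \<Phi>: "smooth_map (prod_diffeology E P) Z \<Phi>"
    and inv: "\<And>g e s. g \<in> carrier G \<Longrightarrow> e \<in> carrier E \<Longrightarrow> s \<in> carrier P \<Longrightarrow> \<Phi> (a g e, s) = \<Phi> (e, s)"
  obtains H where "smooth_map (prod_diffeology X P) Z H"
    "\<And>e s. e \<in> carrier E \<Longrightarrow> s \<in> carrier P \<Longrightarrow> H (\<pi> e, s) = \<Phi> (e, s)"
proof -
  define H where "H z = \<Phi> (SOME e. e \<in> carrier E \<and> \<pi> e = fst z, snd z)" for z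
  have H: "H (\<pi> e, s) = \<Phi> (e, s)" if "e \<in> carrier E" "s \<in> carrier P" for e s
  proof -
    have "(SOME e'. e' \<in> carrier E \<and> \<pi> e' = \<pi> e) \<in> carrier E \<and> \<pi> (SOME e'. e' \<in> carrier E \<and> \<pi> e' = \<pi> e) = \<pi> e"
      by (rule someI[of _ e]) (use that in simp)
    moreover define e' where "e' = (SOME e'. e' \<in> carrier E \<and> \<pi> e' = \<pi> e)"
    ultimately have e': "e' = (SOME e'. e' \<in> carrier E \<and> \<pi> e' = \<pi> e)" "e' \<in> carrier E" "\<pi> e = \<pi> e'"
      by auto
    have "\<Phi> (e', s) = \<Phi> (e, s)"
      using inv[OF torsor_gdiv(1)[OF T \<open>e \<in> carrier E\<close> e'(2,3)] \<open>e \<in> carrier E\<close> \<open>s \<in> carrier P\<close>]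
        torsor_gdiv(2)[OF T \<open>e \<in> carrier E\<close> e'(2,3)] by simp
    then show ?thesis by (simp add: H_def e'(1)[symmetric])
  qed
  note E = torsor_total_space[OF T] and X = torsor_base_space[OF T]
  have "smooth_map (prod_diffeology X P) Z H"
  proof (rule smooth_map_localI[OF diffeological_space_prod[OF X P] Z])
    fix z assume "z \<in> carrier (prod_diffeology X P)"
    then obtain x s where z: "z = (x, s)" "x \<in> carrier X" "s \<in> carrier P" by auto
    then obtain e where "e \<in> carrier E" "\<pi> e = x" using torsor_surj[OF T] by metis
    then show "H z \<in> carrier Z" using smooth_map_carrier[OF \<Phi>, of "(e, s)"] H z by auto
  next
    fix n U p u assume p: "p \<in> plots (prod_diffeology X P) n U" and u: "u \<in> U"
    then have p1: "(\<lambda>u. fst (p u)) \<in> plots X n U" and p2: "(\<lambda>u. snd (p u)) \<in> plots P n U" by (auto simp: plots_prod)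
    obtain V q where V: "eopen n V" "u \<in> V" "V \<subseteq> U" "q \<in> plots E n V" "\<And>v. v \<in> V \<Longrightarrow> \<pi> (q v) = fst (p v)"
      using torsor_lift[OF T p1 u] by blast
    have "(\<lambda>v. (q v, snd (p v))) \<in> plots (prod_diffeology E P) n V"
      using V(4) plot_restrict[OF P p2 V(1,3)] by (simp add: plots_prod)
    from smooth_map_plot[OF \<Phi> this] have "(\<lambda>v. \<Phi> (q v, snd (p v))) \<in> plots Z n V" .
    moreover have "H (p v) = \<Phi> (q v, snd (p v))" if "v \<in> V" for v
      using H[OF plot_in_carrier[OF E V(4) that], of "snd (p v)"] V(3,5) that plot_in_carrier[OF P p2, of v]
      by (metis prod.collapse subsetD)
    ultimately show "\<exists>V q. eopen n V \<and> u \<in> V \<and> V \<subseteq> U \<and> q \<in> plots Z n V \<and> (\<forall>v\<in>V. H (p v) = q v)"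
      using V(1-3) by blast
  qed
  then show ?thesis using H by (rule that)
qed

section \<open>Classifying maps of a torsor\<close>

context
  fixes X :: "'x diffeology" and E :: "'e diffeology" and \<pi> a
  assumes T: "torsor X E \<pi> a"
begin

lemma equivariant_map_covers:
  assumes "equivariant_map E a \<theta>"
  obtains f where "smooth_map X BG f" "covers E \<pi> \<theta> f"
proof -
  have \<theta>: "smooth_map E EG \<theta>" using assms by (simp add: equivariant_map_def)
  \<comment> \<open>A dummy real parameter adapts the map to \<open>torsor_descend\<close>.\<close>
  have 1: "smooth_map (prod_diffeology E real_diffeology) BG (\<lambda>z. projB (\<theta> (fst z)))"
    by (rule smooth_map_compose[OF smooth_map_compose[OF smooth_map_fst \<theta>] smooth_projB])
  have 2: "projB (\<theta> (fst (a g e, s))) = projB (\<theta> (fst (e, s)))"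
    if "g \<in> carrier G" "e \<in> carrier E" for g e s
    using assms that projB_act smooth_map_carrier[OF \<theta>] by (simp add: equivariant_map_def)
  obtain H where H: "smooth_map (prod_diffeology X real_diffeology) BG H"
    "\<And>e s. e \<in> carrier E \<Longrightarrow> s \<in> carrier real_diffeology \<Longrightarrow> H (\<pi> e, s) = projB (\<theta> (fst (e, s)))"
    using torsor_descend[OF T diffeological_space_real BG_space 1 2] by metis
  have "smooth_map X BG (\<lambda>x. H (x, 0))"
    by (rule smooth_map_compose[OF smooth_map_Pair[OF smooth_map_id smooth_real_const] H(1)])
       (rule torsor_base_space[OF T])
  then show ?thesis by (rule that) (simp add: covers_def H(2))
qed

lemma equivariant_homotopy_descends:
  assumes \<Theta>: "smooth_map (prod_diffeology E real_diffeology) EG \<Theta>"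
    and eqv: "\<And>g e s. g \<in> carrier G \<Longrightarrow> e \<in> carrier E \<Longrightarrow> \<Theta> (a g e, s) = milnor_act G g (\<Theta> (e, s))"
    and "covers E \<pi> (\<lambda>e. \<Theta> (e, 0)) f" "covers E \<pi> (\<lambda>e. \<Theta> (e, 1)) f'"
  shows "smoothly_homotopic X BG f f'"
proof -
  have 1: "smooth_map (prod_diffeology E real_diffeology) BG (\<lambda>z. projB (\<Theta> z))"
    by (rule smooth_map_compose[OF \<Theta> smooth_projB])
  have 2: "projB (\<Theta> (a g e, s)) = projB (\<Theta> (e, s))"
    if "g \<in> carrier G" "e \<in> carrier E" for g e s
    using eqv that projB_act smooth_map_carrier[OF \<Theta>] by simp
  obtain H where H: "smooth_map (prod_diffeology X real_diffeology) BG H"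
    "\<And>e s. e \<in> carrier E \<Longrightarrow> s \<in> carrier real_diffeology \<Longrightarrow> H (\<pi> e, s) = projB (\<Theta> (e, s))"
    using torsor_descend[OF T diffeological_space_real BG_space 1 2] by metis
  have "H (x, 0) = f x \<and> H (x, 1) = f' x" if x: "x \<in> carrier X" for x
  proof -
    obtain e where "e \<in> carrier E" "\<pi> e = x" using torsor_surj[OF T x] .
    then show ?thesis using H(2)[of e 0] H(2)[of e 1] assms(3,4) by (simp add: covers_def)
  qed
  then show ?thesis unfolding smoothly_homotopic_def using H(1) by blast
qed

text \<open>Local finiteness of the cover provides lifts to \<open>S\<^sub>G\<close> on one neighbourhood for all slots at once.\<close>

lemma numerable_classifying_map:
  assumes N: "numerable_sections X E \<pi>"
  obtains f where "classifies X E \<pi> a f"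
proof -
  note X = torsor_base_space[OF T] and E = torsor_total_space[OF T]
  obtain U \<zeta> s where oc: "open_cover (D_topology X) UNIV U" and lf: "locally_finite_family (D_topology X) UNIV U"
    and pou: "pointwise_finite_partition_of_unity X UNIV \<zeta>" and sub: "\<And>i::nat. smooth_support X (\<zeta> i) \<subseteq> U i"
    and s: "\<And>i. smooth_section X E \<pi> (U i) (s i)"
    using N unfolding numerable_sections_def by blast
  have Uo: "openin (D_topology X) (U i)" for i using oc by (simp add: open_cover_def)
  have nz: "x \<in> U i" if "x \<in> carrier X" "\<zeta> i x \<noteq> 0" for x i
    using sub[of i] smooth_support_superset[where f = "\<zeta> i", OF X that] by blast
  define t where "t e = (\<lambda>i. \<zeta> i (\<pi> e))" for e
  \<comment> \<open>The element leads from \<open>e\<close> to the section, not the other way round: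
    letting \<open>h\<close> act on \<open>e\<close> then multiplies it by \<open>inv h\<close> on
    the right, as the action on \<open>EG\<close> requires.\<close>
  define g where "g e = (\<lambda>i. gdiv a e (s i (\<pi> e)))" for e
  have sec: "s i (\<pi> e) \<in> carrier E" "\<pi> (s i (\<pi> e)) = \<pi> e" if "e \<in> carrier E" "\<pi> e \<in> U i" for e i
    using smooth_sectionD(1,2)[OF s that(2) torsor_proj_in[OF T that(1)]] by auto
  have gin: "g e i \<in> carrier G" if "e \<in> carrier E" "\<pi> e \<in> U i" for e i
    using torsor_gdiv(1)[OF T that(1) sec(1)[OF that]] sec(2)[OF that] by (simp add: g_def)
  have vc: "valid_coords (t e) (g e)" if e: "e \<in> carrier E" for e
    using in_simplex_partition[OF X pou torsor_proj_in[OF T e]] gin[OF e] nz[OF torsor_proj_in[OF T e]]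
    by (auto simp: valid_coords_def t_def)
  have "smooth_map E EG (\<lambda>e. mkE (t e) (g e))"
  proof (rule EG_mapI[OF E vc])
    show "smooth_real E (\<lambda>e. t e i)" for i
      unfolding t_def by (rule smooth_map_compose[OF torsor_proj[OF T] smooth_real_partition[OF X pou]])
    fix n V p u assume p: "p \<in> plots E n V" and u: "u \<in> V"
    note pp = smooth_map_plot[OF torsor_proj[OF T] p]
    have px: "\<pi> (p v) \<in> carrier X" if "v \<in> V" for v by (rule plot_in_carrier[OF X pp that])
    obtain W where W: "openin (D_topology X) W" "\<pi> (p u) \<in> W" "finite {i. U i \<inter> W \<noteq> {}}"
      using lf px[OF u] unfolding locally_finite_family_def topspace_D_topology[OF X] by auto
    let ?V0 = "{v \<in> V. \<pi> (p v) \<in> W}"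
    have V0: "eopen n ?V0" by (rule D_open_plot[OF W(1) pp])
    have "\<exists>V \<gamma>. eopen n V \<and> u \<in> V \<and> V \<subseteq> ?V0 \<and>
        (\<forall>i. \<gamma> i \<in> plots D n V \<and> (\<forall>v\<in>V. t (p v) i \<noteq> 0 \<longrightarrow> \<gamma> i v = g (p v) i))"
    proof (rule finite_local_plots[OF V0 _ W(3)])
      show "u \<in> ?V0" using u W(2) by simp
    next
      fix i v y assume i: "i \<notin> {i. U i \<inter> W \<noteq> {}}" and v: "v \<in> ?V0"
      then show "t (p v) i \<noteq> 0 \<longrightarrow> y = g (p v) i" using nz[OF px[of v], of i] by (auto simp: t_def)
    next
      fix i
      show "\<exists>V' \<gamma>. eopen n V' \<and> u \<in> V' \<and> \<gamma> \<in> plots D n V' \<and>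
          (\<forall>v\<in>V' \<inter> ?V0. t (p v) i \<noteq> 0 \<longrightarrow> \<gamma> v = g (p v) i)"
      proof (cases "\<pi> (p u) \<in> U i")
        case True
        let ?V = "{v \<in> V. \<pi> (p v) \<in> U i}"
        have V: "eopen n ?V" by (rule D_open_plot[OF Uo pp])
        note pV = plot_restrict[OF E p V]
        have "(\<lambda>v. s i (\<pi> (p v))) \<in> plots E n ?V"
          by (rule smooth_sectionD(3)[OF s plot_restrict[OF X pp V]]) auto
        then have "(\<lambda>v. g (p v) i) \<in> plots D n ?V"
          unfolding g_def using sec(2) plot_in_carrier[OF E p] by (intro torsor_gdiv_plot[OF T] pV) auto
        then show ?thesis using True u V by (intro exI[of _ ?V] exI[of _ "\<lambda>v. g (p v) i"]) simp
      next
        case False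
        \<comment> \<open>A point outside \<open>U i\<close> is off the closed support, so the
          weight vanishes on a whole neighbourhood and the constant \<open>\<one>\<close> will do.
          Vanishing at the point alone would not suffice.\<close>
        let ?V = "{v \<in> V. \<pi> (p v) \<in> carrier X - smooth_support X (\<zeta> i)}"
        have V: "eopen n ?V" by (rule D_open_plot[OF D_open_complement[OF X closedin_smooth_support] pp])
        moreover have "t (p v) i = 0" if "v \<in> ?V" for v
          using that smooth_support_superset[OF X, of "\<pi> (p v)" "\<zeta> i"] by (auto simp: t_def)
        ultimately show ?thesis
          using False u px sub[of i] plot_const[OF D_space V, of \<one>]
          by (intro exI[of _ ?V] exI[of _ "\<lambda>v. \<one>"]) auto
      qed
    qed
    then show "\<exists>V' \<gamma>. eopen n V' \<and> u \<in> V' \<and> V' \<subseteq> V \<and>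
        (\<forall>i. \<gamma> i \<in> plots D n V' \<and> (\<forall>v\<in>V'. t (p v) i \<noteq> 0 \<longrightarrow> \<gamma> i v = g (p v) i))"
      by (elim exE conjE) (rule exI, rule exI, intro conjI, assumption, assumption, blast, assumption)
  qed
  moreover have "mkE (t (a h e)) (g (a h e)) = milnor_act G h (mkE (t e) (g e))"
    if h: "h \<in> carrier G" and e: "e \<in> carrier E" for h e
  proof -
    have "g (a h e) i = g e i \<otimes> inv h" if "t e i \<noteq> 0" for i
    proof -
      have "\<pi> e \<in> U i" using nz[OF torsor_proj_in[OF T e]] that by (simp add: t_def)
      then show ?thesis
        using torsor_gdiv_act_left[OF T e sec(1)[OF e] _ h] sec(2)[OF e] torsor_proj_act[OF T h e]
        by (simp add: g_def)
    qed
    moreover have "t (a h e) = t e" using torsor_proj_act[OF T h e] by (simp add: t_def)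
    ultimately show ?thesis using milnor_act_mkE[OF vc[OF e] h]
      mkE_cong[of "t e" "g (a h e)" "\<lambda>i. g e i \<otimes> inv h"] by simp
  qed
  ultimately have eq: "equivariant_map E a (\<lambda>e. mkE (t e) (g e))" by (simp add: equivariant_map_def)
  obtain f where "smooth_map X BG f" "covers E \<pi> (\<lambda>e. mkE (t e) (g e)) f" using equivariant_map_covers[OF eq] .
  then show ?thesis using that eq unfolding classifies_def by blast
qed

lemma classifies_pullback:
  assumes "diffeological_space Y" "smooth_map Y X \<phi>" "classifies X E \<pi> a f"
  shows "classifies Y (pullback_diffeology Y \<phi> E \<pi>) fst (\<lambda>g (y, e). (y, a g e)) (\<lambda>y. f (\<phi> y))"
proof -
  obtain \<theta> where f: "smooth_map X BG f" and \<theta>: "equivariant_map E a \<theta>" "covers E \<pi> \<theta> f"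
    using assms(3) unfolding classifies_def by blast
  have "equivariant_map (pullback_diffeology Y \<phi> E \<pi>) (\<lambda>g (y, e). (y, a g e)) (\<lambda>z. \<theta> (snd z))"
    using \<theta>(1) smooth_map_compose[OF smooth_map_pullback_snd, of E EG \<theta>]
    by (auto simp: equivariant_map_def carrier_pullback)
  moreover have "covers (pullback_diffeology Y \<phi> E \<pi>) fst (\<lambda>z. \<theta> (snd z)) (\<lambda>y. f (\<phi> y))"
    using \<theta>(2) by (auto simp: covers_def carrier_pullback)
  ultimately show ?thesis using smooth_map_compose[OF assms(2) f] unfolding classifies_def by blast
qed

lemma classifies_map:
  assumes "classifies X F \<rho> b f" "smooth_map E F \<psi>" "\<And>e. e \<in> carrier E \<Longrightarrow> \<rho> (\<psi> e) = \<pi> e"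
    "\<And>g e. g \<in> carrier G \<Longrightarrow> e \<in> carrier E \<Longrightarrow> \<psi> (a g e) = b g (\<psi> e)"
  shows "classifies X E \<pi> a f"
proof -
  obtain \<theta> where f: "smooth_map X BG f" and \<theta>: "equivariant_map F b \<theta>" "covers F \<rho> \<theta> f"
    using assms(1) unfolding classifies_def by blast
  have "equivariant_map E a (\<lambda>e. \<theta> (\<psi> e))"
    using \<theta>(1) smooth_map_compose[OF assms(2), of EG \<theta>] assms(4) smooth_map_carrier[OF assms(2)]
    by (simp add: equivariant_map_def)
  moreover have "covers E \<pi> (\<lambda>e. \<theta> (\<psi> e)) f"
    using \<theta>(2) assms(3) smooth_map_carrier[OF assms(2)] by (simp add: covers_def)
  ultimately show ?thesis using f unfolding classifies_def by blast
qed

text \<open>Both torsors are pullbacks of the universal one along \<open>f\<close>, so a point of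
  \<open>F\<close> is determined by its base point and its image under \<open>\<tau>\<close>. Hence
  \<open>\<psi> e\<close> can be prescribed by these two data, and it is reached from any point of
  the fibre by dividing in \<open>EG\<close>.\<close>

lemma classifies_same_map:
  assumes S: "torsor X F \<rho> b" and "classifies X E \<pi> a f" "classifies X F \<rho> b f"
  obtains \<psi> where "smooth_map E F \<psi>" "\<And>e. e \<in> carrier E \<Longrightarrow> \<rho> (\<psi> e) = \<pi> e"
    "\<And>g e. g \<in> carrier G \<Longrightarrow> e \<in> carrier E \<Longrightarrow> \<psi> (a g e) = b g (\<psi> e)"
proof -
  obtain \<theta> where \<theta>: "smooth_map E EG \<theta>" "\<And>e. e \<in> carrier E \<Longrightarrow> projB (\<theta> e) = f (\<pi> e)"
    "\<And>g e. g \<in> carrier G \<Longrightarrow> e \<in> carrier E \<Longrightarrow> \<theta> (a g e) = milnor_act G g (\<theta> e)"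
    using assms(2) unfolding classifies_def equivariant_map_def covers_def by blast
  obtain \<tau> where \<tau>: "smooth_map F EG \<tau>" "\<And>e. e \<in> carrier F \<Longrightarrow> projB (\<tau> e) = f (\<rho> e)"
    "\<And>g e. g \<in> carrier G \<Longrightarrow> e \<in> carrier F \<Longrightarrow> \<tau> (b g e) = milnor_act G g (\<tau> e)"
    using assms(3) unfolding classifies_def equivariant_map_def covers_def by blast
  note E = torsor_total_space[OF T] and F = torsor_total_space[OF S]
  define \<psi> where "\<psi> e = (THE y. y \<in> carrier F \<and> \<rho> y = \<pi> e \<and> \<tau> y = \<theta> e)" for e
  have uniq: "y = z" if y: "y \<in> carrier F" "z \<in> carrier F" "\<rho> y = \<rho> z" "\<tau> y = \<tau> z" for y z
  proof -
    note d = torsor_gdiv[OF S y(1-3)]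
    note ty = smooth_map_carrier[OF \<tau>(1) y(1)]
    have "milnor_act G (gdiv b y z) (\<tau> y) = milnor_act G \<one> (\<tau> y)"
      using \<tau>(3)[OF d(1) y(1)] d(2) y(4) milnor_act_one[OF ty] by simp
    then have "gdiv b y z = \<one>" using torsor_act_cancel[OF milnor_torsor d(1) one_closed ty] by simp
    then show ?thesis using d(2) torsor_act_one[OF S y(1)] by simp
  qed
  have form: "b (gdiv (milnor_act G) (\<tau> y) (\<theta> e)) y \<in> carrier F \<and>
      \<rho> (b (gdiv (milnor_act G) (\<tau> y) (\<theta> e)) y) = \<pi> e \<and> \<tau> (b (gdiv (milnor_act G) (\<tau> y) (\<theta> e)) y) = \<theta> e"
    if e: "e \<in> carrier E" and y: "y \<in> carrier F" "\<rho> y = \<pi> e" for e y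
  proof -
    have "projB (\<tau> y) = projB (\<theta> e)" using \<theta>(2)[OF e] \<tau>(2)[OF y(1)] y(2) by simp
    note d = torsor_gdiv[OF milnor_torsor smooth_map_carrier[OF \<tau>(1) y(1)] smooth_map_carrier[OF \<theta>(1) e] this]
    show ?thesis using torsor_act_in[OF S d(1) y(1)] torsor_proj_act[OF S d(1) y(1)] y(2) \<tau>(3)[OF d(1) y(1)] d(2)
      by simp
  qed
  have \<psi>eq: "\<psi> e = y" if "e \<in> carrier E" "y \<in> carrier F" "\<rho> y = \<pi> e" "\<tau> y = \<theta> e" for e y
    unfolding \<psi>_def by (rule the_equality) (use that uniq in auto)
  have \<psi>: "\<psi> e \<in> carrier F" "\<rho> (\<psi> e) = \<pi> e" "\<tau> (\<psi> e) = \<theta> e" if e: "e \<in> carrier E" for e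
  proof -
    obtain y where y: "y \<in> carrier F" "\<rho> y = \<pi> e" using torsor_surj[OF S torsor_proj_in[OF T e]] .
    note fo = form[OF e y]
    have "\<psi> e = b (gdiv (milnor_act G) (\<tau> y) (\<theta> e)) y" using fo by (intro \<psi>eq[OF e]) auto
    then show "\<psi> e \<in> carrier F" "\<rho> (\<psi> e) = \<pi> e" "\<tau> (\<psi> e) = \<theta> e" using fo by auto
  qed
  have "smooth_map E F \<psi>"
  proof (rule smooth_map_localI[OF E F \<psi>(1)])
    fix n U p u assume p: "p \<in> plots E n U" and u: "u \<in> U"
    obtain V q where V: "eopen n V" "u \<in> V" "V \<subseteq> U" "q \<in> plots F n V" "\<And>v. v \<in> V \<Longrightarrow> \<rho> (q v) = \<pi> (p v)"
      using torsor_lift[OF S smooth_map_plot[OF torsor_proj[OF T] p] u] by blast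
    note pV = plot_restrict[OF E p V(1,3)]
    have "projB (\<tau> (q v)) = projB (\<theta> (p v))" if "v \<in> V" for v
      using \<theta>(2)[OF plot_in_carrier[OF E pV that]] \<tau>(2)[OF plot_in_carrier[OF F V(4) that]] V(5)[OF that] by simp
    then have "(\<lambda>v. gdiv (milnor_act G) (\<tau> (q v)) (\<theta> (p v))) \<in> plots D n V"
      by (intro torsor_gdiv_plot[OF milnor_torsor] smooth_map_plot[OF \<tau>(1) V(4)] smooth_map_plot[OF \<theta>(1) pV])
    then have "(\<lambda>v. b (gdiv (milnor_act G) (\<tau> (q v)) (\<theta> (p v))) (q v)) \<in> plots F n V"
      by (rule torsor_act_plot[OF S _ V(4)])
    moreover have "\<psi> (p v) = b (gdiv (milnor_act G) (\<tau> (q v)) (\<theta> (p v))) (q v)" if v: "v \<in> V" for v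
      using form[OF plot_in_carrier[OF E pV v] plot_in_carrier[OF F V(4) v] V(5)[OF v]]
      by (intro \<psi>eq[OF plot_in_carrier[OF E pV v]]) auto
    ultimately show "\<exists>V q. eopen n V \<and> u \<in> V \<and> V \<subseteq> U \<and> q \<in> plots F n V \<and> (\<forall>v\<in>V. \<psi> (p v) = q v)"
      using V(1-3) by blast
  qed
  moreover have "\<psi> (a g e) = b g (\<psi> e)" if "g \<in> carrier G" "e \<in> carrier E" for g e
    using that \<psi>[OF that(2)] torsor_act_in[OF T that] torsor_act_in[OF S that(1) \<psi>(1)[OF that(2)]]
      torsor_proj_act[OF T that] torsor_proj_act[OF S that(1) \<psi>(1)[OF that(2)]] \<theta>(3)[OF that] \<tau>(3)[OF that(1) \<psi>(1)[OF that(2)]]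
    by (intro \<psi>eq) auto
  ultimately show ?thesis using \<psi>(2) by (intro that)
qed

end

end

section \<open>Uniqueness of classifying maps\<close>

text \<open>Slot \<open>j\<close> is switched while \<open>s\<close> runs from
  \<open>1 - 1 / 2^j\<close> to \<open>1 - 3/4 / 2^j\<close>. The next switch starts at
  \<open>1 - 1/2 / 2^j\<close>, so the switches are separated by gaps in time and accumulate at
  \<open>s = 1\<close>.\<close>

definition spread_step :: "nat \<Rightarrow> real \<Rightarrow> real" where
  "spread_step j s = smooth_step (4 * (1 - (1 - s) * 2 ^ j))"

lemma spread_step_bounds: "0 \<le> spread_step j s" "spread_step j s \<le> 1"
  by (simp_all add: spread_step_def smooth_step_bounds)

lemma spread_step_0: "(1 - s) * 2 ^ j \<ge> 1 \<Longrightarrow> spread_step j s = 0"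
  and spread_step_1: "(1 - s) * 2 ^ j \<le> 3/4 \<Longrightarrow> spread_step j s = 1"
  by (simp_all add: spread_step_def smooth_step_0 smooth_step_1)

lemma spread_step_at_0: "spread_step j 0 = 0"
  and spread_step_at_1: "spread_step j 1 = 1"
  by (simp_all add: spread_step_0 spread_step_1)

text \<open>Slot \<open>k\<close> has been emptied before slot \<open>j\<close> begins to be filled.\<close>

lemma spread_step_sequential:
  assumes "k < j" "(1 - s) * 2 ^ j < 3/2"
  shows "spread_step k s = 1"
proof (rule spread_step_1)
  show "(1 - s) * 2 ^ k \<le> 3/4"
  proof (cases "1 - s \<ge> 0")
    case True
    have "(2::real) ^ Suc k \<le> 2 ^ j" using assms(1) by (intro power_increasing) auto
    then have "(1 - s) * 2 ^ Suc k \<le> (1 - s) * 2 ^ j" using True by (rule mult_left_mono)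
    then show ?thesis using assms(2) by simp
  next
    case False
    then have "(1 - s) * 2 ^ k \<le> 0" by (simp add: mult_le_0_iff)
    then show ?thesis by simp
  qed
qed

definition slot_weight :: "(nat \<Rightarrow> nat) \<Rightarrow> (nat \<Rightarrow> real) \<Rightarrow> nat \<Rightarrow> real" where
  "slot_weight \<phi> t j = (if j \<in> range \<phi> then t (inv_into UNIV \<phi> j) else 0)"

text \<open>Mass is only moved: of the weight \<open>t m\<close> the part \<open>b m * t m\<close>
  stays in slot \<open>m\<close> and the rest goes to slot \<open>\<phi> m\<close>. Contributions
  that meet in one slot add up, so the total is unchanged.\<close>

lemma in_simplex_interpolate:
  assumes t: "in_simplex t" and \<phi>: "inj \<phi>" and b: "\<And>i. 0 \<le> b i \<and> b i \<le> 1"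
  shows "in_simplex (\<lambda>j. b j * t j + slot_weight \<phi> (\<lambda>m. (1 - b m) * t m) j)"
proof -
  define F where "F = {i. t i \<noteq> 0}"
  have F: "finite F" "sum t F = 1" and t0: "\<And>i. t i \<ge> 0" using t by (auto simp: in_simplex_def F_def)
  let ?K = "F \<union> \<phi> ` F"
  have inv\<phi>: "inv_into UNIV \<phi> (\<phi> m) = m" for m using \<phi> by simp
  show ?thesis
  proof (rule in_simplexI[of _ ?K])
    show "0 \<le> b j * t j + slot_weight \<phi> (\<lambda>m. (1 - b m) * t m) j" for j
      using b t0 by (simp add: slot_weight_def)
    show "finite ?K" using F by simp
    show "b j * t j + slot_weight \<phi> (\<lambda>m. (1 - b m) * t m) j = 0" if "j \<notin> ?K" for j
      using that by (auto simp: slot_weight_def F_def inv\<phi>)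
    have "(\<Sum>j\<in>?K. b j * t j) = (\<Sum>j\<in>F. b j * t j)"
      by (rule sum.mono_neutral_right) (use F in \<open>auto simp: F_def\<close>)
    moreover have "(\<Sum>j\<in>?K. slot_weight \<phi> (\<lambda>m. (1 - b m) * t m) j) = (\<Sum>j\<in>\<phi> ` F. slot_weight \<phi> (\<lambda>m. (1 - b m) * t m) j)"
      by (rule sum.mono_neutral_right) (use F in \<open>auto simp: F_def slot_weight_def inv\<phi>\<close>)
    moreover have "\<dots> = (\<Sum>m\<in>F. (1 - b m) * t m)"
      by (subst sum.reindex) (use \<phi> in \<open>auto simp: slot_weight_def inv\<phi> intro: inj_on_subset\<close>)
    ultimately have "(\<Sum>j\<in>?K. b j * t j + slot_weight \<phi> (\<lambda>m. (1 - b m) * t m) j) =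
        (\<Sum>j\<in>F. b j * t j) + (\<Sum>m\<in>F. (1 - b m) * t m)" by (simp add: sum.distrib)
    also have "\<dots> = sum t F" by (simp add: sum.distrib[symmetric] algebra_simps)
    finally show "(\<Sum>j\<in>?K. b j * t j + slot_weight \<phi> (\<lambda>m. (1 - b m) * t m) j) = 1" using F by simp
  qed
qed

lemma in_simplex_convex:
  assumes "in_simplex t" "in_simplex t'" "0 \<le> b" "b \<le> 1"
  shows "in_simplex (\<lambda>i. (1 - b) * t i + b * t' i)"
proof -
  let ?K = "{i. t i \<noteq> 0} \<union> {i. t' i \<noteq> 0}"
  have fin: "finite ?K" using assms by (simp add: in_simplex_def)
  have "sum t ?K = (\<Sum>i | t i \<noteq> 0. t i)" by (rule sum.mono_neutral_right[OF fin]) auto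
  moreover have "sum t' ?K = (\<Sum>i | t' i \<noteq> 0. t' i)" by (rule sum.mono_neutral_right[OF fin]) auto
  ultimately have "(\<Sum>i\<in>?K. (1 - b) * t i + b * t' i) = 1"
    using assms by (simp add: sum.distrib sum_distrib_left[symmetric] in_simplex_def)
  then show ?thesis using assms fin by (intro in_simplexI[of _ ?K]) (auto simp: in_simplex_def)
qed

lemma in_simplex_slot_weight:
  assumes "in_simplex t" "inj \<phi>"
  shows "in_simplex (slot_weight \<phi> t)"
  using in_simplex_interpolate[OF assms, of "\<lambda>_. 0"] by simp

context diff_group
begin

lemma mkE_eqI: "t = t' \<Longrightarrow> (\<And>i. t i \<noteq> 0 \<Longrightarrow> g i = g' i) \<Longrightarrow> mkE t g = mkE t' g'"
  using mkE_cong by blast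

context
  fixes X :: "'x diffeology" and E :: "'e diffeology" and \<pi> a
  assumes T: "torsor X E \<pi> a"
begin

definition equivariantly_homotopic where
  "equivariantly_homotopic \<theta> \<theta>' \<longleftrightarrow> (\<exists>\<Theta>. smooth_map (prod_diffeology E real_diffeology) EG \<Theta> \<and>
     (\<forall>g\<in>carrier G. \<forall>e\<in>carrier E. \<forall>s. \<Theta> (a g e, s) = milnor_act G g (\<Theta> (e, s))) \<and>
     (\<forall>e\<in>carrier E. \<Theta> (e, 0) = \<theta> e \<and> \<Theta> (e, 1) = \<theta>' e))"

lemma equivariantly_homotopic_covers:
  assumes "equivariantly_homotopic \<theta> \<theta>'" "covers E \<pi> \<theta> f" "covers E \<pi> \<theta>' f'"
  shows "smoothly_homotopic X BG f f'"
proof -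
  obtain \<Theta> where \<Theta>: "smooth_map (prod_diffeology E real_diffeology) EG \<Theta>"
    "\<forall>g\<in>carrier G. \<forall>e\<in>carrier E. \<forall>s. \<Theta> (a g e, s) = milnor_act G g (\<Theta> (e, s))"
    "\<forall>e\<in>carrier E. \<Theta> (e, 0) = \<theta> e \<and> \<Theta> (e, 1) = \<theta>' e"
    using assms(1) unfolding equivariantly_homotopic_def by (elim exE conjE)
  show ?thesis
    by (rule equivariant_homotopy_descends[OF T \<Theta>(1)]) (use assms(2,3) \<Theta>(2,3) in \<open>auto simp: covers_def\<close>)
qed

lemma equivariant_map_end:
  assumes \<Theta>: "smooth_map (prod_diffeology E real_diffeology) EG \<Theta>"
    "\<And>g e s. g \<in> carrier G \<Longrightarrow> e \<in> carrier E \<Longrightarrow> \<Theta> (a g e, s) = milnor_act G g (\<Theta> (e, s))"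
    and "\<And>e. e \<in> carrier E \<Longrightarrow> \<theta> e = \<Theta> (e, s)"
  shows "equivariant_map E a \<theta>"
proof -
  note E = torsor_total_space[OF T]
  have "smooth_map E EG (\<lambda>e. \<Theta> (e, s))"
    by (rule smooth_map_compose[OF smooth_map_Pair[OF smooth_map_id smooth_real_const[OF E]] \<Theta>(1)])
  then have "smooth_map E EG \<theta>" by (rule smooth_map_cong[OF E EG_space]) (rule assms(3))
  then show ?thesis using assms(2,3) torsor_act_in[OF T] by (simp add: equivariant_map_def)
qed

text \<open>Reduces an equivariant homotopy to its coordinates: invariant weights, and group
  coordinates that pick up \<open>inv g\<close> on the right wherever the weight is non-zero. The
  second conclusion comes along because \<open>\<theta>'\<close> is a slice of the homotopy; it
  serves end maps that are given only by coordinates.\<close>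

lemma equivariant_homotopyI:
  assumes v: "\<And>e s. e \<in> carrier E \<Longrightarrow> valid_coords (t e s) (\<gamma> e s)"
    and sm: "\<And>i. smooth_real (prod_diffeology E real_diffeology) (\<lambda>(e, s). t e s i)"
    and loc: "\<And>n U p q u. p \<in> plots E n U \<Longrightarrow> q \<in> plots real_diffeology n U \<Longrightarrow> u \<in> U \<Longrightarrow>
      \<exists>V c. eopen n V \<and> u \<in> V \<and> V \<subseteq> U \<and>
      (\<forall>i. c i \<in> plots D n V \<and> (\<forall>v\<in>V. t (p v) (q v) i \<noteq> 0 \<longrightarrow> c i v = \<gamma> (p v) (q v) i))"
    and ti: "\<And>g e s. g \<in> carrier G \<Longrightarrow> e \<in> carrier E \<Longrightarrow> t (a g e) s = t e s"
    and gi: "\<And>g e s i. g \<in> carrier G \<Longrightarrow> e \<in> carrier E \<Longrightarrow> t e s i \<noteq> 0 \<Longrightarrow> \<gamma> (a g e) s i = \<gamma> e s i \<otimes> inv g"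
    and ends: "\<And>e. e \<in> carrier E \<Longrightarrow> mkE (t e 0) (\<gamma> e 0) = \<theta> e" "\<And>e. e \<in> carrier E \<Longrightarrow> mkE (t e 1) (\<gamma> e 1) = \<theta>' e"
  shows "equivariantly_homotopic \<theta> \<theta>' \<and> equivariant_map E a \<theta>'"
proof -
  note ER = diffeological_space_prod[OF torsor_total_space[OF T] diffeological_space_real]
  define \<Theta> where "\<Theta> z = mkE (t (fst z) (snd z)) (\<gamma> (fst z) (snd z))" for z
  have \<Theta>: "smooth_map (prod_diffeology E real_diffeology) EG \<Theta>"
    unfolding \<Theta>_def
  proof (rule EG_mapI[OF ER])
    show "valid_coords (t (fst z) (snd z)) (\<gamma> (fst z) (snd z))" if "z \<in> carrier (prod_diffeology E real_diffeology)" for z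
      using that v by auto
    show "smooth_real (prod_diffeology E real_diffeology) (\<lambda>z. t (fst z) (snd z) i)" for i
      using sm[of i] by (simp add: case_prod_unfold)
    fix n U p u assume "p \<in> plots (prod_diffeology E real_diffeology) n U" "u \<in> U"
    then show "\<exists>V \<gamma>'. eopen n V \<and> u \<in> V \<and> V \<subseteq> U \<and> (\<forall>i. \<gamma>' i \<in> plots D n V \<and>
       (\<forall>v\<in>V. t (fst (p v)) (snd (p v)) i \<noteq> 0 \<longrightarrow> \<gamma>' i v = \<gamma> (fst (p v)) (snd (p v)) i))"
      using loc[of "\<lambda>u. fst (p u)" n U "\<lambda>u. snd (p u)" u] by (simp add: plots_prod)
  qed
  have eq: "\<Theta> (a g e, s) = milnor_act G g (\<Theta> (e, s))" if "g \<in> carrier G" "e \<in> carrier E" for g e s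
    using milnor_act_mkE[OF v[OF that(2), of s] that(1)] ti[OF that, of s]
      mkE_cong[of "t e s" "\<gamma> (a g e) s" "\<lambda>i. \<gamma> e s i \<otimes> inv g", OF gi[OF that]] by (simp add: \<Theta>_def)
  have "equivariantly_homotopic \<theta> \<theta>'"
    unfolding equivariantly_homotopic_def using \<Theta> eq ends by (intro exI[of _ \<Theta>]) (simp add: \<Theta>_def)
  moreover have "equivariant_map E a \<theta>'"
    by (rule equivariant_map_end[OF \<Theta> eq, of _ 1]) (simp_all add: \<Theta>_def ends)
  ultimately show ?thesis ..
qed

lemma equivariant_mapD:
  assumes "equivariant_map E a \<theta>"
  shows "smooth_map E EG \<theta>" "e \<in> carrier E \<Longrightarrow> \<theta> e \<in> carrier EG"
    "g \<in> carrier G \<Longrightarrow> e \<in> carrier E \<Longrightarrow> tco (\<theta> (a g e)) = tco (\<theta> e)"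
    "g \<in> carrier G \<Longrightarrow> e \<in> carrier E \<Longrightarrow> tco (\<theta> e) i \<noteq> 0 \<Longrightarrow> gco (\<theta> (a g e)) i = gco (\<theta> e) i \<otimes> inv g"
    "smooth_real E (\<lambda>e. tco (\<theta> e) i)"
    "p \<in> plots E n U \<Longrightarrow> (\<lambda>u. \<theta> (p u)) \<in> plots EG n U"
  using assms smooth_map_carrier[of E EG \<theta>] tco_act gco_act smooth_map_compose[of E EG \<theta>, OF _ smooth_tco]
    smooth_map_plot[of E EG \<theta>]
  by (auto simp: equivariant_map_def)

definition locally_finite_coords where
  "locally_finite_coords \<theta> \<longleftrightarrow> (\<forall>n U. \<forall>p\<in>plots E n U. \<forall>u\<in>U. \<exists>V m. eopen n V \<and> u \<in> V \<and> V \<subseteq> U \<and>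
     (\<forall>v\<in>V. \<forall>i\<ge>m. tco (\<theta> (p v)) i = 0))"

text \<open>Only the weights change; the group coordinates of \<open>\<theta>\<close> stay. This is
  legitimate because \<open>\<xi> i\<close> is non-zero only where the old weight is, so no slot is
  filled that lacks a group coordinate.\<close>

lemma homotopic_to_locally_finite:
  assumes sp: "smoothly_paracompact X" and \<theta>: "equivariant_map E a \<theta>" "covers E \<pi> \<theta> f" and f: "smooth_map X BG f"
  obtains \<theta>' where "equivariantly_homotopic \<theta> \<theta>'" "equivariant_map E a \<theta>'" "locally_finite_coords \<theta>'"
proof -
  note X = torsor_base_space[OF T] and E = torsor_total_space[OF T] and eq = equivariant_mapD[OF \<theta>(1)]
  note ER = diffeological_space_prod[OF E diffeological_space_real]
  define W where "W i = {x \<in> carrier X. tcoB (f x) i \<noteq> 0}" for i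
  have "open_cover (D_topology X) UNIV W"
    unfolding open_cover_def topspace_D_topology[OF X]
  proof (intro conjI ballI)
    show "openin (D_topology X) (W i)" for i
      unfolding W_def by (rule D_open_nonzero[OF X smooth_map_compose[OF f smooth_tcoB]])
    show "(\<Union>i. W i) = carrier X"
      using in_simplex_nonzero[OF in_simplex_tcoB[OF smooth_map_carrier[OF f]]] by (auto simp: W_def)
  qed
  then obtain \<xi> where "subordinate_partition_of_unity X UNIV W \<xi>"
    using smoothly_paracompact_countable[OF X sp] by blast
  then have pou: "pointwise_finite_partition_of_unity X UNIV \<xi>"
    and lf: "locally_finite_family (D_topology X) UNIV (\<lambda>i. smooth_support X (\<xi> i))"
    and sub: "\<And>i. smooth_support X (\<xi> i) \<subseteq> W i"
    by (auto simp: subordinate_partition_of_unity_def)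
  have nz: "tco (\<theta> e) i \<noteq> 0" if e: "e \<in> carrier E" and "\<xi> i (\<pi> e) \<noteq> 0" for e i
  proof -
    have "\<pi> e \<in> W i" using smooth_support_superset[where f = "\<xi> i", OF X torsor_proj_in[OF T e] that(2)] sub by blast
    moreover have "tcoB (f (\<pi> e)) = tco (\<theta> e)" using \<theta>(2) e tcoB_projB[OF eq(2)[OF e]] by (simp add: covers_def)
    ultimately show ?thesis by (simp add: W_def)
  qed
  define t where "t e s = (\<lambda>i. (1 - smooth_step s) * tco (\<theta> e) i + smooth_step s * \<xi> i (\<pi> e))" for e s
  define \<theta>' where "\<theta>' e = mkE (\<lambda>i. \<xi> i (\<pi> e)) (gco (\<theta> e))" for e
  have sx: "in_simplex (\<lambda>i. \<xi> i (\<pi> e))" if "e \<in> carrier E" for e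
    by (rule in_simplex_partition[OF X pou torsor_proj_in[OF T that]])
  have tnz: "tco (\<theta> e) i \<noteq> 0" if "e \<in> carrier E" "t e s i \<noteq> 0" for e s i
    using that nz[of e i] by (auto simp: t_def)
  have "equivariantly_homotopic \<theta> \<theta>' \<and> equivariant_map E a \<theta>'"
  proof (rule equivariant_homotopyI[of t "\<lambda>e s. gco (\<theta> e)"], goal_cases)
    case (1 e s) then show ?case
      using in_simplex_convex[OF in_simplex_tco[OF eq(2)[OF 1]] sx[OF 1] smooth_step_bounds] gco_in[OF eq(2)[OF 1]]
      by (simp add: valid_coords_def t_def)
  next
    case (2 i)
    have "smooth_real (prod_diffeology E real_diffeology) (\<lambda>z. (1 - smooth_step (snd z)) * tco (\<theta> (fst z)) i + smooth_step (snd z) * \<xi> i (\<pi> (fst z)))"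
      by (intro smooth_real_add smooth_real_mult smooth_real_diff smooth_real_const smooth_real_step ER smooth_real_snd
          smooth_map_compose[OF smooth_map_fst eq(5)]
          smooth_map_compose[OF smooth_map_fst smooth_map_compose[OF torsor_proj[OF T] smooth_real_partition[OF X pou]]])
    then show ?case by (simp add: t_def case_prod_unfold)
  next
    case (3 n U p q u)
    obtain V c where V: "eopen n V" "u \<in> V" "V \<subseteq> U" "\<And>i. c i \<in> plots D n V"
      "\<And>i v. v \<in> V \<Longrightarrow> tco (\<theta> (p v)) i \<noteq> 0 \<Longrightarrow> c i v = gco (\<theta> (p v)) i"
      using EG_plotE[OF eq(6)[OF 3(1)] 3(3)] by metis
    have "\<forall>v\<in>V. t (p v) (q v) i \<noteq> 0 \<longrightarrow> c i v = gco (\<theta> (p v)) i" for i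
      using V(3,5) tnz plot_in_carrier[OF E 3(1)] by blast
    then show ?case using V(1-4) by blast
  next
    case (4 g e s) then show ?case
      using eq(3)[OF 4] torsor_proj_act[OF T 4] by (simp add: t_def)
  next
    case (5 g e s i) then show ?case using eq(4)[OF 5(1,2) tnz[OF 5(2,3)]] by simp
  next
    case (6 e) then show ?case using mkE_tco[OF eq(2)[OF 6]] by (simp add: t_def smooth_step_0)
  next
    case (7 e) then show ?case by (simp add: t_def \<theta>'_def smooth_step_1)
  qed
  moreover have "locally_finite_coords \<theta>'"
    unfolding locally_finite_coords_def
  proof (intro allI ballI)
    fix n U p u assume p: "p \<in> plots E n U" and u: "u \<in> U"
    note pp = smooth_map_plot[OF torsor_proj[OF T] p]
    have px: "\<pi> (p v) \<in> carrier X" if "v \<in> U" for v by (rule plot_in_carrier[OF X pp that])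
    obtain O' where O': "openin (D_topology X) O'" "\<pi> (p u) \<in> O'" "finite {i. smooth_support X (\<xi> i) \<inter> O' \<noteq> {}}"
      using lf px[OF u] unfolding locally_finite_family_def topspace_D_topology[OF X] by auto
    obtain m where m: "\<And>i. smooth_support X (\<xi> i) \<inter> O' \<noteq> {} \<Longrightarrow> i < m"
      using O'(3) unfolding finite_nat_set_iff_bounded by blast
    have "tco (\<theta>' (p v)) i = 0" if v: "v \<in> U" "\<pi> (p v) \<in> O'" and i: "i \<ge> m" for v i
    proof -
      have e: "p v \<in> carrier E" by (rule plot_in_carrier[OF E p v(1)])
      have "valid_coords (\<lambda>i. \<xi> i (\<pi> (p v))) (gco (\<theta> (p v)))"
        using sx[OF e] gco_in[OF eq(2)[OF e]] by (simp add: valid_coords_def)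
      moreover have "\<xi> i (\<pi> (p v)) = 0"
        using smooth_support_superset[where f = "\<xi> i", OF X px[OF v(1)]] m[of i] i v(2) by force
      ultimately show ?thesis by (simp add: \<theta>'_def tco_mkE)
    qed
    then show "\<exists>V m. eopen n V \<and> u \<in> V \<and> V \<subseteq> U \<and> (\<forall>v\<in>V. \<forall>i\<ge>m. tco (\<theta>' (p v)) i = 0)"
      using D_open_plot[OF O'(1) pp] u O'(2) by (intro exI[of _ "{v \<in> U. \<pi> (p v) \<in> O'}"] exI[of _ m]) auto
  qed
  ultimately show ?thesis using that by blast
qed

definition spread :: "(nat \<Rightarrow> nat) \<Rightarrow> ('e \<Rightarrow> ((nat \<Rightarrow> real) \<times> (nat \<Rightarrow> 'g)) set) \<Rightarrow> 'e \<Rightarrow> ((nat \<Rightarrow> real) \<times> (nat \<Rightarrow> 'g)) set" where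
  "spread \<phi> \<theta> e = mkE (slot_weight \<phi> (tco (\<theta> e))) (\<lambda>j. gco (\<theta> e) (inv_into UNIV \<phi> j))"

text \<open>The coordinates return from slots \<open>\<phi> m\<close> to slots \<open>m\<close> one
  after the other. A slot \<open>j\<close> may have two sources, \<open>j\<close> itself and its
  preimage under \<open>\<phi>\<close>; if the latter is smaller, it has left before
  \<open>j\<close> comes in. Near the end infinitely many switches crowd together, and local
  finiteness of the coordinates leaves only finitely many of them to consider.\<close>

lemma homotopic_to_spread:
  assumes \<theta>: "equivariant_map E a \<theta>" and lf: "locally_finite_coords \<theta>" and \<phi>: "strict_mono \<phi>"
  shows "equivariantly_homotopic (spread \<phi> \<theta>) \<theta>"
proof -
  note E = torsor_total_space[OF T] and eq = equivariant_mapD[OF \<theta>]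
  note ER = diffeological_space_prod[OF E diffeological_space_real]
  have inj: "inj \<phi>" using \<phi> by (rule strict_mono_imp_inj_on)
  have inv\<phi>: "inv_into UNIV \<phi> (\<phi> m) = m" for m using inj by simp
  have ge: "m \<le> \<phi> m" for m using \<phi> by (rule strict_mono_imp_increasing)
  define t where "t e s = (\<lambda>j. spread_step j s * tco (\<theta> e) j +
    slot_weight \<phi> (\<lambda>m. (1 - spread_step m s) * tco (\<theta> e) m) j)" for e s
  \<comment> \<open>Two different sources never occupy a slot at the same time, so the case
    distinction picks the one that is present.\<close>
  define g where "g e s = (\<lambda>j. if spread_step j s * tco (\<theta> e) j \<noteq> 0 then gco (\<theta> e) j else gco (\<theta> e) (inv_into UNIV \<phi> j))" for e s
  have cases: "spread_step j s * tco (\<theta> e) j \<noteq> 0 \<and> g e s j = gco (\<theta> e) j \<or>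
      spread_step j s * tco (\<theta> e) j = 0 \<and> g e s j = gco (\<theta> e) (inv_into UNIV \<phi> j) \<and>
      (1 - spread_step (inv_into UNIV \<phi> j) s) * tco (\<theta> e) (inv_into UNIV \<phi> j) \<noteq> 0 \<and> j \<in> range \<phi>"
    if "t e s j \<noteq> 0" for e s j
    using that by (auto simp: t_def g_def slot_weight_def split: if_splits)
  show ?thesis
  proof (rule equivariant_homotopyI[of t g, THEN conjunct1], goal_cases)
    case (1 e s)
    have "in_simplex (t e s)"
      unfolding t_def by (rule in_simplex_interpolate[OF in_simplex_tco[OF eq(2)[OF 1]] inj]) (simp add: spread_step_bounds)
    then show ?case using gco_in[OF eq(2)[OF 1]] by (simp add: valid_coords_def g_def)
  next
    case (2 i)
    have st: "smooth_real (prod_diffeology E real_diffeology) (\<lambda>z. spread_step j (snd z))" for j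
      unfolding spread_step_def
      by (intro smooth_real_step smooth_real_mult smooth_real_diff smooth_real_const ER smooth_real_snd)
    have tt: "smooth_real (prod_diffeology E real_diffeology) (\<lambda>z. tco (\<theta> (fst z)) j)" for j
      by (rule smooth_map_compose[OF smooth_map_fst eq(5)])
    have "smooth_real (prod_diffeology E real_diffeology) (\<lambda>z. slot_weight \<phi> (\<lambda>m. (1 - spread_step m (snd z)) * tco (\<theta> (fst z)) m) i)"
      unfolding slot_weight_def
      by (cases "i \<in> range \<phi>") (simp_all del: image_iff add: smooth_real_const ER smooth_real_mult smooth_real_diff st tt)
    then show ?case by (simp add: t_def case_prod_unfold smooth_real_add smooth_real_mult st tt ER)
  next
    case (3 n U p q u)
    note pE = plot_in_carrier[OF E 3(1)]
    obtain V1 m where V1: "eopen n V1" "u \<in> V1" "V1 \<subseteq> U" "\<And>v i. v \<in> V1 \<Longrightarrow> i \<ge> m \<Longrightarrow> tco (\<theta> (p v)) i = 0"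
      using lf 3(1,3) unfolding locally_finite_coords_def by metis
    obtain V2 c where V2: "eopen n V2" "u \<in> V2" "V2 \<subseteq> U" "\<And>i. c i \<in> plots D n V2"
      "\<And>i v. v \<in> V2 \<Longrightarrow> tco (\<theta> (p v)) i \<noteq> 0 \<Longrightarrow> c i v = gco (\<theta> (p v)) i"
      using EG_plotE[OF eq(6)[OF 3(1)] 3(3)] by metis
    define V0 where "V0 = V1 \<inter> V2"
    have V0: "eopen n V0" "u \<in> V0" "V0 \<subseteq> U" using V1 V2 by (auto simp: V0_def intro: eopen_Int)
    have cq: "continuous_on V0 (\<lambda>v. (1 - q v) * 2 ^ j)" for j
      using smooth_function_continuous[OF V0(1)] plot_restrict[OF diffeological_space_real 3(2) V0(1,3)]
      by (intro continuous_intros) (simp add: plots_real)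
    have "\<exists>V \<gamma>. eopen n V \<and> u \<in> V \<and> V \<subseteq> V0 \<and>
        (\<forall>j. \<gamma> j \<in> plots D n V \<and> (\<forall>v\<in>V. t (p v) (q v) j \<noteq> 0 \<longrightarrow> \<gamma> j v = g (p v) (q v) j))"
    proof (rule finite_local_plots[OF V0(1,2) finite_lessThan[of "\<phi> m"]])
      \<comment> \<open>From \<open>\<phi> m\<close> on every slot is empty: its own index is at
        least \<open>m\<close>, and so is any index that is sent to it.\<close>
      fix j v y assume j: "j \<notin> {..<\<phi> m}" and v: "v \<in> V0"
      have "tco (\<theta> (p v)) j = 0" using V1(4)[of v j] j v ge[of m] by (auto simp: V0_def)
      moreover have "tco (\<theta> (p v)) k = 0" if "j = \<phi> k" for k
        using V1(4)[of v k] j v that strict_mono_less_eq[OF \<phi>, of m k] by (auto simp: V0_def)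
      ultimately have "t (p v) (q v) j = 0" by (auto simp: t_def slot_weight_def inv\<phi>)
      then show "t (p v) (q v) j \<noteq> 0 \<longrightarrow> y = g (p v) (q v) j" by simp
    next
      fix j
      have one: "\<exists>V \<gamma>. eopen n V \<and> u \<in> V \<and> \<gamma> \<in> plots D n V \<and>
          (\<forall>v\<in>V \<inter> V0. t (p v) (q v) j \<noteq> 0 \<longrightarrow> \<gamma> v = g (p v) (q v) j)"
        if V: "eopen n V" "u \<in> V" "V \<subseteq> V0" and k: "\<And>v. v \<in> V \<Longrightarrow> t (p v) (q v) j \<noteq> 0 \<Longrightarrow>
          g (p v) (q v) j = gco (\<theta> (p v)) k \<and> tco (\<theta> (p v)) k \<noteq> 0" for V k
        using V k V2(5) plot_restrict[OF D_space V2(4) V(1), of k]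
        by (intro exI[of _ V] exI[of _ "c k"]) (auto simp: V0_def)
      show "\<exists>V \<gamma>. eopen n V \<and> u \<in> V \<and> \<gamma> \<in> plots D n V \<and>
          (\<forall>v\<in>V \<inter> V0. t (p v) (q v) j \<noteq> 0 \<longrightarrow> \<gamma> v = g (p v) (q v) j)"
      proof (cases "j \<in> range \<phi> \<and> inv_into UNIV \<phi> j < j")
        case False
        \<comment> \<open>Either nothing is sent to \<open>j\<close>, or \<open>j\<close> is fixed
          by \<open>\<phi>\<close>; in both cases its only source is \<open>j\<close>
          itself.\<close>
        show ?thesis
        proof (rule one[OF V0(1,2) subset_refl, of j])
          fix v assume "t (p v) (q v) j \<noteq> 0"
          from cases[OF this] False ge[of "inv_into UNIV \<phi> j"] show "g (p v) (q v) j = gco (\<theta> (p v)) j \<and> tco (\<theta> (p v)) j \<noteq> 0"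
            by (auto simp: inv\<phi>)
        qed
      next
        case k: True
        \<comment> \<open>While \<open>(1 - s) * 2 ^ j\<close> exceeds 1, slot \<open>j\<close> has
          not started; once it is below 3/2, the smaller source is finished. The two open conditions
          overlap, so one of them holds on a neighbourhood of \<open>u\<close>.\<close>
        show ?thesis
        proof (cases "(1 - q u) * 2 ^ j > 1")
          case True
          let ?V = "{v \<in> V0. (1 - q v) * 2 ^ j \<in> {1<..}}"
          show ?thesis
          proof (rule one[of ?V "inv_into UNIV \<phi> j"])
            show "eopen n ?V" by (rule eopen_preimage[OF V0(1) cq]) simp
            fix v assume v: "v \<in> ?V" and nz: "t (p v) (q v) j \<noteq> 0"
            then have "spread_step j (q v) = 0" by (intro spread_step_0) simp
            then show "g (p v) (q v) j = gco (\<theta> (p v)) (inv_into UNIV \<phi> j) \<and> tco (\<theta> (p v)) (inv_into UNIV \<phi> j) \<noteq> 0"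
              using cases[OF nz] by auto
          qed (use V0 True in auto)
        next
          case False
          let ?V = "{v \<in> V0. (1 - q v) * 2 ^ j \<in> {..<3/2}}"
          show ?thesis
          proof (rule one[of ?V j])
            show "eopen n ?V" by (rule eopen_preimage[OF V0(1) cq]) simp
            fix v assume v: "v \<in> ?V" and nz: "t (p v) (q v) j \<noteq> 0"
            then have "spread_step (inv_into UNIV \<phi> j) (q v) = 1" using k by (intro spread_step_sequential[of _ j]) auto
            then show "g (p v) (q v) j = gco (\<theta> (p v)) j \<and> tco (\<theta> (p v)) j \<noteq> 0"
              using cases[OF nz] by auto
          qed (use V0 False in auto)
        qed
      qed
    qed
    then show ?case using V0(3) by (elim exE conjE) (rule exI, rule exI, intro conjI, assumption, assumption, blast, assumption)
  next
    case (4 h e s) then show ?case using eq(3)[OF 4] by (simp add: t_def)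
  next
    case (5 h e s j)
    have "g (a h e) s j = (if spread_step j s * tco (\<theta> e) j \<noteq> 0 then gco (\<theta> (a h e)) j else gco (\<theta> (a h e)) (inv_into UNIV \<phi> j))"
      using eq(3)[OF 5(1,2)] by (simp add: g_def)
    then show ?case using cases[OF 5(3)] eq(4)[OF 5(1,2)] by auto
  next
    case (6 e) then show ?case
      unfolding spread_def by (intro mkE_eqI) (auto simp: t_def g_def spread_step_at_0)
  next
    case (7 e)
    have z: "slot_weight \<phi> (\<lambda>m. 0) = (\<lambda>_. 0)" by (simp add: slot_weight_def fun_eq_iff)
    have "mkE (t e 1) (g e 1) = mkE (tco (\<theta> e)) (gco (\<theta> e))"
      by (rule mkE_eqI) (auto simp: t_def g_def spread_step_at_1 z)
    then show ?case using mkE_tco[OF eq(2)[OF 7]] by simp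
  qed
qed

text \<open>The two maps occupy disjoint slots, so along the linear path each slot has one source
  and a group coordinate independent of the parameter. Local lifts of the two maps interleave to a
  lift of the homotopy.\<close>

lemma spread_even_odd_homotopic:
  assumes \<theta>: "equivariant_map E a \<theta>" "equivariant_map E a \<theta>'"
  shows "equivariantly_homotopic (spread (\<lambda>m. 2 * m) \<theta>) (spread (\<lambda>m. 2 * m + 1) \<theta>') \<and>
    equivariant_map E a (spread (\<lambda>m. 2 * m + 1) \<theta>')"
proof -
  note E = torsor_total_space[OF T] and eq = equivariant_mapD[OF \<theta>(1)] and eq' = equivariant_mapD[OF \<theta>(2)]
  note ER = diffeological_space_prod[OF E diffeological_space_real]
  have inje: "inj (\<lambda>m::nat. 2 * m)" and injo: "inj (\<lambda>m::nat. 2 * m + 1)" by (auto simp: inj_def)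
  have inve: "inv_into UNIV (\<lambda>m::nat. 2 * m) j = j div 2" if "even j" for j
    using inv_f_f[OF inje, of "j div 2"] that by simp
  have invo: "inv_into UNIV (\<lambda>m::nat. 2 * m + 1) j = j div 2" if "odd j" for j
    using inv_f_f[OF injo, of "j div 2"] that by simp
  have re: "j \<in> range (\<lambda>m::nat. 2 * m) \<longleftrightarrow> even j" for j by (auto elim: evenE)
  have ro: "j \<in> range (\<lambda>m::nat. 2 * m + 1) \<longleftrightarrow> odd j" for j by (auto elim: oddE)
  have se: "slot_weight (\<lambda>m. 2 * m) w j = (if even j then w (j div 2) else 0)" for w j
    using inve unfolding slot_weight_def re by auto
  have so: "slot_weight (\<lambda>m. 2 * m + 1) w j = (if odd j then w (j div 2) else 0)" for w j
    using invo unfolding slot_weight_def ro by auto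
  note so' = so[simplified]
  define t where "t e s = (\<lambda>j. (1 - smooth_step s) * slot_weight (\<lambda>m. 2 * m) (tco (\<theta> e)) j +
    smooth_step s * slot_weight (\<lambda>m. 2 * m + 1) (tco (\<theta>' e)) j)" for e s
  define g where "g e s = (\<lambda>j. if even j then gco (\<theta> e) (j div 2) else gco (\<theta>' e) (j div 2))" for e and s :: real
  have tnz: "if even j then tco (\<theta> e) (j div 2) \<noteq> 0 else tco (\<theta>' e) (j div 2) \<noteq> 0" if "t e s j \<noteq> 0" for e s j
    using that by (auto simp: t_def se so' split: if_splits)
  show ?thesis
  proof (rule equivariant_homotopyI[of t g], goal_cases)
    case (1 e s) 
    have "in_simplex (t e s)" unfolding t_def
      by (intro in_simplex_convex in_simplex_slot_weight in_simplex_tco eq(2) eq'(2) inje injo smooth_step_bounds 1)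
    then show ?case using gco_in[OF eq(2)[OF 1]] gco_in[OF eq'(2)[OF 1]] by (simp add: valid_coords_def g_def)
  next
    case (2 i)
    have "smooth_real (prod_diffeology E real_diffeology) (\<lambda>z. tco (\<theta> (fst z)) j)"
      "smooth_real (prod_diffeology E real_diffeology) (\<lambda>z. tco (\<theta>' (fst z)) j)" for j
      by (rule smooth_map_compose[OF smooth_map_fst eq(5)] smooth_map_compose[OF smooth_map_fst eq'(5)])+
    moreover have "smooth_real (prod_diffeology E real_diffeology) (\<lambda>z. smooth_step (snd z))"
      by (intro smooth_real_step ER smooth_real_snd)
    ultimately show ?case
      by (cases "even i") (simp_all add: t_def se so' case_prod_unfold smooth_real_mult smooth_real_diff smooth_real_const ER)
  next
    case (3 n U p q u)
    obtain V c where V: "eopen n V" "u \<in> V" "V \<subseteq> U" "\<And>i. c i \<in> plots D n V"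
      "\<And>i v. v \<in> V \<Longrightarrow> tco (\<theta> (p v)) i \<noteq> 0 \<Longrightarrow> c i v = gco (\<theta> (p v)) i"
      using EG_plotE[OF eq(6)[OF 3(1)] 3(3)] by metis
    obtain V' c' where V': "eopen n V'" "u \<in> V'" "V' \<subseteq> U" "\<And>i. c' i \<in> plots D n V'"
      "\<And>i v. v \<in> V' \<Longrightarrow> tco (\<theta>' (p v)) i \<noteq> 0 \<Longrightarrow> c' i v = gco (\<theta>' (p v)) i"
      using EG_plotE[OF eq'(6)[OF 3(1)] 3(3)] by metis
    have W: "eopen n (V \<inter> V')" using V V' by (intro eopen_Int)
    define d where "d j = (if even j then c (j div 2) else c' (j div 2))" for j
    have "d j \<in> plots D n (V \<inter> V')" for j
      using plot_restrict[OF D_space V(4) W] plot_restrict[OF D_space V'(4) W] by (simp add: d_def)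
    moreover have "\<forall>v\<in>V \<inter> V'. t (p v) (q v) j \<noteq> 0 \<longrightarrow> d j v = g (p v) (q v) j" for j
      using tnz[of "p v" "q v" j for v] V(5) V'(5) by (auto simp: d_def g_def split: if_splits)
    ultimately show ?case using W V(2,3) V'(2) by (intro exI[of _ "V \<inter> V'"] exI[of _ d]) auto
  next
    case (4 h e s) then show ?case using eq(3)[OF 4] eq'(3)[OF 4] by (simp add: t_def)
  next
    case (5 h e s j)
    then show ?case using tnz[OF 5(3)] eq(4)[OF 5(1,2)] eq'(4)[OF 5(1,2)] by (auto simp: g_def split: if_splits)
  next
    case (6 e) then show ?case unfolding spread_def
      by (intro mkE_eqI) (auto simp: t_def g_def smooth_step_0 se inve split: if_splits)
  next
    case (7 e) then show ?case unfolding spread_def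
      by (intro mkE_eqI) (auto simp: t_def g_def smooth_step_1 so' invo[simplified] split: if_splits)
  qed
qed

lemma classifies_unique:
  assumes sp: "smoothly_paracompact X" and "classifies X E \<pi> a f" "classifies X E \<pi> a f'"
  shows "smoothly_homotopic X BG f f'"
proof -
  note X = torsor_base_space[OF T]
  note trans = smoothly_homotopic_trans[OF X BG_space] and sym = smoothly_homotopic_sym[OF X]
  obtain \<theta> \<theta>' where f: "smooth_map X BG f" "equivariant_map E a \<theta>" "covers E \<pi> \<theta> f"
    and f': "smooth_map X BG f'" "equivariant_map E a \<theta>'" "covers E \<pi> \<theta>' f'"
    using assms(2,3) unfolding classifies_def by blast
  obtain \<sigma> where \<sigma>: "equivariantly_homotopic \<theta> \<sigma>" "equivariant_map E a \<sigma>" "locally_finite_coords \<sigma>"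
    using homotopic_to_locally_finite[OF sp f(2,3,1)] .
  obtain \<sigma>' where \<sigma>': "equivariantly_homotopic \<theta>' \<sigma>'" "equivariant_map E a \<sigma>'" "locally_finite_coords \<sigma>'"
    using homotopic_to_locally_finite[OF sp f'(2,3,1)] .
  let ?e = "spread (\<lambda>m. 2 * m) \<sigma>" and ?o = "spread (\<lambda>m. 2 * m + 1) \<sigma>'"
  have he: "equivariantly_homotopic ?e \<sigma>" and ho: "equivariantly_homotopic ?o \<sigma>'"
    by (rule homotopic_to_spread[OF \<sigma>(2,3)] homotopic_to_spread[OF \<sigma>'(2,3)], simp add: strict_mono_def)+
  note eo = spread_even_odd_homotopic[OF \<sigma>(2) \<sigma>'(2), THEN conjunct1] spread_even_odd_homotopic[OF \<sigma>(2) \<sigma>'(2), THEN conjunct2]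
  obtain k where k: "covers E \<pi> \<sigma> k" using equivariant_map_covers[OF T \<sigma>(2)] .
  obtain k' where k': "covers E \<pi> \<sigma>' k'" using equivariant_map_covers[OF T \<sigma>'(2)] .
  obtain l' where l': "covers E \<pi> ?o l'" using equivariant_map_covers[OF T eo(2)] .
  \<comment> \<open>The even spread is smooth and equivariant because it is the start of the
    homotopy \<open>he\<close>.\<close>
  have "\<exists>l. covers E \<pi> ?e l"
  proof -
    obtain \<Theta> where "smooth_map (prod_diffeology E real_diffeology) EG \<Theta>"
      "\<forall>g\<in>carrier G. \<forall>e\<in>carrier E. \<forall>s. \<Theta> (a g e, s) = milnor_act G g (\<Theta> (e, s))"
      "\<forall>e\<in>carrier E. \<Theta> (e, 0) = ?e e \<and> \<Theta> (e, 1) = \<sigma> e"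
      using he unfolding equivariantly_homotopic_def by (elim exE conjE)
    then have "equivariant_map E a ?e" by (intro equivariant_map_end[of \<Theta> _ 0]) simp_all
    then show ?thesis using equivariant_map_covers[OF T] by blast
  qed
  then obtain l where l: "covers E \<pi> ?e l" ..
  note h = equivariantly_homotopic_covers
  show ?thesis
    by (rule trans[OF h[OF \<sigma>(1) f(3) k] trans[OF sym[OF h[OF he l k]]
          trans[OF h[OF eo(1) l l'] trans[OF h[OF ho l' k'] sym[OF h[OF \<sigma>'(1) f'(3) k']]]]]])
qed

end

end

section \<open>The covering homotopy theorem\<close>

text \<open>The product of \<open>U\<close> with the line is realised as an open set in dimension
  \<open>n + 1\<close>, with the real parameter in coordinate \<open>n\<close>. There
  \<open>\<tau>\<close> is composed with a plot of the product and becomes a smooth function, hence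
  a jointly continuous one.\<close>

lemma continuous_on_plot_times_real:
  assumes X: "diffeological_space X" and p: "p \<in> plots X n U"
    and \<tau>: "smooth_real (prod_diffeology X real_diffeology) \<tau>"
  shows "continuous_on (U \<times> UNIV) (\<lambda>z. \<tau> (p (fst z), snd z))"
proof -
  note U = plot_eopen[OF X p]
  obtain O' where O': "open O'" "U = {x. \<forall>i\<ge>n. x i = 0} \<inter> O'"
    using U unfolding Euclidean_space_eq openin_open by blast
  \<comment> \<open>These are the points in dimension \<open>n + 1\<close> whose first
    \<open>n\<close> coordinates form a point of \<open>U\<close>; erasing coordinate
    \<open>n\<close> recovers that point.\<close>
  define W where "W = {y \<in> topspace (Euclidean_space (Suc n)). y(n := 0) \<in> O'}"
  have cu: "continuous_on S (\<lambda>y :: nat \<Rightarrow> real. y(n := 0))" for S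
  proof (rule continuous_on_coordinatewise_then_product)
    fix i show "continuous_on S (\<lambda>y :: nat \<Rightarrow> real. (y(n := 0)) i)"
      by (cases "i = n") (auto intro: continuous_on_subset[OF continuous_on_product_coordinates])
  qed
  have W: "eopen (Suc n) W"
    unfolding W_def by (rule eopen_preimage[OF openin_topspace cu O'(1)])
  have "smooth_between (Suc n) W n U (\<lambda>y. y(n := 0))"
    unfolding smooth_between_def
  proof (intro conjI allI impI)
    show "(\<lambda>y. y(n := 0)) \<in> W \<rightarrow> U"
      by (auto simp: W_def O' topspace_Euclidean_space)
    fix i assume "i < n"
    then have "(\<lambda>v :: nat \<Rightarrow> real. (v(n := 0)) i) = (\<lambda>v. v i)" by auto
    then show "smooth_function (Suc n) W (\<lambda>v. (v(n := 0)) i)" using smooth_function_coord[OF W] by simp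
  qed
  then have "(\<lambda>y. (p (y(n := 0)), y n)) \<in> plots (prod_diffeology X real_diffeology) (Suc n) W"
    using plot_compose[OF X p W] smooth_function_coord[OF W] W by (simp add: plots_prod plots_real)
  from smooth_function_continuous[OF W smooth_real_plot[OF \<tau> this]]
  have c: "continuous_on W (\<lambda>y. \<tau> (p (y(n := 0)), y n))" .
  have ci: "continuous_on (U \<times> UNIV) (\<lambda>z. (fst z)(n := snd z))"
  proof (rule continuous_on_coordinatewise_then_product)
    fix i show "continuous_on (U \<times> UNIV) (\<lambda>z. ((fst z)(n := snd z)) i)"
    proof (cases "i = n")
      case True
      then show ?thesis by (simp add: continuous_on_snd)
    next
      case False
      then show ?thesis
        using continuous_on_product_then_coordinatewise[OF continuous_on_fst[OF continuous_on_id], of "U \<times> UNIV" i]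
        by simp
    qed
  qed
  have z0: "u(n := 0) = u" if "u \<in> U" for u using eopen_zero[OF U that, of n] by auto
  have im: "(\<lambda>z. (fst z)(n := snd z)) ` (U \<times> UNIV) \<subseteq> W"
    using z0 by (auto simp: W_def O'(2) topspace_Euclidean_space)
  have "continuous_on (U \<times> UNIV) (\<lambda>z. \<tau> (p (((fst z)(n := snd z))(n := 0)), ((fst z)(n := snd z)) n))"
    by (rule continuous_on_compose2[OF c ci im])
  then show ?thesis
    by (rule continuous_on_eq) (use z0 in auto)
qed

text \<open>The tube lemma: the bad parameters form the projection of a closed subset of
  \<open>U\<close> times a compact interval, and projection along a compact factor is a closed
  map.\<close>

lemma D_open_tube:
  assumes X: "diffeological_space X" and \<tau>: "smooth_real (prod_diffeology X real_diffeology) \<tau>"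
  shows "openin (D_topology X) {x \<in> carrier X. \<forall>s\<in>{c..d}. \<tau> (x, s) \<noteq> 0}"
  unfolding openin_D_topology
proof (intro conjI allI ballI)
  fix n U p assume p: "p \<in> plots X n U"
  let ?F = "\<lambda>z. \<tau> (p (fst z), snd z)"
  have c: "continuous_on (U \<times> {c..d}) ?F"
    by (rule continuous_on_subset[OF continuous_on_plot_times_real[OF X p \<tau>]]) auto
  have "closedin (top_of_set (U \<times> {c..d})) (U \<times> {c..d} \<inter> ?F -` {0})"
    by (rule continuous_closedin_preimage[OF c]) simp
  moreover have "closed_map (prod_topology (top_of_set U) (top_of_set {c..d})) (top_of_set U) fst"
    by (rule Abstract_Topological_Spaces.closed_map_fst) (simp add: compact_space_subtopology)
  ultimately have "closedin (top_of_set U) (fst ` (U \<times> {c..d} \<inter> ?F -` {0}))"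
    by (simp add: closed_map_def)
  then have "openin (top_of_set U) (topspace (top_of_set U) - fst ` (U \<times> {c..d} \<inter> ?F -` {0}))"
    by (rule openin_diff[OF openin_topspace])
  then have o: "openin (subtopology (Euclidean_space n) U) (U - fst ` (U \<times> {c..d} \<inter> ?F -` {0}))"
    using subtopology_eopen[OF plot_eopen[OF X p]] by simp
  have "u \<in> fst ` (U \<times> {c..d} \<inter> ?F -` {0}) \<longleftrightarrow> (\<exists>s\<in>{c..d}. \<tau> (p u, s) = 0)" if "u \<in> U" for u
    using that by force
  then have "U - fst ` (U \<times> {c..d} \<inter> ?F -` {0}) = {u \<in> U. p u \<in> {x \<in> carrier X. \<forall>s\<in>{c..d}. \<tau> (x, s) \<noteq> 0}}"
    using plot_in_carrier[OF X p] by auto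
  then show "eopen n {u \<in> U. p u \<in> {x \<in> carrier X. \<forall>s\<in>{c..d}. \<tau> (x, s) \<noteq> 0}}"
    using openin_trans_full[OF o plot_eopen[OF X p]] by simp
qed auto

text \<open>A smooth cut-off of the identity, followed up to 0 and back at 0 from 1 on. In
  \<open>stage\<close> the expression \<open>s - soft_min (s - c)\<close> is thus a smooth version
  of \<open>max s c\<close>, equal to it unless \<open>s\<close> lies between \<open>c\<close> and
  \<open>c + 1\<close>.\<close>

definition soft_min :: "real \<Rightarrow> real" where
  "soft_min u = u * (1 - smooth_step u)"

lemma soft_min_le_0: "u \<le> 0 \<Longrightarrow> soft_min u = u"
  and soft_min_ge_1: "u \<ge> 1 \<Longrightarrow> soft_min u = 0"
  by (simp_all add: soft_min_def smooth_step_0 smooth_step_1)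

lemma soft_min_bounds: "u \<ge> 0 \<Longrightarrow> 0 \<le> soft_min u \<and> soft_min u \<le> 1 \<and> soft_min u \<le> u"
proof -
  assume u: "u \<ge> 0"
  have b: "0 \<le> 1 - smooth_step u" "1 - smooth_step u \<le> 1" using smooth_step_bounds[of u] by auto
  have "0 \<le> soft_min u" using u b by (simp add: soft_min_def)
  moreover have "soft_min u \<le> u" using mult_left_mono[OF b(2) u] by (simp add: soft_min_def)
  moreover have "soft_min u \<le> 1" using soft_min_ge_1[of u] \<open>soft_min u \<le> u\<close> by (cases "u \<ge> 1") auto
  ultimately show ?thesis by simp
qed

text \<open>The way from \<open>s\<close> to \<open>s'\<close> is covered one unit of the grid at a time: after stage \<open>j\<close> its part below \<open>j - 1\<close> is done.\<close>

definition stage :: "real \<Rightarrow> real \<Rightarrow> nat \<Rightarrow> real" where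
  "stage s s' j = s - soft_min (s - (real j - 1)) + soft_min (s' - (real j - 1))"

lemma stage_first: "0 \<le> s \<Longrightarrow> s \<le> s' \<Longrightarrow> stage s s' 0 = s"
  by (simp add: stage_def soft_min_ge_1)

lemma stage_last: "s \<le> s' \<Longrightarrow> s' \<le> real N \<Longrightarrow> stage s s' (Suc N) = s'"
  by (simp add: stage_def soft_min_le_0)

text \<open>In the first case the way is finished and both stages are \<open>s'\<close>; in the
  second it has not begun and both are \<open>s\<close>.\<close>

lemma stage_constant:
  assumes "s \<le> s'" "s' < real j - 1 \<or> s > real j + 1"
  shows "stage s s' (Suc j) = stage s s' j"
  using assms by (auto simp: stage_def soft_min_le_0 soft_min_ge_1)

text \<open>With \<open>c\<close> equal to \<open>j - 1\<close> or \<open>j\<close>, the value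
  \<open>s - soft_min (s - c)\<close> lies between \<open>c\<close> and the larger of
  \<open>c\<close> and \<open>s\<close>, hence is at most \<open>j + 1\<close>. The second cut-off
  adds at most 1, and removes at most 1 in the case \<open>c = j\<close>. This makes the window
  three units wide; scaled by \<open>N\<close> it is a cell of \<open>cell_set\<close>.\<close>

lemma stage_in_cell:
  assumes "real j - 1 \<le> s'" "s \<le> real j + 1"
  shows "real j - 1 \<le> stage s s' j \<and> stage s s' j \<le> real j + 2"
    and "real j - 1 \<le> stage s s' (Suc j) \<and> stage s s' (Suc j) \<le> real j + 2"
proof -
  have r: "u \<le> 0 \<and> soft_min u = u \<or> u \<ge> 0 \<and> 0 \<le> soft_min u \<and> soft_min u \<le> 1 \<and> soft_min u \<le> u" for u
    using soft_min_le_0[of u] soft_min_bounds[of u] by linarith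
  have a: "0 \<le> soft_min (s' - (real j - 1))" "soft_min (s' - (real j - 1)) \<le> 1"
    using soft_min_bounds[of "s' - (real j - 1)"] assms(1) by auto
  show "real j - 1 \<le> stage s s' j \<and> stage s s' j \<le> real j + 2"
    unfolding stage_def using r[of "s - (real j - 1)"] a assms(2) by (elim disjE conjE; linarith)
  show "real j - 1 \<le> stage s s' (Suc j) \<and> stage s s' (Suc j) \<le> real j + 2"
    unfolding stage_def of_nat_Suc using r[of "s - (1 + real j - 1)"] r[of "s' - (1 + real j - 1)"] assms
    by (elim disjE conjE; linarith)
qed

section \<open>Transport of equivariant maps along a homotopy\<close>

context diff_group
begin

context
  fixes X :: "'x diffeology" and E :: "'e diffeology" and \<pi> a
  assumes T: "torsor X E \<pi> a"
begin

text \<open>Over \<open>C\<close> the group coordinate in slot \<open>i\<close> is kept and the base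
  point replaced. Off \<open>C\<close> the base maps agree, and there the same formula returns
  \<open>\<theta>\<close> itself wherever slot \<open>i\<close> has non-zero weight. So the formula
  is valid on an open set around \<open>C\<close>, and the definition by cases is smooth.\<close>

lemma transport_step:
  assumes \<theta>: "equivariant_map E a \<theta>" "covers E \<pi> \<theta> f"
    and f: "smooth_map X BG f" and f': "smooth_map X BG f'" and C: "closedin (D_topology X) C"
    and nz: "\<And>x. x \<in> C \<Longrightarrow> tcoB (f x) i \<noteq> 0 \<and> tcoB (f' x) i \<noteq> 0"
    and eq: "\<And>x. x \<in> carrier X \<Longrightarrow> x \<notin> C \<Longrightarrow> f x = f' x"
  shows "\<exists>\<theta>'. equivariant_map E a \<theta>' \<and> covers E \<pi> \<theta>' f' \<and> (\<forall>e\<in>carrier E. \<pi> e \<notin> C \<longrightarrow> \<theta>' e = \<theta> e)"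
proof -
  note X = torsor_base_space[OF T] and E = torsor_total_space[OF T] and eqv = equivariant_mapD[OF T \<theta>(1)]
  have pB: "projB (\<theta> e) = f (\<pi> e)" if "e \<in> carrier E" for e using \<theta>(2) that by (simp add: covers_def)
  have tB: "tco (\<theta> e) = tcoB (f (\<pi> e))" if "e \<in> carrier E" for e
    using tcoB_projB[OF eqv(2)[OF that]] pB[OF that] by simp
  define \<theta>' where "\<theta>' e = (if \<pi> e \<in> C then pointE i (f' (\<pi> e)) (gco (\<theta> e) i) else \<theta> e)" for e
  have form: "\<theta>' e = pointE i (f' (\<pi> e)) (gco (\<theta> e) i)" if e: "e \<in> carrier E" and "tcoB (f (\<pi> e)) i \<noteq> 0" for e
  proof (cases "\<pi> e \<in> C")
    case False
    then show ?thesis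
      using pointE_self[OF eqv(2)[OF e], of i] tB[OF e] that(2) pB[OF e] eq[OF torsor_proj_in[OF T e]]
      by (simp add: \<theta>'_def)
  qed (simp add: \<theta>'_def)
  have pt: "\<theta>' e \<in> carrier EG" "projB (\<theta>' e) = f' (\<pi> e)" if e: "e \<in> carrier E" for e
  proof -
    have "\<theta>' e \<in> carrier EG \<and> projB (\<theta>' e) = f' (\<pi> e)"
    proof (cases "\<pi> e \<in> C")
      case True
      then show ?thesis
        using pointE[OF smooth_map_carrier[OF f' torsor_proj_in[OF T e]] _ gco_in[OF eqv(2)[OF e]]] nz[OF True]
        by (simp add: \<theta>'_def)
    next
      case False
      then show ?thesis using eqv(2)[OF e] pB[OF e] eq[OF torsor_proj_in[OF T e]] by (simp add: \<theta>'_def)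
    qed
    then show "\<theta>' e \<in> carrier EG" "projB (\<theta>' e) = f' (\<pi> e)" by auto
  qed
  have "smooth_map E EG \<theta>'"
  proof (rule smooth_map_localI[OF E EG_space pt(1)])
    fix n U p u assume p: "p \<in> plots E n U" and u: "u \<in> U"
    note pp = smooth_map_plot[OF torsor_proj[OF T] p] and pE = plot_in_carrier[OF E p]
    show "\<exists>V q. eopen n V \<and> u \<in> V \<and> V \<subseteq> U \<and> q \<in> plots EG n V \<and> (\<forall>v\<in>V. \<theta>' (p v) = q v)"
    proof (cases "\<pi> (p u) \<in> C")
      case True
      let ?O = "{x \<in> carrier X. tcoB (f x) i \<noteq> 0} \<inter> {x \<in> carrier X. tcoB (f' x) i \<noteq> 0}"
      let ?V = "{v \<in> U. \<pi> (p v) \<in> ?O}"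
      have "openin (D_topology X) ?O"
        by (intro openin_Int D_open_nonzero[OF X] smooth_map_compose[OF f smooth_tcoB] smooth_map_compose[OF f' smooth_tcoB])
      then have V: "eopen n ?V" by (rule D_open_plot[OF _ pp])
      have "(\<lambda>v. pointE i (f' (\<pi> (p v))) (gco (\<theta> (p v)) i)) \<in> plots EG n ?V"
      proof (rule pointE_plot)
        show "(\<lambda>v. f' (\<pi> (p v))) \<in> plots BG n ?V"
          by (rule smooth_map_plot[OF f' plot_restrict[OF X pp V]]) auto
        show "(\<lambda>v. gco (\<theta> (p v)) i) \<in> plots D n ?V"
          by (rule gco_plot[OF eqv(6)[OF plot_restrict[OF E p V]]]) (use tB pE in auto)
      qed auto
      moreover have "u \<in> ?V" using u nz[OF True] plot_in_carrier[OF X pp u] by simp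
      moreover have "\<forall>v\<in>?V. \<theta>' (p v) = pointE i (f' (\<pi> (p v))) (gco (\<theta> (p v)) i)" using form pE by simp
      ultimately show ?thesis using V by (intro exI[of _ ?V] exI[of _ "\<lambda>v. pointE i (f' (\<pi> (p v))) (gco (\<theta> (p v)) i)"]) auto
    next
      case False
      let ?V = "{v \<in> U. \<pi> (p v) \<in> carrier X - C}"
      have V: "eopen n ?V" by (rule D_open_plot[OF D_open_complement[OF X C] pp])
      have "(\<lambda>v. \<theta> (p v)) \<in> plots EG n ?V" by (rule eqv(6)[OF plot_restrict[OF E p V]]) auto
      then show ?thesis using V u False plot_in_carrier[OF X pp u]
        by (intro exI[of _ ?V] exI[of _ "\<lambda>v. \<theta> (p v)"]) (auto simp: \<theta>'_def)
    qed
  qed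
  moreover have "\<theta>' (a g e) = milnor_act G g (\<theta>' e)" if g: "g \<in> carrier G" and e: "e \<in> carrier E" for g e
  proof (cases "\<pi> e \<in> C")
    case True
    have "gco (\<theta> (a g e)) i = gco (\<theta> e) i \<otimes> inv g" using eqv(4)[OF g e] nz[OF True] tB[OF e] by simp
    then show ?thesis
      using True nz[OF True] torsor_proj_act[OF T g e]
        pointE_act[OF smooth_map_carrier[OF f' torsor_proj_in[OF T e]] _ gco_in[OF eqv(2)[OF e]] g]
      by (simp add: \<theta>'_def)
  next
    case False
    then show ?thesis using \<theta>(1) g e torsor_proj_act[OF T g e] by (simp add: \<theta>'_def equivariant_map_def)
  qed
  ultimately have "equivariant_map E a \<theta>'" by (simp add: equivariant_map_def)
  moreover have "covers E \<pi> \<theta>' f'" using pt(2) by (simp add: covers_def)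
  ultimately show ?thesis by (intro exI[of _ \<theta>']) (simp add: \<theta>'_def)
qed

text \<open>The way from \<open>S\<close> to \<open>S'\<close> is cut into \<open>N + 1\<close>
  steps. The two ends of each step lie in one cell wherever they differ, so a single slot handles
  it.\<close>

lemma transport_along_cells:
  assumes H: "smooth_map (prod_diffeology X real_diffeology) BG H"
    and S: "smooth_real X S" "smooth_real X S'"
      "\<And>x. x \<in> carrier X \<Longrightarrow> 0 \<le> S x \<and> S x \<le> S' x \<and> S' x \<le> 1"
    and C: "closedin (D_topology X) C" "\<And>x. x \<in> carrier X \<Longrightarrow> x \<notin> C \<Longrightarrow> S x = S' x"
    and N: "N > 0" and cell: "\<And>x k s. x \<in> C \<Longrightarrow> k \<le> N \<Longrightarrow> (real k - 1) / real N \<le> s \<Longrightarrow> s \<le> (real k + 2) / real N \<Longrightarrow>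
      tcoB (H (x, s)) (l k) \<noteq> 0"
    and \<theta>: "equivariant_map E a \<theta>" "covers E \<pi> \<theta> (\<lambda>x. H (x, S x))"
  shows "\<exists>\<theta>'. equivariant_map E a \<theta>' \<and> covers E \<pi> \<theta>' (\<lambda>x. H (x, S' x)) \<and>
    (\<forall>e\<in>carrier E. \<pi> e \<notin> C \<longrightarrow> \<theta>' e = \<theta> e)"
proof -
  note X = torsor_base_space[OF T] and E = torsor_total_space[OF T]
  define r where "r j x = stage (real N * S x) (real N * S' x) j / real N" for j x
  have Nr: "real N > 0" using N by simp
  have le: "real N * S x \<le> real N * S' x" "0 \<le> real N * S x" "real N * S' x \<le> real N" if "x \<in> carrier X" for x
    using S(3)[OF that] Nr by auto
  have sr: "smooth_real X (r j)" for j
    unfolding r_def stage_def soft_min_def divide_inverse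
    by (intro smooth_real_mult smooth_real_add smooth_real_diff smooth_real_step smooth_real_const X S)
  have f: "smooth_map X BG (\<lambda>x. H (x, r j x))" for j
    by (rule smooth_map_compose[OF smooth_map_Pair[OF smooth_map_id sr] H])
  have r0: "r 0 x = S x" and rN: "r (Suc N) x = S' x" if "x \<in> carrier X" for x
    using stage_first[OF le(2,1)[OF that]] stage_last[OF le(1,3)[OF that]] Nr by (auto simp: r_def)
  have "\<exists>\<theta>'. equivariant_map E a \<theta>' \<and> covers E \<pi> \<theta>' (\<lambda>x. H (x, r j x)) \<and>
      (\<forall>e\<in>carrier E. \<pi> e \<notin> C \<longrightarrow> \<theta>' e = \<theta> e)" if "j \<le> Suc N" for j
    using that
  proof (induction j)
    case 0
    have "covers E \<pi> \<theta> (\<lambda>x. H (x, r 0 x))" using \<theta>(2) r0 torsor_proj_in[OF T] by (simp add: covers_def)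
    then show ?case using \<theta>(1) by blast
  next
    case (Suc j)
    then obtain \<tau> where \<tau>: "equivariant_map E a \<tau>" "covers E \<pi> \<tau> (\<lambda>x. H (x, r j x))"
      "\<And>e. e \<in> carrier E \<Longrightarrow> \<pi> e \<notin> C \<Longrightarrow> \<tau> e = \<theta> e" by auto
    \<comment> \<open>Step \<open>j\<close> concerns only those \<open>x\<close> whose way comes
      near cell \<open>j\<close>; for the others it changes nothing, by
      \<open>stage_constant\<close>. The inequalities are not strict, which keeps \<open>C'\<close>
      closed.\<close>
    define C' where "C' = C \<inter> ({x \<in> carrier X. real N * S' x \<in> {real j - 1..}} \<inter> {x \<in> carrier X. real N * S x \<in> {..real j + 1}})"
    have C': "closedin (D_topology X) C'"
      unfolding C'_def
      by (intro closedin_Int C(1) D_closed_real_preimage[OF X] smooth_real_mult[OF X] smooth_real_const[OF X] S closed_atLeast closed_atMost)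
    have cl: "tcoB (H (x, r j x)) (l j) \<noteq> 0 \<and> tcoB (H (x, r (Suc j) x)) (l j) \<noteq> 0" if x: "x \<in> C'" for x
    proof -
      have "real j - 1 \<le> real N * S' x" "real N * S x \<le> real j + 1" using x by (auto simp: C'_def)
      note s = stage_in_cell[OF this]
      show ?thesis
        using cell[of x j] x Suc.prems s Nr by (auto simp: C'_def r_def divide_le_cancel)
    qed
    have eq: "H (x, r j x) = H (x, r (Suc j) x)" if x: "x \<in> carrier X" "x \<notin> C'" for x
    proof (cases "x \<in> C")
      case True
      then have "real N * S' x < real j - 1 \<or> real N * S x > real j + 1" using x by (auto simp: C'_def)
      from stage_constant[OF le(1)[OF x(1)] this] show ?thesis by (simp add: r_def)
    next
      case False
      then show ?thesis using C(2)[OF x(1)] by (simp add: r_def stage_def)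
    qed
    obtain \<tau>' where \<tau>': "equivariant_map E a \<tau>'" "covers E \<pi> \<tau>' (\<lambda>x. H (x, r (Suc j) x))"
      "\<And>e. e \<in> carrier E \<Longrightarrow> \<pi> e \<notin> C' \<Longrightarrow> \<tau>' e = \<tau> e"
      using transport_step[OF \<tau>(1,2) f f C' cl eq] by blast
    have "\<tau>' e = \<theta> e" if "e \<in> carrier E" "\<pi> e \<notin> C" for e
      using \<tau>'(3)[OF that(1)] \<tau>(3)[OF that] that(2) by (auto simp: C'_def)
    then show ?case using \<tau>'(1,2) by blast
  qed
  from this[of "Suc N"] obtain \<theta>' where \<theta>': "equivariant_map E a \<theta>'" "covers E \<pi> \<theta>' (\<lambda>x. H (x, r (Suc N) x))"
      "\<forall>e\<in>carrier E. \<pi> e \<notin> C \<longrightarrow> \<theta>' e = \<theta> e" by blast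
  have "covers E \<pi> \<theta>' (\<lambda>x. H (x, S' x))" using \<theta>'(2) rN torsor_proj_in[OF T] by (simp add: covers_def)
  then show ?thesis using \<theta>'(1,3) by blast
qed

text \<open>The index is a mesh together with a list of slots, one for each cell. Such pairs are
  countable, so \<open>from_nat\<close> turns the cover into a sequence, to which countable
  partitions of unity apply.\<close>

definition cell_set :: "('x \<times> real \<Rightarrow> ((nat \<Rightarrow> real) \<times> (nat \<Rightarrow> 'g)) set set) \<Rightarrow> nat \<times> nat list \<Rightarrow> 'x set" where
  "cell_set H = (\<lambda>(N, l). {x \<in> carrier X. N > 0 \<and> length l = Suc N \<and>
     (\<forall>k\<le>N. \<forall>s\<in>{(real k - 1) / real N..(real k + 2) / real N}. tcoB (H (x, s)) (l ! k) \<noteq> 0)})"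

lemma cell_set_cover:
  assumes H: "smooth_map (prod_diffeology X real_diffeology) BG H"
  shows "open_cover (D_topology X) UNIV (\<lambda>n. cell_set H (from_nat n))"
  unfolding open_cover_def
proof (intro conjI ballI)
  note X = torsor_base_space[OF T]
  have \<tau>: "smooth_real (prod_diffeology X real_diffeology) (\<lambda>z. tcoB (H z) i)" for i
    by (rule smooth_map_compose[OF H smooth_tcoB])
  have "openin (D_topology X) (cell_set H (N, l))" for N l
  proof (cases "N > 0 \<and> length l = Suc N")
    case True
    have "cell_set H (N, l) = (\<Inter>k\<in>{..N}. {x \<in> carrier X. \<forall>s\<in>{(real k - 1) / real N..(real k + 2) / real N}. tcoB (H (x, s)) (l ! k) \<noteq> 0})"
      using True by (auto simp: cell_set_def)
    moreover have "openin (D_topology X) \<dots>"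
      by (intro openin_INT2 D_open_tube[OF X \<tau>]) auto
    ultimately show ?thesis by simp
  next
    case False
    then have "cell_set H (N, l) = {}" by (auto simp: cell_set_def)
    then show ?thesis by simp
  qed
  then show "openin (D_topology X) (cell_set H (from_nat n))" for n by (metis prod.collapse)
  have "\<exists>N l. x \<in> cell_set H (N, l)" if x: "x \<in> carrier X" for x
  proof -
    define O' where "O' i = {s. tcoB (H (x, s)) i \<noteq> 0}" for i
    have "open (O' i)" for i
    proof -
      have "continuous_on ({\<lambda>_::nat. 0::real} \<times> UNIV) (\<lambda>z. tcoB (H (x, snd z)) i)"
        using continuous_on_plot_times_real[OF X plot_const[OF X eopen_singleton_0 x] \<tau>[of i]] by simp
      then have "continuous_on UNIV (\<lambda>s. tcoB (H (x, snd (\<lambda>_::nat. 0::real, s))) i)"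
        by (rule continuous_on_compose2) (auto intro: continuous_intros)
      then have "open ((\<lambda>s. tcoB (H (x, s)) i) -` (- {0}))" by (intro open_vimage) auto
      then show ?thesis by (simp add: O'_def vimage_def)
    qed
    moreover have "{0..2} \<subseteq> \<Union>(range O')"
    proof
      fix s :: real
      have "H (x, s) \<in> carrier BG" by (rule smooth_map_carrier[OF H]) (use x in simp)
      then show "s \<in> \<Union>(range O')" using in_simplex_nonzero[OF in_simplex_tcoB] by (auto simp: O'_def)
    qed
    moreover have "compact {0..2::real}" by simp
    \<comment> \<open>A Lebesgue number for the cover of the parameter interval by the sets where
      one slot is non-zero.\<close>
    ultimately obtain e where e: "0 < e" "\<And>s. s \<in> {0..2} \<Longrightarrow> \<exists>U\<in>range O'. ball s e \<subseteq> U"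
      using Heine_Borel_lemma[of "{0..2::real}" "range O'"] by (metis rangeE)
    \<comment> \<open>A cell reaches at most \<open>2 / N\<close> away from \<open>k / N\<close>, so
      for this \<open>N\<close> it lies in the ball of radius \<open>e\<close>.\<close>
    obtain N :: nat where N: "2 / e < real N" using reals_Archimedean2 by blast
    have N0: "N > 0" using N e(1) by (metis divide_pos_pos gr0I not_less_iff_gr_or_eq of_nat_0 zero_less_numeral less_asym)
    then have Ne: "2 / real N < e" using N e(1) by (simp add: field_simps)
    have "\<exists>i. \<forall>s\<in>{(real k - 1) / real N..(real k + 2) / real N}. s \<in> O' i" if k: "k \<le> N" for k
    proof -
      have "real k / real N \<in> {0..2}" using k N0 by (simp add: divide_le_eq)
      then obtain i where i: "ball (real k / real N) e \<subseteq> O' i" using e(2) by blast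
      have "s \<in> ball (real k / real N) e" if s: "s \<in> {(real k - 1) / real N..(real k + 2) / real N}" for s
      proof -
        have "real k / real N - s \<le> 1 / real N" "s - real k / real N \<le> 2 / real N"
          using s by (auto simp: diff_divide_distrib add_divide_distrib)
        moreover have "1 / real N \<le> 2 / real N" by (simp add: divide_right_mono)
        ultimately show ?thesis using Ne by (simp add: dist_real_def abs_less_iff)
      qed
      then show ?thesis using i by blast
    qed
    then obtain c where c: "\<And>k s. k \<le> N \<Longrightarrow> s \<in> {(real k - 1) / real N..(real k + 2) / real N} \<Longrightarrow> s \<in> O' (c k)"
      by metis
    have "x \<in> cell_set H (N, map c [0..<Suc N])"
      using x N0 c by (auto simp: cell_set_def O'_def nth_append simp del: upt_Suc)
    then show ?thesis by blast
  qed
  moreover have "cell_set H p \<subseteq> carrier X" for p by (auto simp: cell_set_def)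
  ultimately have "carrier X = (\<Union>p. cell_set H p)" by blast
  also have "\<dots> = (\<Union>n. cell_set H (from_nat n))" using surj_from_nat by (metis image_image)
  finally show "(\<Union>n. cell_set H (from_nat n)) = topspace (D_topology X)"
    unfolding topspace_D_topology[OF X] by simp
qed

text \<open>Time at \<open>x\<close> advances along the partial sums of the partition of unity, so
  step \<open>n\<close> happens only over the support of \<open>\<zeta> n\<close>, where one mesh
  and one list of slots work. By local finiteness of the supports the resulting sequence of maps is
  eventually constant near every point, and its limit is smooth and sits at time 1.\<close>

lemma covering_homotopy:
  assumes sp: "smoothly_paracompact X" and H: "smooth_map (prod_diffeology X real_diffeology) BG H"
    and \<theta>: "equivariant_map E a \<theta>" "covers E \<pi> \<theta> (\<lambda>x. H (x, 0))"
  obtains \<theta>' where "equivariant_map E a \<theta>'" "covers E \<pi> \<theta>' (\<lambda>x. H (x, 1))"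
proof -
  note X = torsor_base_space[OF T] and E = torsor_total_space[OF T]
  let ?W = "\<lambda>n. cell_set H (from_nat n)"
  obtain \<zeta> where "subordinate_partition_of_unity X UNIV ?W \<zeta>"
    using smoothly_paracompact_countable[OF X sp cell_set_cover[OF H]] .
  then have pou: "pointwise_finite_partition_of_unity X UNIV \<zeta>"
    and lf: "locally_finite_family (D_topology X) UNIV (\<lambda>i. smooth_support X (\<zeta> i))"
    and sub: "\<And>i. smooth_support X (\<zeta> i) \<subseteq> ?W i"
    by (auto simp: subordinate_partition_of_unity_def)
  define C where "C n = smooth_support X (\<zeta> n)" for n
  define \<sigma> where "\<sigma> n x = (\<Sum>i<n. \<zeta> i x)" for n x
  have z: "\<zeta> n x = 0" if "x \<in> carrier X" "x \<notin> C n" for n x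
    using smooth_support_superset[where f = "\<zeta> n", OF X that(1)] that(2) by (auto simp: C_def)
  have \<zeta>: "\<zeta> n x \<ge> 0" "finite {i. \<zeta> i x \<noteq> 0}" "(\<Sum>i | \<zeta> i x \<noteq> 0. \<zeta> i x) = 1" if "x \<in> carrier X" for n x
    using in_simplex_partition[OF X pou that] by (auto simp: in_simplex_def)
  have \<sigma>01: "0 \<le> \<sigma> n x \<and> \<sigma> n x \<le> \<sigma> (Suc n) x \<and> \<sigma> (Suc n) x \<le> 1" if x: "x \<in> carrier X" for n x
  proof -
    have le: "\<sigma> n x \<le> 1" for n
    proof -
      have "\<sigma> n x = (\<Sum>i\<in>{i. i < n \<and> \<zeta> i x \<noteq> 0}. \<zeta> i x)"
        unfolding \<sigma>_def by (rule sum.mono_neutral_right) auto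
      also have "\<dots> \<le> (\<Sum>i | \<zeta> i x \<noteq> 0. \<zeta> i x)" by (rule sum_mono2) (use \<zeta>[OF x] in auto)
      finally show ?thesis using \<zeta>(3)[OF x] by simp
    qed
    have "0 \<le> \<sigma> n x" unfolding \<sigma>_def using \<zeta>(1)[OF x] by (intro sum_nonneg) auto
    then show ?thesis using \<zeta>(1)[OF x, of n] le[of "Suc n"] by (simp add: \<sigma>_def)
  qed
  have s\<sigma>: "smooth_real X (\<sigma> n)" for n
    unfolding \<sigma>_def by (intro smooth_real_sum X smooth_real_partition[OF X pou])
  have "\<exists>F. \<forall>n. (equivariant_map E a (F n) \<and> covers E \<pi> (F n) (\<lambda>x. H (x, \<sigma> n x))) \<and>
      (\<forall>e\<in>carrier E. \<pi> e \<notin> C n \<longrightarrow> F (Suc n) e = F n e)"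
  proof (rule dependent_nat_choice)
    show "\<exists>\<theta>. equivariant_map E a \<theta> \<and> covers E \<pi> \<theta> (\<lambda>x. H (x, \<sigma> 0 x))"
      using \<theta> by (auto simp: \<sigma>_def)
    fix \<tau> n assume "equivariant_map E a \<tau> \<and> covers E \<pi> \<tau> (\<lambda>x. H (x, \<sigma> n x))"
    then have \<tau>: "equivariant_map E a \<tau>" "covers E \<pi> \<tau> (\<lambda>x. H (x, \<sigma> n x))" by auto
    obtain N0 :: nat and l :: "nat list" where Nl: "from_nat n = (N0, l)" by fastforce
    \<comment> \<open>For \<open>N0 = 0\<close> the cell set is empty, and with it the support; the
      value 1 only meets the demand that the mesh be positive.\<close>
    define N where "N = (if N0 > 0 then N0 else 1)"
    have N: "N > 0" by (simp add: N_def)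
    have cell: "tcoB (H (x, s)) (l ! k) \<noteq> 0"
      if "x \<in> C n" "k \<le> N" "(real k - 1) / real N \<le> s" "s \<le> (real k + 2) / real N" for x k s
      using sub[of n] that by (auto simp: C_def Nl cell_set_def N_def)
    have eq: "\<sigma> n x = \<sigma> (Suc n) x" if "x \<in> carrier X" "x \<notin> C n" for x
      using z[OF that] by (simp add: \<sigma>_def)
    have Cn: "closedin (D_topology X) (C n)" unfolding C_def by (rule closedin_smooth_support)
    obtain \<tau>' where "equivariant_map E a \<tau>'" "covers E \<pi> \<tau>' (\<lambda>x. H (x, \<sigma> (Suc n) x))"
      "\<And>e. e \<in> carrier E \<Longrightarrow> \<pi> e \<notin> C n \<Longrightarrow> \<tau>' e = \<tau> e"
      using transport_along_cells[where l = "(!) l", OF H s\<sigma> s\<sigma> \<sigma>01 Cn eq N cell \<tau>] by blast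
    then show "\<exists>\<tau>'. (equivariant_map E a \<tau>' \<and> covers E \<pi> \<tau>' (\<lambda>x. H (x, \<sigma> (Suc n) x))) \<and>
        (\<forall>e\<in>carrier E. \<pi> e \<notin> C n \<longrightarrow> \<tau>' e = \<tau> e)" by blast
  qed
  then obtain F where F: "\<And>n. equivariant_map E a (F n)" "\<And>n. covers E \<pi> (F n) (\<lambda>x. H (x, \<sigma> n x))"
    "\<And>n e. e \<in> carrier E \<Longrightarrow> \<pi> e \<notin> C n \<Longrightarrow> F (Suc n) e = F n e" by blast
  have stable: "F n e = F m e" if "e \<in> carrier E" "\<forall>k\<ge>m. \<pi> e \<notin> C k" "n \<ge> m" for e m n
    using that(3) by (induction n rule: dec_induct) (use that(1,2) F(3) in auto)
  have nbhd: "\<exists>V m. openin (D_topology X) V \<and> x \<in> V \<and> (\<forall>y\<in>V. \<forall>k\<ge>m. y \<notin> C k)" if x: "x \<in> carrier X" for x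
  proof -
    obtain V where V: "openin (D_topology X) V" "x \<in> V" "finite {i. C i \<inter> V \<noteq> {}}"
      using lf x unfolding locally_finite_family_def topspace_D_topology[OF X] C_def by auto
    then obtain m where "\<forall>i\<in>{i. C i \<inter> V \<noteq> {}}. i < m" unfolding finite_nat_set_iff_bounded by blast
    then have "\<forall>y\<in>V. \<forall>k\<ge>m. y \<notin> C k" by (metis (mono_tags, lifting) IntI empty_iff mem_Collect_eq not_le)
    then show ?thesis using V(1,2) by blast
  qed
  \<comment> \<open>From index \<open>M x\<close> on \<open>x\<close> lies in none of the supports,
    so the sequence of maps no longer changes over \<open>x\<close>.\<close>
  define M where "M x = (LEAST m. \<forall>k\<ge>m. x \<notin> C k)" for x
  have M: "\<forall>k\<ge>M x. x \<notin> C k" if "x \<in> carrier X" for x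
    unfolding M_def by (rule LeastI_ex) (use nbhd[OF that] in blast)
  have Mle: "M x \<le> m" if "\<forall>k\<ge>m. x \<notin> C k" for x m unfolding M_def using that by (rule Least_le)
  define \<theta>' where "\<theta>' e = F (M (\<pi> e)) e" for e
  have \<theta>': "\<theta>' e = F m e" if "e \<in> carrier E" "\<forall>k\<ge>m. \<pi> e \<notin> C k" for e m
    using stable[OF that(1) M[OF torsor_proj_in[OF T that(1)]] Mle[OF that(2)]] by (simp add: \<theta>'_def)
  have "smooth_map E EG \<theta>'"
  proof (rule smooth_map_localI[OF E EG_space])
    show "\<theta>' e \<in> carrier EG" if "e \<in> carrier E" for e
      using equivariant_mapD(2)[OF T F(1) that] by (simp add: \<theta>'_def)
    fix n U p u assume p: "p \<in> plots E n U" and u: "u \<in> U"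
    note pp = smooth_map_plot[OF torsor_proj[OF T] p]
    obtain V m where V: "openin (D_topology X) V" "\<pi> (p u) \<in> V" "\<forall>y\<in>V. \<forall>k\<ge>m. y \<notin> C k"
      using nbhd[OF plot_in_carrier[OF X pp u]] by blast
    let ?V = "{v \<in> U. \<pi> (p v) \<in> V}"
    have o: "eopen n ?V" by (rule D_open_plot[OF V(1) pp])
    have "(\<lambda>v. F m (p v)) \<in> plots EG n ?V"
      by (rule equivariant_mapD(6)[OF T F(1) plot_restrict[OF E p o]]) auto
    moreover have "\<forall>v\<in>?V. \<theta>' (p v) = F m (p v)" using \<theta>' V(3) plot_in_carrier[OF E p] by simp
    ultimately show "\<exists>V q. eopen n V \<and> u \<in> V \<and> V \<subseteq> U \<and> q \<in> plots EG n V \<and> (\<forall>v\<in>V. \<theta>' (p v) = q v)"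
      using o u V(2) by (intro exI[of _ ?V] exI[of _ "\<lambda>v. F m (p v)"]) auto
  qed
  moreover have "\<theta>' (a g e) = milnor_act G g (\<theta>' e)" if "g \<in> carrier G" "e \<in> carrier E" for g e
    using F(1)[of "M (\<pi> e)"] that torsor_proj_act[OF T that] by (simp add: \<theta>'_def equivariant_map_def)
  ultimately have "equivariant_map E a \<theta>'" by (simp add: equivariant_map_def)
  moreover have "covers E \<pi> \<theta>' (\<lambda>x. H (x, 1))"
    unfolding covers_def
  proof
    fix e assume e: "e \<in> carrier E"
    note x = torsor_proj_in[OF T e]
    \<comment> \<open>All non-zero summands have index below \<open>M (\<pi> e)\<close>, so the
      partial sum is already the full sum.\<close>
    have "\<sigma> (M (\<pi> e)) (\<pi> e) = (\<Sum>i | \<zeta> i (\<pi> e) \<noteq> 0. \<zeta> i (\<pi> e))"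
      unfolding \<sigma>_def
    proof (rule sum.mono_neutral_right)
      show "{i. \<zeta> i (\<pi> e) \<noteq> 0} \<subseteq> {..<M (\<pi> e)}" using M[OF x] z[OF x] by (metis (mono_tags, lifting) lessThan_iff mem_Collect_eq not_le subsetI)
    qed auto
    then have "\<sigma> (M (\<pi> e)) (\<pi> e) = 1" using \<zeta>(3)[OF x] by simp
    then show "projB (\<theta>' e) = H (\<pi> e, 1)" using F(2)[of "M (\<pi> e)"] e by (simp add: covers_def \<theta>'_def)
  qed
  ultimately show ?thesis by (rule that)
qed

lemma classifies_homotopic:
  assumes sp: "smoothly_paracompact X" and c: "classifies X E \<pi> a f"
    and h: "smoothly_homotopic X BG f f'" and f': "smooth_map X BG f'"
  shows "classifies X E \<pi> a f'"
proof -
  obtain H where H: "smooth_map (prod_diffeology X real_diffeology) BG H"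
    "\<And>x. x \<in> carrier X \<Longrightarrow> H (x, 0) = f x" "\<And>x. x \<in> carrier X \<Longrightarrow> H (x, 1) = f' x"
    using h unfolding smoothly_homotopic_def by blast
  obtain \<theta> where \<theta>: "equivariant_map E a \<theta>" "covers E \<pi> \<theta> f" using c unfolding classifies_def by blast
  have "covers E \<pi> \<theta> (\<lambda>x. H (x, 0))" using \<theta>(2) H(2) torsor_proj_in[OF T] by (simp add: covers_def)
  then obtain \<theta>' where \<theta>': "equivariant_map E a \<theta>'" "covers E \<pi> \<theta>' (\<lambda>x. H (x, 1))"
    using covering_homotopy[OF sp H(1) \<theta>(1)] by blast
  have "covers E \<pi> \<theta>' f'" using \<theta>'(2) H(3) torsor_proj_in[OF T] by (simp add: covers_def)
  then show ?thesis using f' \<theta>'(1) unfolding classifies_def by blast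
qed

end

end

section \<open>The classification theorem\<close>

lemma smoothly_homotopic_compose:
  assumes "smooth_map X Y \<phi>" "smoothly_homotopic Y Z f g"
  shows "smoothly_homotopic X Z (\<lambda>x. f (\<phi> x)) (\<lambda>x. g (\<phi> x))"
proof -
  obtain H where H: "smooth_map (prod_diffeology Y real_diffeology) Z H"
    "\<forall>y\<in>carrier Y. H (y, 0) = f y \<and> H (y, 1) = g y"
    using assms(2) unfolding smoothly_homotopic_def by blast
  have "smooth_map (prod_diffeology X real_diffeology) Z (\<lambda>z. H (\<phi> (fst z), snd z))"
    by (rule smooth_map_compose[OF smooth_map_Pair[OF smooth_map_compose[OF smooth_map_fst assms(1)] smooth_map_snd] H(1)])
  then show ?thesis unfolding smoothly_homotopic_def
    using H(2) smooth_map_carrier[OF assms(1)] by (intro exI[of _ "\<lambda>z. H (\<phi> (fst z), snd z)"]) simp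
qed

lemma smoothly_homotopic_cong:
  assumes "smoothly_homotopic X Z f g" "\<And>x. x \<in> carrier X \<Longrightarrow> f x = f' x" "\<And>x. x \<in> carrier X \<Longrightarrow> g x = g' x"
  shows "smoothly_homotopic X Z f' g'"
  using assms unfolding smoothly_homotopic_def by metis

lemma smooth_homD: "f \<in> smooth_hom X Z \<Longrightarrow> smooth_map X Z f"
  by (simp add: smooth_hom_def)

lemma restrict_smooth_hom:
  "diffeological_space X \<Longrightarrow> diffeological_space Z \<Longrightarrow> smooth_map X Z f \<Longrightarrow> restrict f (carrier X) \<in> smooth_hom X Z"
  by (auto simp: smooth_hom_def intro: smooth_map_cong)

lemma compose_smooth_hom:
  assumes "diffeological_space X" "diffeological_space Z" "smooth_map X Y \<phi>" "smooth_map Y Z f"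
  shows "compose (carrier X) f \<phi> \<in> smooth_hom X Z"
  unfolding compose_def using restrict_smooth_hom[OF assms(1,2) smooth_map_compose[OF assms(3,4)]] .

lemma equiv_homotopy_rel:
  assumes X: "diffeological_space X" and Z: "diffeological_space Z"
  shows "equiv (smooth_hom X Z) (homotopy_rel X Z)"
proof (rule equivI)
  show "homotopy_rel X Z \<subseteq> smooth_hom X Z \<times> smooth_hom X Z" by (auto simp: homotopy_rel_def)
  show "refl_on (smooth_hom X Z) (homotopy_rel X Z)"
    using smoothly_homotopic_refl[OF X] by (auto simp: refl_on_def homotopy_rel_def smooth_hom_def)
  show "sym (homotopy_rel X Z)"
    using smoothly_homotopic_sym[OF X] by (auto simp: sym_def homotopy_rel_def)
  show "trans (homotopy_rel X Z)"
    using smoothly_homotopic_trans[OF X Z] unfolding trans_def homotopy_rel_def by blast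
qed

text \<open>All composites of members of a class with \<open>\<phi>\<close> are homotopic to each
  other, so one representative decides the saturated set.\<close>

lemma homotopy_precomp_class:
  assumes X: "diffeological_space X" and Z: "diffeological_space Z" and Y: "diffeological_space Y"
    and \<phi>: "smooth_map X Y \<phi>" and f: "f \<in> smooth_hom Y Z"
  shows "homotopy_precomp Z X Y \<phi> (homotopy_rel Y Z `` {f}) = homotopy_rel X Z `` {compose (carrier X) f \<phi>}"
proof -
  note eqv = equiv_homotopy_rel[OF X Z]
  have ff: "f \<in> homotopy_rel Y Z `` {f}" using equiv_class_self[OF equiv_homotopy_rel[OF Y Z] f] .
  have "homotopy_rel X Z `` {compose (carrier X) g \<phi>} = homotopy_rel X Z `` {compose (carrier X) f \<phi>}"
    if g: "g \<in> homotopy_rel Y Z `` {f}" for g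
  proof (rule equiv_class_eq[OF eqv, symmetric])
    have "smooth_map Y Z f" "smooth_map Y Z g" "smoothly_homotopic Y Z f g"
      using g f by (auto simp: homotopy_rel_def smooth_hom_def)
    then show "(compose (carrier X) f \<phi>, compose (carrier X) g \<phi>) \<in> homotopy_rel X Z"
      using compose_smooth_hom[OF X Z \<phi>] smoothly_homotopic_cong[OF smoothly_homotopic_compose[OF \<phi>], of Z f g
          "compose (carrier X) f \<phi>" "compose (carrier X) g \<phi>"]
      by (simp add: homotopy_rel_def compose_def)
  qed
  then show ?thesis unfolding homotopy_precomp_def using ff by blast
qed

lemma homotopy_functor:
  assumes Z: "diffeological_space Z"
  shows "contravariant_set_functor (Diffeol_HSP :: ('x diffeology, 'x \<Rightarrow> 'x) category)
    (homotopy_classes Z) (homotopy_precomp Z)"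
proof -
  have cls: "\<exists>f\<in>smooth_hom X Z. c = homotopy_rel X Z `` {f}" if "c \<in> homotopy_classes Z X" for X c
    using that by (auto simp: homotopy_classes_def elim: quotientE)
  have "homotopy_precomp Z X Y \<phi> c \<in> homotopy_classes Z X"
    if XY: "diffeological_space X" "diffeological_space Y" and \<phi>: "\<phi> \<in> smooth_hom X Y" and c: "c \<in> homotopy_classes Z Y"
    for X Y :: "'x diffeology" and \<phi> c
  proof -
    obtain f where f: "f \<in> smooth_hom Y Z" "c = homotopy_rel Y Z `` {f}" using cls[OF c] by blast
    show ?thesis
      using homotopy_precomp_class[OF XY(1) Z XY(2) smooth_homD[OF \<phi>] f(1)] f(2)
        compose_smooth_hom[OF XY(1) Z smooth_homD[OF \<phi>] smooth_homD[OF f(1)]]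
      by (simp add: homotopy_classes_def quotientI)
  qed
  moreover have "homotopy_precomp Z X X (restrict id (carrier X)) c = c"
    if X: "diffeological_space X" and c: "c \<in> homotopy_classes Z X" for X :: "'x diffeology" and c
  proof -
    obtain f where f: "f \<in> smooth_hom X Z" "c = homotopy_rel X Z `` {f}" using cls[OF c] by blast
    have "smooth_map X X (restrict id (carrier X))"
      by (rule smooth_map_cong[OF X X smooth_map_id]) simp
    moreover have "compose (carrier X) f (restrict id (carrier X)) = f"
      using f(1) by (auto simp: smooth_hom_def compose_def extensional_def fun_eq_iff)
    ultimately show ?thesis using homotopy_precomp_class[OF X Z X _ f(1)] f(2) by simp
  qed
  moreover have "homotopy_precomp Z X W (compose (carrier X) \<psi> \<phi>) c = homotopy_precomp Z X Y \<phi> (homotopy_precomp Z Y W \<psi> c)"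
    if X: "diffeological_space X" and Y: "diffeological_space Y" and W: "diffeological_space W"
      and \<phi>: "\<phi> \<in> smooth_hom X Y" and \<psi>: "\<psi> \<in> smooth_hom Y W" and c: "c \<in> homotopy_classes Z W"
    for X Y W :: "'x diffeology" and \<phi> \<psi> c
  proof -
    obtain f where f: "f \<in> smooth_hom W Z" "c = homotopy_rel W Z `` {f}" using cls[OF c] by blast
    have s: "smooth_map X W (compose (carrier X) \<psi> \<phi>)"
      by (rule smooth_homD[OF compose_smooth_hom[OF X W smooth_homD[OF \<phi>] smooth_homD[OF \<psi>]]])
    have "compose (carrier X) f (compose (carrier X) \<psi> \<phi>) = compose (carrier X) (compose (carrier Y) f \<psi>) \<phi>"
      using smooth_map_carrier[OF smooth_homD[OF \<phi>]] by (auto simp: compose_def fun_eq_iff)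
    then show ?thesis
      using homotopy_precomp_class[OF X Z W s f(1)] homotopy_precomp_class[OF Y Z W smooth_homD[OF \<psi>] f(1)]
        homotopy_precomp_class[OF X Z Y smooth_homD[OF \<phi>] compose_smooth_hom[OF Y Z smooth_homD[OF \<psi>] smooth_homD[OF f(1)]]] f(2)
      by simp
  qed
  ultimately show ?thesis
    unfolding contravariant_set_functor_def Diffeol_HSP_def Diffeol_def
    by (intro conjI ballI funcsetI) simp_all
qed

section \<open>Pullbacks of the universal bundle and isomorphisms of bundles\<close>

context diff_group
begin

text \<open>The weights of \<open>f\<close> are known to be finite only pointwise, so two partitions
  of unity are taken. The first is subordinate to their non-vanishing sets, and its own
  non-vanishing sets form the locally finite cover \<open>V\<close>; the second is subordinate to
  \<open>V\<close>. Over \<open>V i\<close> the points with coordinate \<open>\<one>\<close> in slot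
  \<open>i\<close> give the section.\<close>

lemma pullback_universal_numerable:
  assumes X: "diffeological_space X" and sp: "smoothly_paracompact X" and f: "smooth_map X BG f"
  shows "numerable_sections X (pullback_diffeology X f EG projB) fst"
proof -
  have supp_cover: "open_cover (D_topology X) UNIV (\<lambda>i. {x \<in> carrier X. w x i \<noteq> 0})"
    if "\<And>i. smooth_real X (\<lambda>x. w x i)" "\<And>x. x \<in> carrier X \<Longrightarrow> in_simplex (w x)" for w
    using D_open_nonzero[OF X that(1)] in_simplex_nonzero[OF that(2)]
    by (auto simp: open_cover_def topspace_D_topology[OF X])
  define W where "W i = {x \<in> carrier X. tcoB (f x) i \<noteq> 0}" for i
  have "open_cover (D_topology X) UNIV W"
    unfolding W_def
    by (rule supp_cover[OF smooth_map_compose[OF f smooth_tcoB] in_simplex_tcoB[OF smooth_map_carrier[OF f]]])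
  then obtain \<zeta> where "subordinate_partition_of_unity X UNIV W \<zeta>"
    using smoothly_paracompact_countable[OF X sp] by blast
  then have \<zeta>: "pointwise_finite_partition_of_unity X UNIV \<zeta>"
    "locally_finite_family (D_topology X) UNIV (\<lambda>i. smooth_support X (\<zeta> i))" "\<And>i. smooth_support X (\<zeta> i) \<subseteq> W i"
    by (auto simp: subordinate_partition_of_unity_def)
  define V where "V i = {x \<in> carrier X. \<zeta> i x \<noteq> 0}" for i
  have Vs: "V i \<subseteq> smooth_support X (\<zeta> i)" for i
    using smooth_support_superset[where f = "\<zeta> i", OF X] by (auto simp: V_def)
  have oc: "open_cover (D_topology X) UNIV V"
    unfolding V_def by (rule supp_cover[OF smooth_real_partition[OF X \<zeta>(1)] in_simplex_partition[OF X \<zeta>(1)]])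
  then obtain \<xi> where \<xi>: "subordinate_partition_of_unity X UNIV V \<xi>"
    using smoothly_paracompact_countable[OF X sp] by blast
  have "locally_finite_family (D_topology X) UNIV V"
    unfolding locally_finite_family_def
  proof
    fix x assume "x \<in> topspace (D_topology X)"
    then obtain O' where O': "openin (D_topology X) O'" "x \<in> O'" "finite {i \<in> UNIV. smooth_support X (\<zeta> i) \<inter> O' \<noteq> {}}"
      using \<zeta>(2) unfolding locally_finite_family_def by blast
    have "finite {i \<in> UNIV. V i \<inter> O' \<noteq> {}}" by (rule finite_subset[OF _ O'(3)]) (use Vs in blast)
    then show "\<exists>O'. openin (D_topology X) O' \<and> x \<in> O' \<and> finite {i \<in> UNIV. V i \<inter> O' \<noteq> {}}" using O' by blast
  qed
  moreover have "smooth_section X (pullback_diffeology X f EG projB) fst (V i) (\<lambda>x. (x, pointE i (f x) \<one>))" for i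
  proof -
    have nz: "tcoB (f x) i \<noteq> 0" if "x \<in> V i" for x using Vs[of i] \<zeta>(3)[of i] that by (auto simp: W_def)
    show ?thesis
      unfolding smooth_section_def
    proof (intro conjI ballI allI impI)
      fix x assume "x \<in> V i \<inter> carrier X"
      then show "(x, pointE i (f x) \<one>) \<in> carrier (pullback_diffeology X f EG projB)"
        using pointE[OF smooth_map_carrier[OF f] nz one_closed, of x] by (simp add: carrier_pullback)
    next
      fix n U p assume p: "p \<in> plots X n U" "p \<in> U \<rightarrow> V i"
      have "(\<lambda>u. pointE i (f (p u)) \<one>) \<in> plots EG n U"
        by (rule pointE_plot[OF smooth_map_plot[OF f p(1)] plot_const[OF D_space plot_eopen[OF X p(1)]]]) (use nz p(2) in auto)
      moreover have "f (p u) = projB (pointE i (f (p u)) \<one>)" if "u \<in> U" for u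
        using pointE(2)[OF smooth_map_carrier[OF f plot_in_carrier[OF X p(1) that]] nz one_closed] p(2) that by auto
      ultimately show "(\<lambda>u. (p u, pointE i (f (p u)) \<one>)) \<in> plots (pullback_diffeology X f EG projB) n U"
        using p(1) by (simp add: plots_pullback)
    qed simp
  qed
  ultimately show ?thesis
    unfolding numerable_sections_def using oc \<xi>
    by (intro exI[of _ V] exI[of _ \<xi>] exI[of _ "\<lambda>i x. (x, pointE i (f x) \<one>)"])
       (simp add: subordinate_partition_of_unity_def)
qed

abbreviation torsor_bundle :: "'x diffeology \<Rightarrow> ('e, 'x, 'g) gbundle \<Rightarrow> bool" where
  "torsor_bundle X P \<equiv> torsor X (total P) (proj P) (act P)"

abbreviation bundle_classifies where
  "bundle_classifies X P f \<equiv> classifies X (total P) (proj P) (act P) f"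

lemma bundle_isomorphicI:
  assumes "torsor_bundle X P" "torsor_bundle X Q" "smooth_map (total P) (total Q) \<psi>"
    "\<And>e. e \<in> carrier (total P) \<Longrightarrow> proj Q (\<psi> e) = proj P e"
    "\<And>g e. g \<in> carrier G \<Longrightarrow> e \<in> carrier (total P) \<Longrightarrow> \<psi> (act P g e) = act Q g (\<psi> e)"
  shows "bundle_isomorphic G P Q"
  unfolding bundle_isomorphic_def
  using torsor_map_diffeomorphism[OF assms(1-3)] assms(4,5) by blast

lemma bundle_isomorphicE:
  assumes "bundle_isomorphic G P Q"
  obtains \<psi> where "smooth_map (total P) (total Q) \<psi>"
    "\<And>e. e \<in> carrier (total P) \<Longrightarrow> proj Q (\<psi> e) = proj P e"
    "\<And>g e. g \<in> carrier G \<Longrightarrow> e \<in> carrier (total P) \<Longrightarrow> \<psi> (act P g e) = act Q g (\<psi> e)"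
proof -
  obtain \<psi> where "diffeomorphism (total P) (total Q) \<psi>"
    "\<forall>e\<in>carrier (total P). proj Q (\<psi> e) = proj P e"
    "\<forall>g\<in>carrier G. \<forall>e\<in>carrier (total P). \<psi> (act P g e) = act Q g (\<psi> e)"
    using assms unfolding bundle_isomorphic_def by (elim exE conjE)
  then show ?thesis by (intro that[of \<psi>]) (auto simp: diffeomorphism_def)
qed

lemma bundle_isomorphic_refl: "torsor_bundle X P \<Longrightarrow> bundle_isomorphic G P P"
  by (rule bundle_isomorphicI[OF _ _ smooth_map_id]) auto

lemma bundle_isomorphic_trans:
  assumes "torsor_bundle X P" "torsor_bundle X R" "bundle_isomorphic G P Q" "bundle_isomorphic G Q R"
  shows "bundle_isomorphic G P R"
proof -
  obtain \<psi> where \<psi>: "smooth_map (total P) (total Q) \<psi>"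
    "\<And>e. e \<in> carrier (total P) \<Longrightarrow> proj Q (\<psi> e) = proj P e"
    "\<And>g e. g \<in> carrier G \<Longrightarrow> e \<in> carrier (total P) \<Longrightarrow> \<psi> (act P g e) = act Q g (\<psi> e)"
    using bundle_isomorphicE[OF assms(3)] by metis
  obtain \<kappa> where \<kappa>: "smooth_map (total Q) (total R) \<kappa>"
    "\<And>e. e \<in> carrier (total Q) \<Longrightarrow> proj R (\<kappa> e) = proj Q e"
    "\<And>g e. g \<in> carrier G \<Longrightarrow> e \<in> carrier (total Q) \<Longrightarrow> \<kappa> (act Q g e) = act R g (\<kappa> e)"
    using bundle_isomorphicE[OF assms(4)] by metis
  show ?thesis
    by (rule bundle_isomorphicI[OF assms(1,2) smooth_map_compose[OF \<psi>(1) \<kappa>(1)]])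
       (use \<psi> \<kappa> smooth_map_carrier[OF \<psi>(1)] in auto)
qed

lemma bundle_isomorphic_sym:
  assumes P: "torsor_bundle X P" and Q: "torsor_bundle X Q" and "bundle_isomorphic G P Q"
  shows "bundle_isomorphic G Q P"
proof -
  obtain \<psi> where d: "diffeomorphism (total P) (total Q) \<psi>"
    and \<psi>: "\<forall>e\<in>carrier (total P). proj Q (\<psi> e) = proj P e"
    "\<forall>g\<in>carrier G. \<forall>e\<in>carrier (total P). \<psi> (act P g e) = act Q g (\<psi> e)"
    using assms(3) unfolding bundle_isomorphic_def by (elim exE conjE)
  let ?k = "inv_into (carrier (total P)) \<psi>"
  note k = diffeomorphism_inv[OF d]
  show ?thesis
  proof (rule bundle_isomorphicI[OF Q P k(1)])
    fix y assume y: "y \<in> carrier (total Q)"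
    note ky = smooth_map_carrier[OF k(1) y]
    show "proj P (?k y) = proj Q y" using \<psi>(1) ky k(3)[OF y] by metis
    fix g assume g: "g \<in> carrier G"
    have "\<psi> (act P g (?k y)) = act Q g y" using \<psi>(2) g ky k(3)[OF y] by simp
    then show "?k (act Q g y) = act P g (?k y)" using k(2)[OF torsor_act_in[OF P g ky]] by metis
  qed
qed

text \<open>As a set the total space embeds in \<open>'x \<times> 'g\<close>: each point is compared
  with an arbitrarily chosen, possibly discontinuous, section. No smoothness is lost, since the
  diffeology is carried along by the injection.\<close>

lemma bundle_transport:
  fixes P :: "('d, 'x, 'g) gbundle" and inject :: "'x \<times> 'g \<Rightarrow> 'e"
  assumes P: "torsor_bundle X P" and inj: "inj inject"
  obtains Q :: "('e, 'x, 'g) gbundle" where "torsor_bundle X Q" "bundle_isomorphic G P Q"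
proof -
  define s where "s x = (SOME e. e \<in> carrier (total P) \<and> proj P e = x)" for x
  have s: "s (proj P e) \<in> carrier (total P)" "proj P (s (proj P e)) = proj P e" if "e \<in> carrier (total P)" for e
    using someI[of "\<lambda>e'. e' \<in> carrier (total P) \<and> proj P e' = proj P e" e] that by (auto simp: s_def)
  define j where "j e = inject (proj P e, gdiv (act P) (s (proj P e)) e)" for e
  have j: "inj_on j (carrier (total P))"
  proof (rule inj_onI)
    fix e e' assume e: "e \<in> carrier (total P)" "e' \<in> carrier (total P)" "j e = j e'"
    then have h: "(proj P e, gdiv (act P) (s (proj P e)) e) = (proj P e', gdiv (act P) (s (proj P e')) e')"
      unfolding j_def by (intro injD[OF inj])
    have "proj P e = proj P e'" "gdiv (act P) (s (proj P e)) e = gdiv (act P) (s (proj P e')) e'"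
      by (rule Pair_inject[OF h], assumption)+
    then show "e = e'"
      using torsor_gdiv(2)[OF P s(1)[OF e(1)] e(1) s(2)[OF e(1)]] torsor_gdiv(2)[OF P s(1)[OF e(2)] e(2) s(2)[OF e(2)]]
      by metis
  qed
  let ?k = "inv_into (carrier (total P)) j"
  define Q :: "('e, 'x, 'g) gbundle" where
    "Q = \<lparr>total = image_diffeology j (total P), proj = (\<lambda>y. proj P (?k y)), act = (\<lambda>g y. j (act P g (?k y)))\<rparr>"
  have Q: "torsor_bundle X Q" using torsor_image[OF P j] by (simp add: Q_def)
  moreover have "bundle_isomorphic G P Q"
    by (rule bundle_isomorphicI[OF P Q, of j])
       (use smooth_map_image(1)[OF torsor_total_space[OF P] j] j in \<open>auto simp: Q_def\<close>)
  ultimately show ?thesis by (rule that)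
qed

lemma torsor_pullback_bundle:
  assumes "torsor_bundle Y P" "diffeological_space X" "smooth_map X Y \<phi>"
  shows "torsor_bundle X (pullback_bundle X \<phi> P)"
  using torsor_pullback[OF assms] by (simp add: pullback_bundle_def)

lemma pullback_bundle_isomorphic:
  assumes P: "torsor_bundle Y P" and Q: "torsor_bundle Y Q" and X: "diffeological_space X" and \<phi>: "smooth_map X Y \<phi>"
    and "bundle_isomorphic G P Q"
  shows "bundle_isomorphic G (pullback_bundle X \<phi> P) (pullback_bundle X \<phi> Q)"
proof -
  obtain \<psi> where \<psi>: "smooth_map (total P) (total Q) \<psi>"
    "\<And>e. e \<in> carrier (total P) \<Longrightarrow> proj Q (\<psi> e) = proj P e"
    "\<And>g e. g \<in> carrier G \<Longrightarrow> e \<in> carrier (total P) \<Longrightarrow> \<psi> (act P g e) = act Q g (\<psi> e)"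
    using bundle_isomorphicE[OF assms(5)] by metis
  show ?thesis
  proof (rule bundle_isomorphicI[OF torsor_pullback_bundle[OF P X \<phi>] torsor_pullback_bundle[OF Q X \<phi>], of "\<lambda>z. (fst z, \<psi> (snd z))"])
    show "smooth_map (total (pullback_bundle X \<phi> P)) (total (pullback_bundle X \<phi> Q)) (\<lambda>z. (fst z, \<psi> (snd z)))"
    proof (rule smooth_mapI)
      fix n U p assume "p \<in> plots (total (pullback_bundle X \<phi> P)) n U"
      then have p: "(\<lambda>u. fst (p u)) \<in> plots X n U" "(\<lambda>u. snd (p u)) \<in> plots (total P) n U"
        "\<forall>u\<in>U. \<phi> (fst (p u)) = proj P (snd (p u))" by (auto simp: pullback_bundle_def plots_pullback)
      then show "(\<lambda>u. (fst (p u), \<psi> (snd (p u)))) \<in> plots (total (pullback_bundle X \<phi> Q)) n U"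
        using smooth_map_plot[OF \<psi>(1) p(2)] \<psi>(2) plot_in_carrier[OF torsor_total_space[OF P] p(2)]
        by (simp add: pullback_bundle_def plots_pullback)
    qed (use \<psi>(2) smooth_map_carrier[OF \<psi>(1)] in \<open>auto simp: pullback_bundle_def carrier_pullback\<close>)
  qed (use \<psi>(3) in \<open>auto simp: pullback_bundle_def carrier_pullback\<close>)
qed

lemma pullback_bundle_id:
  assumes P: "torsor_bundle X P"
  shows "bundle_isomorphic G (pullback_bundle X (restrict id (carrier X)) P) P"
proof -
  note X = torsor_base_space[OF P]
  have "smooth_map X X (restrict id (carrier X))" by (rule smooth_map_cong[OF X X smooth_map_id]) simp
  note T = torsor_pullback_bundle[OF P X this]
  show ?thesis
    by (rule bundle_isomorphicI[OF T P, of snd])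
       (use smooth_map_pullback_snd in \<open>auto simp: pullback_bundle_def carrier_pullback\<close>)
qed

text \<open>\<open>Q\<close> stands for a copy of the pullback of \<open>P\<close> along
  \<open>\<psi>\<close> in the fixed type; hence the comparison map involves the isomorphism
  \<open>\<alpha>\<close> onto that copy.\<close>

lemma pullback_bundle_compose:
  assumes P: "torsor_bundle Z P" and Q: "torsor_bundle Y Q" and X: "diffeological_space X"
    and \<phi>: "smooth_map X Y \<phi>" and \<psi>: "smooth_map Y Z \<psi>" and i: "bundle_isomorphic G (pullback_bundle Y \<psi> P) Q"
  shows "bundle_isomorphic G (pullback_bundle X (compose (carrier X) \<psi> \<phi>) P) (pullback_bundle X \<phi> Q)"
proof -
  note Y = torsor_base_space[OF Q] and Z = torsor_base_space[OF P]
  obtain \<alpha> where \<alpha>: "smooth_map (total (pullback_bundle Y \<psi> P)) (total Q) \<alpha>"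
    "\<And>e. e \<in> carrier (total (pullback_bundle Y \<psi> P)) \<Longrightarrow> proj Q (\<alpha> e) = proj (pullback_bundle Y \<psi> P) e"
    "\<And>g e. g \<in> carrier G \<Longrightarrow> e \<in> carrier (total (pullback_bundle Y \<psi> P)) \<Longrightarrow> \<alpha> (act (pullback_bundle Y \<psi> P) g e) = act Q g (\<alpha> e)"
    using bundle_isomorphicE[OF i] by metis
  have c: "smooth_map X Z (compose (carrier X) \<psi> \<phi>)"
    by (rule smooth_homD[OF compose_smooth_hom[OF X Z \<phi> \<psi>]])
  let ?C = "pullback_bundle X (compose (carrier X) \<psi> \<phi>) P"
  have C: "(\<phi> (fst z), snd z) \<in> carrier (total (pullback_bundle Y \<psi> P))" if "z \<in> carrier (total ?C)" for z
    using that smooth_map_carrier[OF \<phi>] by (auto simp: pullback_bundle_def carrier_pullback compose_eq)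
  show ?thesis
  proof (rule bundle_isomorphicI[OF torsor_pullback_bundle[OF P X c] torsor_pullback_bundle[OF Q X \<phi>], of "\<lambda>z. (fst z, \<alpha> (\<phi> (fst z), snd z))"])
    show "smooth_map (total ?C) (total (pullback_bundle X \<phi> Q)) (\<lambda>z. (fst z, \<alpha> (\<phi> (fst z), snd z)))"
    proof (rule smooth_mapI)
      fix n U p assume p0: "p \<in> plots (total ?C) n U"
      then have p: "(\<lambda>u. fst (p u)) \<in> plots X n U" "(\<lambda>u. snd (p u)) \<in> plots (total P) n U"
        "\<forall>u\<in>U. compose (carrier X) \<psi> \<phi> (fst (p u)) = proj P (snd (p u))" by (auto simp: pullback_bundle_def plots_pullback)
      have pc: "p u \<in> carrier (total ?C)" if "u \<in> U" for u
        using plot_in_carrier[OF torsor_total_space[OF torsor_pullback_bundle[OF P X c]] p0 that] .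
      have "\<psi> (\<phi> (fst (p u))) = proj P (snd (p u))" if "u \<in> U" for u
        using bspec[OF p(3) that] compose_eq[OF plot_in_carrier[OF X p(1) that], of \<psi> \<phi>] by simp
      then have "(\<lambda>u. (\<phi> (fst (p u)), snd (p u))) \<in> plots (total (pullback_bundle Y \<psi> P)) n U"
        using p smooth_map_plot[OF \<phi> p(1)] by (simp add: pullback_bundle_def plots_pullback)
      from smooth_map_plot[OF \<alpha>(1) this]
      show "(\<lambda>u. (fst (p u), \<alpha> (\<phi> (fst (p u)), snd (p u)))) \<in> plots (total (pullback_bundle X \<phi> Q)) n U"
        using p(1) \<alpha>(2)[OF C[OF pc]] by (simp add: pullback_bundle_def plots_pullback)
    next
      fix z assume z: "z \<in> carrier (total ?C)"
      then show "(fst z, \<alpha> (\<phi> (fst z), snd z)) \<in> carrier (total (pullback_bundle X \<phi> Q))"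
        using smooth_map_carrier[OF \<alpha>(1) C[OF z]] \<alpha>(2)[OF C[OF z]] by (simp add: pullback_bundle_def carrier_pullback)
    qed
    show "(\<lambda>z. (fst z, \<alpha> (\<phi> (fst z), snd z))) (act ?C g z) = act (pullback_bundle X \<phi> Q) g (fst z, \<alpha> (\<phi> (fst z), snd z))"
      if "g \<in> carrier G" "z \<in> carrier (total ?C)" for g z
      using \<alpha>(3)[OF that(1) C[OF that(2)]] by (simp add: pullback_bundle_def case_prod_unfold)
  qed (simp add: pullback_bundle_def)
qed

lemma bundle_classifies_isomorphic:
  assumes "torsor_bundle X P" "bundle_isomorphic G P Q" "bundle_classifies X Q f"
  shows "bundle_classifies X P f"
proof -
  obtain \<psi> where \<psi>: "smooth_map (total P) (total Q) \<psi>"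
    "\<And>e. e \<in> carrier (total P) \<Longrightarrow> proj Q (\<psi> e) = proj P e"
    "\<And>g e. g \<in> carrier G \<Longrightarrow> e \<in> carrier (total P) \<Longrightarrow> \<psi> (act P g e) = act Q g (\<psi> e)"
    using bundle_isomorphicE[OF assms(2)] by metis
  show ?thesis by (rule classifies_map[OF assms(1,3) \<psi>(1)]) (simp_all add: \<psi>(2,3))
qed

lemma classifies_cong:
  assumes T: "torsor X E \<pi> a" and "classifies X E \<pi> a f" "\<And>x. x \<in> carrier X \<Longrightarrow> f' x = f x"
  shows "classifies X E \<pi> a f'"
proof -
  obtain \<theta> where \<theta>: "smooth_map X BG f" "equivariant_map E a \<theta>" "covers E \<pi> \<theta> f"
    using assms(2) unfolding classifies_def by blast
  have "smooth_map X BG f'" by (rule smooth_map_cong[OF torsor_base_space[OF T] BG_space \<theta>(1) assms(3)])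
  moreover have "covers E \<pi> \<theta> f'" using \<theta>(3) assms(3) torsor_proj_in[OF T] by (simp add: covers_def)
  ultimately show ?thesis using \<theta>(2) unfolding classifies_def by blast
qed

section \<open>Bundle classes as a functor\<close>

context
  fixes inject :: "'x \<times> 'g \<Rightarrow> 'e"
  assumes inject: "inj inject"
begin

abbreviation bundles :: "'x diffeology \<Rightarrow> ('e, 'x, 'g) gbundle set" where
  "bundles X \<equiv> numerable_bundles G D X"

text \<open>From here on bundles are handled as torsors with numerable sections. Through
  \<open>inject\<close> the group embeds in \<open>'e\<close>, the type in which
  \<open>D_numerable\<close> asks for the fibre.\<close>

lemma numerable_bundles_iff:
  fixes P :: "('e, 'x, 'g) gbundle"
  shows "P \<in> bundles X \<longleftrightarrow> torsor_bundle X P \<and> numerable_sections X (total P) (proj P)"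
proof -
  have "inj_on (\<lambda>g. inject (undefined, g)) (carrier G)" using inject by (auto simp: inj_on_def)
  then show ?thesis
    unfolding numerable_bundles_def mem_Collect_eq
    using principal_bundle_imp_torsor torsor_imp_principal_bundle
      numerable_sections_imp_D_numerable D_numerable_imp_numerable_sections by metis
qed

lemma bundles_torsor: "P \<in> bundles X \<Longrightarrow> torsor_bundle X P"
  by (simp add: numerable_bundles_iff)

lemma equiv_bundle_rel: "equiv (bundles X) (bundle_rel G D X)" (is "equiv ?A ?r")
proof (rule equivI)
  show "?r \<subseteq> ?A \<times> ?A" by (auto simp: bundle_rel_def)
  show "refl_on ?A ?r"
    using bundle_isomorphic_refl bundles_torsor by (auto simp: refl_on_def bundle_rel_def)
  show "sym ?r"
  proof (rule symI)
    fix P Q assume "(P, Q) \<in> ?r"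
    then have PQ: "P \<in> bundles X" "Q \<in> bundles X" "bundle_isomorphic G P Q" by (auto simp: bundle_rel_def)
    then show "(Q, P) \<in> ?r"
      using bundle_isomorphic_sym[OF bundles_torsor[OF PQ(1)] bundles_torsor[OF PQ(2)] PQ(3)]
      by (simp add: bundle_rel_def)
  qed
  show "trans ?r"
  proof (rule transI)
    fix P Q R assume "(P, Q) \<in> ?r" "(Q, R) \<in> ?r"
    then have PQR: "P \<in> bundles X" "R \<in> bundles X" "bundle_isomorphic G P Q" "bundle_isomorphic G Q R"
      by (auto simp: bundle_rel_def)
    then show "(P, R) \<in> ?r"
      using bundle_isomorphic_trans[OF bundles_torsor[OF PQR(1)] bundles_torsor[OF PQR(2)] PQR(3,4)]
      by (simp add: bundle_rel_def)
  qed
qed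

text \<open>A pullback lives in a type other than \<open>'e\<close>; a copy inside \<open>'e\<close>
  is what makes its isomorphism class a non-empty set of bundles.\<close>

lemma bundle_realisation:
  fixes P :: "('d, 'x, 'g) gbundle"
  assumes P: "torsor_bundle X P" and N: "numerable_sections X (total P) (proj P)"
  obtains Q where "Q \<in> bundles X" "bundle_isomorphic G P Q"
proof -
  obtain Q :: "('e, 'x, 'g) gbundle" where Q: "torsor_bundle X Q" "bundle_isomorphic G P Q"
    using bundle_transport[OF P inject] .
  obtain \<psi> where "smooth_map (total P) (total Q) \<psi>" "\<And>e. e \<in> carrier (total P) \<Longrightarrow> proj Q (\<psi> e) = proj P e"
    using bundle_isomorphicE[OF Q(2)] by metis
  then have "numerable_sections X (total Q) (proj Q)" by (rule numerable_sections_map[OF N])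
  then show ?thesis using that Q numerable_bundles_iff by blast
qed

lemma pullback_realisation:
  assumes P: "P \<in> bundles Y" and X: "diffeological_space X" and \<phi>: "smooth_map X Y \<phi>"
  obtains Q where "Q \<in> bundles X" "bundle_isomorphic G (pullback_bundle X \<phi> P) Q"
proof (rule bundle_realisation[OF torsor_pullback_bundle[OF bundles_torsor[OF P] X \<phi>]])
  show "numerable_sections X (total (pullback_bundle X \<phi> P)) (proj (pullback_bundle X \<phi> P))"
    using numerable_sections_pullback[OF bundles_torsor[OF P] X \<phi>] P
    by (simp add: numerable_bundles_iff pullback_bundle_def)
qed (rule that)

text \<open>Pullback respects isomorphism, so all copies of pullbacks of members of the class are
  isomorphic to the one copy \<open>Q\<close>.\<close>

lemma bundle_pullback_class:
  assumes P: "P \<in> bundles Y" and X: "diffeological_space X" and \<phi>: "smooth_map X Y \<phi>"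
    and Q: "Q \<in> bundles X" "bundle_isomorphic G (pullback_bundle X \<phi> P) Q"
  shows "bundle_pullback G D X Y \<phi> (bundle_rel G D Y `` {P}) = bundle_rel G D X `` {Q}"
proof -
  have pb: "torsor_bundle X (pullback_bundle X \<phi> R)" if "R \<in> bundles Y" for R
    by (rule torsor_pullback_bundle[OF bundles_torsor[OF that] X \<phi>])
  have 1: "bundle_isomorphic G Q S"
    if "S \<in> bundles X" "R \<in> bundles Y" "bundle_isomorphic G P R" "bundle_isomorphic G (pullback_bundle X \<phi> R) S" for R S
  proof -
    note t = bundles_torsor[OF Q(1)] bundles_torsor[OF that(1)] pb[OF P] pb[OF that(2)]
    have "bundle_isomorphic G (pullback_bundle X \<phi> P) S"
      by (rule bundle_isomorphic_trans[OF t(3,2) pullback_bundle_isomorphic[OF bundles_torsor[OF P] bundles_torsor[OF that(2)] X \<phi> that(3)] that(4)])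
    then show ?thesis by (rule bundle_isomorphic_trans[OF t(1,2) bundle_isomorphic_sym[OF t(3,1) Q(2)]])
  qed
  have 2: "bundle_isomorphic G (pullback_bundle X \<phi> P) S" if "S \<in> bundles X" "bundle_isomorphic G Q S" for S
    by (rule bundle_isomorphic_trans[OF pb[OF P] bundles_torsor[OF that(1)] Q(2) that(2)])
  have PP: "P \<in> bundle_rel G D Y `` {P}" by (rule equiv_class_self[OF equiv_bundle_rel P])
  show ?thesis
  proof
    show "bundle_pullback G D X Y \<phi> (bundle_rel G D Y `` {P}) \<subseteq> bundle_rel G D X `` {Q}"
      using 1 Q(1) unfolding bundle_pullback_def bundle_rel_def by blast
    show "bundle_rel G D X `` {Q} \<subseteq> bundle_pullback G D X Y \<phi> (bundle_rel G D Y `` {P})"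
    proof
      fix S assume "S \<in> bundle_rel G D X `` {Q}"
      then have "S \<in> bundles X" "bundle_isomorphic G Q S" by (auto simp: bundle_rel_def)
      then show "S \<in> bundle_pullback G D X Y \<phi> (bundle_rel G D Y `` {P})"
        unfolding bundle_pullback_def using 2 PP by blast
    qed
  qed
qed

lemma bundle_classesE:
  fixes c :: "('e, 'x, 'g) gbundle set"
  assumes "c \<in> bundle_classes G D X"
  obtains P where "P \<in> bundles X" "c = bundle_rel G D X `` {P}"
  using assms unfolding bundle_classes_def by (rule quotientE)

lemma bundle_functor:
  "contravariant_set_functor Diffeol_HSP
     (bundle_classes G D :: 'x diffeology \<Rightarrow> ('e, 'x, 'g) gbundle set set) (bundle_pullback G D)"
proof -
  have "bundle_pullback G D X Y \<phi> c \<in> bundle_classes G D X"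
    if X: "diffeological_space X" and \<phi>: "\<phi> \<in> smooth_hom X Y" and c: "c \<in> bundle_classes G D Y"
    for X Y \<phi> and c :: "('e, 'x, 'g) gbundle set"
  proof -
    obtain P where P: "P \<in> bundles Y" "c = bundle_rel G D Y `` {P}" using bundle_classesE[OF c] .
    obtain Q where Q: "Q \<in> bundles X" "bundle_isomorphic G (pullback_bundle X \<phi> P) Q"
      using pullback_realisation[OF P(1) X smooth_homD[OF \<phi>]] .
    show ?thesis using bundle_pullback_class[OF P(1) X smooth_homD[OF \<phi>] Q] P(2) Q(1)
      by (simp add: bundle_classes_def quotientI)
  qed
  moreover have "bundle_pullback G D X X (restrict id (carrier X)) c = c"
    if X: "diffeological_space X" and c: "c \<in> bundle_classes G D X" for X and c :: "('e, 'x, 'g) gbundle set"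
  proof -
    obtain P where P: "P \<in> bundles X" "c = bundle_rel G D X `` {P}" using bundle_classesE[OF c] .
    have "smooth_map X X (restrict id (carrier X))"
      by (rule smooth_map_cong[OF X X smooth_map_id]) simp
    then show ?thesis
      using bundle_pullback_class[OF P(1) X _ P(1) pullback_bundle_id[OF bundles_torsor[OF P(1)]]] P(2) by simp
  qed
  moreover have "bundle_pullback G D X Z (compose (carrier X) \<psi> \<phi>) c = bundle_pullback G D X Y \<phi> (bundle_pullback G D Y Z \<psi> c)"
    if X: "diffeological_space X" and Y: "diffeological_space Y" and Z: "diffeological_space Z"
      and \<phi>: "\<phi> \<in> smooth_hom X Y" and \<psi>: "\<psi> \<in> smooth_hom Y Z" and c: "c \<in> bundle_classes G D Z"
    for X Y Z \<phi> \<psi> and c :: "('e, 'x, 'g) gbundle set"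
  proof -
    note \<phi>' = smooth_homD[OF \<phi>] and \<psi>' = smooth_homD[OF \<psi>]
    obtain P where P: "P \<in> bundles Z" "c = bundle_rel G D Z `` {P}" using bundle_classesE[OF c] .
    obtain Q where Q: "Q \<in> bundles Y" "bundle_isomorphic G (pullback_bundle Y \<psi> P) Q"
      using pullback_realisation[OF P(1) Y \<psi>'] .
    obtain R where R: "R \<in> bundles X" "bundle_isomorphic G (pullback_bundle X \<phi> Q) R"
      using pullback_realisation[OF Q(1) X \<phi>'] .
    note s = smooth_homD[OF compose_smooth_hom[OF X Z \<phi>' \<psi>']]
    note tP = bundles_torsor[OF P(1)] and tQ = bundles_torsor[OF Q(1)] and tR = bundles_torsor[OF R(1)]
    have "bundle_isomorphic G (pullback_bundle X (compose (carrier X) \<psi> \<phi>) P) R"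
      by (rule bundle_isomorphic_trans[OF torsor_pullback_bundle[OF tP X s] tR
            pullback_bundle_compose[OF tP tQ X \<phi>' \<psi>' Q(2)] R(2)])
    from bundle_pullback_class[OF P(1) X s R(1) this] bundle_pullback_class[OF P(1) Y \<psi>' Q]
      bundle_pullback_class[OF Q(1) X \<phi>' R]
    show ?thesis using P(2) by simp
  qed
  ultimately show ?thesis
    unfolding contravariant_set_functor_def Diffeol_HSP_def Diffeol_def
    by (intro conjI ballI funcsetI) simp_all
qed

text \<open>The natural isomorphism, defined without any choice: for the class of a bundle this set
  is itself a homotopy class.\<close>

definition classifying_maps :: "'x diffeology \<Rightarrow> ('e, 'x, 'g) gbundle set \<Rightarrow> ('x \<Rightarrow> ((nat \<Rightarrow> real) \<times> (nat \<Rightarrow> 'g)) set set) set" where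
  "classifying_maps X c = {f \<in> smooth_hom X BG. \<exists>P\<in>c. bundle_classifies X P f}"

text \<open>One inclusion is the uniqueness of classifying maps up to homotopy. The other is the
  covering homotopy theorem: a map homotopic to a classifying map classifies the same
  bundle.\<close>

lemma classifying_maps_class:
  assumes sp: "smoothly_paracompact X" and P: "P \<in> bundles X" and f: "f \<in> smooth_hom X BG" "bundle_classifies X P f"
  shows "classifying_maps X (bundle_rel G D X `` {P}) = homotopy_rel X BG `` {f}"
proof
  note T = bundles_torsor[OF P]
  show "classifying_maps X (bundle_rel G D X `` {P}) \<subseteq> homotopy_rel X BG `` {f}"
  proof
    fix f' assume "f' \<in> classifying_maps X (bundle_rel G D X `` {P})"
    then obtain Q :: "('e, 'x, 'g) gbundle" where f': "f' \<in> smooth_hom X BG" and Q: "bundle_isomorphic G P Q" "bundle_classifies X Q f'"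
      by (auto simp: classifying_maps_def bundle_rel_def)
    have "smoothly_homotopic X BG f f'"
      by (rule classifies_unique[OF T sp f(2) bundle_classifies_isomorphic[OF T Q]])
    then show "f' \<in> homotopy_rel X BG `` {f}" using f(1) f' by (simp add: homotopy_rel_def)
  qed
  show "homotopy_rel X BG `` {f} \<subseteq> classifying_maps X (bundle_rel G D X `` {P})"
  proof
    fix f' assume "f' \<in> homotopy_rel X BG `` {f}"
    then have f': "f' \<in> smooth_hom X BG" "smoothly_homotopic X BG f f'" by (auto simp: homotopy_rel_def)
    have "bundle_classifies X P f'" by (rule classifies_homotopic[OF T sp f(2) f'(2) smooth_homD[OF f'(1)]])
    then show "f' \<in> classifying_maps X (bundle_rel G D X `` {P})"
      using f'(1) equiv_class_self[OF equiv_bundle_rel P] unfolding classifying_maps_def by blast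
  qed
qed

lemma exists_classifying_map:
  assumes P: "P \<in> bundles X"
  obtains f where "f \<in> smooth_hom X BG" "bundle_classifies X P f"
proof -
  note T = bundles_torsor[OF P]
  obtain f where f: "bundle_classifies X P f"
    using numerable_classifying_map[OF T] P by (auto simp: numerable_bundles_iff)
  have "restrict f (carrier X) \<in> smooth_hom X BG"
    using restrict_smooth_hom[OF torsor_base_space[OF T] BG_space] f by (auto simp: classifies_def)
  moreover have "bundle_classifies X P (restrict f (carrier X))" by (rule classifies_cong[OF T f]) simp
  ultimately show ?thesis by (rule that)
qed

text \<open>The universal bundle is classified by the identity of \<open>BG\<close>, so its pullback
  along \<open>f\<close> is classified by \<open>f\<close>, and a copy in the fixed type inherits
  this.\<close>

lemma exists_classified_bundle:
  assumes X: "diffeological_space X" and sp: "smoothly_paracompact X" and f: "f \<in> smooth_hom X BG"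
  obtains P where "P \<in> bundles X" "bundle_classifies X P f"
proof -
  let ?U = "\<lparr>total = EG, proj = projB, act = milnor_act G\<rparr>"
  let ?P = "pullback_bundle X f ?U"
  note f' = smooth_homD[OF f]
  have tU: "torsor_bundle BG ?U" using milnor_torsor by simp
  have tP: "torsor_bundle X ?P" by (rule torsor_pullback_bundle[OF tU X f'])
  have "numerable_sections X (total ?P) (proj ?P)"
    using pullback_universal_numerable[OF X sp f'] by (simp add: pullback_bundle_def)
  then obtain Q where Q: "Q \<in> bundles X" "bundle_isomorphic G ?P Q" using bundle_realisation[OF tP] by blast
  have "equivariant_map EG (milnor_act G) (\<lambda>e. e)" by (simp add: equivariant_map_def smooth_map_id)
  then have "classifies BG EG projB (milnor_act G) (\<lambda>b. b)"
    unfolding classifies_def using smooth_map_id by (auto simp: covers_def)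
  from classifies_pullback[OF milnor_torsor X f' this] have "bundle_classifies X ?P f"
    by (simp add: pullback_bundle_def)
  then have "bundle_classifies X Q f"
    by (rule bundle_classifies_isomorphic[OF bundles_torsor[OF Q(1)] bundle_isomorphic_sym[OF tP bundles_torsor[OF Q(1)] Q(2)]])
  then show ?thesis using that Q(1) by blast
qed

text \<open>Injective because two bundles classified by one map are isomorphic, surjective because
  over a smoothly paracompact base the pullback of the universal bundle is numerable.\<close>

lemma bij_classifying_maps:
  assumes X: "diffeological_space X" and sp: "smoothly_paracompact X"
  shows "bij_betw (classifying_maps X) (bundle_classes G D X) (homotopy_classes BG X)"
proof (rule bij_betw_imageI)
  note eqv = equiv_homotopy_rel[OF X BG_space]
  show "inj_on (classifying_maps X) (bundle_classes G D X)"
  proof (rule inj_onI)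
    fix c d :: "('e, 'x, 'g) gbundle set"
    assume c: "c \<in> bundle_classes G D X" and d: "d \<in> bundle_classes G D X" and cd: "classifying_maps X c = classifying_maps X d"
    obtain P where P: "P \<in> bundles X" "c = bundle_rel G D X `` {P}" using bundle_classesE[OF c] .
    obtain Q where Q: "Q \<in> bundles X" "d = bundle_rel G D X `` {Q}" using bundle_classesE[OF d] .
    note tP = bundles_torsor[OF P(1)] and tQ = bundles_torsor[OF Q(1)]
    obtain f where f: "f \<in> smooth_hom X BG" "bundle_classifies X P f" using exists_classifying_map[OF P(1)] .
    have "f \<in> classifying_maps X c"
      using classifying_maps_class[OF sp P(1) f] equiv_class_self[OF eqv f(1)] P(2) by metis
    then have "f \<in> classifying_maps X d" using cd by simp
    then obtain R :: "('e, 'x, 'g) gbundle" where R: "bundle_isomorphic G Q R" "bundle_classifies X R f"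
      unfolding Q(2) by (auto simp: classifying_maps_def bundle_rel_def)
    have fQ: "bundle_classifies X Q f" by (rule bundle_classifies_isomorphic[OF tQ R])
    obtain \<psi> where "smooth_map (total P) (total Q) \<psi>" "\<And>e. e \<in> carrier (total P) \<Longrightarrow> proj Q (\<psi> e) = proj P e"
      "\<And>g e. g \<in> carrier G \<Longrightarrow> e \<in> carrier (total P) \<Longrightarrow> \<psi> (act P g e) = act Q g (\<psi> e)"
      using classifies_same_map[OF tP tQ f(2) fQ] by metis
    then have "bundle_isomorphic G P Q" by (rule bundle_isomorphicI[OF tP tQ])
    then have "(P, Q) \<in> bundle_rel G D X" using P(1) Q(1) by (simp add: bundle_rel_def)
    then show "c = d" using equiv_class_eq[OF equiv_bundle_rel] P(2) Q(2) by blast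
  qed
  show "classifying_maps X ` bundle_classes G D X = homotopy_classes BG X"
  proof
    show "classifying_maps X ` bundle_classes G D X \<subseteq> homotopy_classes BG X"
    proof
      fix h assume "h \<in> classifying_maps X ` bundle_classes G D X"
      then obtain c where c: "c \<in> bundle_classes G D X" "h = classifying_maps X c" by blast
      obtain P where P: "P \<in> bundles X" "c = bundle_rel G D X `` {P}" using bundle_classesE[OF c(1)] .
      obtain f where f: "f \<in> smooth_hom X BG" "bundle_classifies X P f" using exists_classifying_map[OF P(1)] .
      show "h \<in> homotopy_classes BG X"
        using classifying_maps_class[OF sp P(1) f] c(2) P(2) f(1) by (simp add: homotopy_classes_def quotientI)
    qed
    show "homotopy_classes BG X \<subseteq> classifying_maps X ` bundle_classes G D X"
    proof
      fix h assume "h \<in> homotopy_classes BG X"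
      then obtain f where f: "f \<in> smooth_hom X BG" "h = homotopy_rel X BG `` {f}"
        unfolding homotopy_classes_def by (rule quotientE)
      obtain P where P: "P \<in> bundles X" "bundle_classifies X P f" using exists_classified_bundle[OF X sp f(1)] .
      have "bundle_rel G D X `` {P} \<in> bundle_classes G D X"
        using P(1) by (simp add: bundle_classes_def quotientI)
      then show "h \<in> classifying_maps X ` bundle_classes G D X"
        using classifying_maps_class[OF sp P(1) f(1) P(2)] f(2) by (metis imageI)
    qed
  qed
qed

text \<open>If \<open>f\<close> classifies \<open>P\<close>, then \<open>f\<close> after
  \<open>\<phi>\<close> classifies the pullback of \<open>P\<close>; by
  \<open>classifying_maps_class\<close> this one map determines the whole homotopy class.\<close>

lemma natural_classifying_maps:
  assumes X: "diffeological_space X" "smoothly_paracompact X" and Y: "diffeological_space Y" "smoothly_paracompact Y"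
    and \<phi>: "\<phi> \<in> smooth_hom X Y" and c: "c \<in> bundle_classes G D Y"
  shows "classifying_maps X (bundle_pullback G D X Y \<phi> c) = homotopy_precomp BG X Y \<phi> (classifying_maps Y c)"
proof -
  note \<phi>' = smooth_homD[OF \<phi>]
  obtain P where P: "P \<in> bundles Y" "c = bundle_rel G D Y `` {P}" using bundle_classesE[OF c] .
  obtain f where f: "f \<in> smooth_hom Y BG" "bundle_classifies Y P f" using exists_classifying_map[OF P(1)] .
  obtain Q where Q: "Q \<in> bundles X" "bundle_isomorphic G (pullback_bundle X \<phi> P) Q"
    using pullback_realisation[OF P(1) X(1) \<phi>'] .
  note tP = bundles_torsor[OF P(1)] and tQ = bundles_torsor[OF Q(1)]
  note tpb = torsor_pullback_bundle[OF tP X(1) \<phi>']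
  have "bundle_classifies X (pullback_bundle X \<phi> P) (\<lambda>x. f (\<phi> x))"
    using classifies_pullback[OF tP X(1) \<phi>' f(2)] by (simp add: pullback_bundle_def)
  then have "bundle_classifies X Q (\<lambda>x. f (\<phi> x))"
    by (rule bundle_classifies_isomorphic[OF tQ bundle_isomorphic_sym[OF tpb tQ Q(2)]])
  then have "bundle_classifies X Q (compose (carrier X) f \<phi>)"
    by (rule classifies_cong[OF tQ]) (simp add: compose_def)
  moreover have "compose (carrier X) f \<phi> \<in> smooth_hom X BG"
    by (rule compose_smooth_hom[OF X(1) BG_space \<phi>' smooth_homD[OF f(1)]])
  ultimately have "classifying_maps X (bundle_rel G D X `` {Q}) = homotopy_rel X BG `` {compose (carrier X) f \<phi>}"
    using classifying_maps_class[OF X(2) Q(1)] by blast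
  then show ?thesis
    using bundle_pullback_class[OF P(1) X(1) \<phi>' Q] classifying_maps_class[OF Y(2) P(1) f]
      homotopy_precomp_class[OF X(1) BG_space Y(1) \<phi>' f(1)] P(2) by simp
qed

lemma natural_isomorphism_classifying_maps:
  "natural_isomorphism Diffeol_HSP (bundle_classes G D) (bundle_pullback G D)
     (homotopy_classes BG) (homotopy_precomp BG) classifying_maps"
  unfolding natural_isomorphism_def Diffeol_HSP_def Diffeol_def
  using bij_classifying_maps natural_classifying_maps by simp

end

end

theorem theorem3p6:
  fixes G :: "('g, 'm) monoid_scheme" and D :: "'g diffeology"
    and inject :: "'x \<times> 'g \<Rightarrow> 'e"
  assumes "diffeological_group G D"
    and "inj inject"
  shows "contravariant_set_functor (Diffeol_HSP :: ('x diffeology, 'x \<Rightarrow> 'x) category)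
           (bundle_classes G D :: 'x diffeology \<Rightarrow> ('e, 'x, 'g) gbundle set set)
           (bundle_pullback G D) \<and>
         contravariant_set_functor (Diffeol_HSP :: ('x diffeology, 'x \<Rightarrow> 'x) category)
           (homotopy_classes (milnor_BG G D)) (homotopy_precomp (milnor_BG G D)) \<and>
         (\<exists>\<eta>. natural_isomorphism (Diffeol_HSP :: ('x diffeology, 'x \<Rightarrow> 'x) category)
           (bundle_classes G D :: 'x diffeology \<Rightarrow> ('e, 'x, 'g) gbundle set set)
           (bundle_pullback G D)
           (homotopy_classes (milnor_BG G D)) (homotopy_precomp (milnor_BG G D)) \<eta>)"
proof -
  interpret diff_group G D by (rule diff_group.intro) (rule assms(1))
  show ?thesis
  proof (intro conjI exI)
    show "contravariant_set_functor (Diffeol_HSP :: ('x diffeology, 'x \<Rightarrow> 'x) category)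
           (bundle_classes G D :: 'x diffeology \<Rightarrow> ('e, 'x, 'g) gbundle set set)
           (bundle_pullback G D)" by (rule bundle_functor[OF assms(2)])
    show "contravariant_set_functor (Diffeol_HSP :: ('x diffeology, 'x \<Rightarrow> 'x) category)
           (homotopy_classes (milnor_BG G D)) (homotopy_precomp (milnor_BG G D))"
      by (rule homotopy_functor[OF BG_space])
    show "natural_isomorphism (Diffeol_HSP :: ('x diffeology, 'x \<Rightarrow> 'x) category)
           (bundle_classes G D :: 'x diffeology \<Rightarrow> ('e, 'x, 'g) gbundle set set)
           (bundle_pullback G D)
           (homotopy_classes (milnor_BG G D)) (homotopy_precomp (milnor_BG G D)) classifying_maps"
      by (rule natural_isomorphism_classifying_maps[OF assms(2)])
  qed
qed

end
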